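(* Let $m\ge1$, $n\ge0$, $f\in\mathfrak{H}^{\odot m}\otimes\mathfrak{H}^{\odot n}$ and $F=I_{m,n}(f)$. Then $$E[|F|^4]=\frac1m\,E\Big[2\,\|DF\|_{\mathfrak{H}}^2\,|F|^2+\langle DF,\,D\bar F\rangle_{\mathfrak{H}}\,\bar F^2\Big].$$
   Context: Hilbert space and Gaussian process. $\mathfrak{H}=\mathfrak{H}_{\mathbb{R}}+\mathrm{i}\,\mathfrak{H}_{\mathbb{R}}$ is a complex separable Hilbert space (complexification of a real Hilbert space, with conjugation $h\mapsto\bar h$), inner product linear in the first argument. $Z=\{Z(h):h\in\mathfrak{H}\}$ is a complex Gaussian isonormal process: a centered symmetric complex Gaussian family, linear in $h$, with $E[Z(h)^2]=0$ and $E[Z(g)\overline{Z(h)}]=\langle g,h\rangle_{\mathfrak{H}}$. Complex Hermite polynomials: $J_{m,n}(z,\rho)=\sum_{r=0}^{m\wedge n}(-1)^r r!\binom{m}{r}\binom{n}{r}z^{m-r}\bar z^{\,n-r}\rho^r$. Complex multiple Wiener-Itô integral. $\mathfrak{H}^{\odot m}$ is the $m$-fold symmetric tensor product and $\hat\otimes$ the symmetrized tensor product. For an orthonormal basis $\{e_k\}$ of $\mathfrak{H}$ and sequences $(m_k),(n_k)$ of nonnegative integers with $\sum m_k=m$, $\sum n_k=n$, put $$I_{m,n}\big((\hat\otimes_k e_k^{\otimes m_k})\otimes(\hat\otimes_k \bar e_k^{\otimes n_k})\big)=\prod_k 2^{-(m_k+n_k)/2}J_{m_k,n_k}(\sqrt2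 Z(e_k),2).$$ This extends linearly to an isometry $I_{m,n}$ from $\mathfrak{H}^{\odot m}\otimes\mathfrak{H}^{\odot n}$ with norm $\sqrt{m!n!}\,\|\cdot\|_{\mathfrak{H}^{\otimes(m+n)}}$ into $L^2(\Omega)$. Complex Malliavin derivative. For $F=f(Z(\varphi_1),\dots,Z(\varphi_k))$ with $\varphi_i\in\mathfrak{H}$ and $f\in C^\infty(\mathbb{C}^k)$ having, together with all its partial derivatives, polynomial growth, $DF=\sum_i\partial_if(Z(\varphi_1),\dots,Z(\varphi_k))\,\varphi_i\in L^2(\Omega,\mathfrak{H})$, where $\partial_i=\partial/\partial z_i$ is the Wirtinger derivative. $D$ is closable from $L^2(\Omega)$ to $L^2(\Omega,\mathfrak{H})$, and $D$ also denotes the closure. *)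

theory Defs
  imports "HOL-Probability.Probability" "HOL-Combinatorics.Permutations"
begin

section \<open>Complexification of a real Hilbert space\<close>

text \<open>
  For a real Hilbert space \<open>'h\<close>, the pair \<open>(a, b) :: 'h \<times> 'h\<close> stands for \<open>a + \<i> b\<close>. Addition, the
  norm (\<open>norm (a, b)^2 = norm a^2 + norm b^2\<close>) and the Borel sets are those of the product type.
\<close>

type_synonym 'h cplx = "'h \<times> 'h"

definition cscale :: "complex \<Rightarrow> 'h::real_vector cplx \<Rightarrow> 'h cplx" where
  "cscale c x = (Re c *\<^sub>R fst x - Im c *\<^sub>R snd x, Re c *\<^sub>R snd x + Im c *\<^sub>R fst x)"

definition cconj :: "'h::real_vector cplx \<Rightarrow> 'h cplx" where
  "cconj x = (fst x, - snd x)"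

text \<open>Linear in the first argument.\<close>

definition cinner :: "'h::real_inner cplx \<Rightarrow> 'h cplx \<Rightarrow> complex" where
  "cinner x y = Complex (fst x \<bullet> fst y + snd x \<bullet> snd y) (snd x \<bullet> fst y - fst x \<bullet> snd y)"

definition orthonormal_on :: "nat set \<Rightarrow> (nat \<Rightarrow> 'h::real_inner cplx) \<Rightarrow> bool" where
  "orthonormal_on K e \<longleftrightarrow> (\<forall>j\<in>K. \<forall>k\<in>K. cinner (e j) (e k) = (if j = k then 1 else 0))"

text \<open>The index set \<open>K\<close> may be finite or infinite, so that every dimension is covered.\<close>

definition orthonormal_basis :: "nat set \<Rightarrow> (nat \<Rightarrow> 'h::real_inner cplx) \<Rightarrow> bool" where
  "orthonormal_basis K e \<longleftrightarrow> orthonormal_on K e \<and>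
     closure {\<Sum>k\<in>S. cscale (c k) (e k) | S c. finite S \<and> S \<subseteq> K} = UNIV"


section \<open>Complex isonormal Gaussian processes\<close>

definition centered_gaussian :: "'w measure \<Rightarrow> ('w \<Rightarrow> real) \<Rightarrow> bool" where
  "centered_gaussian M X \<longleftrightarrow> X \<in> borel_measurable M \<and>
     ((AE \<omega> in M. X \<omega> = 0) \<or>
      (\<exists>\<sigma>>0. distributed M lborel X (\<lambda>x. ennreal (normal_density 0 \<sigma> x))))"

text \<open>
  Joint Gaussianity of the family is Gaussianity of all finite real linear combinations of real and
  imaginary parts. Symmetry (invariance of the law under multiplication by unimodular constants)
  is, for a centered Gaussian family, the vanishing of the pseudo-covariance.
\<close>

locale complex_isonormal = prob_space M
  for M :: "'w measure" +
  fixes Z :: "'h::{real_inner, polish_space} cplx \<Rightarrow> 'w \<Rightarrow> complex"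
  assumes measurable_Z: "\<And>h. Z h \<in> borel_measurable M"
    and linear_Z: "\<And>c g h. AE \<omega> in M. Z (cscale c g + h) \<omega> = c * Z g \<omega> + Z h \<omega>"
    and gaussian_Z: "\<And>S a b. finite S \<Longrightarrow>
      centered_gaussian M (\<lambda>\<omega>. \<Sum>h\<in>S. a h * Re (Z h \<omega>) + b h * Im (Z h \<omega>))"
    and pseudo_covariance_Z: "\<And>h. (\<integral>\<omega>. (Z h \<omega>)\<^sup>2 \<partial>M) = 0"
    and covariance_Z: "\<And>g h. (\<integral>\<omega>. Z g \<omega> * cnj (Z h \<omega>) \<partial>M) = cinner g h"

definition square_integrable :: "'w measure \<Rightarrow> ('w \<Rightarrow> 'b::{real_normed_vector, second_countable_topology}) \<Rightarrow> bool" where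
  "square_integrable M F \<longleftrightarrow> F \<in> borel_measurable M \<and> integrable M (\<lambda>\<omega>. (norm (F \<omega>))\<^sup>2)"

definition L2_converges ::
  "'w measure \<Rightarrow> (nat \<Rightarrow> 'w \<Rightarrow> 'b::{real_normed_vector, second_countable_topology}) \<Rightarrow> ('w \<Rightarrow> 'b) \<Rightarrow> bool" where
  "L2_converges M X F \<longleftrightarrow> (\<forall>N. square_integrable M (X N)) \<and> square_integrable M F \<and>
     (\<lambda>N. \<integral>\<omega>. (norm (X N \<omega> - F \<omega>))\<^sup>2 \<partial>M) \<longlonglongrightarrow> 0"


section \<open>Hilbert tensor powers\<close>

text \<open>
  The \<open>p\<close>-th Hilbert tensor power is realised as the space of Hilbert-Schmidt functionals in \<open>p\<close>
  conjugate-linear variables (given as a list of length \<open>p\<close>), the tensor of \<open>h\<^sub>1, \<dots>, h\<^sub>p\<close> being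
  the functional taking \<open>x\<^sub>1, \<dots>, x\<^sub>p\<close> to the product of the \<open>cinner h\<^sub>i x\<^sub>i\<close>. For such
  functionals the supremum in \<open>hs_norm_sq\<close> equals the sum of \<open>(cmod (T [e\<^sub>k\<^sub>1, \<dots>, e\<^sub>k\<^sub>p]))^2\<close> over
  any orthonormal basis \<open>e\<close>, and its finiteness implies boundedness.
\<close>

type_synonym 'h tensor = "'h cplx list \<Rightarrow> complex"

definition conj_multilinear :: "nat \<Rightarrow> 'h::real_vector tensor \<Rightarrow> bool" where
  "conj_multilinear p T \<longleftrightarrow> (\<forall>xs i c x y. length xs = p \<longrightarrow> i < p \<longrightarrow>
     T (xs[i := cscale c x + y]) = cnj c * T (xs[i := x]) + T (xs[i := y]))"

definition hs_norm_sq :: "nat \<Rightarrow> 'h::real_inner tensor \<Rightarrow> ennreal" where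
  "hs_norm_sq p T =
     (SUP E \<in> {E. finite E \<and> (\<forall>x\<in>E. \<forall>y\<in>E. cinner x y = (if x = y then 1 else 0))}.
        \<Sum>xs \<in> {xs. set xs \<subseteq> E \<and> length xs = p}. ennreal ((cmod (T xs))\<^sup>2))"

definition tensor_power :: "nat \<Rightarrow> 'h::real_inner tensor set" where
  "tensor_power p = {T. (\<forall>xs. length xs \<noteq> p \<longrightarrow> T xs = 0) \<and> conj_multilinear p T \<and> hs_norm_sq p T < \<infinity>}"

definition pure_tensor :: "'h::real_inner cplx list \<Rightarrow> 'h tensor" where
  "pure_tensor hs xs =
     (if length xs = length hs then \<Prod>i<length hs. cinner (hs ! i) (xs ! i) else 0)"

definition tensor_prod :: "nat \<Rightarrow> 'h tensor \<Rightarrow> 'h tensor \<Rightarrow> 'h tensor" where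
  "tensor_prod m S T xs = S (take m xs) * T (drop m xs)"

definition symmetrize :: "nat \<Rightarrow> 'h tensor \<Rightarrow> 'h tensor" where
  "symmetrize p T xs =
     (if length xs = p then (\<Sum>\<sigma> | \<sigma> permutes {..<p}. T (permute_list \<sigma> xs)) / fact p else 0)"

definition sym_tensor_power :: "nat \<Rightarrow> 'h::real_inner tensor set" where
  "sym_tensor_power p = {T \<in> tensor_power p.
     \<forall>\<sigma> xs. \<sigma> permutes {..<p} \<longrightarrow> length xs = p \<longrightarrow> T (permute_list \<sigma> xs) = T xs}"

text \<open>The Hilbert tensor product of two symmetric powers, inside the power of order \<open>m + n\<close>.\<close>

definition sym_tensor_power2 :: "nat \<Rightarrow> nat \<Rightarrow> 'h::real_inner tensor set" where
  "sym_tensor_power2 m n = {f \<in> tensor_power (m + n).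
     \<forall>\<epsilon>>0. \<exists>(r::nat) S T. (\<forall>i<r. S i \<in> sym_tensor_power m \<and> T i \<in> sym_tensor_power n) \<and>
       hs_norm_sq (m + n) (\<lambda>xs. (\<Sum>i<r. tensor_prod m (S i) (T i) xs) - f xs) < \<epsilon>}"


section \<open>Complex multiple Wiener-Ito integrals\<close>

definition complex_hermite :: "nat \<Rightarrow> nat \<Rightarrow> complex \<Rightarrow> real \<Rightarrow> complex" where
  "complex_hermite m n z \<rho> =
     (\<Sum>r = 0..min m n. (-1) ^ r * fact r * of_nat (m choose r) * of_nat (n choose r)
        * z ^ (m - r) * cnj z ^ (n - r) * of_real \<rho> ^ r)"

definition multi_indices :: "nat set \<Rightarrow> nat \<Rightarrow> (nat \<Rightarrow> nat) set" where
  "multi_indices K m = {\<mu>. finite {k. \<mu> k \<noteq> 0} \<and> {k. \<mu> k \<noteq> 0} \<subseteq> K \<and> (\<Sum>k | \<mu> k \<noteq> 0. \<mu> k) = m}"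

text \<open>The list in which each \<open>g k\<close> occurs \<open>\<mu> k\<close> times, in increasing order of \<open>k\<close>.\<close>

definition repeated_list :: "(nat \<Rightarrow> 'a) \<Rightarrow> (nat \<Rightarrow> nat) \<Rightarrow> 'a list" where
  "repeated_list g \<mu> = concat (map (\<lambda>k. replicate (\<mu> k) (g k)) (sorted_list_of_set {k. \<mu> k \<noteq> 0}))"

definition basis_tensor ::
  "(nat \<Rightarrow> 'h::real_inner cplx) \<Rightarrow> nat \<Rightarrow> nat \<Rightarrow> (nat \<Rightarrow> nat) \<Rightarrow> (nat \<Rightarrow> nat) \<Rightarrow> 'h tensor" where
  "basis_tensor e m n \<mu> \<nu> = tensor_prod m
     (symmetrize m (pure_tensor (repeated_list e \<mu>)))
     (symmetrize n (pure_tensor (repeated_list (\<lambda>k. cconj (e k)) \<nu>)))"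

definition basis_integral ::
  "('h cplx \<Rightarrow> 'w \<Rightarrow> complex) \<Rightarrow> (nat \<Rightarrow> 'h cplx) \<Rightarrow> (nat \<Rightarrow> nat) \<Rightarrow> (nat \<Rightarrow> nat) \<Rightarrow> 'w \<Rightarrow> complex" where
  "basis_integral Z e \<mu> \<nu> \<omega> = (\<Prod>k | \<mu> k \<noteq> 0 \<or> \<nu> k \<noteq> 0.
     of_real (2 powr (- real (\<mu> k + \<nu> k) / 2)) *
       complex_hermite (\<mu> k) (\<nu> k) (of_real (sqrt 2) * Z (e k) \<omega>) 2)"

text \<open>
  The graph of the integral: the closure, with respect to the tensor norm and the norm of
  \<open>L\<^sup>2(M)\<close>, of the linear span of the pairs \<open>(basis_tensor, basis_integral)\<close>.
\<close>

definition is_wiener_ito ::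
  "'w measure \<Rightarrow> ('h::real_inner cplx \<Rightarrow> 'w \<Rightarrow> complex) \<Rightarrow> nat set \<Rightarrow> (nat \<Rightarrow> 'h cplx) \<Rightarrow>
   nat \<Rightarrow> nat \<Rightarrow> 'h tensor \<Rightarrow> ('w \<Rightarrow> complex) \<Rightarrow> bool" where
  "is_wiener_ito M Z K e m n f F \<longleftrightarrow>
     (\<exists>A c. (\<forall>N::nat. finite (A N) \<and> A N \<subseteq> multi_indices K m \<times> multi_indices K n) \<and>
        (\<lambda>N. hs_norm_sq (m + n)
           (\<lambda>xs. (\<Sum>(\<mu>, \<nu>) \<in> A N. c N \<mu> \<nu> * basis_tensor e m n \<mu> \<nu> xs) - f xs)) \<longlonglongrightarrow> 0 \<and>
        L2_converges M (\<lambda>N \<omega>. \<Sum>(\<mu>, \<nu>) \<in> A N. c N \<mu> \<nu> * basis_integral Z e \<mu> \<nu> \<omega>) F)"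

text \<open>A representative of the almost-everywhere class of the integral of \<open>f\<close>.\<close>

definition wiener_ito ::
  "'w measure \<Rightarrow> ('h::real_inner cplx \<Rightarrow> 'w \<Rightarrow> complex) \<Rightarrow> nat set \<Rightarrow> (nat \<Rightarrow> 'h cplx) \<Rightarrow>
   nat \<Rightarrow> nat \<Rightarrow> 'h tensor \<Rightarrow> 'w \<Rightarrow> complex" where
  "wiener_ito M Z K e m n f = (SOME F. is_wiener_ito M Z K e m n f F)"


section \<open>Complex Malliavin derivative\<close>

text \<open>
  A function on \<open>\<complex>\<^sup>k\<close> is a function of sequences that depends on the coordinates \<open>i < k\<close> only. Its
  real partial derivatives are those in the directions \<open>v = 1\<close> and \<open>v = \<i>\<close> of a coordinate \<open>j\<close>.
\<close>

definition partial_deriv ::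
  "nat \<times> complex \<Rightarrow> ((nat \<Rightarrow> complex) \<Rightarrow> complex) \<Rightarrow> (nat \<Rightarrow> complex) \<Rightarrow> complex" where
  "partial_deriv = (\<lambda>(j, v) f z.
     vector_derivative (\<lambda>t::real. f (z(j := z j + of_real t * v))) (at 0))"

definition wirtinger_deriv ::
  "nat \<Rightarrow> ((nat \<Rightarrow> complex) \<Rightarrow> complex) \<Rightarrow> (nat \<Rightarrow> complex) \<Rightarrow> complex" where
  "wirtinger_deriv j f z = (partial_deriv (j, 1) f z - \<i> * partial_deriv (j, \<i>) f z) / 2"

text \<open>\<open>C\<^sup>\<infinity>\<close>: all iterated partial derivatives exist and are continuous.\<close>

definition smooth_polynomial_growth :: "nat \<Rightarrow> ((nat \<Rightarrow> complex) \<Rightarrow> complex) \<Rightarrow> bool" where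
  "smooth_polynomial_growth k f \<longleftrightarrow>
     (\<forall>z w. (\<forall>i<k. z i = w i) \<longrightarrow> f z = f w) \<and>
     (\<forall>ds. set ds \<subseteq> {..<k} \<times> {1, \<i>} \<longrightarrow>
        (let g = fold partial_deriv ds f in
           (\<forall>z. \<forall>j<k. \<forall>v\<in>{1, \<i>}. (\<lambda>t::real. g (z(j := z j + of_real t * v))) differentiable (at 0)) \<and>
           continuous_on UNIV g \<and>
           (\<exists>C (q::nat). \<forall>z. cmod (g z) \<le> C * (1 + (\<Sum>i<k. cmod (z i))) ^ q)))"

definition smooth_malliavin ::
  "('h::real_vector cplx \<Rightarrow> 'w \<Rightarrow> complex) \<Rightarrow> ('w \<Rightarrow> complex) \<Rightarrow> ('w \<Rightarrow> 'h cplx) \<Rightarrow> bool" where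
  "smooth_malliavin Z F u \<longleftrightarrow>
     (\<exists>k \<phi> f. smooth_polynomial_growth k f \<and>
        F = (\<lambda>\<omega>. f (\<lambda>i. Z (\<phi> i) \<omega>)) \<and>
        u = (\<lambda>\<omega>. \<Sum>i<k. cscale (wirtinger_deriv i f (\<lambda>i. Z (\<phi> i) \<omega>)) (\<phi> i)))"

text \<open>The graph of the closure of the derivative.\<close>

definition is_malliavin_deriv ::
  "'w measure \<Rightarrow> ('h::{real_inner, polish_space} cplx \<Rightarrow> 'w \<Rightarrow> complex) \<Rightarrow>
   ('w \<Rightarrow> complex) \<Rightarrow> ('w \<Rightarrow> 'h cplx) \<Rightarrow> bool" where
  "is_malliavin_deriv M Z F u \<longleftrightarrow>
     (\<exists>X U. (\<forall>N. smooth_malliavin Z (X N) (U N)) \<and> L2_converges M X F \<and> L2_converges M U u)"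

definition malliavin_domain ::
  "'w measure \<Rightarrow> ('h::{real_inner, polish_space} cplx \<Rightarrow> 'w \<Rightarrow> complex) \<Rightarrow> ('w \<Rightarrow> complex) set" where
  "malliavin_domain M Z = {F. \<exists>u. is_malliavin_deriv M Z F u}"

text \<open>A representative of the almost-everywhere class of the derivative of \<open>F\<close>.\<close>

definition malliavin_deriv ::
  "'w measure \<Rightarrow> ('h::{real_inner, polish_space} cplx \<Rightarrow> 'w \<Rightarrow> complex) \<Rightarrow>
   ('w \<Rightarrow> complex) \<Rightarrow> 'w \<Rightarrow> 'h cplx" where
  "malliavin_deriv M Z F = (SOME u. is_malliavin_deriv M Z F u)"

end

theory Submission
  imports Defs
begin

text \<open>
  For \<open>F\<close> in a chaos of bidegree \<open>(m, n)\<close> spanned by finitely many Hermite polynomials, Gaussian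
  integration by parts shows that the number operator \<open>\<delta> D\<close> acts as multiplication by \<open>m\<close>. Pairing
  \<open>m F = \<delta> D F\<close> with \<open>|F|^2 F\<close> and applying the product rule to the derivative of \<open>|F|^2 F\<close> gives the
  identity. The same identity bounds \<open>E|F|^4\<close> by fourth moments of the derivatives of \<open>F\<close> and of its
  conjugate, which lie in chaoses of smaller degree; by induction on the degree,
  \<open>E|F|^4 \<le> C (E|F|^2)^2\<close>. Hence the finite expansions approximating a general \<open>F\<close> converge, together
  with their derivatives, in \<open>L\<^sup>4\<close>, and the identity passes to the limit. The derivative of the limit is
  determined almost everywhere because integration by parts against the exponentials \<open>iexp (Re (Z g))\<close>,
  whose span is dense, expresses the pairing with any direction through \<open>F\<close>.
\<close>

section \<open>Complexified Hilbert spaces\<close>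

text \<open>Gaussianity is given only through real linear combinations, and the vectors
  \<open>Z (\<phi> i)\<close> may be degenerate, so no joint density is available: integration by
  parts is reduced to one real Gaussian variable by replacing \<open>Re (Z h)\<close> with an
  independent copy, which characteristic functions show to preserve the law. The sigma-algebra of
  \<open>M\<close> may be larger than the one generated by \<open>Z\<close>; exponentials are total
  only among functionals of \<open>Z\<close>, so uniqueness also uses that every derivative is a
  limit of such functionals. The derivative of the conjugate of \<open>F\<close> brings in bidegree
  (n - 1, m), which is why the fourth-moment induction runs over m + n and treats both orders
  together. Both \<open>wiener_ito\<close> and \<open>malliavin_deriv\<close> are choices: the first
  is meaningful only once an approximating sequence is built from the coordinates of
  \<open>f\<close>, the second only up to almost-everywhere equality. Tensors are evaluated on
  \<open>e\<close> in the first m slots and on its conjugate in the last n, so the norm estimates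
  let the orthonormal family vary with the slot.\<close>

lemma cscale_simps [simp]:
  "cscale 0 x = 0" "cscale c 0 = 0" "cscale 1 x = x"
  by (auto simp: cscale_def prod_eq_iff)

lemma cscale_add_left: "cscale (a + b) x = cscale a x + cscale b x"
  and cscale_add_right: "cscale a (x + y) = cscale a x + cscale a y"
  and cscale_diff_left: "cscale (a - b) x = cscale a x - cscale b x"
  and cscale_diff_right: "cscale a (x - y) = cscale a x - cscale a y"
  and cscale_minus_left: "cscale (- a) x = - cscale a x"
  and cscale_minus_right: "cscale a (- x) = - cscale a x"
  by (auto simp: cscale_def prod_eq_iff algebra_simps)

lemma cscale_cscale: "cscale a (cscale b x) = cscale (a * b) x"
  by (auto simp: cscale_def prod_eq_iff algebra_simps)

lemma scaleR_cscale: "r *\<^sub>R cscale a x = cscale (r *\<^sub>R a) x"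
  and cscale_scaleR: "cscale a (r *\<^sub>R x) = r *\<^sub>R cscale a x"
  by (auto simp: cscale_def prod_eq_iff algebra_simps)

lemma cinner_add_left: "cinner (x + y) z = cinner x z + cinner y z"
  and cinner_add_right: "cinner x (y + z) = cinner x y + cinner x z"
  and cinner_diff_left: "cinner (x - y) z = cinner x z - cinner y z"
  and cinner_diff_right: "cinner x (y - z) = cinner x y - cinner x z"
  and cinner_minus_left: "cinner (- x) z = - cinner x z"
  and cinner_minus_right: "cinner x (- z) = - cinner x z"
  by (auto simp: cinner_def complex_eq_iff algebra_simps)

lemma cinner_zero [simp]: "cinner 0 x = 0" "cinner x 0 = 0"
  by (auto simp: cinner_def complex_eq_iff)

lemma cinner_cscale_left [simp]: "cinner (cscale c x) y = c * cinner x y"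
  and cinner_cscale_right [simp]: "cinner x (cscale c y) = cnj c * cinner x y"
  by (auto simp: cinner_def cscale_def complex_eq_iff algebra_simps)

lemma cinner_scaleR_left: "cinner (r *\<^sub>R x) y = r *\<^sub>R cinner x y"
  and cinner_scaleR_right: "cinner x (r *\<^sub>R y) = r *\<^sub>R cinner x y"
  by (auto simp: cinner_def complex_eq_iff algebra_simps)

lemma cinner_sum_left: "cinner (sum f I) y = (\<Sum>i\<in>I. cinner (f i) y)"
  by (induction I rule: infinite_finite_induct) (auto simp: cinner_add_left)

lemma cinner_sum_right: "cinner y (sum f I) = (\<Sum>i\<in>I. cinner y (f i))"
  by (induction I rule: infinite_finite_induct) (auto simp: cinner_add_right)

lemma cnj_cinner: "cnj (cinner x y) = cinner y x"
  by (auto simp: cinner_def complex_eq_iff inner_commute)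

lemma cinner_self: "cinner x x = of_real ((norm x)\<^sup>2)"
  by (cases x) (auto simp: cinner_def complex_eq_iff norm_Pair power2_norm_eq_inner inner_commute)

lemma of_real_cmod_sq: "(complex_of_real (cmod z))\<^sup>2 = z * cnj z"
  by (simp flip: complex_norm_square)

lemma norm_cscale: "norm (cscale c (x::'h::real_inner cplx)) = cmod c * norm x"
proof -
  have "complex_of_real ((norm (cscale c x))\<^sup>2) = of_real ((cmod c * norm x)\<^sup>2)"
    unfolding cinner_self [symmetric] by (simp only: cinner_cscale_left cinner_cscale_right)
      (simp add: cinner_self power_mult_distrib of_real_cmod_sq)
  then have "(norm (cscale c x))\<^sup>2 = (cmod c * norm x)\<^sup>2"
    unfolding of_real_eq_iff .
  then show ?thesis by (simp add: power2_eq_iff_nonneg)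
qed

lemma norm_add_sq_orthogonal:
  assumes "cinner x y = 0"
  shows "(norm (x + y))\<^sup>2 = (norm x)\<^sup>2 + (norm y)\<^sup>2"
proof -
  have "cinner y x = 0" using assms by (metis cnj_cinner complex_cnj_zero)
  then have "complex_of_real ((norm (x + y))\<^sup>2) = of_real ((norm x)\<^sup>2 + (norm y)\<^sup>2)"
    unfolding cinner_self [symmetric] of_real_add
    by (simp add: cinner_add_left cinner_add_right assms)
  then show ?thesis unfolding of_real_eq_iff .
qed

lemma cinner_cconj: "cinner (cconj x) (cconj y) = cnj (cinner x y)"
  by (auto simp: cinner_def cconj_def complex_eq_iff)

lemma cconj_cconj [simp]: "cconj (cconj x) = x"
  by (simp add: cconj_def)

lemma cconj_cscale: "cconj (cscale c x) = cscale (cnj c) (cconj x)"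
  and cconj_add: "cconj (x + y) = cconj x + cconj y"
  and cconj_diff: "cconj (x - y) = cconj x - cconj y"
  by (auto simp: cconj_def cscale_def)

lemma cconj_sum: "cconj (sum f I) = (\<Sum>i\<in>I. cconj (f i))"
  by (induction I rule: infinite_finite_induct) (auto simp: cconj_add, auto simp: cconj_def zero_prod_def)

section \<open>Projections onto finite orthonormal families\<close>

definition proj :: "('b \<Rightarrow> 'h::real_inner cplx) \<Rightarrow> 'b set \<Rightarrow> 'h cplx \<Rightarrow> 'h cplx" where
  "proj b S x = (\<Sum>k\<in>S. cscale (cinner x (b k)) (b k))"

text \<open>The index type is arbitrary, unlike in \<open>orthonormal_on\<close>, so that a finite
  orthonormal set can be indexed by its own elements through the identity.\<close>

definition orthonormal_family :: "'b set \<Rightarrow> ('b \<Rightarrow> 'h::real_inner cplx) \<Rightarrow> bool" where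
  "orthonormal_family S b \<longleftrightarrow> (\<forall>j\<in>S. \<forall>k\<in>S. cinner (b j) (b k) = (if j = k then 1 else 0))"

lemma orthonormal_familyD:
  "orthonormal_family S b \<Longrightarrow> j \<in> S \<Longrightarrow> k \<in> S \<Longrightarrow> cinner (b j) (b k) = (if j = k then 1 else 0)"
  by (simp add: orthonormal_family_def)

lemma orthonormal_family_norm:
  assumes "orthonormal_family S b" "k \<in> S" shows "norm (b k) = 1"
proof -
  have "complex_of_real ((norm (b k))\<^sup>2) = of_real 1"
    using orthonormal_familyD[OF assms assms(2)] by (simp add: cinner_self)
  then show ?thesis unfolding of_real_eq_iff by (simp add: power2_eq_1_iff) (use norm_ge_zero[of "b k"] in linarith)
qed

lemma orthonormal_family_subset:
  "orthonormal_family S b \<Longrightarrow> S' \<subseteq> S \<Longrightarrow> orthonormal_family S' b"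
  by (auto simp: orthonormal_family_def subset_iff)

lemma orthonormal_family_cconj:
  "orthonormal_family S b \<Longrightarrow> orthonormal_family S (\<lambda>k. cconj (b k))"
  by (auto simp: orthonormal_family_def cinner_cconj)

lemma norm_sq_sum_orthonormal:
  assumes "finite S" "orthonormal_family S b"
  shows "(norm (\<Sum>k\<in>S. cscale (c k) (b k)))\<^sup>2 = (\<Sum>k\<in>S. (cmod (c k))\<^sup>2)"
proof -
  have "complex_of_real ((norm (\<Sum>k\<in>S. cscale (c k) (b k)))\<^sup>2)
      = (\<Sum>j\<in>S. \<Sum>k\<in>S. c k * (cnj (c j) * cinner (b k) (b j)))"
    unfolding cinner_self[symmetric]
    by (simp add: cinner_sum_left cinner_sum_right sum_distrib_left mult_ac)
  also have "\<dots> = (\<Sum>j\<in>S. \<Sum>k\<in>S. if k = j then c j * cnj (c j) else 0)"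
    by (intro sum.cong refl) (auto simp: orthonormal_familyD[OF assms(2)])
  also have "\<dots> = of_real (\<Sum>k\<in>S. (cmod (c k))\<^sup>2)"
    using assms(1) by (simp add: of_real_cmod_sq)
  finally show ?thesis unfolding of_real_eq_iff .
qed

lemma cinner_sum_orthonormal:
  assumes "finite S" "orthonormal_family S b" "j \<in> S"
  shows "cinner (\<Sum>k\<in>S. cscale (c k) (b k)) (b j) = c j"
proof -
  have "cinner (\<Sum>k\<in>S. cscale (c k) (b k)) (b j) = (\<Sum>k\<in>S. if k = j then c j else 0)"
    unfolding cinner_sum_left
    by (intro sum.cong refl) (auto simp: orthonormal_familyD[OF assms(2) _ assms(3)])
  then show ?thesis using assms by simp
qed

lemma proj_zero [simp]: "proj b S 0 = 0"
  by (simp add: proj_def)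

lemma cinner_residual:
  assumes "finite S" "orthonormal_family S b" "j \<in> S"
  shows "cinner (x - proj b S x) (b j) = 0"
  using cinner_sum_orthonormal[OF assms, of "\<lambda>k. cinner x (b k)"]
  by (simp add: cinner_diff_left proj_def)

lemma cinner_residual_span:
  assumes "finite S" "orthonormal_family S b"
  shows "cinner (x - proj b S x) (\<Sum>k\<in>S. cscale (c k) (b k)) = 0"
  by (simp add: cinner_sum_right cinner_residual[OF assms])

text \<open>The difference splits into the residual \<open>x - proj b S x\<close>, orthogonal to the
  span, and a vector of the span with coefficients \<open>cinner x (b k) - c k\<close>. With c = 0
  this yields Bessel's inequality; dropping the sum yields best approximation.\<close>

lemma proj_pythagoras:
  assumes "finite S" "orthonormal_family S b"
  shows "(norm (x - (\<Sum>k\<in>S. cscale (c k) (b k))))\<^sup>2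
    = (norm (x - proj b S x))\<^sup>2 + (\<Sum>k\<in>S. (cmod (cinner x (b k) - c k))\<^sup>2)"
proof -
  let ?w = "\<Sum>k\<in>S. cscale (cinner x (b k) - c k) (b k)"
  have "x - (\<Sum>k\<in>S. cscale (c k) (b k)) = (x - proj b S x) + ?w"
    by (simp add: proj_def cscale_diff_left sum_subtractf)
  then show ?thesis
    by (simp only: norm_add_sq_orthogonal[OF cinner_residual_span[OF assms]] norm_sq_sum_orthonormal[OF assms])
qed

lemma bessel:
  assumes "finite S" "orthonormal_family S b"
  shows "(\<Sum>k\<in>S. (cmod (cinner x (b k)))\<^sup>2) \<le> (norm x)\<^sup>2"
  using proj_pythagoras[OF assms, of x "\<lambda>_. 0"] by simp

lemma norm_proj_le:
  assumes "finite S" "orthonormal_family S b"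
  shows "norm (proj b S x) \<le> norm x"
proof -
  have "(norm (proj b S x))\<^sup>2 \<le> (norm x)\<^sup>2"
    unfolding proj_def norm_sq_sum_orthonormal[OF assms] by (rule bessel[OF assms])
  then show ?thesis by simp
qed

text \<open>Cauchy-Schwarz is Bessel's inequality for the one-element family consisting of the
  normalised \<open>y\<close>.\<close>

lemma cmod_cinner_le: "cmod (cinner x y) \<le> norm x * norm y"
proof (cases "y = 0")
  case False
  define u where "u = cscale (of_real (1 / norm y)) y"
  have "cinner u u = 1"
    using False by (simp only: u_def cinner_cscale_left cinner_cscale_right)
      (simp add: cinner_self field_simps power2_eq_square)
  then have "orthonormal_family {()} (\<lambda>_. u)" by (simp add: orthonormal_family_def)
  from bessel[OF _ this, of x] have "cmod (cinner x u) \<le> norm x"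
    by (simp)
  then show ?thesis using False by (simp add: u_def norm_mult field_simps norm_divide)
qed simp

lemma bounded_bilinear_cinner: "bounded_bilinear cinner"
  by (rule bounded_bilinear.intro)
    (auto simp: cinner_add_left cinner_add_right cinner_scaleR_left cinner_scaleR_right
      intro!: exI[of _ 1] cmod_cinner_le)

lemma bounded_bilinear_cscale: "bounded_bilinear (cscale :: complex \<Rightarrow> 'h::real_inner cplx \<Rightarrow> _)"
  by (rule bounded_bilinear.intro)
    (auto simp: cscale_add_left cscale_add_right cscale_scaleR scaleR_cscale norm_cscale
      intro!: exI[of _ 1])

text \<open>The span is recorded only through fixed points of the projection: this is what later
  turns evaluation at arbitrary vectors into evaluation at members of an orthonormal set, as the
  supremum in \<open>hs_norm_sq\<close> requires.\<close>

lemma gram_schmidt: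
  assumes "finite X"
  shows "\<exists>E. finite E \<and> orthonormal_family E (\<lambda>x. x) \<and> (\<forall>x\<in>X. proj (\<lambda>x. x) E x = (x::'h::real_inner cplx))"
  using assms
proof induction
  case empty
  show ?case by (auto simp: orthonormal_family_def)
next
  case (insert x X)
  then obtain E where E: "finite E" "orthonormal_family E (\<lambda>x. x)" "\<And>x. x \<in> X \<Longrightarrow> proj (\<lambda>x. x) E x = x" by blast
  define r where "r = x - proj (\<lambda>x. x) E x"
  show ?case
  proof (cases "r = 0")
    case True
    then have "proj (\<lambda>x. x) E x = x" by (simp add: r_def)
    with E show ?thesis by (intro exI[of _ E] conjI ballI) (auto simp del: split_paired_All)
  next
    case False
    define u where "u = cscale (of_real (1 / norm r)) r"
    have re: "cinner r y = 0" if "y \<in> E" for y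
      using cinner_residual[OF E(1,2) that] by (simp add: r_def)
    have ue: "cinner u y = 0" "cinner y u = 0" if "y \<in> E" for y
      using re[OF that] cnj_cinner[of r y] by (auto simp: u_def)
    have uu: "cinner u u = 1" using False by (simp only: u_def cinner_cscale_left cinner_cscale_right)
      (simp add: cinner_self field_simps power2_eq_square)
    then have un: "u \<notin> E" using ue(1)[of u] by auto
    have on: "orthonormal_family (insert u E) (\<lambda>x. x)"
      using E(2) ue uu un by (auto simp: orthonormal_family_def)
    have pr: "proj (\<lambda>x. x) (insert u E) y = cscale (cinner y u) u + proj (\<lambda>x. x) E y" for y
      using E(1) un by (simp add: proj_def)
    have pu: "cinner (proj (\<lambda>x. x) E y) u = 0" for y
      by (simp add: proj_def cinner_sum_left ue)
    have "proj (\<lambda>x. x) (insert u E) y = y" if "y \<in> X" for y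
      using E(3)[OF that] pu[of y] by (simp add: pr)
    moreover have "proj (\<lambda>x. x) (insert u E) x = x"
    proof -
      have "cinner x u = cinner r u" using pu[of x] by (simp add: r_def cinner_diff_left)
      also have "\<dots> = of_real (norm r)"
        using False by (simp add: u_def cinner_self power2_eq_square)
      finally have "cscale (cinner x u) u = r" using False by (simp add: u_def cscale_cscale)
      then show ?thesis by (simp add: pr r_def)
    qed
    ultimately show ?thesis using E(1) on by (intro exI[of _ "insert u E"]) auto
  qed
qed

lemma orthonormal_basis_family: "orthonormal_basis K e \<Longrightarrow> orthonormal_family K e"
  by (simp add: orthonormal_basis_def orthonormal_on_def orthonormal_family_def)

text \<open>Density of the span provides some finite combination near \<open>x\<close>; the
  projection is the best approximation from any span containing it, and
  \<open>K \<inter> {..<N}\<close> eventually contains its finite index set.\<close>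

lemma proj_tendsto:
  assumes "orthonormal_basis K e"
  shows "(\<lambda>N::nat. proj e (K \<inter> {..<N}) x) \<longlonglongrightarrow> x"
proof (rule LIMSEQ_I)
  fix r :: real assume "r > 0"
  have ON: "orthonormal_family K e" by (rule orthonormal_basis_family[OF assms])
  have "x \<in> closure {\<Sum>k\<in>S. cscale (c k) (e k) | S c. finite S \<and> S \<subseteq> K}"
    using assms by (simp add: orthonormal_basis_def)
  then obtain S c where S: "finite S" "S \<subseteq> K" and d: "dist (\<Sum>k\<in>S. cscale (c k) (e k)) x < r"
    unfolding closure_approachable using \<open>r > 0\<close> by blast
  obtain N0 where N0: "S \<subseteq> {..<N0}" using S(1) by (metis finite_nat_iff_bounded)
  have "norm (proj e (K \<inter> {..<N}) x - x) < r" if "N \<ge> N0" for N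
  proof -
    let ?S = "K \<inter> {..<N}"
    have sub: "S \<subseteq> ?S" using N0 S that by auto
    \<comment> \<open>Padding by zero turns the approximating combination into one over the larger
      index set, so that \<open>proj_pythagoras\<close> applies to it.\<close>
    define c' where "c' k = (if k \<in> S then c k else 0)" for k
    have eq: "(\<Sum>k\<in>?S. cscale (c' k) (e k)) = (\<Sum>k\<in>S. cscale (c k) (e k))"
      using sub by (intro sum.mono_neutral_cong_right) (auto simp: c'_def)
    have "(norm (x - proj e ?S x))\<^sup>2 \<le> (norm (x - (\<Sum>k\<in>?S. cscale (c' k) (e k))))\<^sup>2"
      by (subst proj_pythagoras) (auto intro: orthonormal_family_subset[OF ON] sum_nonneg)
    then have "norm (x - proj e ?S x) \<le> norm (x - (\<Sum>k\<in>S. cscale (c k) (e k)))"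
      by (simp add: eq)
    with d show ?thesis by (simp add: dist_norm norm_minus_commute)
  qed
  then show "\<exists>no. \<forall>n\<ge>no. norm (proj e (K \<inter> {..<n}) x - x) < r" by blast
qed

lemma proj_cconj: "proj (\<lambda>k. cconj (b k)) S (cconj x) = cconj (proj b S x)"
  by (simp add: proj_def cinner_cconj cconj_sum cconj_cscale)

lemma continuous_on_cconj: "continuous_on UNIV (cconj :: 'h::real_inner cplx \<Rightarrow> _)"
  unfolding cconj_def by (intro continuous_intros)

text \<open>Conjugation is continuous and intertwines the projections of the two families, so the
  conjugated basis approximates every vector as well.\<close>

lemma proj_cconj_tendsto:
  assumes "orthonormal_basis K e"
  shows "(\<lambda>N::nat. proj (\<lambda>k. cconj (e k)) (K \<inter> {..<N}) x) \<longlonglongrightarrow> x"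
proof -
  have "(\<lambda>N. cconj (proj e (K \<inter> {..<N}) (cconj x))) \<longlonglongrightarrow> cconj (cconj x)"
    by (rule continuous_on_tendsto_compose[OF continuous_on_cconj proj_tendsto[OF assms]]) auto
  then show ?thesis using proj_cconj[where x = "cconj x" and b = e] by simp
qed

lemma orthonormal_basis_ext:
  assumes "orthonormal_basis K e" "\<And>k. k \<in> K \<Longrightarrow> cinner x (e k) = 0"
  shows "x = 0"
proof -
  have "(\<lambda>N::nat. proj e (K \<inter> {..<N}) x) = (\<lambda>_. 0)"
    using assms(2) by (auto simp: proj_def intro!: sum.neutral)
  with proj_tendsto[OF assms(1), of x] show ?thesis by (metis LIMSEQ_unique tendsto_const)
qed

section \<open>Hilbert tensors in coordinates\<close>

text \<open>Peels the head off a list index; the slot-by-slot inductions over tensors run through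
  this identity.\<close>

lemma sum_lists_Suc:
  assumes "finite A"
  shows "(\<Sum>xs\<in>{xs. set xs \<subseteq> A \<and> length xs = Suc n}. f xs)
       = (\<Sum>x\<in>A. \<Sum>xs\<in>{xs. set xs \<subseteq> A \<and> length xs = n}. f (x # xs))"
proof -
  have "(\<Sum>xs\<in>{xs. set xs \<subseteq> A \<and> length xs = Suc n}. f xs)
     = (\<Sum>(xs, x)\<in>{xs. set xs \<subseteq> A \<and> length xs = n} \<times> A. f (x # xs))"
    unfolding lists_length_Suc_eq
    by (subst sum.reindex) (auto simp: inj_on_def case_prod_unfold)
  also have "\<dots> = (\<Sum>xs\<in>{xs. set xs \<subseteq> A \<and> length xs = n}. \<Sum>x\<in>A. f (x # xs))"
    by (simp add: sum.cartesian_product)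
  finally show ?thesis by (subst sum.swap) simp
qed

lemma conj_multilinear_head:
  assumes "conj_multilinear (Suc p) T" "length xs = p"
  shows "T ((cscale c x + y) # xs) = cnj c * T (x # xs) + T (y # xs)"
proof -
  have "T ((0 # xs)[0 := cscale c x + y]) = cnj c * T ((0 # xs)[0 := x]) + T ((0 # xs)[0 := y])"
    using assms unfolding conj_multilinear_def by (metis length_Cons zero_less_Suc)
  then show ?thesis by simp
qed

lemma conj_multilinear_tail:
  assumes "conj_multilinear (Suc p) T"
  shows "conj_multilinear p (\<lambda>xs. T (z # xs))"
  unfolding conj_multilinear_def
proof (intro allI impI)
  fix xs :: "'a cplx list" and i c x y assume "length xs = p" "i < p"
  then have "T ((z # xs)[Suc i := cscale c x + y]) = cnj c * T ((z # xs)[Suc i := x]) + T ((z # xs)[Suc i := y])"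
    using assms unfolding conj_multilinear_def by (metis length_Cons Suc_less_eq)
  then show "T (z # xs[i := cscale c x + y]) = cnj c * T (z # xs[i := x]) + T (z # xs[i := y])" by simp
qed

lemma conj_multilinear_head_zero:
  assumes "conj_multilinear (Suc p) T" "length xs = p"
  shows "T (0 # xs) = 0"
  using conj_multilinear_head[OF assms, of 1 0 0] by simp

lemma conj_multilinear_head_diff:
  assumes "conj_multilinear (Suc p) T" "length xs = p"
  shows "T ((x - y) # xs) = T (x # xs) - T (y # xs)"
  using conj_multilinear_head[OF assms, of "-1" y x] by (simp add: cscale_minus_left)

lemma conj_multilinear_head_sum:
  assumes "conj_multilinear (Suc p) T" "length xs = p" "finite S"
  shows "T ((\<Sum>k\<in>S. cscale (c k) (b k)) # xs) = (\<Sum>k\<in>S. cnj (c k) * T (b k # xs))"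
  using assms(3)
  by induction (auto simp: conj_multilinear_head[OF assms(1,2)] conj_multilinear_head_zero[OF assms(1,2)])

text \<open>As a function of its head, \<open>T\<close> restricted to the span of \<open>b\<close> is represented by a vector
  (Riesz), so that Bessel's inequality applies.\<close>

lemma conj_multilinear_head_proj:
  assumes "conj_multilinear (Suc p) T" "length xs = p" "finite S"
  shows "T (proj b S x # xs) = cinner (\<Sum>k\<in>S. cscale (T (b k # xs)) (b k)) x"
  unfolding proj_def conj_multilinear_head_sum[OF assms]
  by (simp add: cinner_sum_left cnj_cinner mult.commute)

text \<open>Cauchy-Schwarz for the Riesz representer of the head.\<close>

lemma head_proj_bound:
  assumes "conj_multilinear (Suc p) T" "length xs = p" "finite S" "orthonormal_family S b"
  shows "(cmod (T (proj b S x # xs)))\<^sup>2 \<le> (norm x)\<^sup>2 * (\<Sum>k\<in>S. (cmod (T (b k # xs)))\<^sup>2)"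
proof -
  let ?y = "\<Sum>k\<in>S. cscale (T (b k # xs)) (b k)"
  have "(cmod (T (proj b S x # xs)))\<^sup>2 \<le> (norm ?y * norm x)\<^sup>2"
    unfolding conj_multilinear_head_proj[OF assms(1-3)]
    by (intro power_mono cmod_cinner_le) auto
  also have "\<dots> = (norm x)\<^sup>2 * (\<Sum>k\<in>S. (cmod (T (b k # xs)))\<^sup>2)"
    by (simp add: power_mult_distrib norm_sq_sum_orthonormal[OF assms(3,4)])
  finally show ?thesis .
qed

text \<open>Bessel's inequality in the opposite role: the Riesz representer of the head is tested
  against the family \<open>a\<close>, so the sum over \<open>R\<close> costs no dimension
  factor.\<close>

lemma head_proj_sum_bound:
  assumes "conj_multilinear (Suc p) T" "length xs = p" "finite S" "orthonormal_family S b"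
    "finite R" "orthonormal_family R a"
  shows "(\<Sum>r\<in>R. (cmod (T (proj b S (a r) # xs)))\<^sup>2) \<le> (\<Sum>k\<in>S. (cmod (T (b k # xs)))\<^sup>2)"
  unfolding conj_multilinear_head_proj[OF assms(1-3)] norm_sq_sum_orthonormal[OF assms(3,4), symmetric]
  by (rule bessel[OF assms(5,6)])

text \<open>Induction over the slots: the tail is bounded with the projected head held fixed, then
  \<open>head_proj_bound\<close> treats the head for each choice of tail indices.\<close>

lemma proj_lists_bound:
  assumes "conj_multilinear (length xs) T" "finite S" "orthonormal_family S b"
  shows "(cmod (T (map (proj b S) xs)))\<^sup>2
    \<le> (\<Prod>x\<leftarrow>xs. (norm x)\<^sup>2) * (\<Sum>ks\<in>{ks. set ks \<subseteq> S \<and> length ks = length xs}. (cmod (T (map b ks)))\<^sup>2)"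
  using assms(1)
proof (induction xs arbitrary: T)
  case Nil
  then show ?case by (simp add: conj_disj_distribL cong: conj_cong)
next
  case (Cons x xs)
  let ?L = "{ks. set ks \<subseteq> S \<and> length ks = length xs}"
  have cm: "conj_multilinear (Suc (length xs)) T" using Cons.prems by simp
  have nn: "0 \<le> (\<Prod>x\<leftarrow>xs. (norm x)\<^sup>2)" by (induction xs) auto
  have "(cmod (T (map (proj b S) (x # xs))))\<^sup>2
    \<le> (\<Prod>x\<leftarrow>xs. (norm x)\<^sup>2) * (\<Sum>ks\<in>?L. (cmod (T (proj b S x # map b ks)))\<^sup>2)"
    using Cons.IH[OF conj_multilinear_tail[OF cm], of "proj b S x"] by simp
  also have "\<dots> \<le> (\<Prod>x\<leftarrow>xs. (norm x)\<^sup>2) * (\<Sum>ks\<in>?L. (norm x)\<^sup>2 * (\<Sum>k\<in>S. (cmod (T (b k # map b ks)))\<^sup>2))"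
    by (intro mult_left_mono sum_mono head_proj_bound[OF cm _ assms(2,3)] nn) auto
  also have "\<dots> = (\<Prod>x\<leftarrow>x#xs. (norm x)\<^sup>2) * (\<Sum>ks\<in>?L. \<Sum>k\<in>S. (cmod (T (b k # map b ks)))\<^sup>2)"
    by (simp add: sum_distrib_left mult_ac)
  also have "(\<Sum>ks\<in>?L. \<Sum>k\<in>S. (cmod (T (b k # map b ks)))\<^sup>2)
     = (\<Sum>ks\<in>{ks. set ks \<subseteq> S \<and> length ks = Suc (length xs)}. (cmod (T (map b ks)))\<^sup>2)"
    unfolding sum_lists_Suc[OF assms(2)] by (subst sum.swap) simp
  finally show ?case by simp
qed

text \<open>One application of \<open>head_proj_sum_bound\<close> per slot. The target families may
  differ from slot to slot because later the first m slots carry \<open>e\<close> and the last n its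
  conjugate.\<close>

lemma contraction_lists:
  assumes "conj_multilinear (length bs) T" "finite R" "finite S" "orthonormal_family R a"
    "\<And>b. b \<in> set bs \<Longrightarrow> orthonormal_family S b"
  shows "(\<Sum>rs\<in>{rs. set rs \<subseteq> R \<and> length rs = length bs}. (cmod (T (map2 (\<lambda>b r. proj b S (a r)) bs rs)))\<^sup>2)
    \<le> (\<Sum>ks\<in>{ks. set ks \<subseteq> S \<and> length ks = length bs}. (cmod (T (map2 (\<lambda>b k. b k) bs ks)))\<^sup>2)"
  using assms(1,5)
proof (induction bs arbitrary: T)
  case Nil
  then show ?case by (simp add: conj_disj_distribL cong: conj_cong)
next
  case (Cons b bs)
  let ?L = "\<lambda>S. {ks. set ks \<subseteq> S \<and> length ks = length bs}"
  have cm: "conj_multilinear (Suc (length bs)) T" using Cons.prems by simp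
  have "(\<Sum>r\<in>R. \<Sum>rs\<in>?L R. (cmod (T (proj b S (a r) # map2 (\<lambda>b r. proj b S (a r)) bs rs)))\<^sup>2)
     \<le> (\<Sum>r\<in>R. \<Sum>ks\<in>?L S. (cmod (T (proj b S (a r) # map2 (\<lambda>b k. b k) bs ks)))\<^sup>2)"
    by (intro sum_mono Cons.IH conj_multilinear_tail[OF cm] Cons.prems(2)) auto
  also have "\<dots> = (\<Sum>ks\<in>?L S. \<Sum>r\<in>R. (cmod (T (proj b S (a r) # map2 (\<lambda>b k. b k) bs ks)))\<^sup>2)"
    by (rule sum.swap)
  also have "\<dots> \<le> (\<Sum>ks\<in>?L S. \<Sum>k\<in>S. (cmod (T (b k # map2 (\<lambda>b k. b k) bs ks)))\<^sup>2)"
    using Cons.prems(2)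
    by (intro sum_mono head_proj_sum_bound[OF cm _ assms(3) _ assms(2,4)]) auto
  also have "\<dots> = (\<Sum>k\<in>S. \<Sum>ks\<in>?L S. (cmod (T (b k # map2 (\<lambda>b k. b k) bs ks)))\<^sup>2)"
    by (rule sum.swap)
  finally show ?case by (simp add: sum_lists_Suc[OF assms(2)] sum_lists_Suc[OF assms(3)])
qed

text \<open>The mixed version of \<open>contraction_lists\<close>: the source families vary with the slot.\<close>

lemma mixed_lists_bound:
  assumes "conj_multilinear (length bs) T" "finite R" "finite S" "orthonormal_family S a"
    "\<And>b. b \<in> set bs \<Longrightarrow> orthonormal_family R b"
  shows "(\<Sum>rs\<in>{rs. set rs \<subseteq> R \<and> length rs = length bs}. (cmod (T (map2 (\<lambda>b r. proj a S (b r)) bs rs)))\<^sup>2)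
    \<le> (\<Sum>ks\<in>{ks. set ks \<subseteq> S \<and> length ks = length bs}. (cmod (T (map a ks)))\<^sup>2)"
  using assms(1,5)
proof (induction bs arbitrary: T)
  case Nil
  then show ?case by (simp add: conj_disj_distribL cong: conj_cong)
next
  case (Cons b bs)
  let ?L = "\<lambda>S. {ks. set ks \<subseteq> S \<and> length ks = length bs}"
  have cm: "conj_multilinear (Suc (length bs)) T" using Cons.prems by simp
  have "(\<Sum>r\<in>R. \<Sum>rs\<in>?L R. (cmod (T (proj a S (b r) # map2 (\<lambda>b r. proj a S (b r)) bs rs)))\<^sup>2)
     \<le> (\<Sum>r\<in>R. \<Sum>ks\<in>?L S. (cmod (T (proj a S (b r) # map a ks)))\<^sup>2)"
    by (intro sum_mono Cons.IH conj_multilinear_tail[OF cm] Cons.prems(2)) auto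
  also have "\<dots> = (\<Sum>ks\<in>?L S. \<Sum>r\<in>R. (cmod (T (proj a S (b r) # map a ks)))\<^sup>2)"
    by (rule sum.swap)
  also have "\<dots> \<le> (\<Sum>ks\<in>?L S. \<Sum>k\<in>S. (cmod (T (a k # map a ks)))\<^sup>2)"
    using Cons.prems(2)
    by (intro sum_mono head_proj_sum_bound[OF cm _ assms(3,4,2)]) auto
  also have "\<dots> = (\<Sum>k\<in>S. \<Sum>ks\<in>?L S. (cmod (T (a k # map a ks)))\<^sup>2)"
    by (rule sum.swap)
  finally show ?case by (simp add: sum_lists_Suc[OF assms(2)] sum_lists_Suc[OF assms(3)])
qed

section \<open>Computing the Hilbert-Schmidt norm with other orthonormal families\<close>

lemma sum_lists_le_hs_norm_sq:
  assumes "finite E" "orthonormal_family E (\<lambda>x. x)"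
  shows "ennreal (\<Sum>xs\<in>{xs. set xs \<subseteq> E \<and> length xs = p}. (cmod (T xs))\<^sup>2) \<le> hs_norm_sq p T"
  unfolding hs_norm_sq_def
proof (rule SUP_upper2)
  show "E \<in> {E. finite E \<and> (\<forall>x\<in>E. \<forall>y\<in>E. cinner x y = (if x = y then 1 else 0))}"
    using assms unfolding orthonormal_family_def by simp
qed simp

text \<open>Gram-Schmidt on all the vectors \<open>b k\<close> gives one orthonormal set
  \<open>E\<close> for which each of them is its own projection; \<open>mixed_lists_bound\<close>
  then compares with the sum over \<open>E\<close>, a competitor in the supremum.\<close>

lemma mixed_sum_le_hs_norm_sq:
  assumes "conj_multilinear (length bs) T" "finite S"
    "\<And>b. b \<in> set bs \<Longrightarrow> orthonormal_family S b"
  shows "ennreal (\<Sum>ks\<in>{ks. set ks \<subseteq> S \<and> length ks = length bs}. (cmod (T (map2 (\<lambda>b k. b k) bs ks)))\<^sup>2)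
    \<le> hs_norm_sq (length bs) T"
proof -
  obtain E where E: "finite E" "orthonormal_family E (\<lambda>x. x)"
    "\<And>x. x \<in> (\<Union>b\<in>set bs. b ` S) \<Longrightarrow> proj (\<lambda>x. x) E x = x"
    using gram_schmidt[of "\<Union>b\<in>set bs. b ` S"] assms(2) by blast
  have m: "map2 (\<lambda>b r. proj (\<lambda>x. x) E (b r)) bs ks = map2 (\<lambda>b k. b k) bs ks"
    if "set ks \<subseteq> S" for ks
  proof (rule map_cong[OF refl], clarify)
    fix b r assume "(b, r) \<in> set (zip bs ks)"
    then have "b \<in> set bs" "r \<in> S" using that by (auto dest: set_zip_leftD set_zip_rightD)
    then show "proj (\<lambda>x. x) E (b r) = b r" by (intro E(3)) blast
  qed
  have "(\<Sum>ks\<in>{ks. set ks \<subseteq> S \<and> length ks = length bs}. (cmod (T (map2 (\<lambda>b k. b k) bs ks)))\<^sup>2)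
    = (\<Sum>ks\<in>{ks. set ks \<subseteq> S \<and> length ks = length bs}. (cmod (T (map2 (\<lambda>b r. proj (\<lambda>x. x) E (b r)) bs ks)))\<^sup>2)"
    by (intro sum.cong refl) (simp only: m mem_Collect_eq)
  then have "(\<Sum>ks\<in>{ks. set ks \<subseteq> S \<and> length ks = length bs}. (cmod (T (map2 (\<lambda>b k. b k) bs ks)))\<^sup>2)
    \<le> (\<Sum>ks\<in>{ks. set ks \<subseteq> E \<and> length ks = length bs}. (cmod (T ks))\<^sup>2)"
    using mixed_lists_bound[OF assms(1,2) E(1,2) assms(3)] by simp
  then show ?thesis using sum_lists_le_hs_norm_sq[OF E(1,2), where p = "length bs" and T = T]
    by (meson ennreal_leI order_trans)
qed

text \<open>Evaluation at fixed vectors is continuous for the Hilbert-Schmidt norm: a finite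
  orthonormal set whose span contains the arguments is one of the competitors.\<close>

lemma hs_norm_sq_pointwise:
  assumes "conj_multilinear p T" "length xs = p"
  shows "ennreal ((cmod (T xs))\<^sup>2) \<le> ennreal (\<Prod>x\<leftarrow>xs. (norm x)\<^sup>2) * hs_norm_sq p T"
proof -
  obtain E where E: "finite E" "orthonormal_family E (\<lambda>x. x)"
    "\<And>x. x \<in> set xs \<Longrightarrow> proj (\<lambda>x. x) E x = x"
    using gram_schmidt[of "set xs"] by blast
  have m: "map (proj (\<lambda>x. x) E) xs = xs" by (rule map_idI) (use E(3) in blast)
  have nn: "0 \<le> (\<Prod>x\<leftarrow>xs. (norm x)\<^sup>2)" by (induction xs) auto
  have "(cmod (T xs))\<^sup>2 \<le> (\<Prod>x\<leftarrow>xs. (norm x)\<^sup>2) * (\<Sum>ks\<in>{ks. set ks \<subseteq> E \<and> length ks = p}. (cmod (T ks))\<^sup>2)"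
    using proj_lists_bound[of xs T E "\<lambda>x. x"] assms E(1,2) m by simp
  then have "ennreal ((cmod (T xs))\<^sup>2) \<le> ennreal (\<Prod>x\<leftarrow>xs. (norm x)\<^sup>2) * ennreal (\<Sum>ks\<in>{ks. set ks \<subseteq> E \<and> length ks = p}. (cmod (T ks))\<^sup>2)"
    using nn by (simp add: ennreal_leI ennreal_mult'[symmetric] sum_nonneg)
  also have "\<dots> \<le> ennreal (\<Prod>x\<leftarrow>xs. (norm x)\<^sup>2) * hs_norm_sq p T"
    by (intro mult_left_mono sum_lists_le_hs_norm_sq E) auto
  finally show ?thesis .
qed

text \<open>Multilinearity alone does not give continuity in infinite dimension; the bound is what
  allows each argument to be recovered as the limit of its projections.\<close>

definition bounded_multilinear :: "nat \<Rightarrow> 'h::real_inner tensor \<Rightarrow> bool" where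
  "bounded_multilinear p T \<longleftrightarrow> conj_multilinear p T \<and>
     (\<exists>C. \<forall>xs. length xs = p \<longrightarrow> cmod (T xs) \<le> C * (\<Prod>x\<leftarrow>xs. norm x))"

lemma prod_list_map_nonneg: "(\<And>x. 0 \<le> f x) \<Longrightarrow> 0 \<le> (\<Prod>x\<leftarrow>xs. f x :: real)"
  by (induction xs) auto

lemma prod_list_norm_nonneg: "0 \<le> (\<Prod>x\<leftarrow>xs. norm (x::'a::real_normed_vector))"
  by (rule prod_list_map_nonneg) simp

lemma bounded_multilinearE:
  assumes "bounded_multilinear p T"
  obtains C where "C \<ge> 0" "\<And>xs. length xs = p \<Longrightarrow> cmod (T xs) \<le> C * (\<Prod>x\<leftarrow>xs. norm x)"
proof -
  obtain C where C: "\<And>xs. length xs = p \<Longrightarrow> cmod (T xs) \<le> C * (\<Prod>x\<leftarrow>xs. norm x)"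
    using assms unfolding bounded_multilinear_def by blast
  have "cmod (T xs) \<le> max C 0 * (\<Prod>x\<leftarrow>xs. norm x)" if "length xs = p" for xs
    by (rule order_trans[OF C[OF that]]) (intro mult_right_mono prod_list_norm_nonneg, simp)
  then show ?thesis using that[of "max C 0"] by simp
qed

text \<open>Finiteness of the supremum already bounds the functional, by
  \<open>hs_norm_sq_pointwise\<close>, with the square root of \<open>hs_norm_sq p T\<close> as
  constant.\<close>

lemma tensor_power_bounded:
  assumes "T \<in> tensor_power p"
  shows "bounded_multilinear p T"
proof -
  have cm: "conj_multilinear p T" and fin: "hs_norm_sq p T < \<infinity>" using assms by (auto simp: tensor_power_def)
  obtain h where h: "hs_norm_sq p T = ennreal h" "h \<ge> 0" using fin by (cases "hs_norm_sq p T") auto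
  have "cmod (T xs) \<le> sqrt h * (\<Prod>x\<leftarrow>xs. norm x)" if "length xs = p" for xs
  proof -
    have nn: "0 \<le> (\<Prod>x\<leftarrow>xs. (norm x)\<^sup>2)" by (induction xs) auto
    have e: "(\<Prod>x\<leftarrow>xs. (norm x)\<^sup>2) = (\<Prod>x\<leftarrow>xs. norm x)\<^sup>2" for xs :: "'a cplx list"
      by (induction xs) (auto simp: power_mult_distrib)
    have "(cmod (T xs))\<^sup>2 \<le> (\<Prod>x\<leftarrow>xs. (norm x)\<^sup>2) * h"
      using hs_norm_sq_pointwise[OF cm that] h nn by (simp add: ennreal_mult'[symmetric])
    also have "\<dots> = (sqrt h * (\<Prod>x\<leftarrow>xs. norm x))\<^sup>2"
      using h by (simp add: e power_mult_distrib)
    finally show ?thesis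
      by (rule power2_le_imp_le) (use h in \<open>auto intro!: mult_nonneg_nonneg prod_list_norm_nonneg\<close>)
  qed
  then show ?thesis using cm unfolding bounded_multilinear_def by blast
qed

lemma bounded_multilinear_tail:
  assumes "bounded_multilinear (Suc p) T"
  shows "bounded_multilinear p (\<lambda>xs. T (z # xs))"
proof -
  obtain C where C: "\<And>xs. length xs = Suc p \<Longrightarrow> cmod (T xs) \<le> C * (\<Prod>x\<leftarrow>xs. norm x)"
    using bounded_multilinearE[OF assms] by blast
  have "cmod (T (z # xs)) \<le> (C * norm z) * (\<Prod>x\<leftarrow>xs. norm x)" if "length xs = p" for xs
    using C[of "z # xs"] that by (simp add: mult_ac)
  then show ?thesis
    using assms conj_multilinear_tail unfolding bounded_multilinear_def by blast
qed

lemma prod_list_norm_proj_le: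
  assumes "finite S" "\<And>b. b \<in> set bs \<Longrightarrow> orthonormal_family S b" "length ys = length bs"
  shows "(\<Prod>x\<leftarrow>map2 (\<lambda>b x. proj b S x) bs ys. norm x) \<le> (\<Prod>x\<leftarrow>ys. norm (x::'h::real_inner cplx))"
  using assms(2,3)
proof (induction bs arbitrary: ys)
  case (Cons c cs)
  then obtain z zs where ys: "ys = z # zs" "length zs = length cs" by (cases ys) auto
  have "norm (proj c S z) \<le> norm z" using Cons.prems by (intro norm_proj_le assms(1)) auto
  moreover have "0 \<le> (\<Prod>x\<leftarrow>zs'. norm (f x))" for zs' and f :: "_ \<Rightarrow> 'h cplx"
    by (rule prod_list_map_nonneg) simp
  ultimately show ?case using Cons.IH[of zs] Cons.prems ys
    by (auto intro!: mult_mono simp: o_def)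
qed simp

text \<open>Telescoping over the slots: the error in the head is controlled by its projection error
  times the norms of the other projected arguments, which never exceed those of the originals; the
  rest is the induction hypothesis for the tail.\<close>

lemma bounded_multilinear_tendsto:
  assumes "bounded_multilinear (length bs) T" "length xs = length bs"
    "\<And>b x. b \<in> set bs \<Longrightarrow> (\<lambda>N::nat. proj b (S N) x) \<longlonglongrightarrow> x"
    "\<And>b N. b \<in> set bs \<Longrightarrow> orthonormal_family (S N) b" "\<And>N. finite (S N)"
  shows "(\<lambda>N. T (map2 (\<lambda>b x. proj b (S N) x) bs xs)) \<longlonglongrightarrow> T xs"
  using assms(1-4)
proof (induction bs arbitrary: T xs)
  case Nil
  then show ?case by simp
next
  case (Cons b bs)
  obtain x ys where xs: "xs = x # ys" "length ys = length bs" using Cons.prems(2) by (cases xs) auto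
  let ?y = "\<lambda>N. map2 (\<lambda>b x. proj b (S N) x) bs ys"
  have bm: "bounded_multilinear (Suc (length bs)) T" using Cons.prems(1) by simp
  then have cm: "conj_multilinear (Suc (length bs)) T" by (simp add: bounded_multilinear_def)
  obtain C where C: "C \<ge> 0" "\<And>xs. length xs = Suc (length bs) \<Longrightarrow> cmod (T xs) \<le> C * (\<Prod>x\<leftarrow>xs. norm x)"
    using bounded_multilinearE[OF bm] by blast
  have 1: "(\<lambda>N. T ((proj b (S N) x - x) # ?y N)) \<longlonglongrightarrow> 0"
  proof (rule Lim_null_comparison)
    have "cmod (T ((proj b (S N) x - x) # ?y N)) \<le> C * (norm (proj b (S N) x - x) * (\<Prod>x\<leftarrow>ys. norm x))" for N
    proof -
      have "cmod (T ((proj b (S N) x - x) # ?y N)) \<le> C * (norm (proj b (S N) x - x) * (\<Prod>x\<leftarrow>?y N. norm x))"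
        using C(2)[of "(proj b (S N) x - x) # ?y N"] xs by simp
      also have "\<dots> \<le> C * (norm (proj b (S N) x - x) * (\<Prod>x\<leftarrow>ys. norm x))"
        using xs Cons.prems(4) C(1) assms(5)
        by (intro mult_left_mono prod_list_norm_proj_le) auto
      finally show ?thesis .
    qed
    then show "\<forall>\<^sub>F N in sequentially. cmod (T ((proj b (S N) x - x) # ?y N)) \<le> C * (norm (proj b (S N) x - x) * (\<Prod>x\<leftarrow>ys. norm x))"
      by simp
    have "(\<lambda>N. norm (proj b (S N) x - x)) \<longlonglongrightarrow> 0"
      using Cons.prems(3)[of b x] by (simp add: LIM_zero tendsto_norm_zero)
    then show "(\<lambda>N. C * (norm (proj b (S N) x - x) * (\<Prod>x\<leftarrow>ys. norm x))) \<longlonglongrightarrow> 0"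
      by (intro tendsto_mult_right_zero tendsto_mult_left_zero)
  qed
  have 2: "(\<lambda>N. T (x # ?y N)) \<longlonglongrightarrow> T (x # ys)"
    using Cons.prems xs(2) by (intro Cons.IH[OF bounded_multilinear_tail[OF bm]]) auto
  have "T (map2 (\<lambda>b x. proj b (S N) x) (b # bs) xs) = T ((proj b (S N) x - x) # ?y N) + T (x # ?y N)" for N
    using conj_multilinear_head_diff[OF cm, of "?y N" "proj b (S N) x" x] xs by simp
  then show ?case using tendsto_add[OF 1 2] by (simp add: xs)
qed

text \<open>The converse estimate to \<open>mixed_sum_le_hs_norm_sq\<close>: for any competing
  \<open>E\<close>, the sum over its projected vectors stays below B by
  \<open>contraction_lists\<close>, and the projections converge to the vectors themselves.\<close>

lemma hs_norm_sq_le: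
  fixes T :: "'h::real_inner tensor"
  assumes "bounded_multilinear (length bs) T"
    "\<And>b x. b \<in> set bs \<Longrightarrow> (\<lambda>N::nat. proj b (S N) x) \<longlonglongrightarrow> x"
    "\<And>b N. b \<in> set bs \<Longrightarrow> orthonormal_family (S N) b" "\<And>N. finite (S N)"
    "\<And>N. (\<Sum>ks\<in>{ks. set ks \<subseteq> S N \<and> length ks = length bs}. (cmod (T (map2 (\<lambda>b k. b k) bs ks)))\<^sup>2) \<le> B"
  shows "hs_norm_sq (length bs) T \<le> ennreal B"
  unfolding hs_norm_sq_def
proof (rule SUP_least)
  fix E :: "'h cplx set"
  assume "E \<in> {E. finite E \<and> (\<forall>x\<in>E. \<forall>y\<in>E. cinner x y = (if x = y then 1 else 0))}"
  then have E: "finite E" "orthonormal_family E (\<lambda>x. x)" unfolding orthonormal_family_def by auto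
  let ?L = "{xs. set xs \<subseteq> E \<and> length xs = length bs}"
  have cm: "conj_multilinear (length bs) T" using assms(1) by (simp add: bounded_multilinear_def)
  have "(\<lambda>N. \<Sum>xs\<in>?L. (cmod (T (map2 (\<lambda>b x. proj b (S N) x) bs xs)))\<^sup>2) \<longlonglongrightarrow> (\<Sum>xs\<in>?L. (cmod (T xs))\<^sup>2)"
    using assms by (intro tendsto_sum tendsto_power tendsto_norm bounded_multilinear_tendsto) auto
  moreover have "(\<Sum>xs\<in>?L. (cmod (T (map2 (\<lambda>b x. proj b (S N) x) bs xs)))\<^sup>2) \<le> B" for N
    by (rule order_trans[OF contraction_lists[OF cm E(1) assms(4) E(2) assms(3)] assms(5)])
  ultimately have "(\<Sum>xs\<in>?L. (cmod (T xs))\<^sup>2) \<le> B"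
    by (intro LIMSEQ_le_const2) auto
  then show "(\<Sum>xs\<in>?L. ennreal ((cmod (T xs))\<^sup>2)) \<le> ennreal B"
    by (simp add: ennreal_leI)
qed

section \<open>Closure properties of bounded multilinear functionals\<close>

lemma conj_multilinearD:
  "conj_multilinear p T \<Longrightarrow> length xs = p \<Longrightarrow> i < p \<Longrightarrow>
    T (xs[i := cscale c x + y]) = cnj c * T (xs[i := x]) + T (xs[i := y])"
  unfolding conj_multilinear_def by blast

lemma bounded_multilinearD: "bounded_multilinear p T \<Longrightarrow> conj_multilinear p T"
  unfolding bounded_multilinear_def by blast

lemma bounded_multilinearI:
  assumes "conj_multilinear p T" "\<And>xs. length xs = p \<Longrightarrow> cmod (T xs) \<le> C * (\<Prod>x\<leftarrow>xs. norm x)"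
  shows "bounded_multilinear p T"
  using assms unfolding bounded_multilinear_def by blast

lemma prod_list_norm_nth: "(\<Prod>x\<leftarrow>xs. norm x) = (\<Prod>i<length xs. norm (xs ! i))"
  by (simp add: prod.list_conv_set_nth atLeast0LessThan)

lemma bounded_multilinear_pure_tensor: "bounded_multilinear (length hs) (pure_tensor hs)"
proof (rule bounded_multilinearI)
  show "conj_multilinear (length hs) (pure_tensor hs)"
    unfolding conj_multilinear_def
  proof (intro allI impI)
    fix xs :: "'a cplx list" and i c x y assume l: "length xs = length hs" "i < length hs"
    have "pure_tensor hs (xs[i := z]) = cinner (hs ! i) z * (\<Prod>j\<in>{..<length hs} - {i}. cinner (hs ! j) (xs ! j))" for z
      using l by (simp add: pure_tensor_def prod.remove[of _ i])
    then show "pure_tensor hs (xs[i := cscale c x + y])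
      = cnj c * pure_tensor hs (xs[i := x]) + pure_tensor hs (xs[i := y])"
      by (simp add: cinner_add_right algebra_simps)
  qed
next
  fix xs :: "'a cplx list" assume l: "length xs = length hs"
  have "cmod (pure_tensor hs xs) = (\<Prod>i<length hs. cmod (cinner (hs ! i) (xs ! i)))"
    using l by (simp add: pure_tensor_def prod_norm)
  also have "\<dots> \<le> (\<Prod>i<length hs. norm (hs ! i) * norm (xs ! i))"
    by (intro prod_mono) (auto intro: cmod_cinner_le)
  finally show "cmod (pure_tensor hs xs) \<le> (\<Prod>h\<leftarrow>hs. norm h) * (\<Prod>x\<leftarrow>xs. norm x)"
    using l by (simp add: prod.distrib prod_list_norm_nth)
qed

lemma bounded_multilinear_sum:
  fixes T :: "'i \<Rightarrow> 'h::real_inner tensor"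
  assumes "\<And>i. i \<in> I \<Longrightarrow> bounded_multilinear p (T i)"
  shows "bounded_multilinear p (\<lambda>xs. \<Sum>i\<in>I. c i * T i xs)"
proof -
  obtain C where C: "\<And>i xs. i \<in> I \<Longrightarrow> length xs = p \<Longrightarrow> cmod (T i xs) \<le> C i * (\<Prod>x\<leftarrow>xs. norm x)"
    using assms unfolding bounded_multilinear_def by metis
  show ?thesis
  proof (rule bounded_multilinearI)
    show "conj_multilinear p (\<lambda>xs. \<Sum>i\<in>I. c i * T i xs)"
      unfolding conj_multilinear_def
    proof (intro allI impI)
      fix xs :: "'h cplx list" and j a x y assume l: "length xs = p" "j < p"
      have "(\<Sum>i\<in>I. c i * T i (xs[j := cscale a x + y]))
          = (\<Sum>i\<in>I. cnj a * (c i * T i (xs[j := x])) + c i * T i (xs[j := y]))"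
        using l by (intro sum.cong refl)
          (simp add: conj_multilinearD[OF bounded_multilinearD[OF assms]] distrib_left mult.left_commute del: split_paired_All)
      then show "(\<Sum>i\<in>I. c i * T i (xs[j := cscale a x + y]))
          = cnj a * (\<Sum>i\<in>I. c i * T i (xs[j := x])) + (\<Sum>i\<in>I. c i * T i (xs[j := y]))"
        by (simp add: sum.distrib sum_distrib_left)
    qed
  next
    fix xs :: "'h cplx list" assume l: "length xs = p"
    have "cmod (\<Sum>i\<in>I. c i * T i xs) \<le> (\<Sum>i\<in>I. cmod (c i) * (C i * (\<Prod>x\<leftarrow>xs. norm x)))"
      by (rule order_trans[OF norm_sum]) (auto simp: norm_mult intro!: sum_mono mult_left_mono C l)
    then show "cmod (\<Sum>i\<in>I. c i * T i xs) \<le> (\<Sum>i\<in>I. cmod (c i) * C i) * (\<Prod>x\<leftarrow>xs. norm x)"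
      by (simp add: sum_distrib_right mult.assoc)
  qed
qed

lemma bounded_multilinear_diff:
  assumes "bounded_multilinear p S" "bounded_multilinear p T"
  shows "bounded_multilinear p (\<lambda>xs. S xs - T xs)"
proof -
  have "bounded_multilinear p (\<lambda>xs. \<Sum>i\<in>{True, False}. (if i then 1 else -1) * (if i then S else T) xs)"
    by (rule bounded_multilinear_sum) (use assms in auto)
  then show ?thesis by simp
qed

text \<open>\<open>permute_list \<sigma> xs\<close> has at position j the entry number
  \<open>\<sigma> j\<close> of \<open>xs\<close>, so a change at i surfaces at
  \<open>inv \<sigma> i\<close>.\<close>

lemma permute_list_update:
  assumes "\<sigma> permutes {..<length xs}" "i < length xs"
  shows "permute_list \<sigma> (xs[i := x]) = (permute_list \<sigma> xs)[inv \<sigma> i := x]"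
proof (rule nth_equalityI)
  fix j assume "j < length (permute_list \<sigma> (xs[i := x]))"
  then have j: "j < length xs" by simp
  have s: "\<sigma> j < length xs" using permutes_in_image[OF assms(1), of j] j by simp
  have "inv \<sigma> i = j \<longleftrightarrow> \<sigma> j = i" using permutes_inverses[OF assms(1)] by metis
  then show "permute_list \<sigma> (xs[i := x]) ! j = (permute_list \<sigma> xs)[inv \<sigma> i := x] ! j"
    using j s assms by (auto simp: permute_list_nth nth_list_update)
qed simp

lemma bounded_multilinear_symmetrize:
  assumes "bounded_multilinear p T"
  shows "bounded_multilinear p (symmetrize p T)"
proof -
  have cm: "conj_multilinear p T" using assms by (simp add: bounded_multilinear_def)
  obtain C where C: "\<And>xs. length xs = p \<Longrightarrow> cmod (T xs) \<le> C * (\<Prod>x\<leftarrow>xs. norm x)"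
    using bounded_multilinearE[OF assms] by blast
  have "bounded_multilinear p (\<lambda>xs. T (permute_list \<sigma> xs))" if \<sigma>: "\<sigma> permutes {..<p}" for \<sigma>
  proof (rule bounded_multilinearI)
    show "conj_multilinear p (\<lambda>xs. T (permute_list \<sigma> xs))"
      unfolding conj_multilinear_def
    proof (intro allI impI)
      fix xs :: "'a cplx list" and i c x y assume l: "length xs = p" "i < p"
      have "inv \<sigma> i < p" using permutes_in_image[OF permutes_inv[OF \<sigma>], of i] l by simp
      then show "T (permute_list \<sigma> (xs[i := cscale c x + y]))
        = cnj c * T (permute_list \<sigma> (xs[i := x])) + T (permute_list \<sigma> (xs[i := y]))"
        using conj_multilinearD[OF cm, of "permute_list \<sigma> xs" "inv \<sigma> i" c x y] l \<sigma>
          by (simp only: permute_list_update length_permute_list)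
    qed
    fix xs :: "'a cplx list" assume l: "length xs = p"
    have "(\<Prod>x\<leftarrow>permute_list \<sigma> xs. norm x) = (\<Prod>x\<leftarrow>xs. norm x)"
      unfolding prod_mset_prod_list[symmetric] using mset_permute_list[of \<sigma> xs] \<sigma> l by (metis mset_map)
    then show "cmod (T (permute_list \<sigma> xs)) \<le> C * (\<Prod>x\<leftarrow>xs. norm x)"
      using C[of "permute_list \<sigma> xs"] l by simp
  qed
  then have "bounded_multilinear p (\<lambda>xs. \<Sum>\<sigma> | \<sigma> permutes {..<p}. (1 / fact p) * T (permute_list \<sigma> xs))"
    by (intro bounded_multilinear_sum) auto
  then have *: "bounded_multilinear p (\<lambda>xs. (\<Sum>\<sigma> | \<sigma> permutes {..<p}. T (permute_list \<sigma> xs)) / fact p)"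
    by (simp add: sum_divide_distrib)
  have "symmetrize p T xs = (\<Sum>\<sigma> | \<sigma> permutes {..<p}. T (permute_list \<sigma> xs)) / fact p" if "length xs = p" for xs
    using that by (simp add: symmetrize_def)
  then show ?thesis using * by (simp add: bounded_multilinear_def conj_multilinear_def)
qed

lemma bounded_multilinear_tensor_prod:
  assumes "bounded_multilinear m S" "bounded_multilinear n T"
  shows "bounded_multilinear (m + n) (tensor_prod m S T)"
proof -
  obtain C where C: "C \<ge> 0" "\<And>xs. length xs = m \<Longrightarrow> cmod (S xs) \<le> C * (\<Prod>x\<leftarrow>xs. norm x)"
    using bounded_multilinearE[OF assms(1)] by blast
  obtain D where D: "D \<ge> 0" "\<And>xs. length xs = n \<Longrightarrow> cmod (T xs) \<le> D * (\<Prod>x\<leftarrow>xs. norm x)"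
    using bounded_multilinearE[OF assms(2)] by blast
  show ?thesis
  proof (rule bounded_multilinearI)
    show "conj_multilinear (m + n) (tensor_prod m S T)"
      unfolding conj_multilinear_def
    proof (intro allI impI)
      fix xs :: "'a cplx list" and i c x y assume l: "length xs = m + n" "i < m + n"
      show "tensor_prod m S T (xs[i := cscale c x + y])
        = cnj c * tensor_prod m S T (xs[i := x]) + tensor_prod m S T (xs[i := y])"
      proof (cases "i < m")
        case True
        have "S ((take m xs)[i := cscale c x + y]) = cnj c * S ((take m xs)[i := x]) + S ((take m xs)[i := y])"
          using True l by (intro conj_multilinearD[OF bounded_multilinearD[OF assms(1)]]) auto
        then show ?thesis using True
          by (simp add: tensor_prod_def take_update_swap algebra_simps)
      next
        case False
        have "T ((drop m xs)[i - m := cscale c x + y]) = cnj c * T ((drop m xs)[i - m := x]) + T ((drop m xs)[i - m := y])"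
          using False l by (intro conj_multilinearD[OF bounded_multilinearD[OF assms(2)]]) auto
        then show ?thesis using False
          by (simp add: tensor_prod_def drop_update_swap algebra_simps)
      qed
    qed
    fix xs :: "'a cplx list" assume l: "length xs = m + n"
    have "cmod (tensor_prod m S T xs) \<le> (C * (\<Prod>x\<leftarrow>take m xs. norm x)) * (D * (\<Prod>x\<leftarrow>drop m xs. norm x))"
      unfolding tensor_prod_def norm_mult using l
      by (intro mult_mono C D mult_nonneg_nonneg prod_list_norm_nonneg) auto
    also have "\<dots> = C * D * ((\<Prod>x\<leftarrow>take m xs. norm x) * (\<Prod>x\<leftarrow>drop m xs. norm x))" by (simp add: mult_ac)
    also have "(\<Prod>x\<leftarrow>take m xs. norm x) * (\<Prod>x\<leftarrow>drop m xs. norm x) = (\<Prod>x\<leftarrow>xs. norm x)"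
      by (metis append_take_drop_id map_append prod_list.append)
    finally show "cmod (tensor_prod m S T xs) \<le> C * D * (\<Prod>x\<leftarrow>xs. norm x)" .
  qed
qed

section \<open>Symmetrized tensors on an orthonormal family\<close>

lemma symmetrize_permute:
  assumes "\<tau> permutes {..<p}" "length xs = p"
  shows "symmetrize p T (permute_list \<tau> xs) = symmetrize p T xs"
proof -
  have "(\<Sum>\<sigma> | \<sigma> permutes {..<p}. T (permute_list \<sigma> (permute_list \<tau> xs)))
      = (\<Sum>\<sigma> | \<sigma> permutes {..<p}. T (permute_list (\<tau> \<circ> \<sigma>) xs))"
    using assms by (intro sum.cong refl) (simp add: permute_list_compose)
  also have "\<dots> = (\<Sum>\<sigma> | \<sigma> permutes {..<p}. T (permute_list \<sigma> xs))"
    using setum_permutations_compose_left[OF assms(1), of "\<lambda>\<sigma>. T (permute_list \<sigma> xs)"] by simp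
  finally show ?thesis using assms by (simp add: symmetrize_def)
qed

text \<open>On an orthonormal family every permutation contributes 0 or 1, so the symmetrization
  counts the rearrangements carrying \<open>ks\<close> to \<open>ks0\<close>.\<close>

lemma symmetrize_pure_tensor_basis:
  assumes "orthonormal_family K b" "set ks0 \<subseteq> K" "set ks \<subseteq> K" "length ks0 = p" "length ks = p"
  shows "symmetrize p (pure_tensor (map b ks0)) (map b ks)
    = of_nat (card {\<sigma>. \<sigma> permutes {..<p} \<and> permute_list \<sigma> ks = ks0}) / fact p"
proof -
  have "pure_tensor (map b ks0) (permute_list \<sigma> (map b ks)) = of_bool (permute_list \<sigma> ks = ks0)"
    if "\<sigma> permutes {..<p}" for \<sigma>
  proof -
    have s: "\<sigma> i < p" if "i < p" for i
      using permutes_in_image[OF \<open>\<sigma> permutes {..<p}\<close>, of i] that by simp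
    have "pure_tensor (map b ks0) (permute_list \<sigma> (map b ks))
      = (\<Prod>i<p. cinner (b (ks0 ! i)) (b (ks ! \<sigma> i)))"
      using assms that s by (simp add: pure_tensor_def permute_list_nth)
    also have "\<dots> = (\<Prod>i<p. of_bool (ks0 ! i = ks ! \<sigma> i))"
      using assms s by (intro prod.cong refl) (auto simp: orthonormal_familyD[OF assms(1)] subset_iff)
    also have "\<dots> = of_bool (\<forall>i<p. ks0 ! i = ks ! \<sigma> i)"
      by (auto simp: prod_zero_iff)
    also have "(\<forall>i<p. ks0 ! i = ks ! \<sigma> i) \<longleftrightarrow> permute_list \<sigma> ks = ks0"
      using assms that by (auto simp: list_eq_iff_nth_eq permute_list_nth)
    finally show ?thesis .
  qed
  then have "(\<Sum>\<sigma> | \<sigma> permutes {..<p}. pure_tensor (map b ks0) (permute_list \<sigma> (map b ks)))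
    = (\<Sum>\<sigma> | \<sigma> permutes {..<p}. of_bool (permute_list \<sigma> ks = ks0))"
    by (intro sum.cong refl) auto
  also have "\<dots> = of_nat (card {\<sigma>. \<sigma> permutes {..<p} \<and> permute_list \<sigma> ks = ks0})"
    by (simp add: sum_of_bool_eq finite_permutations Int_def)
  finally show ?thesis using assms by (simp add: symmetrize_def)
qed

lemma symmetrize_pure_tensor_basis_eq_0:
  assumes "orthonormal_family K b" "set ks0 \<subseteq> K" "set ks \<subseteq> K" "length ks0 = p" "length ks = p"
    "mset ks \<noteq> mset ks0"
  shows "symmetrize p (pure_tensor (map b ks0)) (map b ks) = 0"
proof -
  have "{\<sigma>. \<sigma> permutes {..<p} \<and> permute_list \<sigma> ks = ks0} = {}"
    using assms(5,6) mset_permute_list[of _ ks] by auto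
  then show ?thesis unfolding symmetrize_pure_tensor_basis[OF assms(1-5)]
    by (simp only: card.empty) simp
qed

text \<open>The identity permutation is always among those counted.\<close>

lemma symmetrize_pure_tensor_basis_ge:
  assumes "orthonormal_family K b" "set ks \<subseteq> K" "length ks = p"
  shows "1 / fact p \<le> cmod (symmetrize p (pure_tensor (map b ks)) (map b ks))"
proof -
  have "id \<in> {\<sigma>. \<sigma> permutes {..<p} \<and> permute_list \<sigma> ks = ks}" by (simp add: permutes_id)
  moreover have "finite {\<sigma>. \<sigma> permutes {..<p} \<and> permute_list \<sigma> ks = ks}"
    by (rule finite_subset[OF _ finite_permutations[of "{..<p}"]]) auto
  ultimately have "card {\<sigma>. \<sigma> permutes {..<p} \<and> permute_list \<sigma> ks = ks} \<ge> 1"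
    by (metis One_nat_def Suc_leI card_gt_0_iff empty_iff)
  then show ?thesis
    unfolding symmetrize_pure_tensor_basis[OF assms(1,2,2,3,3)] by (simp add: norm_divide divide_right_mono)
qed

text \<open>A canonical ordering of the multiset described by \<mu>, in terms of which every
  \<open>repeated_list g \<mu>\<close> is a map.\<close>

definition index_list :: "(nat \<Rightarrow> nat) \<Rightarrow> nat list" where
  "index_list \<mu> = repeated_list (\<lambda>k. k) \<mu>"

lemma repeated_list_eq: "repeated_list g \<mu> = map g (index_list \<mu>)"
  by (simp add: repeated_list_def index_list_def map_concat o_def)

lemma count_index_list:
  assumes "finite {k. \<mu> k \<noteq> 0}"
  shows "count (mset (index_list \<mu>)) = \<mu>"
proof
  fix j
  have *: "count (mset (concat (map (\<lambda>k. replicate (\<mu> k) k) xs))) j = (if j \<in> set xs then \<mu> j else 0)"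
    if "distinct xs" for xs
    using that by (induction xs) auto
  show "count (mset (index_list \<mu>)) j = \<mu> j"
    unfolding index_list_def repeated_list_def by (subst *) (use assms in auto)
qed

lemma multi_indicesD:
  assumes "\<mu> \<in> multi_indices K m"
  shows "finite {k. \<mu> k \<noteq> 0}" "{k. \<mu> k \<noteq> 0} \<subseteq> K" "(\<Sum>k | \<mu> k \<noteq> 0. \<mu> k) = m"
    "length (index_list \<mu>) = m" "set (index_list \<mu>) = {k. \<mu> k \<noteq> 0}"
proof -
  show f: "finite {k. \<mu> k \<noteq> 0}" "{k. \<mu> k \<noteq> 0} \<subseteq> K" and s: "(\<Sum>k | \<mu> k \<noteq> 0. \<mu> k) = m"
    using assms by (auto simp: multi_indices_def)
  have "length (index_list \<mu>) = size (mset (index_list \<mu>))" by simp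
  also have st: "set_mset (mset (index_list \<mu>)) = {k. \<mu> k \<noteq> 0}"
    by (simp only: set_mset_def count_index_list[OF f(1)]) auto
  have "size (mset (index_list \<mu>)) = (\<Sum>k\<in>{k. \<mu> k \<noteq> 0}. \<mu> k)"
    unfolding size_multiset_overloaded_eq st count_index_list[OF f(1)] ..
  finally show "length (index_list \<mu>) = m" using s by simp
  show "set (index_list \<mu>) = {k. \<mu> k \<noteq> 0}" using st by simp
qed

lemma count_mset_multi_indices:
  assumes "set ks \<subseteq> K"
  shows "count (mset ks) \<in> multi_indices K (length ks)"
proof -
  have e: "{k. count (mset ks) k \<noteq> 0} = set ks"
    by auto
  have "(\<Sum>k\<in>set ks. count (mset ks) k) = length ks"
    using size_multiset_overloaded_eq[of "mset ks"] by simp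
  then show ?thesis unfolding multi_indices_def mem_Collect_eq e using assms by simp
qed

lemma mset_index_list_count: "mset (index_list (count M)) = M"
proof -
  have "{k. count M k \<noteq> 0} = set_mset M" by auto
  then have "count (mset (index_list (count M))) = count M" by (intro count_index_list) simp
  then show ?thesis by (simp only: count_inject)
qed

lemma inj_on_index_list: "inj_on index_list (multi_indices K m)"
proof (rule inj_onI)
  fix \<mu> \<nu> assume *: "\<mu> \<in> multi_indices K m" "\<nu> \<in> multi_indices K m" "index_list \<mu> = index_list \<nu>"
  have "\<mu> = count (mset (index_list \<mu>))"
    by (rule count_index_list[OF multi_indicesD(1)[OF *(1)], symmetric])
  also have "\<dots> = \<nu>"
    unfolding *(3) by (rule count_index_list[OF multi_indicesD(1)[OF *(2)]])
  finally show "\<mu> = \<nu>" .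
qed

lemma finite_multi_indices:
  assumes "finite K" shows "finite (multi_indices K m)"
proof (rule inj_on_finite[OF inj_on_index_list])
  show "index_list ` multi_indices K m \<subseteq> {xs. set xs \<subseteq> K \<and> length xs = m}"
  proof clarify
    fix \<mu> assume "\<mu> \<in> multi_indices K m"
    from multi_indicesD(2,4,5)[OF this] show "set (index_list \<mu>) \<subseteq> K \<and> length (index_list \<mu>) = m" by simp
  qed
  show "finite {xs. set xs \<subseteq> K \<and> length xs = m}" by (rule finite_lists_length_eq[OF assms])
qed

lemma multi_indices_mono: "K \<subseteq> L \<Longrightarrow> multi_indices K m \<subseteq> multi_indices L m"
  by (auto simp: multi_indices_def)

text \<open>Conjugates occupy the last slots because \<open>basis_tensor\<close> is built on
  \<open>cconj (e k)\<close> there; at these lists its value is a product of two normalised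
  rearrangement counts when \<open>e\<close> is orthonormal.\<close>

definition mixed_vectors :: "(nat \<Rightarrow> 'h::real_inner cplx) \<Rightarrow> nat list \<Rightarrow> nat list \<Rightarrow> 'h cplx list" where
  "mixed_vectors e ks ls = map e ks @ map (\<lambda>k. cconj (e k)) ls"

lemma basis_tensor_mixed:
  assumes "\<mu> \<in> multi_indices K m" "\<nu> \<in> multi_indices K n" "length ks = m" "length ls = n"
  shows "basis_tensor e m n \<mu> \<nu> (mixed_vectors e ks ls)
    = symmetrize m (pure_tensor (map e (index_list \<mu>))) (map e ks)
    * symmetrize n (pure_tensor (map (\<lambda>k. cconj (e k)) (index_list \<nu>))) (map (\<lambda>k. cconj (e k)) ls)"
  using assms by (simp add: basis_tensor_def tensor_prod_def mixed_vectors_def repeated_list_eq)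

lemma bounded_multilinear_basis_tensor:
  assumes "\<mu> \<in> multi_indices K m" "\<nu> \<in> multi_indices K n"
  shows "bounded_multilinear (m + n) (basis_tensor e m n \<mu> \<nu>)"
  using bounded_multilinear_pure_tensor[of "map e (index_list \<mu>)"]
    bounded_multilinear_pure_tensor[of "map (\<lambda>k. cconj (e k)) (index_list \<nu>)"]
    multi_indicesD(4)[OF assms(1)] multi_indicesD(4)[OF assms(2)]
  unfolding basis_tensor_def repeated_list_eq
  by (intro bounded_multilinear_tensor_prod bounded_multilinear_symmetrize) simp_all

text \<open>Approximants built from products of symmetric tensors have the invariance exactly, and
  evaluation is continuous in the Hilbert-Schmidt norm, so the invariance survives the closure in
  \<open>sym_tensor_power2\<close>.\<close>

lemma sym_tensor_power2_permute:
  assumes f: "f \<in> sym_tensor_power2 m n" and \<sigma>: "\<sigma> permutes {..<m}" and \<tau>: "\<tau> permutes {..<n}"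
    and len: "length xs = m" "length ys = n"
  shows "f (permute_list \<sigma> xs @ permute_list \<tau> ys) = f (xs @ ys)"
proof -
  let ?x = "xs @ ys" let ?y = "permute_list \<sigma> xs @ permute_list \<tau> ys"
  define P where "P = (\<Prod>x\<leftarrow>?x. (norm x)\<^sup>2)"
  have P0: "0 \<le> P" unfolding P_def by (rule prod_list_map_nonneg) simp
  have "(\<Prod>x\<leftarrow>permute_list \<sigma> xs. (norm x)\<^sup>2) = (\<Prod>x\<leftarrow>xs. (norm x)\<^sup>2)" if "\<sigma> permutes {..<length xs}" for \<sigma> and xs :: "'a cplx list"
    unfolding prod_mset_prod_list[symmetric] using mset_permute_list[OF that] by (metis mset_map)
  then have Py: "(\<Prod>x\<leftarrow>?y. (norm x)\<^sup>2) = P" unfolding P_def using \<sigma> \<tau> len by simp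
  have fb: "bounded_multilinear (m + n) f"
    using f by (intro tensor_power_bounded) (simp add: sym_tensor_power2_def)
  have "(cmod (f ?y - f ?x))\<^sup>2 \<le> 0 + r" if "r > 0" for r
  proof -
    \<comment> \<open>Both evaluations then differ from the approximant by at most r/4 in square,
      and \<open>(a + b)^2 \<le> 2 a^2 + 2 b^2\<close> adds these up to r; the 1 in the denominator
      covers P = 0.\<close>
    define \<epsilon> where "\<epsilon> = ennreal (r / (4 * (P + 1)))"
    have r0: "r / (4 * (P + 1)) > 0" using that P0 by (intro divide_pos_pos mult_pos_pos) auto
    then have "\<epsilon> > 0" by (simp add: \<epsilon>_def)
    then obtain q :: nat and S T where ST: "\<And>i. i < q \<Longrightarrow> S i \<in> sym_tensor_power m \<and> T i \<in> sym_tensor_power n"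
      and h: "hs_norm_sq (m + n) (\<lambda>xs. (\<Sum>i<q. tensor_prod m (S i) (T i) xs) - f xs) < \<epsilon>"
      using f unfolding sym_tensor_power2_def by blast
    define g where "g xs = (\<Sum>i<q. tensor_prod m (S i) (T i) xs)" for xs
    have "bounded_multilinear (m + n) (\<lambda>xs. \<Sum>i<q. 1 * tensor_prod m (S i) (T i) xs)"
      using ST by (intro bounded_multilinear_sum bounded_multilinear_tensor_prod tensor_power_bounded)
        (auto simp: sym_tensor_power_def)
    then have "bounded_multilinear (m + n) (\<lambda>xs. g xs - f xs)"
      using fb by (intro bounded_multilinear_diff) (simp_all add: g_def)
    then have cm: "conj_multilinear (m + n) (\<lambda>xs. g xs - f xs)" by (simp add: bounded_multilinear_def)
    have geq: "g ?y = g ?x"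
      using ST \<sigma> \<tau> len by (auto simp: g_def tensor_prod_def sym_tensor_power_def intro!: sum.cong)
    have b: "(cmod (g z - f z))\<^sup>2 \<le> r / 4" if "length z = m + n" "(\<Prod>x\<leftarrow>z. (norm x)\<^sup>2) = P" for z
    proof -
      have "ennreal ((cmod (g z - f z))\<^sup>2) \<le> ennreal P * hs_norm_sq (m + n) (\<lambda>xs. g xs - f xs)"
        using hs_norm_sq_pointwise[OF cm that(1)] that(2) by simp
      also have "\<dots> \<le> ennreal P * \<epsilon>" using h by (intro mult_left_mono) (auto simp: g_def)
      also have "\<dots> = ennreal (P * (r / (4 * (P + 1))))"
        unfolding \<epsilon>_def by (rule ennreal_mult'[OF P0, symmetric])
      finally have "(cmod (g z - f z))\<^sup>2 \<le> P * (r / (4 * (P + 1)))"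
        by (subst (asm) ennreal_le_iff) (rule mult_nonneg_nonneg[OF P0 less_imp_le[OF r0]])
      also have "\<dots> \<le> r / 4" using P0 that \<open>r > 0\<close> by (simp add: field_simps)
      finally show ?thesis .
    qed
    have "cmod (f ?y - f ?x) \<le> cmod (g ?x - f ?x) + cmod (g ?y - f ?y)"
      using norm_triangle_ineq4[of "g ?x - f ?x" "g ?y - f ?y"] geq by (simp add: algebra_simps)
    then have "(cmod (f ?y - f ?x))\<^sup>2 \<le> (cmod (g ?x - f ?x) + cmod (g ?y - f ?y))\<^sup>2"
      by (intro power_mono) auto
    also have "\<dots> \<le> 2 * (cmod (g ?x - f ?x))\<^sup>2 + 2 * (cmod (g ?y - f ?y))\<^sup>2"
      using sum_squares_bound[of "cmod (g ?x - f ?x)" "cmod (g ?y - f ?y)"]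
      by (simp add: power2_sum)
    also have "\<dots> \<le> 0 + r" using b[of ?x] b[of ?y] len Py P_def by simp
    finally show ?thesis .
  qed
  then have "(cmod (f ?y - f ?x))\<^sup>2 \<le> 0" by (rule field_le_epsilon)
  then show ?thesis by simp
qed

text \<open>The slot-by-slot list of families in the form expected by the slot-varying norm
  estimates.\<close>

definition mixed_bases :: "(nat \<Rightarrow> 'h::real_inner cplx) \<Rightarrow> nat \<Rightarrow> nat \<Rightarrow> (nat \<Rightarrow> 'h cplx) list" where
  "mixed_bases e m n = replicate m e @ replicate n (\<lambda>k. cconj (e k))"

lemma map2_replicate: "length ks = m \<Longrightarrow> map2 (\<lambda>b k. b k) (replicate m g) ks = map g ks"
  by (induction ks arbitrary: m) auto

lemma map2_mixed_bases:
  assumes "length ks = m + n"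
  shows "map2 (\<lambda>b k. b k) (mixed_bases e m n) ks = mixed_vectors e (take m ks) (drop m ks)"
proof -
  have "zip (mixed_bases e m n) ks
    = zip (replicate m e) (take m ks) @ zip (replicate n (\<lambda>k. cconj (e k))) (drop m ks)"
    using assms by (simp add: mixed_bases_def zip_append1)
  then show ?thesis using assms by (simp add: map2_replicate mixed_vectors_def)
qed

lemma mixed_bases_props:
  assumes "orthonormal_basis K e" "b \<in> set (mixed_bases e m n)"
  shows "orthonormal_family K b" "(\<lambda>N::nat. proj b (K \<inter> {..<N}) x) \<longlonglongrightarrow> x"
proof -
  have "b = e \<or> b = (\<lambda>k. cconj (e k))" using assms(2) by (auto simp: mixed_bases_def)
  then show "orthonormal_family K b" "(\<lambda>N::nat. proj b (K \<inter> {..<N}) x) \<longlonglongrightarrow> x"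
    using orthonormal_basis_family[OF assms(1)] proj_tendsto[OF assms(1), of x] proj_cconj_tendsto[OF assms(1), of x]
    by (elim disjE; simp add: orthonormal_family_cconj)+
qed

lemma length_mixed_bases [simp]: "length (mixed_bases e m n) = m + n"
  by (simp add: mixed_bases_def)

lemma permuted_mixed_vectors:
  assumes "\<sigma> permutes {..<length ks}" "\<tau> permutes {..<length ls}"
  shows "mixed_vectors e (permute_list \<sigma> ks) (permute_list \<tau> ls)
    = permute_list \<sigma> (map e ks) @ permute_list \<tau> (map (\<lambda>k. cconj (e k)) ls)"
  using assms by (simp add: mixed_vectors_def permute_list_map)

text \<open>Lists with equal multisets differ by a permutation, so within each block a coordinate of
  f depends only on the multiset of its indices.\<close>

lemma sym_tensor_power2_mixed_mset:
  assumes "f \<in> sym_tensor_power2 m n" "length ks = m" "length ls = n"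
    "mset ks' = mset ks" "mset ls' = mset ls"
  shows "f (mixed_vectors e ks' ls') = f (mixed_vectors e ks ls)"
proof -
  obtain \<sigma> where \<sigma>: "\<sigma> permutes {..<length ks}" "permute_list \<sigma> ks = ks'"
    using mset_eq_permutation[OF assms(4)] by blast
  obtain \<tau> where \<tau>: "\<tau> permutes {..<length ls}" "permute_list \<tau> ls = ls'"
    using mset_eq_permutation[OF assms(5)] by blast
  have "f (permute_list \<sigma> (map e ks) @ permute_list \<tau> (map (\<lambda>k. cconj (e k)) ls)) = f (map e ks @ map (\<lambda>k. cconj (e k)) ls)"
    using \<sigma>(1) \<tau>(1) assms(2,3) by (intro sym_tensor_power2_permute[OF assms(1)]) auto
  then show ?thesis
    using permuted_mixed_vectors[OF \<sigma>(1) \<tau>(1), of e] \<sigma>(2) \<tau>(2) by (simp add: mixed_vectors_def)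
qed

lemma basis_tensor_mixed_mset:
  assumes "\<mu> \<in> multi_indices K m" "\<nu> \<in> multi_indices K n" "length ks = m" "length ls = n"
    "mset ks' = mset ks" "mset ls' = mset ls"
  shows "basis_tensor e m n \<mu> \<nu> (mixed_vectors e ks' ls') = basis_tensor e m n \<mu> \<nu> (mixed_vectors e ks ls)"
proof -
  obtain \<sigma> where \<sigma>: "\<sigma> permutes {..<length ks}" "permute_list \<sigma> ks = ks'"
    using mset_eq_permutation[OF assms(5)] by blast
  obtain \<tau> where \<tau>: "\<tau> permutes {..<length ls}" "permute_list \<tau> ls = ls'"
    using mset_eq_permutation[OF assms(6)] by blast
  have l: "length ks' = m" "length ls' = n" using assms(3-6) by (metis mset_eq_length)+
  show ?thesis
    unfolding basis_tensor_mixed[OF assms(1-4)] basis_tensor_mixed[OF assms(1,2) l]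
    unfolding \<sigma>(2)[symmetric] \<tau>(2)[symmetric]
    using \<sigma>(1) \<tau>(1) assms(3,4)
    by (simp add: permute_list_map[symmetric] symmetrize_permute)
qed

text \<open>The coefficients of \<open>f\<close> are read off at the sorted index lists; there the basis tensor itself
  is bounded below by \<open>1 / (m! n!)\<close>, and it vanishes at all index lists of another type.\<close>

lemma basis_tensor_index_list_ge:
  assumes "orthonormal_family K e" "\<mu> \<in> multi_indices K m" "\<nu> \<in> multi_indices K n"
  shows "1 / (fact m * fact n) \<le> cmod (basis_tensor e m n \<mu> \<nu> (mixed_vectors e (index_list \<mu>) (index_list \<nu>)))"
proof -
  note \<mu> = multi_indicesD[OF assms(2)] and \<nu> = multi_indicesD[OF assms(3)]
  have "1 / fact m * (1 / fact n) \<le> cmod (symmetrize m (pure_tensor (map e (index_list \<mu>))) (map e (index_list \<mu>)))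
    * cmod (symmetrize n (pure_tensor (map (\<lambda>k. cconj (e k)) (index_list \<nu>))) (map (\<lambda>k. cconj (e k)) (index_list \<nu>)))"
    using \<mu> \<nu> by (intro mult_mono symmetrize_pure_tensor_basis_ge[of K] assms orthonormal_family_cconj) auto
  then show ?thesis
    unfolding basis_tensor_mixed[OF assms(2,3) \<mu>(4) \<nu>(4)] by (simp add: norm_mult)
qed

lemma basis_tensor_mixed_eq_0:
  assumes "orthonormal_family K e" "\<mu> \<in> multi_indices K m" "\<nu> \<in> multi_indices K n"
    "length ks = m" "length ls = n" "set ks \<subseteq> K" "set ls \<subseteq> K"
    "(\<mu>, \<nu>) \<noteq> (count (mset ks), count (mset ls))"
  shows "basis_tensor e m n \<mu> \<nu> (mixed_vectors e ks ls) = 0"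
proof -
  note \<mu> = multi_indicesD[OF assms(2)] and \<nu> = multi_indicesD[OF assms(3)]
  have "mset ks \<noteq> mset (index_list \<mu>) \<or> mset ls \<noteq> mset (index_list \<nu>)"
    using assms(8) count_index_list[OF \<mu>(1)] count_index_list[OF \<nu>(1)] by force
  then show ?thesis
    unfolding basis_tensor_mixed[OF assms(2-5)]
    using symmetrize_pure_tensor_basis_eq_0[OF assms(1), of "index_list \<mu>" ks m]
      symmetrize_pure_tensor_basis_eq_0[OF orthonormal_family_cconj[OF assms(1)], of "index_list \<nu>" ls n]
      \<mu>(2,4,5) \<nu>(2,4,5) assms(4-7) by auto
qed

text \<open>The coefficients are chosen so that the partial sum agrees with \<open>f\<close> at
  every mixed coordinate with indices below N and vanishes at all others; the remainder is then the
  tail of the convergent series of squared coordinates of \<open>f\<close>. The sequence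
  \<open>s\<close> records the square-summability of the coefficients in the form in which the
  corresponding integrals are shown to be Cauchy.\<close>

lemma sym_tensor_power2_approx:
  fixes f :: "'h::real_inner tensor"
  assumes B: "orthonormal_basis K e" and f: "f \<in> sym_tensor_power2 m n"
  defines "A \<equiv> \<lambda>N. multi_indices (K \<inter> {..<N}) m \<times> multi_indices (K \<inter> {..<N}) n"
  obtains c s where
    "(\<lambda>N. hs_norm_sq (m + n) (\<lambda>xs. (\<Sum>(\<mu>, \<nu>)\<in>A N. c \<mu> \<nu> * basis_tensor e m n \<mu> \<nu> xs) - f xs)) \<longlonglongrightarrow> 0"
    "convergent s" "\<And>N M. N \<le> M \<Longrightarrow> (\<Sum>(\<mu>, \<nu>)\<in>A M - A N. (cmod (c \<mu> \<nu>))\<^sup>2) \<le> s M - s N"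
proof -
  have ON: "orthonormal_family K e" by (rule orthonormal_basis_family[OF B])
  define L where "L N = {ks. set ks \<subseteq> K \<inter> {..<N} \<and> length ks = m + n}" for N :: nat
  have finL: "finite (L N)" for N unfolding L_def by (rule finite_lists_length_eq) auto
  have Lmono: "L N \<subseteq> L M" if "N \<le> M" for N M using that unfolding L_def by fastforce
  define x where "x ks = mixed_vectors e (take m ks) (drop m ks)" for ks
  \<comment> \<open>The canonical index list of a pair of multi-indices; each class of coordinates
    that agree by symmetry contains exactly one of these.\<close>
  define rp where "rp = (\<lambda>(\<mu>, \<nu>). index_list \<mu> @ index_list \<nu>)"
  have finA: "finite (A N)" for N unfolding A_def by (intro finite_cartesian_product finite_multi_indices) auto
  have A_sub: "A N \<subseteq> multi_indices K m \<times> multi_indices K n" for N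
    unfolding A_def using multi_indices_mono[of "K \<inter> {..<N}" K] by blast
  define s0 where "s0 N = (\<Sum>ks\<in>L N. (cmod (f (x ks)))\<^sup>2)" for N
  have fT: "f \<in> tensor_power (m + n)" using f by (simp add: sym_tensor_power2_def)
  have fb: "bounded_multilinear (m + n) f" by (rule tensor_power_bounded[OF fT])
  obtain h where h: "hs_norm_sq (m + n) f = ennreal h" "h \<ge> 0"
    using fT by (cases "hs_norm_sq (m + n) f") (auto simp: tensor_power_def)
  \<comment> \<open>Partial sums of squared mixed coordinates stay below the squared norm of
    \<open>f\<close>, which makes the increasing sequence \<open>s0\<close> converge.\<close>
  have s0_le: "s0 N \<le> h" for N
  proof -
    have "ennreal (\<Sum>ks\<in>{ks. set ks \<subseteq> K \<inter> {..<N} \<and> length ks = length (mixed_bases e m n)}.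
        (cmod (f (map2 (\<lambda>b k. b k) (mixed_bases e m n) ks)))\<^sup>2) \<le> hs_norm_sq (length (mixed_bases e m n)) f"
      by (rule mixed_sum_le_hs_norm_sq)
        (use fb mixed_bases_props(1)[OF B] in \<open>auto simp: bounded_multilinear_def intro: orthonormal_family_subset\<close>)
    moreover have "(\<Sum>ks\<in>{ks. set ks \<subseteq> K \<inter> {..<N} \<and> length ks = length (mixed_bases e m n)}.
        (cmod (f (map2 (\<lambda>b k. b k) (mixed_bases e m n) ks)))\<^sup>2) = s0 N"
      unfolding s0_def L_def by (intro sum.cong) (auto simp: map2_mixed_bases x_def)
    ultimately have "ennreal (s0 N) \<le> ennreal h" using h by simp
    then show ?thesis using h by simp
  qed
  have s0_diff: "(\<Sum>ks\<in>L M - L N. (cmod (f (x ks)))\<^sup>2) = s0 M - s0 N" if "N \<le> M" for N M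
    unfolding s0_def by (intro sum_diff finL Lmono that)
  have s0_mono: "s0 N \<le> s0 M" if "N \<le> M" for N M
    using s0_diff[OF that] sum_nonneg[of "L M - L N" "\<lambda>ks. (cmod (f (x ks)))\<^sup>2"] by simp
  then have "incseq s0" by (simp add: incseq_def)
  then obtain s1 where s1: "s0 \<longlonglongrightarrow> s1" "\<And>N. s0 N \<le> s1"
    using incseq_convergent[of s0 h] s0_le by blast
  \<comment> \<open>Only the basis tensor of the same type is nonzero at this point, so dividing by
    its value there makes the sum reproduce \<open>f\<close>.\<close>
  define c where "c \<mu> \<nu> = f (x (rp (\<mu>, \<nu>))) / basis_tensor e m n \<mu> \<nu> (x (rp (\<mu>, \<nu>)))" for \<mu> \<nu>
  have xrp: "x (rp (\<mu>, \<nu>)) = mixed_vectors e (index_list \<mu>) (index_list \<nu>)"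
    if "(\<mu>, \<nu>) \<in> multi_indices K m \<times> multi_indices K n" for \<mu> \<nu>
    using that multi_indicesD(4)[of \<mu> K m] by (simp add: x_def rp_def)
  have ge: "1 / (fact m * fact n) \<le> cmod (basis_tensor e m n \<mu> \<nu> (x (rp (\<mu>, \<nu>))))"
    if "(\<mu>, \<nu>) \<in> multi_indices K m \<times> multi_indices K n" for \<mu> \<nu>
    unfolding xrp[OF that] using that by (intro basis_tensor_index_list_ge[OF ON]) auto
  have ne: "basis_tensor e m n \<mu> \<nu> (x (rp (\<mu>, \<nu>))) \<noteq> 0"
    if "(\<mu>, \<nu>) \<in> multi_indices K m \<times> multi_indices K n" for \<mu> \<nu>
  proof
    assume "basis_tensor e m n \<mu> \<nu> (x (rp (\<mu>, \<nu>))) = 0"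
    moreover have "0 < 1 / (fact m * fact n :: real)" by simp
    ultimately show False using ge[OF that] by (metis norm_zero not_le)
  qed
  \<comment> \<open>The squared inverse of the lower bound for a basis tensor at its own index list;
    it makes the coefficients comparable with the coordinates of \<open>f\<close>.\<close>
  define C where "C = ((fact m * fact n)\<^sup>2 :: real)"
  have c_le: "(cmod (c \<mu> \<nu>))\<^sup>2 \<le> C * (cmod (f (x (rp (\<mu>, \<nu>)))))\<^sup>2"
    if "(\<mu>, \<nu>) \<in> multi_indices K m \<times> multi_indices K n" for \<mu> \<nu>
  proof -
    have "cmod (f (x (rp (\<mu>, \<nu>)))) * 1 \<le> cmod (f (x (rp (\<mu>, \<nu>)))) * ((fact m * fact n) * cmod (basis_tensor e m n \<mu> \<nu> (x (rp (\<mu>, \<nu>)))))"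
      using ge[OF that] by (intro mult_left_mono) (auto simp: field_simps)
    then have "cmod (c \<mu> \<nu>) \<le> (fact m * fact n) * cmod (f (x (rp (\<mu>, \<nu>))))"
      using ne[OF that] by (simp add: c_def norm_divide field_simps)
    then have "(cmod (c \<mu> \<nu>))\<^sup>2 \<le> ((fact m * fact n) * cmod (f (x (rp (\<mu>, \<nu>)))))\<^sup>2"
      by (rule power_mono) simp
    then show ?thesis by (simp add: C_def power_mult_distrib)
  qed
  have rp_L: "rp (\<mu>, \<nu>) \<in> L N \<longleftrightarrow> (\<mu>, \<nu>) \<in> A N"
    if "(\<mu>, \<nu>) \<in> multi_indices K m \<times> multi_indices K n" for \<mu> \<nu> N
    using that multi_indicesD(4,5)[of \<mu> K m] multi_indicesD(4,5)[of \<nu> K n]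
    by (auto simp: L_def rp_def A_def multi_indices_def)
  have rp_inj: "inj_on rp (multi_indices K m \<times> multi_indices K n)"
  proof (rule inj_onI, clarify)
    fix \<mu> \<nu> \<mu>' \<nu>' assume *: "\<mu> \<in> multi_indices K m" "\<nu> \<in> multi_indices K n" "\<mu>' \<in> multi_indices K m" "\<nu>' \<in> multi_indices K n"
      and "rp (\<mu>, \<nu>) = rp (\<mu>', \<nu>')"
    then have "index_list \<mu> = index_list \<mu>'" "index_list \<nu> = index_list \<nu>'"
      using multi_indicesD(4)[OF *(1)] multi_indicesD(4)[OF *(3)] by (auto simp: rp_def)
    then show "\<mu> = \<mu>' \<and> \<nu> = \<nu>'" using inj_onD[OF inj_on_index_list] * by metis
  qed
  have c_tail: "(\<Sum>(\<mu>, \<nu>)\<in>A M - A N. (cmod (c \<mu> \<nu>))\<^sup>2) \<le> C * s0 M - C * s0 N" if "N \<le> M" for N M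
  proof -
    have "(\<Sum>(\<mu>, \<nu>)\<in>A M - A N. (cmod (c \<mu> \<nu>))\<^sup>2) \<le> (\<Sum>p\<in>A M - A N. C * (cmod (f (x (rp p))))\<^sup>2)"
      using c_le A_sub by (intro sum_mono) fastforce
    also have "\<dots> = C * (\<Sum>p\<in>A M - A N. (cmod (f (x (rp p))))\<^sup>2)" by (simp add: sum_distrib_left)
    also have "(\<Sum>p\<in>A M - A N. (cmod (f (x (rp p))))\<^sup>2) = (\<Sum>ks\<in>rp ` (A M - A N). (cmod (f (x ks)))\<^sup>2)"
      using inj_on_subset[OF rp_inj, of "A M - A N"] A_sub by (subst sum.reindex) auto
    also have "\<dots> \<le> (\<Sum>ks\<in>L M - L N. (cmod (f (x ks)))\<^sup>2)"
    proof (intro sum_mono2)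
      show "rp ` (A M - A N) \<subseteq> L M - L N"
      proof clarify
        fix \<mu> \<nu> assume *: "(\<mu>, \<nu>) \<in> A M" "(\<mu>, \<nu>) \<notin> A N"
        then have "(\<mu>, \<nu>) \<in> multi_indices K m \<times> multi_indices K n" using A_sub by blast
        from rp_L[OF this] * show "rp (\<mu>, \<nu>) \<in> L M - L N" by blast
      qed
    qed (auto simp: finL)
    finally show ?thesis by (simp add: s0_diff[OF that] C_def right_diff_distrib)
  qed
  define T where "T N xs = (\<Sum>(\<mu>, \<nu>)\<in>A N. c \<mu> \<nu> * basis_tensor e m n \<mu> \<nu> xs) - f xs" for N xs
  \<comment> \<open>A list \<open>ks\<close> determines one pair of multi-indices; its term occurs
    in the sum precisely when all entries are below N, and then it cancels \<open>f\<close>.\<close>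
  have T_at: "T N (x ks) = (if ks \<in> L N then 0 else - f (x ks))" if "ks \<in> L M" for N M ks
  proof -
    have ks: "set ks \<subseteq> K" "length (take m ks) = m" "length (drop m ks) = n" "length ks = m + n"
      using that by (auto simp: L_def)
    have sets: "set (take m ks) \<subseteq> K" "set (drop m ks) \<subseteq> K"
      using ks(1) set_take_subset[of m ks] set_drop_subset[of m ks] by auto
    define \<mu> where "\<mu> = count (mset (take m ks))"
    define \<nu> where "\<nu> = count (mset (drop m ks))"
    have mi: "(\<mu>, \<nu>) \<in> multi_indices K m \<times> multi_indices K n"
      using count_mset_multi_indices[OF sets(1)] count_mset_multi_indices[OF sets(2)] ks by (simp add: \<mu>_def \<nu>_def)
    have ms: "mset (index_list \<mu>) = mset (take m ks)" "mset (index_list \<nu>) = mset (drop m ks)"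
      by (simp_all add: \<mu>_def \<nu>_def mset_index_list_count)
    have "set (index_list \<mu>) = set (take m ks)" "set (index_list \<nu>) = set (drop m ks)"
      using ms by (metis set_mset_mset)+
    then have st: "set (rp (\<mu>, \<nu>)) = set ks"
      by (simp add: rp_def) (metis append_take_drop_id set_append)
    have "length (rp (\<mu>, \<nu>)) = length ks"
      using multi_indicesD(4)[of \<mu> K m] multi_indicesD(4)[of \<nu> K n] mi ks by (simp add: rp_def)
    with st have AL: "(\<mu>, \<nu>) \<in> A N \<longleftrightarrow> ks \<in> L N"
      unfolding rp_L[OF mi, symmetric] by (simp add: L_def)
    have fe: "f (x (rp (\<mu>, \<nu>))) = f (x ks)"
      unfolding xrp[OF mi] unfolding x_def by (rule sym_tensor_power2_mixed_mset[OF f ks(2,3) ms])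
    have be: "basis_tensor e m n \<mu> \<nu> (x (rp (\<mu>, \<nu>))) = basis_tensor e m n \<mu> \<nu> (x ks)"
      unfolding xrp[OF mi] unfolding x_def using mi by (intro basis_tensor_mixed_mset[OF _ _ ks(2,3) ms]) auto
    have "(\<Sum>(\<mu>', \<nu>')\<in>A N. c \<mu>' \<nu>' * basis_tensor e m n \<mu>' \<nu>' (x ks)) = (\<Sum>p\<in>A N. if p = (\<mu>, \<nu>) then f (x ks) else 0)"
    proof (rule sum.cong[OF refl], clarify)
      fix \<mu>' \<nu>' assume "(\<mu>', \<nu>') \<in> A N"
      then have mi': "\<mu>' \<in> multi_indices K m" "\<nu>' \<in> multi_indices K n" using A_sub by auto
      show "c \<mu>' \<nu>' * basis_tensor e m n \<mu>' \<nu>' (x ks) = (if (\<mu>', \<nu>') = (\<mu>, \<nu>) then f (x ks) else 0)"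
      proof (cases "(\<mu>', \<nu>') = (\<mu>, \<nu>)")
        case True
        then show ?thesis using ne[OF mi] fe be by (simp add: c_def)
      next
        case False
        then have "basis_tensor e m n \<mu>' \<nu>' (x ks) = 0"
          unfolding x_def \<mu>_def \<nu>_def by (rule basis_tensor_mixed_eq_0[OF ON mi' ks(2,3) sets])
        with False show ?thesis by (simp only: mult_zero_right if_False)
      qed
    qed
    then show ?thesis using AL finA by (simp add: T_def)
  qed
  have Tb: "bounded_multilinear (m + n) (T N)" for N
  proof -
    have "bounded_multilinear (m + n) (\<lambda>xs. \<Sum>p\<in>A N. c (fst p) (snd p) * basis_tensor e m n (fst p) (snd p) xs)"
    proof (rule bounded_multilinear_sum)
      fix p assume "p \<in> A N"
      then have "p \<in> multi_indices K m \<times> multi_indices K n" using A_sub by blast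
      then show "bounded_multilinear (m + n) (basis_tensor e m n (fst p) (snd p))"
        unfolding mem_Times_iff by (elim conjE) (rule bounded_multilinear_basis_tensor)
    qed
    from bounded_multilinear_diff[OF this fb] show ?thesis
      unfolding T_def [abs_def] case_prod_unfold .
  qed
  have hsT: "hs_norm_sq (m + n) (T N) \<le> ennreal (s1 - s0 N)" for N
  proof -
    have ON': "orthonormal_family (K \<inter> {..<N}) b" if "b \<in> set (mixed_bases e m n)" for b N
      by (rule orthonormal_family_subset[OF mixed_bases_props(1)[OF B that]]) blast
    have "hs_norm_sq (length (mixed_bases e m n)) (T N) \<le> ennreal (s1 - s0 N)"
    proof (rule hs_norm_sq_le[where S = "\<lambda>N. K \<inter> {..<N}", OF _ mixed_bases_props(2)[OF B] ON'])
      fix M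
      have "(\<Sum>ks\<in>{ks. set ks \<subseteq> K \<inter> {..<M} \<and> length ks = length (mixed_bases e m n)}.
          (cmod (T N (map2 (\<lambda>b k. b k) (mixed_bases e m n) ks)))\<^sup>2) = (\<Sum>ks\<in>L M. (cmod (T N (x ks)))\<^sup>2)"
        unfolding L_def by (intro sum.cong) (auto simp: map2_mixed_bases x_def)
      also have "\<dots> = (\<Sum>ks\<in>L M - L N. (cmod (f (x ks)))\<^sup>2)"
      proof (rule sum.mono_neutral_cong_right[OF finL])
        show "\<forall>ks\<in>L M - (L M - L N). (cmod (T N (x ks)))\<^sup>2 = 0"
          by (metis DiffD1 DiffD2 DiffI T_at norm_zero zero_power2)
        show "(cmod (T N (x ks)))\<^sup>2 = (cmod (f (x ks)))\<^sup>2" if "ks \<in> L M - L N" for ks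
          using T_at[of ks M N] that by simp
      qed auto
      \<comment> \<open>Enlarging to \<open>max M N\<close> avoids a separate case for M < N, where
        the difference is empty.\<close>
      also have "\<dots> \<le> (\<Sum>ks\<in>L (max M N) - L N. (cmod (f (x ks)))\<^sup>2)"
        using Lmono[of M "max M N"] by (intro sum_mono2) (auto simp: finL)
      also have "\<dots> = s0 (max M N) - s0 N" by (rule s0_diff) simp
      also have "\<dots> \<le> s1 - s0 N" using s1(2) by simp
      finally show "(\<Sum>ks\<in>{ks. set ks \<subseteq> K \<inter> {..<M} \<and> length ks = length (mixed_bases e m n)}.
          (cmod (T N (map2 (\<lambda>b k. b k) (mixed_bases e m n) ks)))\<^sup>2) \<le> s1 - s0 N" .
    qed (use Tb in simp_all)
    then show ?thesis by simp
  qed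
  have "(\<lambda>N. ennreal (s1 - s0 N)) \<longlonglongrightarrow> ennreal 0"
    using tendsto_diff[OF tendsto_const s1(1), of s1] unfolding diff_self by (rule tendsto_ennrealI)
  then have up: "(\<lambda>N. ennreal (s1 - s0 N)) \<longlonglongrightarrow> 0" by (simp only: ennreal_0)
  have lim: "(\<lambda>N. hs_norm_sq (m + n) (T N)) \<longlonglongrightarrow> 0"
    by (rule tendsto_sandwich[OF always_eventually[OF allI] always_eventually[OF allI] tendsto_const up])
      (rule zero_le, rule hsT)
  have cv: "convergent (\<lambda>N. C * s0 N)"
    unfolding convergent_def using tendsto_mult_left[OF s1(1)] by blast
  show thesis
    by (rule that[OF lim[unfolded T_def [abs_def]] cv c_tail])
qed

section \<open>Gaussian laws and integration by parts\<close>

text \<open>Levy's uniqueness theorem concerns probability measures; both measures are rescaled by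
  their common mass, which is the value of the transform at 0, and mass zero is treated
  separately.\<close>

lemma finite_real_measure_eqI_char:
  fixes M N :: "real measure"
  assumes fin: "finite_measure M" "finite_measure N" and sets: "sets M = sets borel" "sets N = sets borel"
    and eq: "\<And>t. (CLINT x|M. iexp (t * x)) = (CLINT x|N. iexp (t * x))"
  shows "M = N"
proof -
  interpret M: finite_measure M by fact
  interpret N: finite_measure N by fact
  have sp: "space M = UNIV" "space N = UNIV" using sets by (auto dest: sets_eq_imp_space_eq)
  have "complex_of_real (measure M (space M)) = of_real (measure N (space N))"
    using eq[of 0] by (simp add: scaleR_conv_of_real)
  then have mass: "measure M (space M) = measure N (space N)" unfolding of_real_eq_iff .
  define r where "r = measure M (space M)"
  show ?thesis
  proof (cases "r = 0")
    case True
    then have "emeasure M (space M) = 0" "emeasure N (space N) = 0"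
      using mass by (auto simp: r_def M.emeasure_eq_measure N.emeasure_eq_measure)
    then have "emeasure M A = 0" "emeasure N A = 0" for A
      by (metis emeasure_space le_zero_eq)+
    then show ?thesis using sets by (intro measure_eqI) auto
  next
    case False
    then have r: "r > 0" by (simp add: r_def zero_less_measure_iff)
    let ?d = "\<lambda>M. density M (\<lambda>_. ennreal (1 / r))"
    have real_dist: "real_distribution (?d L)"
      if "finite_measure L" "sets L = sets borel" "measure L (space L) = r" for L :: "real measure"
    proof -
      interpret L: finite_measure L by fact
      have "emeasure (?d L) (space (?d L)) = ennreal (1 / r) * emeasure L (space L)"
        by (simp add: emeasure_density)
      also have "\<dots> = 1" using r that(3) by (simp add: L.emeasure_eq_measure ennreal_mult'[symmetric])
      finally have "prob_space (?d L)" by (rule prob_spaceI)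
      then show ?thesis
        using that(2) by (simp add: real_distribution_def real_distribution_axioms_def)
    qed
    have ch: "char (?d L) t = (1 / r) *\<^sub>R (CLINT x|L. iexp (t * x))"
      if "sets L = sets borel" for L :: "real measure" and t
    proof -
      have [measurable_cong]: "sets L = sets borel" by fact
      show ?thesis unfolding char_def using r by (subst integral_density) auto
    qed
    have "char (?d M) = char (?d N)" by (rule ext) (simp only: ch sets eq)
    with real_dist fin sets mass have d: "?d M = ?d N"
      by (intro Levy_uniqueness) (auto simp: r_def)
    show ?thesis
    proof (rule measure_eqI)
      fix A assume "A \<in> sets M"
      then have A: "A \<in> sets M" "A \<in> sets N" using sets by auto
      have "ennreal (1 / r) * emeasure M A = ennreal (1 / r) * emeasure N A"
        using arg_cong[OF d, of "\<lambda>L. emeasure L A"] A by (simp add: emeasure_density nn_integral_cmult)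
      then have "ennreal r * (ennreal (1 / r) * emeasure M A) = ennreal r * (ennreal (1 / r) * emeasure N A)" by simp
      then show "emeasure M A = emeasure N A"
        using r by (simp add: mult.assoc[symmetric] ennreal_mult'[symmetric])
    qed (use sets in simp)
  qed
qed

text \<open>The weight is absorbed into the measure: the one-dimensional theorem applies to the laws
  of \<open>X\<close> under the two weighted measures, which are finite because \<open>w\<close> is
  bounded.\<close>

lemma weighted_char_unique:
  fixes \<mu> \<nu> :: "'a measure" and X w :: "'a \<Rightarrow> real"
  assumes fin: "finite_measure \<mu>" "finite_measure \<nu>" and sets: "sets \<mu> = sets \<nu>"
    and X: "X \<in> borel_measurable \<mu>" and w: "w \<in> borel_measurable \<mu>" "\<And>x. 0 \<le> w x" "\<And>x. w x \<le> C"
    and eq: "\<And>s. (CLINT x|\<mu>. w x *\<^sub>R iexp (s * X x)) = (CLINT x|\<nu>. w x *\<^sub>R iexp (s * X x))"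
    and B: "B \<in> sets borel"
  shows "(\<integral>x. w x * indicator B (X x) \<partial>\<mu>) = (\<integral>x. w x * indicator B (X x) \<partial>\<nu>)"
proof -
  have [measurable_cong]: "sets \<nu> = sets \<mu>" using sets by simp
  note [measurable] = X w(1) B
  let ?D = "\<lambda>\<mu>. distr (density \<mu> (\<lambda>x. ennreal (w x))) borel X"
  have fd: "finite_measure (?D \<mu>')" if "finite_measure \<mu>'" "sets \<mu>' = sets \<mu>" for \<mu>'
  proof -
    interpret finite_measure \<mu>' by fact
    have [measurable_cong]: "sets \<mu>' = sets \<mu>" by fact
    have "emeasure (?D \<mu>') (space (?D \<mu>')) = (\<integral>\<^sup>+x. ennreal (w x) \<partial>\<mu>')"
      by (simp add: emeasure_distr emeasure_density cong: nn_integral_cong)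
    also have "\<dots> \<le> (\<integral>\<^sup>+x. ennreal C \<partial>\<mu>')"
      by (intro nn_integral_mono ennreal_leI w)
    also have "\<dots> < \<infinity>" by (simp add: ennreal_mult_less_top emeasure_eq_measure)
    finally show ?thesis by (intro finite_measureI) auto
  qed
  have ch: "(CLINT x|?D \<mu>'. iexp (t * x)) = (CLINT x|\<mu>'. w x *\<^sub>R iexp (t * X x))" if "sets \<mu>' = sets \<mu>" for \<mu>' t
  proof -
    have [measurable_cong]: "sets \<mu>' = sets \<mu>" by fact
    show ?thesis using w(2) by (subst integral_distr) (auto simp: integral_density)
  qed
  have "?D \<mu> = ?D \<nu>"
    by (rule finite_real_measure_eqI_char) (use fd fin sets eq ch in auto)
  moreover have "(\<integral>x. w x * indicator B (X x) \<partial>\<mu>') = (\<integral>x. indicator B x \<partial>?D \<mu>')" if "sets \<mu>' = sets \<mu>" for \<mu>'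
  proof -
    have [measurable_cong]: "sets \<mu>' = sets \<mu>" by fact
    show ?thesis using w(2) by (subst integral_distr) (auto simp: integral_density)
  qed
  ultimately show ?thesis using sets by simp
qed

text \<open>Coordinates are passed one at a time from the exponential to an indicator. The weights
  \<open>1 + cos\<close> and \<open>1 + sin\<close> are nonnegative, which reduces each step to the one-dimensional theorem.\<close>

theorem PiM_measure_eqI_char:
  fixes \<mu> \<nu> :: "('i \<Rightarrow> real) measure"
  assumes I: "finite I" and fin: "finite_measure \<mu>" "finite_measure \<nu>"
    and sets: "sets \<mu> = sets (PiM I (\<lambda>_. borel))" "sets \<nu> = sets (PiM I (\<lambda>_. borel))"
    and eq: "\<And>t. (CLINT x|\<mu>. iexp (\<Sum>i\<in>I. t i * x i)) = (CLINT x|\<nu>. iexp (\<Sum>i\<in>I. t i * x i))"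
  shows "\<mu> = \<nu>"
proof -
  interpret \<mu>: finite_measure \<mu> by fact
  interpret \<nu>: finite_measure \<nu> by fact
  note [measurable_cong] = sets
  have "(CLINT x|\<mu>. (\<Prod>i\<in>J. indicator (A i) (x i)) *\<^sub>R iexp (\<Sum>i\<in>I - J. t i * x i))
     = (CLINT x|\<nu>. (\<Prod>i\<in>J. indicator (A i) (x i)) *\<^sub>R iexp (\<Sum>i\<in>I - J. t i * x i))"
    if "J \<subseteq> I" "\<And>i. i \<in> I \<Longrightarrow> A i \<in> sets borel" for J and A :: "'i \<Rightarrow> real set" and t
    using finite_subset[OF that(1) I] that(1)
  proof (induction J arbitrary: t rule: finite_induct)
    case empty
    then show ?case using eq by simp
  next
    case (insert j J)
    then have j: "j \<in> I" "j \<notin> J" "J \<subseteq> I" by auto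
    note A = that(2)
    have JI: "i \<in> I" if "i \<in> J" for i using j that by auto
    note Aj[measurable] = A[OF j(1)]
    have xm: "(\<lambda>x. x i) \<in> borel_measurable \<mu>" "(\<lambda>x. x i) \<in> borel_measurable \<nu>" if "i \<in> I" for i
      unfolding measurable_cong_sets[OF sets(1) refl] measurable_cong_sets[OF sets(2) refl]
      using that by (auto intro: measurable_component_singleton)
    note xj[measurable] = xm[OF j(1)]
    define b :: "('i \<Rightarrow> real) \<Rightarrow> real" where "b x = (\<Prod>i\<in>J. indicator (A i) (x i))" for x
    define S where "S x = (\<Sum>i\<in>I - insert j J. t i * x i)" for x :: "'i \<Rightarrow> real"
    have b01: "0 \<le> b x" "b x \<le> 1" for x
      unfolding b_def by (rule prod_nonneg, simp) (rule prod_le_1, simp add: indicator_def)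
    have bm[measurable]: "b \<in> borel_measurable \<mu>" "b \<in> borel_measurable \<nu>"
      unfolding b_def
      by (intro borel_measurable_prod measurable_compose[OF xm(1)[OF JI]] measurable_compose[OF xm(2)[OF JI]]
          borel_measurable_indicator A[OF JI]; assumption)+
    have Sm[measurable]: "S \<in> borel_measurable \<mu>" "S \<in> borel_measurable \<nu>"
      unfolding S_def by (intro borel_measurable_sum borel_measurable_times xm borel_measurable_const; simp)+
    \<comment> \<open>The factor \<open>r\<close> is taken as 0, 1 and -1 below: these three
      exponentials generate the weights \<open>b\<close>, \<open>b * (1 + cos S)\<close> and
      \<open>b * (1 + sin S)\<close>.\<close>
    have IHb: "(CLINT x|\<mu>. b x *\<^sub>R iexp (s * x j + r * S x)) = (CLINT x|\<nu>. b x *\<^sub>R iexp (s * x j + r * S x))" for s r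
    proof -
      define t' where "t' i = (if i = j then s else r * t i)" for i
      have IJ: "I - J = insert j (I - insert j J)" using j by auto
      have "(\<Sum>i\<in>I - J. t' i * x i) = s * x j + r * S x" for x
      proof -
        have "(\<Sum>i\<in>I - J. t' i * x i) = t' j * x j + (\<Sum>i\<in>I - insert j J. t' i * x i)"
          unfolding IJ using I by (intro sum.insert) auto
        also have "(\<Sum>i\<in>I - insert j J. t' i * x i) = (\<Sum>i\<in>I - insert j J. r * (t i * x i))"
          by (intro sum.cong) (auto simp: t'_def)
        finally show ?thesis by (simp add: S_def t'_def sum_distrib_left)
      qed
      then show ?thesis using insert.IH[OF j(3), of t'] unfolding b_def by (simp only:)
    qed
    have int: "integrable \<mu>' (\<lambda>x. b x *\<^sub>R iexp (s * x j + r * S x))" if "\<mu>' \<in> {\<mu>, \<nu>}" for s r \<mu>'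
      using that b01 by (auto intro!: \<mu>.integrable_const_bound[where B = 1] \<nu>.integrable_const_bound[where B = 1])
    have ceq: "(CLINT x|\<mu>. (b x * (1 + cos (S x))) *\<^sub>R iexp (s * x j)) = (CLINT x|\<nu>. (b x * (1 + cos (S x))) *\<^sub>R iexp (s * x j))" for s
    proof -
      have e: "(b x * (1 + cos (S x))) *\<^sub>R iexp (s * x j)
        = b x *\<^sub>R iexp (s * x j + 0 * S x) + (1/2) * (b x *\<^sub>R iexp (s * x j + 1 * S x)) + (1/2) * (b x *\<^sub>R iexp (s * x j + (-1) * S x))" for x
        unfolding cis_conv_exp[symmetric]
        by (simp add: complex_eq_iff cos_add sin_add cos_diff sin_diff field_simps)
      have "(CLINT x|\<mu>'. (b x * (1 + cos (S x))) *\<^sub>R iexp (s * x j))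
        = (CLINT x|\<mu>'. b x *\<^sub>R iexp (s * x j + 0 * S x)) + (1/2) * (CLINT x|\<mu>'. b x *\<^sub>R iexp (s * x j + 1 * S x)) + (1/2) * (CLINT x|\<mu>'. b x *\<^sub>R iexp (s * x j + (-1) * S x))" if "\<mu>' \<in> {\<mu>, \<nu>}" for \<mu>'
        unfolding e using int[OF that] by (simp only: Bochner_Integration.integral_add integrable_mult_right Bochner_Integration.integrable_add integral_mult_right_zero)
      from this[of \<mu>] this[of \<nu>] show ?thesis by (simp only: IHb insertI1 insertI2 simp_thms)
    qed
    have seq: "(CLINT x|\<mu>. (b x * (1 + sin (S x))) *\<^sub>R iexp (s * x j)) = (CLINT x|\<nu>. (b x * (1 + sin (S x))) *\<^sub>R iexp (s * x j))" for s
    proof -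
      have e: "(b x * (1 + sin (S x))) *\<^sub>R iexp (s * x j)
        = b x *\<^sub>R iexp (s * x j + 0 * S x) + (-\<i>/2) * (b x *\<^sub>R iexp (s * x j + 1 * S x)) + (\<i>/2) * (b x *\<^sub>R iexp (s * x j + (-1) * S x))" for x
        unfolding cis_conv_exp[symmetric]
        by (simp add: complex_eq_iff cos_add sin_add cos_diff sin_diff field_simps)
      have "(CLINT x|\<mu>'. (b x * (1 + sin (S x))) *\<^sub>R iexp (s * x j))
        = (CLINT x|\<mu>'. b x *\<^sub>R iexp (s * x j + 0 * S x)) + (-\<i>/2) * (CLINT x|\<mu>'. b x *\<^sub>R iexp (s * x j + 1 * S x)) + (\<i>/2) * (CLINT x|\<mu>'. b x *\<^sub>R iexp (s * x j + (-1) * S x))" if "\<mu>' \<in> {\<mu>, \<nu>}" for \<mu>'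
        unfolding e using int[OF that] by (simp only: Bochner_Integration.integral_add integrable_mult_right Bochner_Integration.integrable_add integral_mult_right_zero)
      from this[of \<mu>] this[of \<nu>] show ?thesis by (simp only: IHb insertI1 insertI2 simp_thms)
    qed
    have beq: "(CLINT x|\<mu>. b x *\<^sub>R iexp (s * x j)) = (CLINT x|\<nu>. b x *\<^sub>R iexp (s * x j))" for s
      using IHb[of s 0] by simp
    have W: "(\<integral>x. w x * indicator (A j) (x j) \<partial>\<mu>) = (\<integral>x. w x * indicator (A j) (x j) \<partial>\<nu>)"
      if "w \<in> borel_measurable \<mu>" "\<And>x. 0 \<le> w x" "\<And>x. w x \<le> 2"
        "\<And>s. (CLINT x|\<mu>. w x *\<^sub>R iexp (s * x j)) = (CLINT x|\<nu>. w x *\<^sub>R iexp (s * x j))" for w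
      by (rule weighted_char_unique[OF fin _ xj(1) that A[OF j(1)]]) (use sets in simp)
    have le2: "b x * (1 + c) \<le> 2" if "c \<le> 1" "- 1 \<le> c" for x c
      using mult_mono[of "b x" 1 "1 + c" 2] b01[of x] that by simp
    have ge0: "0 \<le> b x * (1 + c)" if "- 1 \<le> c" for x c
      using b01[of x] that by (intro mult_nonneg_nonneg) auto
    note Wb = W[OF bm(1) b01(1) order_trans[OF b01(2)] beq, simplified]
    have Wc: "(\<integral>x. (b x * (1 + cos (S x))) * indicator (A j) (x j) \<partial>\<mu>) = (\<integral>x. (b x * (1 + cos (S x))) * indicator (A j) (x j) \<partial>\<nu>)"
      by (rule W[OF _ _ _ ceq]) (auto intro!: le2 ge0)
    have Ws: "(\<integral>x. (b x * (1 + sin (S x))) * indicator (A j) (x j) \<partial>\<mu>) = (\<integral>x. (b x * (1 + sin (S x))) * indicator (A j) (x j) \<partial>\<nu>)"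
      by (rule W[OF _ _ _ seq]) (auto intro!: le2 ge0)
    have bi: "0 \<le> b x * indicator (A j) (x j)" "b x * indicator (A j) (x j) \<le> 1" for x
      using b01[of x] by (auto simp: indicator_def)
    \<comment> \<open>Subtracting the plain weight again recovers cosine and sine, hence the
      exponential of the remaining coordinates.\<close>
    have split: "(CLINT x|\<mu>'. (b x * indicator (A j) (x j)) *\<^sub>R iexp (S x))
      = of_real ((\<integral>x. (b x * (1 + cos (S x))) * indicator (A j) (x j) \<partial>\<mu>') - (\<integral>x. b x * indicator (A j) (x j) \<partial>\<mu>'))
      + \<i> * of_real ((\<integral>x. (b x * (1 + sin (S x))) * indicator (A j) (x j) \<partial>\<mu>') - (\<integral>x. b x * indicator (A j) (x j) \<partial>\<mu>'))"
      if "\<mu>' \<in> {\<mu>, \<nu>}" for \<mu>'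
    proof -
      have fm: "finite_measure \<mu>'" and m[measurable]: "b \<in> borel_measurable \<mu>'" "S \<in> borel_measurable \<mu>'"
        "(\<lambda>x. indicator (A j) (x j) :: real) \<in> borel_measurable \<mu>'"
        using that fin by (auto)
      interpret finite_measure \<mu>' by fact
      have i0: "integrable \<mu>' (\<lambda>x. b x * indicator (A j) (x j))"
        using bi by (intro integrable_const_bound[where B = 1]) auto
      have i1: "integrable \<mu>' (\<lambda>x. (b x * (1 + g (S x))) * indicator (A j) (x j))" if "g \<in> {sin, cos}" for g :: "real \<Rightarrow> real"
      proof (rule integrable_const_bound[where B = 2])
        show "AE x in \<mu>'. norm (b x * (1 + g (S x)) * indicator (A j) (x j)) \<le> 2"
          using le2[of "g (S _)"] ge0[of "g (S _)"] that
          by (intro AE_I2) (auto simp: indicator_def)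
      qed (use that in auto)
      have "(CLINT x|\<mu>'. (b x * indicator (A j) (x j)) *\<^sub>R iexp (S x))
        = (CLINT x|\<mu>'. of_real ((b x * (1 + cos (S x))) * indicator (A j) (x j) - b x * indicator (A j) (x j))
           + \<i> * of_real ((b x * (1 + sin (S x))) * indicator (A j) (x j) - b x * indicator (A j) (x j)))"
        by (intro Bochner_Integration.integral_cong refl)
          (auto simp: cis_conv_exp[symmetric] complex_eq_iff algebra_simps)
      also have "\<dots> = (CLINT x|\<mu>'. of_real ((b x * (1 + cos (S x))) * indicator (A j) (x j) - b x * indicator (A j) (x j)))
         + (CLINT x|\<mu>'. \<i> * of_real ((b x * (1 + sin (S x))) * indicator (A j) (x j) - b x * indicator (A j) (x j)))"
        using i0 i1 by (intro Bochner_Integration.integral_add integrable_mult_right integrable_of_real Bochner_Integration.integrable_diff) auto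
      also have "\<dots> = of_real (\<integral>x. ((b x * (1 + cos (S x))) * indicator (A j) (x j) - b x * indicator (A j) (x j)) \<partial>\<mu>')
         + \<i> * of_real (\<integral>x. ((b x * (1 + sin (S x))) * indicator (A j) (x j) - b x * indicator (A j) (x j)) \<partial>\<mu>')"
        by (simp only: integral_mult_right_zero integral_complex_of_real)
      finally show ?thesis using i0 i1 by (simp only: Bochner_Integration.integral_diff insertI1 insertI2)
    qed
    have "(CLINT x|\<mu>. (b x * indicator (A j) (x j)) *\<^sub>R iexp (S x)) = (CLINT x|\<nu>. (b x * indicator (A j) (x j)) *\<^sub>R iexp (S x))"
      using split[of \<mu>] split[of \<nu>] Wb Wc Ws by simp
    then show ?case using insert.hyps by (simp add: b_def S_def mult.commute)
  qed
  from this[OF subset_refl] have prod_eq: "(\<integral>x. (\<Prod>i\<in>I. indicator (A i) (x i)) \<partial>\<mu>) = (\<integral>x. (\<Prod>i\<in>I. indicator (A i) (x i) :: real) \<partial>\<nu>)"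
    if "\<And>i. i \<in> I \<Longrightarrow> A i \<in> sets borel" for A :: "'i \<Rightarrow> real set"
    using that by (simp add: scaleR_conv_of_real of_real_prod[symmetric] del: of_real_prod)
  have box: "emeasure \<mu>' (Pi\<^sub>E I A) = ennreal (\<integral>x. (\<Prod>i\<in>I. indicator (A i) (x i)) \<partial>\<mu>')"
    if "\<mu>' \<in> {\<mu>, \<nu>}" "\<And>i. i \<in> I \<Longrightarrow> A i \<in> sets borel" for A :: "'i \<Rightarrow> real set" and \<mu>'
  proof -
    have fm: "finite_measure \<mu>'" and s: "sets \<mu>' = sets (PiM I (\<lambda>_. borel))" using that fin sets by auto
    interpret finite_measure \<mu>' by fact
    have sp: "space \<mu>' = Pi\<^sub>E I (\<lambda>_. UNIV)" using sets_eq_imp_space_eq[OF s] by (simp add: space_PiM)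
    have "(\<integral>x. (\<Prod>i\<in>I. indicator (A i) (x i)) \<partial>\<mu>') = (\<integral>x. (indicator (Pi\<^sub>E I A) x :: real) \<partial>\<mu>')"
    proof (rule Bochner_Integration.integral_cong[OF refl])
      fix x assume "x \<in> space \<mu>'"
      then have x: "x \<in> extensional I" by (simp add: sp PiE_iff)
      show "(\<Prod>i\<in>I. indicator (A i) (x i)) = (indicator (Pi\<^sub>E I A) x :: real)"
      proof (cases "\<forall>i\<in>I. x i \<in> A i")
        case True
        then show ?thesis using x by (simp add: PiE_iff)
      next
        case False
        then have "(\<Prod>i\<in>I. indicator (A i) (x i) :: real) = 0"
          by (intro prod_zero I) (metis indicator_simps(2))
        moreover have "x \<notin> Pi\<^sub>E I A" using False by auto
        ultimately show ?thesis by simp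
      qed
    qed
    also have "\<dots> = measure \<mu>' (Pi\<^sub>E I A)"
      using sets_PiM_I_finite[OF I, of A "\<lambda>_. borel"] that(2) s by simp
    finally show ?thesis by (simp add: emeasure_eq_measure)
  qed
  show ?thesis
  proof (rule measure_eqI_PiM_finite[OF I sets])
    show "emeasure \<mu> (Pi\<^sub>E I A) = emeasure \<nu> (Pi\<^sub>E I A)" if "\<And>i. i \<in> I \<Longrightarrow> A i \<in> sets borel" for A
      using box[of \<mu> A] box[of \<nu> A] prod_eq[of A] that by simp
    \<comment> \<open>The measures are finite, so a constant sequence consisting of the whole space
      exhausts it.\<close>
    show "range (\<lambda>_::nat. Pi\<^sub>E I (\<lambda>_. UNIV)) \<subseteq> prod_algebra I (\<lambda>_. borel)"
      using I by (auto intro!: prod_algebraI_finite)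
    show "(\<Union>i::nat. Pi\<^sub>E I (\<lambda>_. UNIV)) = space (PiM I (\<lambda>_. borel))" by (simp add: space_PiM)
    show "emeasure \<mu> (Pi\<^sub>E I (\<lambda>_. UNIV)) \<noteq> \<infinity>" for i :: nat by simp
  qed
qed

section \<open>One-dimensional Gaussian variables\<close>

lemma normal_expectation:
  fixes g :: "real \<Rightarrow> 'b::{banach, second_countable_topology}"
  assumes X: "distributed M lborel X (\<lambda>x. ennreal (normal_density 0 \<sigma> x))" and [measurable]: "g \<in> borel_measurable borel"
  shows "(\<integral>\<omega>. g (X \<omega>) \<partial>M) = (\<integral>x. normal_density 0 \<sigma> x *\<^sub>R g x \<partial>lborel)"
    and "integrable M (\<lambda>\<omega>. g (X \<omega>)) \<longleftrightarrow> integrable lborel (\<lambda>x. normal_density 0 \<sigma> x *\<^sub>R g x)"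
proof -
  have [measurable]: "X \<in> borel_measurable M" using distributed_measurable[OF X] by simp
  have d: "distr M lborel X = density lborel (\<lambda>x. ennreal (normal_density 0 \<sigma> x))"
    by (rule distributed_distr_eq_density[OF X])
  have "(\<integral>\<omega>. g (X \<omega>) \<partial>M) = (\<integral>x. g x \<partial>distr M lborel X)" by (simp add: integral_distr)
  also have "\<dots> = (\<integral>x. normal_density 0 \<sigma> x *\<^sub>R g x \<partial>lborel)"
    unfolding d by (rule integral_density) auto
  finally show "(\<integral>\<omega>. g (X \<omega>) \<partial>M) = (\<integral>x. normal_density 0 \<sigma> x *\<^sub>R g x \<partial>lborel)" .
  have "integrable M (\<lambda>\<omega>. g (X \<omega>)) \<longleftrightarrow> integrable (distr M lborel X) g" by (simp add: integrable_distr_eq)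
  also have "\<dots> \<longleftrightarrow> integrable lborel (\<lambda>x. normal_density 0 \<sigma> x *\<^sub>R g x)"
    unfolding d by (rule integrable_density) auto
  finally show "integrable M (\<lambda>\<omega>. g (X \<omega>)) \<longleftrightarrow> integrable lborel (\<lambda>x. normal_density 0 \<sigma> x *\<^sub>R g x)" .
qed

context prob_space
begin

lemma centered_gaussian_measurable: "centered_gaussian M X \<Longrightarrow> X \<in> borel_measurable M"
  by (simp add: centered_gaussian_def)

lemma centered_gaussian_integrable_power:
  assumes "centered_gaussian M X"
  shows "integrable M (\<lambda>\<omega>. \<bar>X \<omega>\<bar> ^ k)"
proof -
  have [measurable]: "X \<in> borel_measurable M" by (rule centered_gaussian_measurable[OF assms])
  consider "AE \<omega> in M. X \<omega> = 0" | \<sigma> where "\<sigma> > 0" "distributed M lborel X (\<lambda>x. ennreal (normal_density 0 \<sigma> x))"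
    using assms unfolding centered_gaussian_def by blast
  then show ?thesis
  proof cases
    case 1
    \<comment> \<open>\<open>0 ^ k\<close> in place of 0 covers k = 0, where the power is 1.\<close>
    then have "AE \<omega> in M. \<bar>X \<omega>\<bar> ^ k = 0 ^ k" by eventually_elim simp
    then show ?thesis
      by (subst integrable_cong_AE[where g = "\<lambda>_. 0 ^ k"]) auto
  next
    case 2
    show ?thesis
      unfolding normal_expectation(2)[OF 2(2), of "\<lambda>x. \<bar>x\<bar> ^ k", simplified]
      using integrable_normal_moment_abs[OF 2(1), of 0 k] by simp
  qed
qed

lemma centered_gaussian_char:
  assumes "centered_gaussian M X"
  shows "(CLINT \<omega>|M. iexp (t * X \<omega>)) = exp (- (t\<^sup>2) * (\<integral>\<omega>. (X \<omega>)\<^sup>2 \<partial>M) / 2)"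
proof -
  have [measurable]: "X \<in> borel_measurable M" by (rule centered_gaussian_measurable[OF assms])
  consider "AE \<omega> in M. X \<omega> = 0" | \<sigma> where "\<sigma> > 0" "distributed M lborel X (\<lambda>x. ennreal (normal_density 0 \<sigma> x))"
    using assms unfolding centered_gaussian_def by blast
  then show ?thesis
  proof cases
    case 1
    then have "AE \<omega> in M. iexp (t * X \<omega>) = 1" "AE \<omega> in M. (X \<omega>)\<^sup>2 = 0" by (eventually_elim, simp)+
    then have "(CLINT \<omega>|M. iexp (t * X \<omega>)) = (CLINT \<omega>|M. 1)" "(\<integral>\<omega>. (X \<omega>)\<^sup>2 \<partial>M) = (\<integral>\<omega>. 0 \<partial>M)"
      by (intro integral_cong_AE; simp)+
    then show ?thesis by (simp add: prob_space)
  next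
    case 2
    let ?Y = "\<lambda>\<omega>. X \<omega> / \<sigma>"
    have Y: "distributed M lborel ?Y std_normal_density"
      using normal_standard_normal_convert[OF 2(1), of X 0] 2(2) by simp
    have "(CLINT \<omega>|M. iexp (t * X \<omega>)) = (CLINT \<omega>|M. iexp ((t * \<sigma>) * ?Y \<omega>))"
      using 2(1) by simp
    also have "\<dots> = (\<integral>x. std_normal_density x *\<^sub>R iexp ((t * \<sigma>) * x) \<partial>lborel)"
      by (rule normal_expectation(1)[OF Y, of "\<lambda>x. iexp ((t * \<sigma>) * x)"]) simp
    also have "\<dots> = char std_normal_distribution (t * \<sigma>)"
      unfolding char_def by (subst integral_density) auto
    also have "\<dots> = exp (- (t * \<sigma>)\<^sup>2 / 2)" by (simp add: char_std_normal_distribution)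
    finally have 1: "(CLINT \<omega>|M. iexp (t * X \<omega>)) = exp (- (t * \<sigma>)\<^sup>2 / 2)" .
    have "(\<integral>\<omega>. (X \<omega>)\<^sup>2 \<partial>M) = \<sigma>\<^sup>2"
      using normal_expectation(1)[OF 2(2), of "\<lambda>x. x\<^sup>2"] integral_normal_moment_even[OF 2(1), of 0 1]
      by (simp add: fact_numeral)
    then show ?thesis using 1 by (simp add: power_mult_distrib)
  qed
qed

text \<open>A positive second moment rules out the degenerate alternative of
  \<open>centered_gaussian\<close> and pins down the standard deviation.\<close>

lemma centered_gaussian_normal:
  assumes "centered_gaussian M X" "(\<integral>\<omega>. (X \<omega>)\<^sup>2 \<partial>M) = \<sigma>\<^sup>2" "\<sigma> > 0"
  shows "distributed M lborel X (\<lambda>x. ennreal (normal_density 0 \<sigma> x))"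
proof -
  have [measurable]: "X \<in> borel_measurable M" by (rule centered_gaussian_measurable[OF assms(1)])
  consider "AE \<omega> in M. X \<omega> = 0" | \<tau> where "\<tau> > 0" "distributed M lborel X (\<lambda>x. ennreal (normal_density 0 \<tau> x))"
    using assms(1) unfolding centered_gaussian_def by blast
  then show ?thesis
  proof cases
    case 1
    then have "AE \<omega> in M. (X \<omega>)\<^sup>2 = 0" by eventually_elim simp
    then have "(\<integral>\<omega>. (X \<omega>)\<^sup>2 \<partial>M) = (\<integral>\<omega>. 0 \<partial>M)" by (intro integral_cong_AE) auto
    then show ?thesis using assms by simp
  next
    case 2
    have "(\<integral>\<omega>. (X \<omega>)\<^sup>2 \<partial>M) = \<tau>\<^sup>2"
      using normal_expectation(1)[OF 2(2), of "\<lambda>x. x\<^sup>2"] integral_normal_moment_even[OF 2(1), of 0 1]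
      by (simp add: fact_numeral)
    then have "\<tau> = \<sigma>" using assms 2(1) by (simp add: power2_eq_iff_nonneg)
    then show ?thesis using 2 by simp
  qed
qed

end

section \<open>Moments and characteristic functions of the process\<close>

context complex_isonormal
begin

lemma measurable_Z' [measurable]: "Z h \<in> borel_measurable M"
  by (rule measurable_Z)

lemma Z_zero: "AE \<omega> in M. Z 0 \<omega> = 0"
  using linear_Z[of 1 0 0] by eventually_elim simp

lemma Z_cscale: "AE \<omega> in M. Z (cscale c h) \<omega> = c * Z h \<omega>"
  using linear_Z[of c h 0] Z_zero by eventually_elim simp

lemma Z_diff_cscale: "AE \<omega> in M. Z (g - cscale c h) \<omega> = Z g \<omega> - c * Z h \<omega>"
  using linear_Z[of "-c" h g] by eventually_elim (simp add: cscale_minus_left)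

lemma Z_sum:
  assumes "finite I"
  shows "AE \<omega> in M. Z (\<Sum>i\<in>I. cscale (c i) (\<phi> i)) \<omega> = (\<Sum>i\<in>I. c i * Z (\<phi> i) \<omega>)"
  using assms
proof induction
  case empty
  then show ?case using Z_zero by simp
next
  case (insert j I)
  have "AE \<omega> in M. Z (cscale (c j) (\<phi> j) + (\<Sum>i\<in>I. cscale (c i) (\<phi> i))) \<omega>
      = c j * Z (\<phi> j) \<omega> + Z (\<Sum>i\<in>I. cscale (c i) (\<phi> i)) \<omega>" by (rule linear_Z)
  then show ?case using insert by (auto elim!: eventually_elim2)
qed

lemma gaussian_Re: "centered_gaussian M (\<lambda>\<omega>. Re (Z h \<omega>))"
  and gaussian_Im: "centered_gaussian M (\<lambda>\<omega>. Im (Z h \<omega>))"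
  using gaussian_Z[of "{h}" "\<lambda>_. 1" "\<lambda>_. 0"] gaussian_Z[of "{h}" "\<lambda>_. 0" "\<lambda>_. 1"] by simp_all

lemma integrable_Z_power: "integrable M (\<lambda>\<omega>. cmod (Z h \<omega>) ^ k)"
proof (rule Bochner_Integration.integrable_bound)
  show "integrable M (\<lambda>\<omega>. 2 ^ k * (\<bar>Re (Z h \<omega>)\<bar> ^ k + \<bar>Im (Z h \<omega>)\<bar> ^ k))"
    by (intro integrable_mult_right Bochner_Integration.integrable_add
        centered_gaussian_integrable_power gaussian_Re gaussian_Im)
  have "cmod (Z h \<omega>) ^ k \<le> 2 ^ k * (\<bar>Re (Z h \<omega>)\<bar> ^ k + \<bar>Im (Z h \<omega>)\<bar> ^ k)" for \<omega>
  proof -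
    have "cmod (Z h \<omega>) \<le> \<bar>Re (Z h \<omega>)\<bar> + \<bar>Im (Z h \<omega>)\<bar>" by (rule cmod_le)
    also have "\<dots> \<le> 2 * max \<bar>Re (Z h \<omega>)\<bar> \<bar>Im (Z h \<omega>)\<bar>" by simp
    finally have "cmod (Z h \<omega>) ^ k \<le> (2 * max \<bar>Re (Z h \<omega>)\<bar> \<bar>Im (Z h \<omega>)\<bar>) ^ k"
      by (intro power_mono) auto
    also have "\<dots> \<le> 2 ^ k * (\<bar>Re (Z h \<omega>)\<bar> ^ k + \<bar>Im (Z h \<omega>)\<bar> ^ k)"
      by (auto simp: power_mult_distrib max_def)
    finally show ?thesis .
  qed
  then show "AE \<omega> in M. norm (cmod (Z h \<omega>) ^ k) \<le> norm (2 ^ k * (\<bar>Re (Z h \<omega>)\<bar> ^ k + \<bar>Im (Z h \<omega>)\<bar> ^ k))"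
    by (auto intro!: AE_I2 order_trans[OF _ abs_ge_self])
qed simp

text \<open>Twice the square of \<open>Re z\<close> is \<open>(cmod z)^2 + Re (z^2)\<close>, and the
  vanishing pseudo-covariance removes the second term: this is the source of the variance 1/2 for a
  unit vector.\<close>

lemma variance_Re: "(\<integral>\<omega>. (Re (Z h \<omega>))\<^sup>2 \<partial>M) = (norm h)\<^sup>2 / 2"
proof -
  have i2: "integrable M (\<lambda>\<omega>. (cmod (Z h \<omega>))\<^sup>2)" by (rule integrable_Z_power)
  then have i1: "integrable M (\<lambda>\<omega>. (Z h \<omega>)\<^sup>2)"
    by (subst integrable_norm_iff[symmetric]) (auto simp: norm_power)
  have "of_real (\<integral>\<omega>. (cmod (Z h \<omega>))\<^sup>2 \<partial>M) = complex_of_real ((norm h)\<^sup>2)"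
    using covariance_Z[of h h] unfolding cinner_self complex_norm_square[symmetric] integral_complex_of_real .
  then have 1: "(\<integral>\<omega>. (cmod (Z h \<omega>))\<^sup>2 \<partial>M) = (norm h)\<^sup>2" unfolding of_real_eq_iff .
  have 2: "(\<integral>\<omega>. Re ((Z h \<omega>)\<^sup>2) \<partial>M) = 0"
    using integral_Re[OF i1] pseudo_covariance_Z[of h] by simp
  have "(\<integral>\<omega>. (Re (Z h \<omega>))\<^sup>2 \<partial>M) = (\<integral>\<omega>. ((cmod (Z h \<omega>))\<^sup>2 + Re ((Z h \<omega>)\<^sup>2)) / 2 \<partial>M)"
  proof (rule Bochner_Integration.integral_cong[OF refl])
    show "(Re (Z h \<omega>))\<^sup>2 = ((cmod (Z h \<omega>))\<^sup>2 + Re ((Z h \<omega>)\<^sup>2)) / 2" for \<omega>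
      unfolding cmod_power2 by (simp add: power2_eq_square)
  qed
  also have "\<dots> = (norm h)\<^sup>2 / 2"
    using i1 i2 1 2 by simp
  finally show ?thesis .
qed

text \<open>With linearity this determines all finite-dimensional laws, because the real part of a
  complex combination of the \<open>Z (\<phi> i)\<close> is almost surely \<open>Re (Z H)\<close>
  for a single vector H.\<close>

lemma char_Re: "(CLINT \<omega>|M. iexp (Re (Z h \<omega>))) = exp (- (norm h)\<^sup>2 / 4)"
  using centered_gaussian_char[OF gaussian_Re[of h], of 1] by (simp add: variance_Re)

end

text \<open>All terms are compared with the largest of 1 and the \<open>a i\<close>; its power is 1
  or one of the summands on the right.\<close>

lemma sum_power_bound:
  fixes a :: "'i \<Rightarrow> real"
  assumes "finite I" "\<And>i. i \<in> I \<Longrightarrow> 0 \<le> a i"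
  shows "(1 + (\<Sum>i\<in>I. a i)) ^ q \<le> (1 + real (card I)) ^ q * (1 + (\<Sum>i\<in>I. a i ^ q))"
proof -
  define m where "m = Max (insert 1 (a ` I))"
  have fin: "finite (insert 1 (a ` I))" using assms(1) by simp
  have m1: "m \<in> insert 1 (a ` I)" unfolding m_def by (rule Max_in[OF fin]) simp
  have m: "1 \<le> m" "\<And>i. i \<in> I \<Longrightarrow> a i \<le> m"
    unfolding m_def by (rule Max_ge[OF fin], simp)+
  have "1 + (\<Sum>i\<in>I. a i) \<le> m + (\<Sum>i\<in>I. m)" using m by (intro add_mono sum_mono) auto
  also have "\<dots> = (1 + real (card I)) * m" by (simp add: algebra_simps)
  finally have "(1 + (\<Sum>i\<in>I. a i)) ^ q \<le> ((1 + real (card I)) * m) ^ q"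
    using assms(2) by (intro power_mono) (auto intro!: add_nonneg_nonneg sum_nonneg)
  also have "\<dots> = (1 + real (card I)) ^ q * m ^ q" by (simp add: power_mult_distrib)
  also have "m ^ q \<le> 1 + (\<Sum>i\<in>I. a i ^ q)"
  proof (cases "m = 1")
    case True
    then show ?thesis using assms(2) by (auto intro!: sum_nonneg)
  next
    case False
    then obtain i where "i \<in> I" "m = a i" using m1 by auto
    then have "m ^ q \<le> (\<Sum>i\<in>I. a i ^ q)"
      using member_le_sum[of i I "\<lambda>i. a i ^ q"] assms by auto
    then show ?thesis by simp
  qed
  finally show ?thesis by (simp add: mult_left_mono)
qed

context complex_isonormal
begin

lemma integrable_polynomial_bound:
  assumes "finite I"
  shows "integrable M (\<lambda>\<omega>. (1 + (\<Sum>i\<in>I. cmod (Z (\<phi> i) \<omega>))) ^ q)"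
proof (rule Bochner_Integration.integrable_bound)
  show "integrable M (\<lambda>\<omega>. (1 + real (card I)) ^ q * (1 + (\<Sum>i\<in>I. cmod (Z (\<phi> i) \<omega>) ^ q)))"
    by (intro integrable_mult_right Bochner_Integration.integrable_add Bochner_Integration.integrable_sum
        integrable_Z_power) auto
  show "AE \<omega> in M. norm ((1 + (\<Sum>i\<in>I. cmod (Z (\<phi> i) \<omega>))) ^ q)
    \<le> norm ((1 + real (card I)) ^ q * (1 + (\<Sum>i\<in>I. cmod (Z (\<phi> i) \<omega>) ^ q)))"
    using sum_power_bound[OF assms, of "\<lambda>i. cmod (Z (\<phi> i) _)" q]
    by (auto intro!: AE_I2 order_trans[OF _ abs_ge_self] simp: sum_nonneg add_nonneg_nonneg)
qed simp

end

section \<open>Polynomial growth against a Gaussian density\<close>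

lemma integrable_normal_poly:
  assumes "\<sigma> > 0"
  shows "integrable lborel (\<lambda>x. normal_density 0 \<sigma> x * (1 + \<bar>x\<bar>) ^ q)"
proof (rule Bochner_Integration.integrable_bound)
  show "integrable lborel (\<lambda>x. 2 ^ q * (normal_density 0 \<sigma> x + normal_density 0 \<sigma> x * \<bar>x - 0\<bar> ^ q))"
    using assms by (intro integrable_mult_right Bochner_Integration.integrable_add integrable_normal_moment_abs) auto
  have "normal_density 0 \<sigma> x * (1 + \<bar>x\<bar>) ^ q \<le> 2 ^ q * (normal_density 0 \<sigma> x + normal_density 0 \<sigma> x * \<bar>x - 0\<bar> ^ q)" for x
  proof -
    have "(1 + \<bar>x\<bar>) ^ q \<le> 2 ^ q * (1 + \<bar>x\<bar> ^ q)"
      using sum_power_bound[of "{()}" "\<lambda>_. \<bar>x\<bar>" q] by simp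
    from mult_left_mono[OF this, of "normal_density 0 \<sigma> x"] show ?thesis
      by (simp add: algebra_simps)
  qed
  then show "AE x in lborel. norm (normal_density 0 \<sigma> x * (1 + \<bar>x\<bar>) ^ q)
      \<le> norm (2 ^ q * (normal_density 0 \<sigma> x + normal_density 0 \<sigma> x * \<bar>x - 0\<bar> ^ q))"
    by (auto intro!: AE_I2 order_trans[OF _ abs_ge_self] simp: abs_mult)
qed simp

lemma normal_poly_tendsto_0:
  assumes "\<sigma> > 0" "filterlim (\<lambda>x::real. \<bar>x\<bar>) at_top F"
  shows "((\<lambda>x. normal_density 0 \<sigma> x * (1 + \<bar>x\<bar>) ^ q) \<longlongrightarrow> 0) F"
proof (rule Lim_null_comparison)
  \<comment> \<open>\<open>2 * \<bar>x\<bar> \<le> x^2 / \<sigma>^2 + \<sigma>^2\<close> turns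
    Gaussian decay into exponential decay in \<open>1 + \<bar>x\<bar>\<close>; this is the constant
    that arises.\<close>
  define c where "c = 1 / sqrt (2 * pi * \<sigma>\<^sup>2) * exp (1 + \<sigma>\<^sup>2 / 2)"
  have "normal_density 0 \<sigma> x * (1 + \<bar>x\<bar>) ^ q \<le> c * ((1 + \<bar>x\<bar>) ^ q / exp (1 + \<bar>x\<bar>))" for x
  proof -
    have "0 \<le> (\<bar>x\<bar> / \<sigma> - \<sigma>)\<^sup>2" by simp
    then have "2 * \<bar>x\<bar> \<le> x\<^sup>2 / \<sigma>\<^sup>2 + \<sigma>\<^sup>2" using assms(1) by (simp add: power2_diff power_divide)
    then have "- x\<^sup>2 / (2 * \<sigma>\<^sup>2) \<le> (1 + \<sigma>\<^sup>2 / 2) - (1 + \<bar>x\<bar>)" using assms(1) by (simp add: field_simps)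
    then have "exp (- x\<^sup>2 / (2 * \<sigma>\<^sup>2)) \<le> exp (1 + \<sigma>\<^sup>2 / 2) / exp (1 + \<bar>x\<bar>)"
      by (simp add: exp_diff[symmetric])
    then have "1 / sqrt (2 * pi * \<sigma>\<^sup>2) * exp (- x\<^sup>2 / (2 * \<sigma>\<^sup>2)) * (1 + \<bar>x\<bar>) ^ q
      \<le> 1 / sqrt (2 * pi * \<sigma>\<^sup>2) * (exp (1 + \<sigma>\<^sup>2 / 2) / exp (1 + \<bar>x\<bar>)) * (1 + \<bar>x\<bar>) ^ q"
      by (intro mult_right_mono mult_left_mono) auto
    then show ?thesis by (simp add: normal_density_def c_def)
  qed
  then show "\<forall>\<^sub>F x in F. norm (normal_density 0 \<sigma> x * (1 + \<bar>x\<bar>) ^ q) \<le> c * ((1 + \<bar>x\<bar>) ^ q / exp (1 + \<bar>x\<bar>))"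
    by (simp add: abs_mult)
  have "filterlim (\<lambda>x. 1 + \<bar>x\<bar>) at_top F"
    by (rule filterlim_tendsto_add_at_top[OF tendsto_const assms(2)])
  from filterlim_compose[OF tendsto_power_div_exp_0 this]
  show "((\<lambda>x. c * ((1 + \<bar>x\<bar>) ^ q / exp (1 + \<bar>x\<bar>))) \<longlongrightarrow> 0) F"
    by (rule tendsto_mult_right_zero)
qed

lemma normal_density_deriv:
  assumes "\<sigma> > 0"
  shows "(normal_density 0 \<sigma> has_real_derivative - (x / \<sigma>\<^sup>2) * normal_density 0 \<sigma> x) (at x)"
  using assms unfolding normal_density_def
  by (auto intro!: derivative_eq_intros simp: field_simps power2_eq_square)

text \<open>The fundamental theorem of calculus on the whole line for the density times F: the
  density has derivative \<open>- (x / \<sigma>^2)\<close> times itself, and polynomial growth of F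
  makes the boundary terms vanish.\<close>

lemma normal_integration_by_parts:
  fixes F F' :: "real \<Rightarrow> complex"
  assumes \<sigma>: "\<sigma> > 0" and der: "\<And>x. (F has_vector_derivative F' x) (at x)" and cont: "continuous_on UNIV F'"
    and bd: "\<And>x. cmod (F x) \<le> C * (1 + \<bar>x\<bar>) ^ q" "\<And>x. cmod (F' x) \<le> C * (1 + \<bar>x\<bar>) ^ q"
  shows "(\<integral>x. normal_density 0 \<sigma> x *\<^sub>R F' x \<partial>lborel) = (1 / \<sigma>\<^sup>2) *\<^sub>R (\<integral>x. normal_density 0 \<sigma> x *\<^sub>R (x *\<^sub>R F x) \<partial>lborel)"
proof -
  let ?n = "normal_density 0 \<sigma>"
  define G where "G x = ?n x *\<^sub>R F x" for x
  define G' where "G' x = ?n x *\<^sub>R F' x - (1 / \<sigma>\<^sup>2) *\<^sub>R (?n x *\<^sub>R (x *\<^sub>R F x))" for x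
  have contF: "continuous_on UNIV F"
    by (intro continuous_at_imp_continuous_on ballI has_vector_derivative_continuous[OF der])
  have contn: "continuous_on UNIV ?n"
    by (intro continuous_at_imp_continuous_on ballI DERIV_isCont[OF normal_density_deriv[OF \<sigma>]])
  have [measurable]: "F \<in> borel_measurable borel" "F' \<in> borel_measurable borel"
    by (intro borel_measurable_continuous_onI contF cont)+
  have C0: "C \<ge> 0" using order_trans[OF norm_ge_zero bd(1)[of 0]] by simp
  have derG: "(G has_vector_derivative G' x) (at x)" for x
  proof -
    have "(G has_vector_derivative (?n x *\<^sub>R F' x + (- (x / \<sigma>\<^sup>2) * ?n x) *\<^sub>R F x)) (at x)"
      unfolding G_def by (rule has_vector_derivative_scaleR[OF normal_density_deriv[OF \<sigma>] der])
    then show ?thesis by (simp add: G'_def mult_ac)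
  qed
  have contG': "continuous_on UNIV G'"
    unfolding G'_def by (intro continuous_intros contn contF cont)
  have i1: "integrable lborel (\<lambda>x. ?n x *\<^sub>R F' x)"
  proof (rule Bochner_Integration.integrable_bound)
    show "integrable lborel (\<lambda>x. C * (?n x * (1 + \<bar>x\<bar>) ^ q))"
      by (intro integrable_mult_right integrable_normal_poly \<sigma>)
    show "AE x in lborel. norm (?n x *\<^sub>R F' x) \<le> norm (C * (?n x * (1 + \<bar>x\<bar>) ^ q))"
      using mult_left_mono[OF bd(2) normal_density_nonneg] C0 by (auto simp: abs_mult mult_ac)
  qed simp
  have i2: "integrable lborel (\<lambda>x. ?n x *\<^sub>R (x *\<^sub>R F x))"
  proof (rule Bochner_Integration.integrable_bound)
    show "integrable lborel (\<lambda>x. C * (?n x * (1 + \<bar>x\<bar>) ^ Suc q))"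
      by (intro integrable_mult_right integrable_normal_poly \<sigma>)
    have "\<bar>x\<bar> * cmod (F x) \<le> (1 + \<bar>x\<bar>) * (C * (1 + \<bar>x\<bar>) ^ q)" for x
      using bd(1)[of x] by (intro mult_mono) auto
    from mult_left_mono[OF this normal_density_nonneg]
    show "AE x in lborel. norm (?n x *\<^sub>R (x *\<^sub>R F x)) \<le> norm (C * (?n x * (1 + \<bar>x\<bar>) ^ Suc q))"
      using C0 by (auto simp: abs_mult mult_ac)
  qed simp
  have iG': "integrable lborel G'" unfolding G'_def
    by (rule Bochner_Integration.integrable_diff[OF i1 integrable_scaleR_right[OF i2]])
  have lim: "(G \<longlongrightarrow> 0) F'" if "filterlim (\<lambda>x::real. \<bar>x\<bar>) at_top F'" for F'
  proof (rule Lim_null_comparison)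
    show "\<forall>\<^sub>F x in F'. norm (G x) \<le> C * (?n x * (1 + \<bar>x\<bar>) ^ q)"
      using mult_left_mono[OF bd(1) normal_density_nonneg] by (auto simp: G_def mult_ac)
    show "((\<lambda>x. C * (?n x * (1 + \<bar>x\<bar>) ^ q)) \<longlongrightarrow> 0) F'"
      by (intro tendsto_mult_right_zero normal_poly_tendsto_0 \<sigma> that)
  qed
  have abs_bot: "filterlim (\<lambda>x::real. \<bar>x\<bar>) at_top at_bot"
    using filterlim_compose[OF filterlim_abs_real filterlim_uminus_at_top_at_bot] by simp
  have "(LBINT x=-\<infinity>..\<infinity>. G' x) = 0 - 0"
  proof (rule interval_integral_FTC_integrable)
    show "(G has_vector_derivative G' x) (at x)" for x by (rule derG)
    show "isCont G' x" for x using contG' by (simp add: continuous_on_eq_continuous_at)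
    show "set_integrable lborel (einterval (-\<infinity>) \<infinity>) G'" using iG' by (simp add: set_integrable_def einterval_def)
    show "((G \<circ> real_of_ereal) \<longlongrightarrow> 0) (at_right (-\<infinity>))"
      unfolding at_right_MInf by (simp add: filterlim_filtermap o_def) (rule lim, rule abs_bot)
    show "((G \<circ> real_of_ereal) \<longlongrightarrow> 0) (at_left \<infinity>)"
      unfolding at_left_PInf by (simp add: filterlim_filtermap o_def) (rule lim, rule filterlim_abs_real)
  qed simp
  moreover have "(LBINT x=-\<infinity>..\<infinity>. G' x) = (\<integral>x. G' x \<partial>lborel)"
    by (simp add: interval_lebesgue_integral_def set_lebesgue_integral_def einterval_def)
  ultimately have "(\<integral>x. G' x \<partial>lborel) = 0" by simp
  then have "(\<integral>x. ?n x *\<^sub>R F' x \<partial>lborel) - (\<integral>x. (1 / \<sigma>\<^sup>2) *\<^sub>R (?n x *\<^sub>R (x *\<^sub>R F x)) \<partial>lborel) = 0"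
    unfolding G'_def Bochner_Integration.integral_diff[OF i1 integrable_scaleR_right[OF i2]] .
  then show ?thesis using i2 by (simp only: integral_scaleR_right right_minus_eq)
qed

text \<open>Characteristic functions of the real and imaginary parts determine the law of the first
  k coordinates, hence every integral of g. Finite rather than probability measures are allowed,
  since the result is also applied to the measures with densities the positive and the negative part
  of a function.\<close>

lemma complex_vector_law_eqI:
  fixes g :: "(nat \<Rightarrow> complex) \<Rightarrow> 'b::{banach, second_countable_topology}"
    and X :: "'x \<Rightarrow> nat \<Rightarrow> complex" and Y :: "'y \<Rightarrow> nat \<Rightarrow> complex"
  assumes fin: "finite_measure N" "finite_measure L"
    and X: "\<And>i. (\<lambda>\<omega>. X \<omega> i) \<in> borel_measurable N" and Y: "\<And>i. (\<lambda>\<omega>. Y \<omega> i) \<in> borel_measurable L"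
    and char: "\<And>d. (CLINT \<omega>|N. iexp (Re (\<Sum>i<k. d i * X \<omega> i))) = (CLINT \<omega>|L. iexp (Re (\<Sum>i<k. d i * Y \<omega> i)))"
    and g: "g \<in> borel_measurable borel"
    and dep: "\<And>z w. (\<And>i. i < k \<Longrightarrow> z i = w i) \<Longrightarrow> g z = g w"
  shows "integrable N (\<lambda>\<omega>. g (X \<omega>)) \<longleftrightarrow> integrable L (\<lambda>\<omega>. g (Y \<omega>))"
    and "(\<integral>\<omega>. g (X \<omega>) \<partial>N) = (\<integral>\<omega>. g (Y \<omega>) \<partial>L)"
proof -
  define I where "I = {..<k} \<times> (UNIV :: bool set)"
  have finI: "finite I" by (simp add: I_def)
  define R :: "(nat \<Rightarrow> complex) \<Rightarrow> nat \<times> bool \<Rightarrow> real" where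
    "R z = (\<lambda>p\<in>I. if snd p then Im (z (fst p)) else Re (z (fst p)))" for z
  \<comment> \<open>The Boolean marks the imaginary part; coordinates from k on are filled with 0,
    which \<open>dep\<close> makes harmless.\<close>
  define S :: "(nat \<times> bool \<Rightarrow> real) \<Rightarrow> nat \<Rightarrow> complex" where
    "S x i = (if i < k then Complex (x (i, False)) (x (i, True)) else 0)" for x i
  have gS: "g (S (R z)) = g z" for z
    by (rule dep) (simp add: S_def R_def I_def)
  have Rm: "(\<lambda>\<omega>. R (W \<omega>)) \<in> measurable Q (PiM I (\<lambda>_. borel))"
    if "\<And>i. (\<lambda>\<omega>. W \<omega> i) \<in> borel_measurable Q" for W and Q :: "'z measure"
    unfolding R_def using that by (intro measurable_restrict) (auto split: if_splits)
  have Sm: "S \<in> borel_measurable (PiM I (\<lambda>_. borel))"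
  proof (rule measurable_coordinatewise_then_product)
    fix i
    show "(\<lambda>x. S x i) \<in> borel_measurable (PiM I (\<lambda>_. borel))"
    proof (cases "i < k")
      case True
      then have [measurable]: "(\<lambda>x. x (i, b)) \<in> borel_measurable (PiM I (\<lambda>_. borel :: real measure))" for b
        by (intro measurable_component_singleton) (simp add: I_def)
      have "(\<lambda>x. S x i) = (\<lambda>x. of_real (x (i, False)) + \<i> * of_real (x (i, True)))"
        using True by (simp add: S_def fun_eq_iff Complex_eq)
      then show ?thesis by simp
    qed (simp add: S_def)
  qed
  then have gSm: "(\<lambda>x. g (S x)) \<in> borel_measurable (PiM I (\<lambda>_. borel))" by (rule measurable_compose[OF _ g])
  define \<mu> where "\<mu> = distr N (PiM I (\<lambda>_. borel)) (\<lambda>\<omega>. R (X \<omega>))"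
  define \<nu> where "\<nu> = distr L (PiM I (\<lambda>_. borel)) (\<lambda>\<omega>. R (Y \<omega>))"
  have m1: "(\<lambda>\<omega>. R (X \<omega>)) \<in> measurable N (PiM I (\<lambda>_. borel))" by (rule Rm[OF X])
  have m2: "(\<lambda>\<omega>. R (Y \<omega>)) \<in> measurable L (PiM I (\<lambda>_. borel))" by (rule Rm[OF Y])
  have "\<mu> = \<nu>"
  proof (rule PiM_measure_eqI_char[OF finI])
    show "finite_measure \<mu>" unfolding \<mu>_def by (rule finite_measure.finite_measure_distr[OF fin(1) m1])
    show "finite_measure \<nu>" unfolding \<nu>_def by (rule finite_measure.finite_measure_distr[OF fin(2) m2])
    fix t :: "nat \<times> bool \<Rightarrow> real"
    \<comment> \<open>The sign makes \<open>Re (d i * z i)\<close> the real pairing of t with the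
      real and imaginary parts.\<close>
    define d where "d i = Complex (t (i, False)) (- t (i, True))" for i
    have sum_R: "(\<Sum>p\<in>I. t p * R z p) = Re (\<Sum>i<k. d i * z i)" for z
    proof -
      have "(\<Sum>p\<in>I. t p * R z p) = (\<Sum>i<k. \<Sum>b\<in>UNIV. t (i, b) * R z (i, b))"
        unfolding I_def by (simp add: sum.cartesian_product)
      also have "\<dots> = (\<Sum>i<k. Re (d i * z i))"
        by (intro sum.cong refl) (simp add: UNIV_bool R_def I_def d_def)
      finally show ?thesis by simp
    qed
    have cm: "(\<lambda>x. iexp (\<Sum>p\<in>I. t p * x p)) \<in> borel_measurable (PiM I (\<lambda>_. borel))"
    proof -
      have "(\<lambda>x. \<Sum>p\<in>I. t p * x p) \<in> borel_measurable (PiM I (\<lambda>_. borel))"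
        by (intro borel_measurable_sum borel_measurable_times borel_measurable_const measurable_component_singleton)
      from measurable_compose[OF this, of "\<lambda>s. iexp s" borel] show ?thesis by simp
    qed
    show "(CLINT x|\<mu>. iexp (\<Sum>p\<in>I. t p * x p)) = (CLINT x|\<nu>. iexp (\<Sum>p\<in>I. t p * x p))"
      unfolding \<mu>_def \<nu>_def integral_distr[OF m1 cm] integral_distr[OF m2 cm] sum_R by (rule char)
  qed (simp_all add: \<mu>_def \<nu>_def)
  have "integrable \<mu> (\<lambda>x. g (S x)) \<longleftrightarrow> integrable N (\<lambda>\<omega>. g (X \<omega>))"
    "(\<integral>x. g (S x) \<partial>\<mu>) = (\<integral>\<omega>. g (X \<omega>) \<partial>N)"
    unfolding \<mu>_def integrable_distr_eq[OF m1 gSm] integral_distr[OF m1 gSm] gS by auto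
  moreover have "integrable \<nu> (\<lambda>x. g (S x)) \<longleftrightarrow> integrable L (\<lambda>\<omega>. g (Y \<omega>))"
    "(\<integral>x. g (S x) \<partial>\<nu>) = (\<integral>\<omega>. g (Y \<omega>) \<partial>L)"
    unfolding \<nu>_def integrable_distr_eq[OF m2 gSm] integral_distr[OF m2 gSm] gS by auto
  ultimately show "integrable N (\<lambda>\<omega>. g (X \<omega>)) \<longleftrightarrow> integrable L (\<lambda>\<omega>. g (Y \<omega>))"
    "(\<integral>\<omega>. g (X \<omega>) \<partial>N) = (\<integral>\<omega>. g (Y \<omega>) \<partial>L)"
    using \<open>\<mu> = \<nu>\<close> by simp_all
qed

context complex_isonormal
begin

text \<open>Conditionally on the component of the process orthogonal to \<open>h\<close>, the functional \<open>g\<close> depends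
  on the scalar Gaussian variable \<open>Re (Z h)\<close> only; the second copy of the probability space carries it.\<close>

lemma law_shift:
  fixes g :: "(nat \<Rightarrow> complex) \<Rightarrow> 'b::{banach, second_countable_topology}" and \<phi> :: "nat \<Rightarrow> 'h cplx"
  assumes unit: "norm h = 1" and g[measurable]: "g \<in> borel_measurable borel"
    and dep: "\<And>z w. (\<And>i. i < k \<Longrightarrow> z i = w i) \<Longrightarrow> g z = g w"
  defines "V \<equiv> \<lambda>\<omega>' \<omega> i. Z (\<phi> i) \<omega>' + of_real (Re (Z h \<omega>) - Re (Z h \<omega>')) * cinner (\<phi> i) h"
  shows "integrable (M \<Otimes>\<^sub>M M) (\<lambda>(\<omega>', \<omega>). g (V \<omega>' \<omega>)) \<longleftrightarrow> integrable M (\<lambda>\<omega>. g (\<lambda>i. Z (\<phi> i) \<omega>))"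
    and "(\<integral>(\<omega>', \<omega>). g (V \<omega>' \<omega>) \<partial>(M \<Otimes>\<^sub>M M)) = (\<integral>\<omega>. g (\<lambda>i. Z (\<phi> i) \<omega>) \<partial>M)"
proof -
  interpret P: pair_prob_space M M ..
  have char: "(CLINT p|M \<Otimes>\<^sub>M M. iexp (Re (\<Sum>i<k. d i * V (fst p) (snd p) i)))
      = (CLINT \<omega>|M. iexp (Re (\<Sum>i<k. d i * Z (\<phi> i) \<omega>)))" for d
  proof -
    define H where "H = (\<Sum>i<k. cscale (d i) (\<phi> i))"
    \<comment> \<open>Only the real component of \<open>H\<close> along \<open>h\<close> is carried
      by \<open>Re (Z h)\<close>. Removing it leaves \<open>H - cscale \<gamma> h\<close>, whose
      squared norm plus \<open>\<gamma>^2\<close> is that of \<open>H\<close>; hence the product of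
      the two characteristic functions is the original one.\<close>
    define \<gamma> where "\<gamma> = Re (cinner H h)"
    have HZ: "AE \<omega> in M. Z H \<omega> = (\<Sum>i<k. d i * Z (\<phi> i) \<omega>)"
      unfolding H_def by (rule Z_sum) simp
    have "(CLINT \<omega>|M. iexp (Re (\<Sum>i<k. d i * Z (\<phi> i) \<omega>))) = (CLINT \<omega>|M. iexp (Re (Z H \<omega>)))"
      using HZ by (intro integral_cong_AE) auto
    also have "\<dots> = exp (- (norm H)\<^sup>2 / 4)" by (rule char_Re)
    finally have 1: "(CLINT \<omega>|M. iexp (Re (\<Sum>i<k. d i * Z (\<phi> i) \<omega>))) = exp (- (norm H)\<^sup>2 / 4)" .
    have cH: "(\<Sum>i<k. d i * cinner (\<phi> i) h) = cinner H h"
      by (simp add: H_def cinner_sum_left)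
    have sum_V: "Re (\<Sum>i<k. d i * V \<omega>' \<omega> i) = Re (\<Sum>i<k. d i * Z (\<phi> i) \<omega>') - \<gamma> * Re (Z h \<omega>') + \<gamma> * Re (Z h \<omega>)" for \<omega>' \<omega>
    proof -
      have "d i * V \<omega>' \<omega> i = d i * Z (\<phi> i) \<omega>' + of_real (Re (Z h \<omega>) - Re (Z h \<omega>')) * (d i * cinner (\<phi> i) h)" for i
        by (simp add: V_def algebra_simps)
      then have "(\<Sum>i<k. d i * V \<omega>' \<omega> i)
        = (\<Sum>i<k. d i * Z (\<phi> i) \<omega>') + of_real (Re (Z h \<omega>) - Re (Z h \<omega>')) * cinner H h"
        by (simp only: sum.distrib sum_distrib_left[symmetric] cH)
      then show ?thesis
        by (simp only: plus_complex.sel times_complex.sel Re_complex_of_real Im_complex_of_real \<gamma>_def)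
          (simp add: algebra_simps)
    qed
    have "(CLINT p|M \<Otimes>\<^sub>M M. iexp (Re (\<Sum>i<k. d i * V (fst p) (snd p) i)))
      = (CLINT \<omega>'|M. CLINT \<omega>|M. iexp (Re (\<Sum>i<k. d i * V \<omega>' \<omega> i)))"
      by (subst P.integral_fst'[symmetric])
        (auto simp: V_def intro!: P.integrable_const_bound[where B = 1])
    also have "\<dots> = (CLINT \<omega>'|M. CLINT \<omega>|M. iexp (Re (\<Sum>i<k. d i * Z (\<phi> i) \<omega>') - \<gamma> * Re (Z h \<omega>')) * iexp (\<gamma> * Re (Z h \<omega>)))"
      unfolding sum_V by (simp add: exp_add[symmetric] algebra_simps)
    also have "\<dots> = (CLINT \<omega>'|M. iexp (Re (\<Sum>i<k. d i * Z (\<phi> i) \<omega>') - \<gamma> * Re (Z h \<omega>'))) * (CLINT \<omega>|M. iexp (\<gamma> * Re (Z h \<omega>)))"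
      by simp
    also have "(CLINT \<omega>'|M. iexp (Re (\<Sum>i<k. d i * Z (\<phi> i) \<omega>') - \<gamma> * Re (Z h \<omega>')))
      = (CLINT \<omega>|M. iexp (Re (Z (H - cscale (of_real \<gamma>) h) \<omega>)))"
      using HZ Z_diff_cscale[of H "of_real \<gamma>" h] by (intro integral_cong_AE) (auto elim!: eventually_elim2)
    also have "\<dots> = exp (- (norm (H - cscale (of_real \<gamma>) h))\<^sup>2 / 4)" by (rule char_Re)
    also have "(CLINT \<omega>|M. iexp (\<gamma> * Re (Z h \<omega>))) = exp (- \<gamma>\<^sup>2 / 4)"
      using centered_gaussian_char[OF gaussian_Re[of h], of \<gamma>] by (simp add: variance_Re unit)
    also have "complex_of_real (exp (- (norm (H - cscale (of_real \<gamma>) h))\<^sup>2 / 4)) * of_real (exp (- \<gamma>\<^sup>2 / 4))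
      = of_real (exp (- ((norm (H - cscale (of_real \<gamma>) h))\<^sup>2 + \<gamma>\<^sup>2) / 4))"
      by (simp only: of_real_mult[symmetric] exp_add[symmetric]) (simp add: add_divide_distrib)
    also have "(norm (H - cscale (of_real \<gamma>) h))\<^sup>2 + \<gamma>\<^sup>2 = (norm H)\<^sup>2"
    proof -
      have "(norm (H - cscale (of_real \<gamma>) h))\<^sup>2 = Re (cinner (H - cscale (of_real \<gamma>) h) (H - cscale (of_real \<gamma>) h))"
        unfolding cinner_self by simp
      also have "\<dots> = Re (cinner H H) - \<gamma> * Re (cinner H h) - \<gamma> * Re (cinner h H) + \<gamma> * \<gamma> * Re (cinner h h)"
        by (simp add: cinner_diff_left cinner_diff_right algebra_simps)
      also have "Re (cinner h H) = Re (cinner H h)" using cnj_cinner[of H h] by (metis complex_cnj cnj.sel(1))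
      finally show ?thesis by (simp add: cinner_self unit \<gamma>_def power2_eq_square)
    qed
    finally show ?thesis using 1 by simp
  qed
  show "integrable (M \<Otimes>\<^sub>M M) (\<lambda>(\<omega>', \<omega>). g (V \<omega>' \<omega>)) \<longleftrightarrow> integrable M (\<lambda>\<omega>. g (\<lambda>i. Z (\<phi> i) \<omega>))"
    and "(\<integral>(\<omega>', \<omega>). g (V \<omega>' \<omega>) \<partial>(M \<Otimes>\<^sub>M M)) = (\<integral>\<omega>. g (\<lambda>i. Z (\<phi> i) \<omega>) \<partial>M)"
    using complex_vector_law_eqI[OF P.finite_measure_axioms finite_measure_axioms _ _ char g dep]
    by (simp_all add: V_def case_prod_unfold)
qed

end

section \<open>Integration by parts for functionals of the process\<close>

lemma borel_measurable_cnj [measurable (raw)]: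
  "f \<in> borel_measurable N \<Longrightarrow> (\<lambda>x. cnj (f x)) \<in> borel_measurable N"
  by (rule measurable_compose[OF _ borel_measurable_continuous_onI[OF continuous_on_cnj[OF continuous_on_id]]])

context complex_isonormal
begin

lemma measurable_Z_family [measurable]: "(\<lambda>\<omega> i. Z (\<phi> i) \<omega>) \<in> borel_measurable M"
  for \<phi> :: "'i::countable \<Rightarrow> 'h cplx"
  by (rule measurable_coordinatewise_then_product) simp

lemma integrable_poly_growth:
  fixes g :: "(nat \<Rightarrow> complex) \<Rightarrow> 'b::{banach, second_countable_topology}"
  assumes g: "g \<in> borel_measurable borel" and bd: "\<And>z. norm (g z) \<le> C * (1 + (\<Sum>i<k. cmod (z i))) ^ q"
  shows "integrable M (\<lambda>\<omega>. g (\<lambda>i. Z (\<phi> i) \<omega>))"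
proof (rule Bochner_Integration.integrable_bound)
  show "integrable M (\<lambda>\<omega>. C * (1 + (\<Sum>i<k. cmod (Z (\<phi> i) \<omega>))) ^ q)"
    by (intro integrable_mult_right integrable_polynomial_bound) simp
  show "(\<lambda>\<omega>. g (\<lambda>i. Z (\<phi> i) \<omega>)) \<in> borel_measurable M"
    by (rule measurable_compose[OF measurable_Z_family g])
  show "AE \<omega> in M. norm (g (\<lambda>i. Z (\<phi> i) \<omega>)) \<le> norm (C * (1 + (\<Sum>i<k. cmod (Z (\<phi> i) \<omega>))) ^ q)"
    using bd by (auto intro!: AE_I2 order_trans[OF _ abs_ge_self])
qed

text \<open>Freezing the part of the process independent of \<open>Re (Z h)\<close> leaves a
  one-dimensional integration by parts along the line with directions
  \<open>cinner (\<phi> i) h\<close>. The factor 2 is the inverse of the variance 1/2.\<close>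

lemma stein:
  fixes f D :: "(nat \<Rightarrow> complex) \<Rightarrow> complex" and \<phi> :: "nat \<Rightarrow> 'h cplx"
  assumes unit: "norm h = 1"
    and dep: "\<And>z w. (\<And>i. i < k \<Longrightarrow> z i = w i) \<Longrightarrow> f z = f w"
    and der: "\<And>z. ((\<lambda>t::real. f (\<lambda>i. z i + of_real t * cinner (\<phi> i) h)) has_vector_derivative D z) (at 0)"
    and cont: "continuous_on UNIV f" "continuous_on UNIV D"
    and bd: "\<And>z. cmod (f z) \<le> C * (1 + (\<Sum>i<k. cmod (z i))) ^ q"
      "\<And>z. cmod (D z) \<le> C * (1 + (\<Sum>i<k. cmod (z i))) ^ q"
  shows "(\<integral>\<omega>. D (\<lambda>i. Z (\<phi> i) \<omega>) \<partial>M) = 2 * (\<integral>\<omega>. of_real (Re (Z h \<omega>)) * f (\<lambda>i. Z (\<phi> i) \<omega>) \<partial>M)"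
proof -
  interpret P: pair_prob_space M M ..
  have fm[measurable]: "f \<in> borel_measurable borel" "D \<in> borel_measurable borel"
    by (intro borel_measurable_continuous_onI cont)+
  \<comment> \<open>The derivative inherits the dependence on the first k coordinates from the
    uniqueness of derivatives.\<close>
  have depD: "D z = D w" if "\<And>i. i < k \<Longrightarrow> z i = w i" for z w
  proof -
    have eq: "(\<lambda>t::real. f (\<lambda>i. z i + of_real t * cinner (\<phi> i) h)) = (\<lambda>t. f (\<lambda>i. w i + of_real t * cinner (\<phi> i) h))"
      by (intro ext dep) (simp add: that)
    have "((\<lambda>t::real. f (\<lambda>i. w i + of_real t * cinner (\<phi> i) h)) has_vector_derivative D z) (at 0)"
      using der[of z] unfolding eq .
    then show ?thesis by (rule vector_derivative_unique_at[OF _ der])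
  qed
  have C0: "C \<ge> 0" using order_trans[OF norm_ge_zero bd(1)[of "\<lambda>_. 0"]] by simp
  \<comment> \<open>An extra coordinate holding \<open>h\<close> makes the product with
    \<open>Re (Z h)\<close> itself a function of the family, so that \<open>law_shift\<close>
    applies to it.\<close>
  define \<phi>' where "\<phi>' = \<phi>(k := h)"
  define g where "g z = of_real (Re (z k)) * f z" for z :: "nat \<Rightarrow> complex"
  define V where "V \<omega>' \<omega> i = Z (\<phi> i) \<omega>' + of_real (Re (Z h \<omega>) - Re (Z h \<omega>')) * cinner (\<phi> i) h" for \<omega>' \<omega> i
  define V' where "V' \<omega>' \<omega> i = Z (\<phi>' i) \<omega>' + of_real (Re (Z h \<omega>) - Re (Z h \<omega>')) * cinner (\<phi>' i) h" for \<omega>' \<omega> i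
  have coordm: "(\<lambda>z::nat \<Rightarrow> complex. z i) \<in> borel_measurable borel" for i
    by (intro borel_measurable_continuous_onI continuous_on_product_coordinates)
  have gm: "g \<in> borel_measurable borel"
    unfolding g_def using measurable_compose[OF coordm[of k], of Re borel] by simp
  have depg: "g z = g w" if "\<And>i. i < Suc k \<Longrightarrow> z i = w i" for z w
    using dep[of z w] that by (simp add: g_def)
  have g_bd: "cmod (g z) \<le> C * (1 + (\<Sum>i<Suc k. cmod (z i))) ^ Suc q" for z
  proof -
    have s: "0 \<le> (\<Sum>i<k. cmod (z i))" by (intro sum_nonneg) simp
    have "cmod (g z) \<le> cmod (z k) * (C * (1 + (\<Sum>i<k. cmod (z i))) ^ q)"
      unfolding g_def norm_mult by (intro mult_mono bd) (auto intro: abs_Re_le_cmod)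
    also have "\<dots> \<le> (1 + (\<Sum>i<Suc k. cmod (z i))) * (C * (1 + (\<Sum>i<Suc k. cmod (z i))) ^ q)"
      using C0 s by (intro mult_mono mult_left_mono power_mono) auto
    finally show ?thesis by (simp add: mult_ac)
  qed
  have iD: "integrable M (\<lambda>\<omega>. D (\<lambda>i. Z (\<phi> i) \<omega>))"
    by (rule integrable_poly_growth[OF fm(2) bd(2)])
  have ig: "integrable M (\<lambda>\<omega>. g (\<lambda>i. Z (\<phi>' i) \<omega>))"
    by (rule integrable_poly_growth[OF gm g_bd])
  have g_eq: "g (\<lambda>i. Z (\<phi>' i) \<omega>) = of_real (Re (Z h \<omega>)) * f (\<lambda>i. Z (\<phi> i) \<omega>)" for \<omega>
  proof -
    have "f (\<lambda>i. Z (\<phi>' i) \<omega>) = f (\<lambda>i. Z (\<phi> i) \<omega>)" by (rule dep) (simp add: \<phi>'_def)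
    then show ?thesis by (simp add: g_def \<phi>'_def)
  qed
  have hh: "cinner h h = 1" by (simp add: cinner_self unit)
  have gV: "g (V' \<omega>' \<omega>) = of_real (Re (Z h \<omega>)) * f (V \<omega>' \<omega>)" for \<omega>' \<omega>
  proof -
    have "f (V' \<omega>' \<omega>) = f (V \<omega>' \<omega>)" by (rule dep) (simp add: V_def V'_def \<phi>'_def)
    then show ?thesis by (simp add: g_def V'_def \<phi>'_def hh)
  qed
  have inner: "(\<integral>\<omega>. D (V \<omega>' \<omega>) \<partial>M) = 2 * (\<integral>\<omega>. g (V' \<omega>' \<omega>) \<partial>M)" for \<omega>'
  proof -
    define u where "u i = Z (\<phi> i) \<omega>' - of_real (Re (Z h \<omega>')) * cinner (\<phi> i) h" for i
    define L where "L a i = u i + of_real a * cinner (\<phi> i) h" for a :: real and i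
    have VL: "V \<omega>' \<omega> = L (Re (Z h \<omega>))" for \<omega>
      by (simp add: V_def L_def u_def fun_eq_iff algebra_simps)
    define \<sigma> where "\<sigma> = sqrt (1/2)"
    have \<sigma>: "\<sigma> > 0" "\<sigma>\<^sup>2 = 1/2" by (simp_all add: \<sigma>_def)
    have nd: "distributed M lborel (\<lambda>\<omega>. Re (Z h \<omega>)) (\<lambda>x. ennreal (normal_density 0 \<sigma> x))"
      by (rule centered_gaussian_normal[OF gaussian_Re]) (simp_all add: variance_Re unit \<sigma>)
    have contL: "continuous_on UNIV L"
      unfolding L_def by (intro continuous_on_coordinatewise_then_product continuous_intros)
    have contfL: "continuous_on UNIV (\<lambda>a. f (L a))" "continuous_on UNIV (\<lambda>a. D (L a))"
      by (rule continuous_on_compose2[OF cont(1) contL], simp)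
        (rule continuous_on_compose2[OF cont(2) contL], simp)
    have m[measurable]: "(\<lambda>a. f (L a)) \<in> borel_measurable borel" "(\<lambda>a. D (L a)) \<in> borel_measurable borel"
      by (intro borel_measurable_continuous_onI contfL)+
    have derL: "((\<lambda>a. f (L a)) has_vector_derivative D (L a)) (at a)" for a
    proof -
      have 1: "((\<lambda>x. x - a) has_vector_derivative 1) (at a)"
        by (auto intro!: derivative_eq_intros)
      have 2: "((\<lambda>t. f (\<lambda>i. L a i + of_real t * cinner (\<phi> i) h)) has_vector_derivative D (L a)) (at (a - a))"
        using der[of "L a"] by simp
      have "((\<lambda>t. f (\<lambda>i. L a i + of_real t * cinner (\<phi> i) h)) \<circ> (\<lambda>x. x - a) has_vector_derivative 1 *\<^sub>R D (L a)) (at a)"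
        by (rule vector_diff_chain_at[OF 1 2])
      moreover have "(\<lambda>t. f (\<lambda>i. L a i + of_real t * cinner (\<phi> i) h)) \<circ> (\<lambda>x. x - a) = (\<lambda>x. f (L x))"
        by (simp add: L_def [abs_def] o_def algebra_simps)
      ultimately show ?thesis by simp
    qed
    \<comment> \<open>Along the line the coordinates grow at most linearly in a, so polynomial
      growth in the coordinates becomes polynomial growth in a.\<close>
    define B where "B = 1 + (\<Sum>i<k. cmod (u i)) + (\<Sum>i<k. cmod (cinner (\<phi> i) h))"
    have sb: "(1 + (\<Sum>i<k. cmod (L a i))) ^ q \<le> B ^ q * (1 + \<bar>a\<bar>) ^ q" for a
    proof -
      have "cmod (L a i) \<le> cmod (u i) + \<bar>a\<bar> * cmod (cinner (\<phi> i) h)" for i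
        unfolding L_def using norm_triangle_ineq[of "u i" "of_real a * cinner (\<phi> i) h"] by (simp add: norm_mult)
      then have "1 + (\<Sum>i<k. cmod (L a i)) \<le> 1 + (\<Sum>i<k. cmod (u i) + \<bar>a\<bar> * cmod (cinner (\<phi> i) h))"
        by (intro add_left_mono sum_mono)
      also have "\<dots> = 1 + (\<Sum>i<k. cmod (u i)) + \<bar>a\<bar> * (\<Sum>i<k. cmod (cinner (\<phi> i) h))"
        by (simp add: sum.distrib sum_distrib_left)
      also have "\<dots> \<le> B * (1 + \<bar>a\<bar>)"
        using sum_nonneg[of "{..<k}" "\<lambda>i. cmod (cinner (\<phi> i) h)"] sum_nonneg[of "{..<k}" "\<lambda>i. cmod (u i)"]
        by (simp add: B_def algebra_simps)
      finally have "(1 + (\<Sum>i<k. cmod (L a i))) ^ q \<le> (B * (1 + \<bar>a\<bar>)) ^ q"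
        by (intro power_mono) (auto intro!: add_nonneg_nonneg sum_nonneg)
      then show ?thesis by (simp add: power_mult_distrib)
    qed
    have bL: "cmod (f (L a)) \<le> (C * B ^ q) * (1 + \<bar>a\<bar>) ^ q" "cmod (D (L a)) \<le> (C * B ^ q) * (1 + \<bar>a\<bar>) ^ q" for a
      using order_trans[OF bd(1) mult_left_mono[OF sb C0]] order_trans[OF bd(2) mult_left_mono[OF sb C0]]
      by (simp_all add: mult.assoc)
    have "(\<integral>\<omega>. D (V \<omega>' \<omega>) \<partial>M) = (\<integral>x. normal_density 0 \<sigma> x *\<^sub>R D (L x) \<partial>lborel)"
      unfolding VL by (rule normal_expectation(1)[OF nd m(2)])
    also have "\<dots> = (1 / \<sigma>\<^sup>2) *\<^sub>R (\<integral>x. normal_density 0 \<sigma> x *\<^sub>R (x *\<^sub>R f (L x)) \<partial>lborel)"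
      by (rule normal_integration_by_parts[OF \<sigma>(1) derL contfL(2) bL])
    also have "(\<integral>x. normal_density 0 \<sigma> x *\<^sub>R (x *\<^sub>R f (L x)) \<partial>lborel) = (\<integral>\<omega>. Re (Z h \<omega>) *\<^sub>R f (L (Re (Z h \<omega>))) \<partial>M)"
      by (rule normal_expectation(1)[OF nd, symmetric]) simp
    finally show ?thesis unfolding gV VL by (simp add: \<sigma>(2) scaleR_conv_of_real)
  qed
  have sD: "integrable (M \<Otimes>\<^sub>M M) (\<lambda>(\<omega>', \<omega>). D (V \<omega>' \<omega>))"
    "(\<integral>(\<omega>', \<omega>). D (V \<omega>' \<omega>) \<partial>(M \<Otimes>\<^sub>M M)) = (\<integral>\<omega>. D (\<lambda>i. Z (\<phi> i) \<omega>) \<partial>M)"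
    using law_shift[OF unit fm(2) depD, where \<phi> = \<phi>] iD unfolding V_def by auto
  have sg: "integrable (M \<Otimes>\<^sub>M M) (\<lambda>(\<omega>', \<omega>). g (V' \<omega>' \<omega>))"
    "(\<integral>(\<omega>', \<omega>). g (V' \<omega>' \<omega>) \<partial>(M \<Otimes>\<^sub>M M)) = (\<integral>\<omega>. g (\<lambda>i. Z (\<phi>' i) \<omega>) \<partial>M)"
    using law_shift[OF unit gm depg, where \<phi> = \<phi>'] ig unfolding V'_def by auto
  have "(\<integral>\<omega>. D (\<lambda>i. Z (\<phi> i) \<omega>) \<partial>M) = (\<integral>\<omega>'. \<integral>\<omega>. D (V \<omega>' \<omega>) \<partial>M \<partial>M)"
    unfolding sD(2)[symmetric] P.integral_fst'[OF sD(1), symmetric] by simp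
  also have "\<dots> = 2 * (\<integral>\<omega>'. \<integral>\<omega>. g (V' \<omega>' \<omega>) \<partial>M \<partial>M)"
    unfolding inner by simp
  also have "(\<integral>\<omega>'. \<integral>\<omega>. g (V' \<omega>' \<omega>) \<partial>M \<partial>M) = (\<integral>\<omega>. g (\<lambda>i. Z (\<phi>' i) \<omega>) \<partial>M)"
    unfolding sg(2)[symmetric] P.integral_fst'[OF sg(1), symmetric] by simp
  finally show ?thesis unfolding g_eq .
qed

text \<open>The real identity is applied in the directions \<open>h\<close> and
  \<open>cscale (-\<i>) h\<close>. The real part of the process at the latter is almost surely
  \<open>Im (Z h)\<close>, so the combination \<open>(D1 - \<i> * D2) / 2\<close> produces the
  conjugate of \<open>Z h\<close>.\<close>

lemma complex_integration_by_parts: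
  fixes f D1 D2 :: "(nat \<Rightarrow> complex) \<Rightarrow> complex" and \<phi> :: "nat \<Rightarrow> 'h cplx"
  assumes unit: "norm h = 1"
    and dep: "\<And>z w. (\<And>i. i < k \<Longrightarrow> z i = w i) \<Longrightarrow> f z = f w"
    and der: "\<And>z. ((\<lambda>t::real. f (\<lambda>i. z i + of_real t * cinner (\<phi> i) h)) has_vector_derivative D1 z) (at 0)"
      "\<And>z. ((\<lambda>t::real. f (\<lambda>i. z i + of_real t * (\<i> * cinner (\<phi> i) h))) has_vector_derivative D2 z) (at 0)"
    and cont: "continuous_on UNIV f" "continuous_on UNIV D1" "continuous_on UNIV D2"
    and bd: "\<And>z. cmod (f z) \<le> C * (1 + (\<Sum>i<k. cmod (z i))) ^ q"
      "\<And>z. cmod (D1 z) \<le> C * (1 + (\<Sum>i<k. cmod (z i))) ^ q"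
      "\<And>z. cmod (D2 z) \<le> C * (1 + (\<Sum>i<k. cmod (z i))) ^ q"
  shows "(\<integral>\<omega>. (D1 (\<lambda>i. Z (\<phi> i) \<omega>) - \<i> * D2 (\<lambda>i. Z (\<phi> i) \<omega>)) / 2 \<partial>M)
    = (\<integral>\<omega>. cnj (Z h \<omega>) * f (\<lambda>i. Z (\<phi> i) \<omega>) \<partial>M)"
    and "integrable M (\<lambda>\<omega>. cnj (Z h \<omega>) * f (\<lambda>i. Z (\<phi> i) \<omega>))"
proof -
  have fm[measurable]: "f \<in> borel_measurable borel" "D1 \<in> borel_measurable borel" "D2 \<in> borel_measurable borel"
    by (intro borel_measurable_continuous_onI cont)+
  have m[measurable]: "(\<lambda>\<omega>. f (\<lambda>i. Z (\<phi> i) \<omega>)) \<in> borel_measurable M"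
    by (rule measurable_compose[OF measurable_Z_family fm(1)])
  have if2: "integrable M (\<lambda>\<omega>. (cmod (f (\<lambda>i. Z (\<phi> i) \<omega>)))\<^sup>2)"
  proof (rule integrable_poly_growth[of "\<lambda>z. (cmod (f z))\<^sup>2" "C\<^sup>2" k "q * 2"])
    fix z
    have "(cmod (f z))\<^sup>2 \<le> (C * (1 + (\<Sum>i<k. cmod (z i))) ^ q)\<^sup>2" by (intro power_mono bd) simp
    then show "norm ((cmod (f z))\<^sup>2) \<le> C\<^sup>2 * (1 + (\<Sum>i<k. cmod (z i))) ^ (q * 2)"
      by (simp add: power_mult_distrib power_mult)
  qed simp
  have prod: "integrable M (\<lambda>\<omega>. X \<omega> * f (\<lambda>i. Z (\<phi> i) \<omega>))"
    if [measurable]: "X \<in> borel_measurable M" and "\<And>\<omega>. cmod (X \<omega>) \<le> cmod (Z h \<omega>)" for X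
  proof (rule Bochner_Integration.integrable_bound)
    show "integrable M (\<lambda>\<omega>. cmod (Z h \<omega>) ^ 2 + (cmod (f (\<lambda>i. Z (\<phi> i) \<omega>)))\<^sup>2)"
      by (intro Bochner_Integration.integrable_add integrable_Z_power if2)
    have "cmod (X \<omega>) * y \<le> (cmod (Z h \<omega>))\<^sup>2 + y\<^sup>2" if "y \<ge> 0" for y \<omega>
    proof -
      have "cmod (X \<omega>) * y \<le> cmod (Z h \<omega>) * y" using that \<open>\<And>\<omega>. cmod (X \<omega>) \<le> cmod (Z h \<omega>)\<close> by (intro mult_right_mono)
      also have "\<dots> \<le> 2 * cmod (Z h \<omega>) * y" using that by (simp add: mult_ac)
      also have "\<dots> \<le> (cmod (Z h \<omega>))\<^sup>2 + y\<^sup>2" by (rule sum_squares_bound)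
      finally show ?thesis .
    qed
    then show "AE \<omega> in M. norm (X \<omega> * f (\<lambda>i. Z (\<phi> i) \<omega>)) \<le> norm (cmod (Z h \<omega>) ^ 2 + (cmod (f (\<lambda>i. Z (\<phi> i) \<omega>)))\<^sup>2)"
      by (auto simp: norm_mult)
  qed simp
  show "integrable M (\<lambda>\<omega>. cnj (Z h \<omega>) * f (\<lambda>i. Z (\<phi> i) \<omega>))" by (rule prod[OF borel_measurable_cnj[OF measurable_Z]]) simp
  have iR: "integrable M (\<lambda>\<omega>. of_real (Re (Z h \<omega>)) * f (\<lambda>i. Z (\<phi> i) \<omega>))"
    and iI: "integrable M (\<lambda>\<omega>. of_real (Im (Z h \<omega>)) * f (\<lambda>i. Z (\<phi> i) \<omega>))"
    by (rule prod; simp add: abs_Re_le_cmod abs_Im_le_cmod)+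
  have iD1: "integrable M (\<lambda>\<omega>. D1 (\<lambda>i. Z (\<phi> i) \<omega>))" by (rule integrable_poly_growth[OF fm(2) bd(2)])
  have iD2: "integrable M (\<lambda>\<omega>. D2 (\<lambda>i. Z (\<phi> i) \<omega>))" by (rule integrable_poly_growth[OF fm(3) bd(3)])
  have 1: "(\<integral>\<omega>. D1 (\<lambda>i. Z (\<phi> i) \<omega>) \<partial>M) = 2 * (\<integral>\<omega>. of_real (Re (Z h \<omega>)) * f (\<lambda>i. Z (\<phi> i) \<omega>) \<partial>M)"
    by (rule stein[OF unit dep der(1) cont(1,2) bd(1,2)])
  \<comment> \<open>The inner product is conjugate-linear in its second argument, so this vector
    gives the direction \<open>\<i> * cinner (\<phi> i) h\<close> required for D2.\<close>
  define h' where "h' = cscale (-\<i>) h"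
  have unit': "norm h' = 1" by (simp add: h'_def norm_cscale unit)
  have c': "cinner (\<phi> i) h' = \<i> * cinner (\<phi> i) h" for i by (simp add: h'_def)
  have "(\<integral>\<omega>. D2 (\<lambda>i. Z (\<phi> i) \<omega>) \<partial>M) = 2 * (\<integral>\<omega>. of_real (Re (Z h' \<omega>)) * f (\<lambda>i. Z (\<phi> i) \<omega>) \<partial>M)"
    by (rule stein[OF unit' dep _ cont(1,3) bd(1,3)]) (simp_all add: c' der(2))
  also have "(\<integral>\<omega>. of_real (Re (Z h' \<omega>)) * f (\<lambda>i. Z (\<phi> i) \<omega>) \<partial>M) = (\<integral>\<omega>. of_real (Im (Z h \<omega>)) * f (\<lambda>i. Z (\<phi> i) \<omega>) \<partial>M)"
    using Z_cscale[of "-\<i>" h] unfolding h'_def by (intro integral_cong_AE) (auto elim!: eventually_mono)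
  finally have 2: "(\<integral>\<omega>. D2 (\<lambda>i. Z (\<phi> i) \<omega>) \<partial>M) = 2 * (\<integral>\<omega>. of_real (Im (Z h \<omega>)) * f (\<lambda>i. Z (\<phi> i) \<omega>) \<partial>M)" .
  have "(\<integral>\<omega>. (D1 (\<lambda>i. Z (\<phi> i) \<omega>) - \<i> * D2 (\<lambda>i. Z (\<phi> i) \<omega>)) / 2 \<partial>M)
    = ((\<integral>\<omega>. D1 (\<lambda>i. Z (\<phi> i) \<omega>) \<partial>M) - \<i> * (\<integral>\<omega>. D2 (\<lambda>i. Z (\<phi> i) \<omega>) \<partial>M)) / 2"
    using iD1 iD2 by simp
  also have "\<dots> = (\<integral>\<omega>. of_real (Re (Z h \<omega>)) * f (\<lambda>i. Z (\<phi> i) \<omega>) \<partial>M) - \<i> * (\<integral>\<omega>. of_real (Im (Z h \<omega>)) * f (\<lambda>i. Z (\<phi> i) \<omega>) \<partial>M)"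
    unfolding 1 2 by (simp add: field_simps)
  also have "\<dots> = (\<integral>\<omega>. of_real (Re (Z h \<omega>)) * f (\<lambda>i. Z (\<phi> i) \<omega>) - \<i> * (of_real (Im (Z h \<omega>)) * f (\<lambda>i. Z (\<phi> i) \<omega>)) \<partial>M)"
    by (simp only: Bochner_Integration.integral_diff[OF iR integrable_mult_right[OF iI]] integral_mult_right_zero)
  also have "\<dots> = (\<integral>\<omega>. cnj (Z h \<omega>) * f (\<lambda>i. Z (\<phi> i) \<omega>) \<partial>M)"
    by (intro Bochner_Integration.integral_cong refl) (simp add: complex_eq_iff algebra_simps)
  finally show "(\<integral>\<omega>. (D1 (\<lambda>i. Z (\<phi> i) \<omega>) - \<i> * D2 (\<lambda>i. Z (\<phi> i) \<omega>)) / 2 \<partial>M)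
    = (\<integral>\<omega>. cnj (Z h \<omega>) * f (\<lambda>i. Z (\<phi> i) \<omega>) \<partial>M)" .
qed

end

section \<open>Uniqueness of the Malliavin derivative\<close>

lemma has_vector_derivative_shift_0:
  fixes f :: "real \<Rightarrow> 'a::real_normed_vector"
  assumes "((\<lambda>t. f (a + t)) has_vector_derivative D) (at 0)"
  shows "(f has_vector_derivative D) (at a)"
proof -
  have 1: "((\<lambda>x. x - a) has_vector_derivative 1) (at a)" by (auto intro!: derivative_eq_intros)
  have 2: "((\<lambda>t. f (a + t)) has_vector_derivative D) (at (a - a))" using assms by simp
  have "((\<lambda>t. f (a + t)) \<circ> (\<lambda>x. x - a) has_vector_derivative 1 *\<^sub>R D) (at a)"
    by (rule vector_diff_chain_at[OF 1 2])
  then show ?thesis by (simp add: o_def)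
qed

text \<open>Partial derivatives alone do not give a directional derivative. In the two parameters
  along the old direction and along \<open>v\<close> in coordinate j, one partial derivative at the
  point and a continuous one in the other parameter yield total differentiability; the new direction
  is the line r = t * s.\<close>

lemma directional_derivative_step:
  fixes f :: "(nat \<Rightarrow> complex) \<Rightarrow> complex"
  assumes der: "((\<lambda>t::real. f (\<lambda>i. z i + of_real t * a i)) has_vector_derivative A) (at 0)"
    and part: "\<And>z. ((\<lambda>t::real. f (z(j := z j + of_real t * v))) has_vector_derivative P z) (at 0)"
    and cont: "continuous_on UNIV P"
  shows "((\<lambda>t::real. f (\<lambda>i. z i + of_real t * (a(j := a j + of_real s * v)) i)) has_vector_derivative A + s *\<^sub>R P z) (at 0)"
proof -
  define w where "w t r = (\<lambda>i. z i + of_real t * a i + of_real r * (if i = j then v else 0))" for t r :: real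
  have w_upd: "w t (r + s) = (w t r)(j := w t r j + of_real s * v)" for t r s
    by (auto simp: w_def fun_eq_iff algebra_simps)
  have fy: "((\<lambda>r. f (w t r)) has_derivative blinfun_apply (blinfun_scaleR_left (P (w t r)))) (at r)" for t r
  proof -
    have "((\<lambda>r. f (w t r)) has_vector_derivative P (w t r)) (at r)"
      by (rule has_vector_derivative_shift_0) (simp add: w_upd part)
    then show ?thesis by (simp add: has_vector_derivative_def)
  qed
  have wc: "continuous_on UNIV (\<lambda>(t, r). w t r)"
    unfolding w_def case_prod_unfold
    by (intro continuous_on_coordinatewise_then_product continuous_intros)
  have "continuous_on UNIV (\<lambda>x. P (case x of (t, r) \<Rightarrow> w t r))"
    by (rule continuous_on_compose2[OF cont wc]) simp
  then have "continuous_on UNIV (\<lambda>x. blinfun_scaleR_left (P (case x of (t, r) \<Rightarrow> w t r)))"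
    by (rule bounded_linear.continuous_on[OF bounded_linear_blinfun_scaleR_left])
  then have cb: "continuous (at (0, 0)) (\<lambda>(t, r). blinfun_scaleR_left (P (w t r)))"
    by (simp add: continuous_on_eq_continuous_at case_prod_unfold)
  have "((\<lambda>(t, r). f (w t r)) has_derivative (\<lambda>(tx, ty). tx *\<^sub>R A + blinfun_apply (blinfun_scaleR_left (P (w 0 0))) ty)) (at (0, 0) within UNIV \<times> UNIV)"
  proof (rule has_derivative_partialsI[where fy = "\<lambda>t r. blinfun_scaleR_left (P (w t r))" and f = "\<lambda>t r. f (w t r)" and fx = "\<lambda>tx. tx *\<^sub>R A"])
    show "((\<lambda>t. f (w t 0)) has_derivative (\<lambda>tx. tx *\<^sub>R A)) (at 0 within UNIV)"
      using der by (simp add: w_def has_vector_derivative_def)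
    show "((\<lambda>r. f (w t r)) has_derivative blinfun_apply (blinfun_scaleR_left (P (w t r)))) (at r within UNIV)" for t r
      using fy by simp
    show "continuous (at (0, 0) within UNIV \<times> UNIV) (\<lambda>(t, r). blinfun_scaleR_left (P (w t r)))"
      using cb by simp
  qed auto
  then have 1: "((\<lambda>(t, r). f (w t r)) has_derivative (\<lambda>(tx, ty). tx *\<^sub>R A + ty *\<^sub>R P (w 0 0))) (at (0, 0 * s))"
    by simp
  have 2: "((\<lambda>t. (t, t * s)) has_derivative (\<lambda>t. (t, t * s))) (at 0)"
    by (auto intro!: derivative_eq_intros)
  have "((\<lambda>(t, r). f (w t r)) \<circ> (\<lambda>t. (t, t * s)) has_derivative (\<lambda>(tx, ty). tx *\<^sub>R A + ty *\<^sub>R P (w 0 0)) \<circ> (\<lambda>t. (t, t * s))) (at 0)"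
    by (rule diff_chain_at[OF 2]) (use 1 in simp)
  moreover have "w 0 0 = z" by (simp add: w_def)
  moreover have "w t (t * s) = (\<lambda>i. z i + of_real t * (a(j := a j + of_real s * v)) i)" for t
    by (auto simp: w_def fun_eq_iff algebra_simps)
  ultimately show ?thesis
    by (simp add: has_vector_derivative_def o_def scaleR_add_right)
qed

lemma smooth_polynomial_growthD:
  assumes "smooth_polynomial_growth k f" "set ds \<subseteq> {..<k} \<times> {1, \<i>}"
  shows "\<And>j v z. j < k \<Longrightarrow> v \<in> {1, \<i>} \<Longrightarrow>
      ((\<lambda>t::real. fold partial_deriv ds f (z(j := z j + of_real t * v))) has_vector_derivative partial_deriv (j, v) (fold partial_deriv ds f) z) (at 0)"
    and "continuous_on UNIV (fold partial_deriv ds f)"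
    and "\<exists>C q. \<forall>z. cmod (fold partial_deriv ds f z) \<le> C * (1 + (\<Sum>i<k. cmod (z i))) ^ q"
  using assms unfolding smooth_polynomial_growth_def Let_def
  by (auto simp: partial_deriv_def vector_derivative_works[symmetric])

lemma smooth_polynomial_growth_dep:
  "smooth_polynomial_growth k f \<Longrightarrow> (\<And>i. i < k \<Longrightarrow> z i = w i) \<Longrightarrow> f z = f w"
  unfolding smooth_polynomial_growth_def by blast

lemma smooth_partial:
  assumes f: "smooth_polynomial_growth k f" and j: "j < k" "v \<in> {1, \<i>}"
  shows "\<And>z. ((\<lambda>t::real. f (z(j := z j + of_real t * v))) has_vector_derivative partial_deriv (j, v) f z) (at 0)"
    and "continuous_on UNIV (partial_deriv (j, v) f)"
    and "\<exists>C q. \<forall>z. cmod (partial_deriv (j, v) f z) \<le> C * (1 + (\<Sum>i<k. cmod (z i))) ^ q"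
  using smooth_polynomial_growthD(1)[OF f, of "[]"] smooth_polynomial_growthD(2,3)[OF f, of "[(j, v)]"] j by auto

text \<open>The direction is assembled coordinate by coordinate, the real before the imaginary part,
  with one use of \<open>directional_derivative_step\<close> for each.\<close>

lemma smooth_directional_derivative:
  assumes f: "smooth_polynomial_growth k f"
  shows "((\<lambda>t::real. f (\<lambda>i. z i + of_real t * c i)) has_vector_derivative
    (\<Sum>j<k. Re (c j) *\<^sub>R partial_deriv (j, 1) f z + Im (c j) *\<^sub>R partial_deriv (j, \<i>) f z)) (at 0)"
proof -
  have "((\<lambda>t::real. f (\<lambda>i. z i + of_real t * (if i < n then c i else 0))) has_vector_derivative
    (\<Sum>j<n. Re (c j) *\<^sub>R partial_deriv (j, 1) f z + Im (c j) *\<^sub>R partial_deriv (j, \<i>) f z)) (at 0)"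
    if "n \<le> k" for n
    using that
  proof (induction n)
    case 0
    then show ?case by simp
  next
    case (Suc n)
    then have n: "n < k" by simp
    let ?a = "\<lambda>i. if i < n then c i else 0"
    let ?b = "?a(n := ?a n + of_real (Re (c n)) * 1)"
    let ?A = "\<Sum>j<n. Re (c j) *\<^sub>R partial_deriv (j, 1) f z + Im (c j) *\<^sub>R partial_deriv (j, \<i>) f z"
    have 1: "((\<lambda>t::real. f (\<lambda>i. z i + of_real t * ?b i)) has_vector_derivative ?A + Re (c n) *\<^sub>R partial_deriv (n, 1) f z) (at 0)"
      using Suc n by (intro directional_derivative_step smooth_partial[OF f n]) auto
    have 2: "((\<lambda>t::real. f (\<lambda>i. z i + of_real t * (?b(n := ?b n + of_real (Im (c n)) * \<i>)) i)) has_vector_derivative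
        (?A + Re (c n) *\<^sub>R partial_deriv (n, 1) f z) + Im (c n) *\<^sub>R partial_deriv (n, \<i>) f z) (at 0)"
      by (intro directional_derivative_step[OF 1] smooth_partial[OF f n]) auto
    have eq: "?b(n := ?b n + of_real (Im (c n)) * \<i>) = (\<lambda>i. if i < Suc n then c i else 0)"
      by (auto simp: fun_eq_iff complex_eq_iff less_Suc_eq)
    show ?case using 2 unfolding eq sum.lessThan_Suc add.assoc .
  qed
  from this[of k] have "((\<lambda>t::real. f (\<lambda>i. z i + of_real t * (if i < k then c i else 0))) has_vector_derivative
    (\<Sum>j<k. Re (c j) *\<^sub>R partial_deriv (j, 1) f z + Im (c j) *\<^sub>R partial_deriv (j, \<i>) f z)) (at 0)" by simp
  moreover have "f (\<lambda>i. z i + of_real t * (if i < k then c i else 0)) = f (\<lambda>i. z i + of_real t * c i)" for t :: real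
    by (rule smooth_polynomial_growth_dep[OF f]) simp
  ultimately show ?thesis by simp
qed

lemma smooth_continuous: "smooth_polynomial_growth k f \<Longrightarrow> continuous_on UNIV f"
  using smooth_polynomial_growthD(2)[of k f "[]"] by simp

lemma smooth_wirtinger_continuous:
  assumes "smooth_polynomial_growth k f" "j < k" shows "continuous_on UNIV (wirtinger_deriv j f)"
  unfolding wirtinger_deriv_def [abs_def]
  using assms by (intro continuous_intros smooth_partial(2)) auto

section \<open>Functions of polynomial growth\<close>

lemma poly_growth_mono:
  assumes "cmod x \<le> C * (1 + s) ^ q" "0 \<le> s" "C \<le> C'" "q \<le> q'"
  shows "cmod x \<le> C' * (1 + s :: real) ^ q'"
proof -
  have "0 \<le> C * (1 + s) ^ q" by (rule order_trans[OF norm_ge_zero assms(1)])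
  moreover have "0 < (1 + s) ^ q" using assms(2) by simp
  ultimately have "C \<ge> 0" by (metis mult_neg_pos not_le)
  have "C * (1 + s) ^ q \<le> C' * (1 + s) ^ q'"
    using assms \<open>C \<ge> 0\<close> by (intro mult_mono power_increasing) auto
  with assms(1) show ?thesis by linarith
qed

definition poly_growth :: "nat \<Rightarrow> ((nat \<Rightarrow> complex) \<Rightarrow> complex) \<Rightarrow> bool" where
  "poly_growth k f \<longleftrightarrow> (\<exists>C q. \<forall>z. cmod (f z) \<le> C * (1 + (\<Sum>i<k. cmod (z i))) ^ q)"

lemma poly_growthI:
  assumes "\<And>z. cmod (f z) \<le> C * (1 + (\<Sum>i<k. cmod (z i))) ^ q" shows "poly_growth k f"
  unfolding poly_growth_def by (intro exI allI) (rule assms)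

lemma poly_growthE:
  assumes "poly_growth k f"
  obtains C q where "C \<ge> 0" "\<And>z. cmod (f z) \<le> C * (1 + (\<Sum>i<k. cmod (z i))) ^ q"
proof -
  obtain C q where *: "\<And>z. cmod (f z) \<le> C * (1 + (\<Sum>i<k. cmod (z i))) ^ q"
    using assms unfolding poly_growth_def by blast
  have "C \<ge> 0" using order_trans[OF norm_ge_zero *[of "\<lambda>_. 0"]] by simp
  with * show ?thesis using that by blast
qed

text \<open>The integration-by-parts lemmas ask for one constant and one exponent shared by a
  function and its derivatives.\<close>

lemma poly_growth_common:
  assumes "poly_growth k f" "poly_growth k g" "poly_growth k h"
  obtains C q where "\<And>z. cmod (f z) \<le> C * (1 + (\<Sum>i<k. cmod (z i))) ^ q"
    "\<And>z. cmod (g z) \<le> C * (1 + (\<Sum>i<k. cmod (z i))) ^ q" "\<And>z. cmod (h z) \<le> C * (1 + (\<Sum>i<k. cmod (z i))) ^ q"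
proof -
  obtain C1 q1 where 1: "\<And>z. cmod (f z) \<le> C1 * (1 + (\<Sum>i<k. cmod (z i))) ^ q1" using poly_growthE[OF assms(1)] by blast
  obtain C2 q2 where 2: "\<And>z. cmod (g z) \<le> C2 * (1 + (\<Sum>i<k. cmod (z i))) ^ q2" using poly_growthE[OF assms(2)] by blast
  obtain C3 q3 where 3: "\<And>z. cmod (h z) \<le> C3 * (1 + (\<Sum>i<k. cmod (z i))) ^ q3" using poly_growthE[OF assms(3)] by blast
  show ?thesis
    by (rule that[of "max C1 (max C2 C3)" "max q1 (max q2 q3)"];
        rule poly_growth_mono[OF 1] poly_growth_mono[OF 2] poly_growth_mono[OF 3]; simp add: sum_nonneg)
qed

lemma poly_growth_const: "poly_growth k (\<lambda>_. c)"
  by (rule poly_growthI[of _ "cmod c" _ 0]) simp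

lemma poly_growth_bound:
  assumes "poly_growth k f" "\<And>z. cmod (g z) \<le> cmod (f z)" shows "poly_growth k g"
proof -
  obtain C q where *: "\<And>z. cmod (f z) \<le> C * (1 + (\<Sum>i<k. cmod (z i))) ^ q" using poly_growthE[OF assms(1)] by blast
  have "cmod (g z) \<le> C * (1 + (\<Sum>i<k. cmod (z i))) ^ q" for z by (rule order_trans[OF assms(2) *])
  then show ?thesis by (rule poly_growthI)
qed

lemma poly_growth_add:
  assumes "poly_growth k f" "poly_growth k g"
  shows "poly_growth k (\<lambda>z. f z + g z)"
proof -
  obtain C q where *: "\<And>z. cmod (f z) \<le> C * (1 + (\<Sum>i<k. cmod (z i))) ^ q"
    "\<And>z. cmod (g z) \<le> C * (1 + (\<Sum>i<k. cmod (z i))) ^ q"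
    by (rule poly_growth_common[OF assms assms(1)], rule that)
  have "cmod (f z + g z) \<le> (C + C) * (1 + (\<Sum>i<k. cmod (z i))) ^ q" for z
    using norm_triangle_ineq[of "f z" "g z"] *[of z] by (simp add: distrib_right)
  then show ?thesis by (rule poly_growthI)
qed

lemma poly_growth_mult:
  assumes "poly_growth k f" "poly_growth k g"
  shows "poly_growth k (\<lambda>z. f z * g z)"
proof -
  obtain C q where 1: "C \<ge> 0" "\<And>z. cmod (f z) \<le> C * (1 + (\<Sum>i<k. cmod (z i))) ^ q" using poly_growthE[OF assms(1)] by blast
  obtain D r where 2: "D \<ge> 0" "\<And>z. cmod (g z) \<le> D * (1 + (\<Sum>i<k. cmod (z i))) ^ r" using poly_growthE[OF assms(2)] by blast
  have "cmod (f z * g z) \<le> (C * D) * (1 + (\<Sum>i<k. cmod (z i))) ^ (q + r)" for z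
  proof -
    have "cmod (f z * g z) \<le> (C * (1 + (\<Sum>i<k. cmod (z i))) ^ q) * (D * (1 + (\<Sum>i<k. cmod (z i))) ^ r)"
      unfolding norm_mult by (intro mult_mono 1 2 mult_nonneg_nonneg zero_le_power) (auto intro!: add_nonneg_nonneg sum_nonneg)
    then show ?thesis by (simp add: power_add mult_ac)
  qed
  then show ?thesis by (rule poly_growthI)
qed

lemma poly_growth_sum:
  assumes "\<And>i. i \<in> I \<Longrightarrow> poly_growth k (f i)" shows "poly_growth k (\<lambda>z. \<Sum>i\<in>I. f i z)"
  using assms by (induction I rule: infinite_finite_induct) (auto intro: poly_growth_add poly_growth_const)

lemma poly_growth_Suc:
  assumes "poly_growth k f" "k \<le> k'" shows "poly_growth k' f"
proof -
  obtain C q where *: "C \<ge> 0" "\<And>z. cmod (f z) \<le> C * (1 + (\<Sum>i<k. cmod (z i))) ^ q" using poly_growthE[OF assms(1)] by blast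
  have "cmod (f z) \<le> C * (1 + (\<Sum>i<k'. cmod (z i))) ^ q" for z
  proof -
    have "(\<Sum>i<k. cmod (z i)) \<le> (\<Sum>i<k'. cmod (z i))" using assms(2) by (intro sum_mono2) auto
    then have "C * (1 + (\<Sum>i<k. cmod (z i))) ^ q \<le> C * (1 + (\<Sum>i<k'. cmod (z i))) ^ q"
      using *(1) by (intro mult_left_mono power_mono) (auto intro!: add_nonneg_nonneg sum_nonneg)
    with *(2)[of z] show ?thesis by linarith
  qed
  then show ?thesis by (rule poly_growthI)
qed

lemma smooth_poly_growth:
  assumes "smooth_polynomial_growth k f"
  shows "poly_growth k f" "\<And>j v. j < k \<Longrightarrow> v \<in> {1, \<i>} \<Longrightarrow> poly_growth k (partial_deriv (j, v) f)"
  using smooth_polynomial_growthD(3)[OF assms, of "[]"] smooth_partial(3)[OF assms] unfolding poly_growth_def by auto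

context complex_isonormal
begin

text \<open>Integration by parts against the exponential \<open>iexp (Re (Z g))\<close>, which is carried by an extra
  coordinate of index \<open>k\<close>.\<close>

lemma smooth_test:
  assumes f: "smooth_polynomial_growth k f" and unit: "norm h = 1"
  shows "(\<integral>\<omega>. cinner (\<Sum>i<k. cscale (wirtinger_deriv i f (\<lambda>i. Z (\<phi> i) \<omega>)) (\<phi> i)) h * iexp (Re (Z g \<omega>)) \<partial>M)
    = (\<integral>\<omega>. f (\<lambda>i. Z (\<phi> i) \<omega>) * ((cnj (Z h \<omega>) - \<i> / 2 * cinner g h) * iexp (Re (Z g \<omega>))) \<partial>M)"
proof -
  define \<psi> where "\<psi> = \<phi>(k := g)"
  define c where "c i = cinner (\<psi> i) h" for i
  define E where "E z = iexp (Re (z k))" for z :: "nat \<Rightarrow> complex"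
  define D where "D c z = (\<Sum>j<k. Re (c j) *\<^sub>R partial_deriv (j, 1) f z + Im (c j) *\<^sub>R partial_deriv (j, \<i>) f z)" for c z
  \<comment> \<open>Product rule for f times the exponential in direction c; the exponential feels
    only the real part of \<open>c k\<close>.\<close>
  define DD where "DD c z = D c z * E z + f z * (\<i> * of_real (Re (c k)) * E z)" for c z
  have Enorm: "cmod (E z) = 1" for z by (simp add: E_def)
  have Econt: "continuous_on UNIV E" unfolding E_def by (intro continuous_intros continuous_on_product_coordinates)
  have Dcont: "continuous_on UNIV (D c)" for c
    unfolding D_def using smooth_partial(2)[OF f] by (intro continuous_intros) auto
  have DDcont: "continuous_on UNIV (DD c)" for c
    unfolding DD_def by (intro continuous_intros Dcont Econt smooth_continuous[OF f])
  have fEcont: "continuous_on UNIV (\<lambda>z. f z * E z)"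
    by (intro continuous_intros Econt smooth_continuous[OF f])
  have Ed: "((\<lambda>t::real. E (\<lambda>i. z i + of_real t * c i)) has_vector_derivative \<i> * of_real (Re (c k)) * E z) (at 0)" for z c
  proof -
    have "((\<lambda>t::real. exp (\<i> * of_real (Re (z k) + t * Re (c k)))) has_vector_derivative \<i> * of_real (Re (c k)) * exp (\<i> * of_real (Re (z k)))) (at 0)"
      by (auto intro!: derivative_eq_intros has_vector_derivative_real_field simp: algebra_simps)
    then show ?thesis by (simp add: E_def)
  qed
  have der: "((\<lambda>t::real. f (\<lambda>i. z i + of_real t * c i) * E (\<lambda>i. z i + of_real t * c i)) has_vector_derivative DD c z) (at 0)" for z c
  proof -
    have "((\<lambda>t::real. f (\<lambda>i. z i + of_real t * c i) * E (\<lambda>i. z i + of_real t * c i)) has_vector_derivative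
        f (\<lambda>i. z i + of_real 0 * c i) * (\<i> * of_real (Re (c k)) * E z) + D c z * E (\<lambda>i. z i + of_real 0 * c i)) (at 0)"
      unfolding D_def by (intro has_vector_derivative_mult Ed smooth_directional_derivative[OF f])
    then show ?thesis by (simp add: DD_def add.commute)
  qed
  have pD: "poly_growth k (D c)" for c
    unfolding D_def scaleR_conv_of_real
    by (rule poly_growth_sum, rule poly_growth_add;
        rule poly_growth_mult[OF poly_growth_const smooth_poly_growth(2)[OF f]]; simp)
  have pE: "poly_growth k E"
    by (rule poly_growth_bound[OF poly_growth_const[of k 1]]) (simp add: Enorm)
  have pfE: "poly_growth (Suc k) (\<lambda>z. f z * E z)"
    by (rule poly_growth_Suc[OF poly_growth_mult[OF smooth_poly_growth(1)[OF f] pE]]) simp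
  have pDD: "poly_growth (Suc k) (DD c)" for c
    unfolding DD_def
    by (rule poly_growth_Suc[OF poly_growth_add[OF poly_growth_mult[OF pD pE]
            poly_growth_mult[OF smooth_poly_growth(1)[OF f] poly_growth_mult[OF poly_growth_const pE]]]]) simp
  obtain C q where bd: "\<And>z. cmod (f z * E z) \<le> C * (1 + (\<Sum>i<Suc k. cmod (z i))) ^ q"
    "\<And>z. cmod (DD c z) \<le> C * (1 + (\<Sum>i<Suc k. cmod (z i))) ^ q"
    "\<And>z. cmod (DD (\<lambda>i. \<i> * c i) z) \<le> C * (1 + (\<Sum>i<Suc k. cmod (z i))) ^ q"
    using poly_growth_common[OF pfE pDD[of c] pDD[of "\<lambda>i. \<i> * c i"]] by blast
  have dep: "f z * E z = f w * E w" if "\<And>i. i < Suc k \<Longrightarrow> z i = w i" for z w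
  proof -
    have "f z = f w" by (rule smooth_polynomial_growth_dep[OF f]) (simp add: that)
    moreover have "E z = E w" by (simp add: E_def that)
    ultimately show ?thesis by simp
  qed
  have der1: "((\<lambda>t::real. f (\<lambda>i. z i + of_real t * cinner (\<psi> i) h) * E (\<lambda>i. z i + of_real t * cinner (\<psi> i) h))
      has_vector_derivative DD c z) (at 0)" for z
    using der[of z c] by (simp only: c_def)
  have der2: "((\<lambda>t::real. f (\<lambda>i. z i + of_real t * (\<i> * cinner (\<psi> i) h)) * E (\<lambda>i. z i + of_real t * (\<i> * cinner (\<psi> i) h)))
      has_vector_derivative DD (\<lambda>i. \<i> * c i) z) (at 0)" for z
    using der[of z "\<lambda>i. \<i> * c i"] by (simp only: c_def)
  have ibp1: "(\<integral>\<omega>. (DD c (\<lambda>i. Z (\<psi> i) \<omega>) - \<i> * DD (\<lambda>i. \<i> * c i) (\<lambda>i. Z (\<psi> i) \<omega>)) / 2 \<partial>M)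
    = (\<integral>\<omega>. cnj (Z h \<omega>) * (f (\<lambda>i. Z (\<psi> i) \<omega>) * E (\<lambda>i. Z (\<psi> i) \<omega>)) \<partial>M)"
    by (rule complex_integration_by_parts(1)[OF unit dep der1 der2 fEcont DDcont DDcont bd])
  have ibp2: "integrable M (\<lambda>\<omega>. cnj (Z h \<omega>) * (f (\<lambda>i. Z (\<psi> i) \<omega>) * E (\<lambda>i. Z (\<psi> i) \<omega>)))"
    by (rule complex_integration_by_parts(2)[OF unit dep der1 der2 fEcont DDcont DDcont bd])
  \<comment> \<open>Combining the directions c and \<open>\<i> * c\<close> turns D into the
    Wirtinger pairing, while the exponential contributes \<open>\<i> / 2 * cinner g h\<close>, the
    1/2 being the Wirtinger derivative of a real part.\<close>
  have DDeq: "(DD c z - \<i> * DD (\<lambda>i. \<i> * c i) z) / 2 = (\<Sum>i<k. c i * wirtinger_deriv i f z) * E z + \<i> / 2 * c k * (f z * E z)" for z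
  proof -
    have "(D c z - \<i> * D (\<lambda>i. \<i> * c i) z) / 2 = (\<Sum>i<k. c i * wirtinger_deriv i f z)"
      unfolding D_def sum_distrib_left sum_subtractf[symmetric] sum_divide_distrib
      by (intro sum.cong refl) (simp add: wirtinger_deriv_def scaleR_conv_of_real complex_eq_iff field_simps)
    moreover have "(DD c z - \<i> * DD (\<lambda>i. \<i> * c i) z) / 2
      = (D c z - \<i> * D (\<lambda>i. \<i> * c i) z) / 2 * E z + f z * E z * ((\<i> * of_real (Re (c k)) - \<i> * \<i> * of_real (Re (\<i> * c k))) / 2)"
      by (simp add: DD_def field_simps)
    moreover have "(\<i> * of_real (Re (c k)) - \<i> * \<i> * of_real (Re (\<i> * c k))) / 2 = \<i> / 2 * c k"
      by (simp add: complex_eq_iff)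
    ultimately show ?thesis by (simp add: mult_ac)
  qed
  have \<psi>: "\<psi> k = g" "\<And>i. i < k \<Longrightarrow> \<psi> i = \<phi> i" by (auto simp: \<psi>_def)
  let ?z = "\<lambda>\<omega> i. Z (\<psi> i) \<omega>"
  have f\<psi>: "f (?z \<omega>) = f (\<lambda>i. Z (\<phi> i) \<omega>)" for \<omega>
    by (rule smooth_polynomial_growth_dep[OF f]) (simp add: \<psi>)
  have w\<psi>: "wirtinger_deriv j f (?z \<omega>) = wirtinger_deriv j f (\<lambda>i. Z (\<phi> i) \<omega>)" if "j < k" for j \<omega>
  proof -
    have "partial_deriv (j, v) f (?z \<omega>) = partial_deriv (j, v) f (\<lambda>i. Z (\<phi> i) \<omega>)" for v
    proof -
      have "f ((?z \<omega>)(j := ?z \<omega> j + of_real t * v)) = f ((\<lambda>i. Z (\<phi> i) \<omega>)(j := Z (\<phi> j) \<omega> + of_real t * v))" for t :: real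
        by (rule smooth_polynomial_growth_dep[OF f]) (simp add: \<psi> that)
      then show ?thesis by (simp add: partial_deriv_def)
    qed
    then show ?thesis by (simp add: wirtinger_deriv_def)
  qed
  have i1: "integrable M (\<lambda>\<omega>. f (?z \<omega>) * E (?z \<omega>))"
    by (rule integrable_poly_growth[OF borel_measurable_continuous_onI[OF fEcont] bd(1)])
  have i2: "integrable M (\<lambda>\<omega>. (DD c (?z \<omega>) - \<i> * DD (\<lambda>i. \<i> * c i) (?z \<omega>)) / 2)"
    using integrable_poly_growth[OF borel_measurable_continuous_onI[OF DDcont] bd(2)]
      integrable_poly_growth[OF borel_measurable_continuous_onI[OF DDcont] bd(3)] by simp
  have "(\<integral>\<omega>. cinner (\<Sum>i<k. cscale (wirtinger_deriv i f (\<lambda>i. Z (\<phi> i) \<omega>)) (\<phi> i)) h * iexp (Re (Z g \<omega>)) \<partial>M)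
    = (\<integral>\<omega>. (DD c (?z \<omega>) - \<i> * DD (\<lambda>i. \<i> * c i) (?z \<omega>)) / 2 - \<i> / 2 * c k * (f (?z \<omega>) * E (?z \<omega>)) \<partial>M)"
    unfolding DDeq
    by (intro Bochner_Integration.integral_cong refl)
      (simp add: cinner_sum_left c_def \<psi> w\<psi> E_def mult.commute)
  also have "\<dots> = (\<integral>\<omega>. (DD c (?z \<omega>) - \<i> * DD (\<lambda>i. \<i> * c i) (?z \<omega>)) / 2 \<partial>M) - (\<integral>\<omega>. \<i> / 2 * c k * (f (?z \<omega>) * E (?z \<omega>)) \<partial>M)"
    by (rule Bochner_Integration.integral_diff[OF i2 integrable_mult_right[OF i1]])
  also have "\<dots> = (\<integral>\<omega>. cnj (Z h \<omega>) * (f (?z \<omega>) * E (?z \<omega>)) \<partial>M) - (\<integral>\<omega>. \<i> / 2 * c k * (f (?z \<omega>) * E (?z \<omega>)) \<partial>M)"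
    unfolding ibp1 by (rule refl)
  also have "\<dots> = (\<integral>\<omega>. cnj (Z h \<omega>) * (f (?z \<omega>) * E (?z \<omega>)) - \<i> / 2 * c k * (f (?z \<omega>) * E (?z \<omega>)) \<partial>M)"
    by (rule Bochner_Integration.integral_diff[OF ibp2 integrable_mult_right[OF i1], symmetric])
  also have "\<dots> = (\<integral>\<omega>. f (\<lambda>i. Z (\<phi> i) \<omega>) * ((cnj (Z h \<omega>) - \<i> / 2 * cinner g h) * iexp (Re (Z g \<omega>))) \<partial>M)"
    unfolding f\<psi> by (intro Bochner_Integration.integral_cong refl) (simp add: c_def \<psi> E_def algebra_simps)
  finally show ?thesis .
qed

end

section \<open>Square-integrable functions and bilinear products\<close>

lemma Cauchy_Schwarz_integral:
  fixes f g :: "'a \<Rightarrow> real"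
  assumes [measurable]: "f \<in> borel_measurable M" "g \<in> borel_measurable M"
    and int: "integrable M (\<lambda>x. (f x)\<^sup>2)" "integrable M (\<lambda>x. (g x)\<^sup>2)" and nn: "\<And>x. 0 \<le> f x" "\<And>x. 0 \<le> g x"
  shows "integrable M (\<lambda>x. f x * g x)"
    and "(\<integral>x. f x * g x \<partial>M)\<^sup>2 \<le> (\<integral>x. (f x)\<^sup>2 \<partial>M) * (\<integral>x. (g x)\<^sup>2 \<partial>M)"
proof -
  show i: "integrable M (\<lambda>x. f x * g x)"
  proof (rule Bochner_Integration.integrable_bound[OF Bochner_Integration.integrable_add[OF int]])
    have "f x * g x \<le> (f x)\<^sup>2 + (g x)\<^sup>2" for x
      using sum_squares_bound[of "f x" "g x"] mult_nonneg_nonneg[OF nn(1)[of x] nn(2)[of x]] by simp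
    then show "AE x in M. norm (f x * g x) \<le> norm ((f x)\<^sup>2 + (g x)\<^sup>2)" using nn by auto
  qed simp
  have "(\<integral>\<^sup>+x. ennreal (f x) * ennreal (g x) \<partial>M)\<^sup>2 \<le> (\<integral>\<^sup>+x. (ennreal (f x))\<^sup>2 \<partial>M) * (\<integral>\<^sup>+x. (ennreal (g x))\<^sup>2 \<partial>M)"
    by (rule Cauchy_Schwarz_nn_integral) auto
  moreover have "(\<integral>\<^sup>+x. ennreal (f x) * ennreal (g x) \<partial>M) = ennreal (\<integral>x. f x * g x \<partial>M)"
    using nn by (subst nn_integral_eq_integral[OF i, symmetric]) (auto simp: ennreal_mult)
  moreover have "(\<integral>\<^sup>+x. (ennreal (f x))\<^sup>2 \<partial>M) = ennreal (\<integral>x. (f x)\<^sup>2 \<partial>M)"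
    using nn by (subst nn_integral_eq_integral[OF int(1), symmetric]) (auto simp: ennreal_power)
  moreover have "(\<integral>\<^sup>+x. (ennreal (g x))\<^sup>2 \<partial>M) = ennreal (\<integral>x. (g x)\<^sup>2 \<partial>M)"
    using nn by (subst nn_integral_eq_integral[OF int(2), symmetric]) (auto simp: ennreal_power)
  ultimately have "(ennreal (\<integral>x. f x * g x \<partial>M))\<^sup>2 \<le> ennreal (\<integral>x. (f x)\<^sup>2 \<partial>M) * ennreal (\<integral>x. (g x)\<^sup>2 \<partial>M)" by simp
  moreover have "0 \<le> (\<integral>x. f x * g x \<partial>M)" using nn by (intro integral_nonneg_AE) auto
  moreover have "0 \<le> (\<integral>x. (f x)\<^sup>2 \<partial>M)" "0 \<le> (\<integral>x. (g x)\<^sup>2 \<partial>M)" by (intro integral_nonneg_AE; simp)+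
  ultimately show "(\<integral>x. f x * g x \<partial>M)\<^sup>2 \<le> (\<integral>x. (f x)\<^sup>2 \<partial>M) * (\<integral>x. (g x)\<^sup>2 \<partial>M)"
    by (simp add: ennreal_power ennreal_mult[symmetric])
qed

lemma square_integrable_norm_mult:
  assumes "square_integrable M X" "square_integrable M Y"
  shows "integrable M (\<lambda>\<omega>. norm (X \<omega>) * norm (Y \<omega>))"
    and "(\<integral>\<omega>. norm (X \<omega>) * norm (Y \<omega>) \<partial>M)
      \<le> sqrt (\<integral>\<omega>. (norm (X \<omega>))\<^sup>2 \<partial>M) * sqrt (\<integral>\<omega>. (norm (Y \<omega>))\<^sup>2 \<partial>M)"
proof -
  have [measurable]: "X \<in> borel_measurable M" "Y \<in> borel_measurable M"
    using assms by (auto simp: square_integrable_def)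
  note cs = Cauchy_Schwarz_integral[of "\<lambda>\<omega>. norm (X \<omega>)" M "\<lambda>\<omega>. norm (Y \<omega>)"]
  show "integrable M (\<lambda>\<omega>. norm (X \<omega>) * norm (Y \<omega>))"
    using assms by (intro cs(1)) (auto simp: square_integrable_def)
  show "(\<integral>\<omega>. norm (X \<omega>) * norm (Y \<omega>) \<partial>M)
      \<le> sqrt (\<integral>\<omega>. (norm (X \<omega>))\<^sup>2 \<partial>M) * sqrt (\<integral>\<omega>. (norm (Y \<omega>))\<^sup>2 \<partial>M)"
    unfolding real_sqrt_mult[symmetric]
    using assms by (intro real_le_rsqrt cs(2)) (auto simp: square_integrable_def)
qed

lemma square_integrable_diff:
  assumes "square_integrable M X" "square_integrable M Y"
  shows "square_integrable M (\<lambda>\<omega>. X \<omega> - Y \<omega>)"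
proof -
  have [measurable]: "X \<in> borel_measurable M" "Y \<in> borel_measurable M"
    using assms by (auto simp: square_integrable_def)
  have "integrable M (\<lambda>\<omega>. (norm (X \<omega> - Y \<omega>))\<^sup>2)"
  proof (rule Bochner_Integration.integrable_bound)
    show "integrable M (\<lambda>\<omega>. 2 * (norm (X \<omega>))\<^sup>2 + 2 * (norm (Y \<omega>))\<^sup>2)"
      using assms by (auto simp: square_integrable_def)
    have "(norm (X \<omega> - Y \<omega>))\<^sup>2 \<le> 2 * (norm (X \<omega>))\<^sup>2 + 2 * (norm (Y \<omega>))\<^sup>2" for \<omega>
    proof -
      have "(norm (X \<omega> - Y \<omega>))\<^sup>2 \<le> (norm (X \<omega>) + norm (Y \<omega>))\<^sup>2"
        by (intro power_mono norm_triangle_ineq4) simp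
      then show ?thesis
        using sum_squares_bound[of "norm (X \<omega>)" "norm (Y \<omega>)"] by (simp add: power2_sum)
    qed
    then show "AE \<omega> in M. norm ((norm (X \<omega> - Y \<omega>))\<^sup>2) \<le> norm (2 * (norm (X \<omega>))\<^sup>2 + 2 * (norm (Y \<omega>))\<^sup>2)"
      by (auto intro!: AE_I2)
  qed simp
  then show ?thesis by (simp add: square_integrable_def)
qed

lemma bilinear_integral_bound:
  fixes X :: "'w \<Rightarrow> 'a::{real_normed_vector, second_countable_topology}"
    and Y :: "'w \<Rightarrow> 'b::{real_normed_vector, second_countable_topology}"
    and prod :: "'a \<Rightarrow> 'b \<Rightarrow> 'c::{banach, second_countable_topology}"
  assumes bb: "bounded_bilinear prod" and X: "square_integrable M X" and Y: "square_integrable M Y"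
    and K: "K \<ge> 0" "\<And>x y. norm (prod x y) \<le> K * (norm x * norm y)"
  shows "integrable M (\<lambda>\<omega>. prod (X \<omega>) (Y \<omega>))"
    and "norm (\<integral>\<omega>. prod (X \<omega>) (Y \<omega>) \<partial>M) \<le> K * (sqrt (\<integral>\<omega>. (norm (X \<omega>))\<^sup>2 \<partial>M) * sqrt (\<integral>\<omega>. (norm (Y \<omega>))\<^sup>2 \<partial>M))"
proof -
  have [measurable]: "X \<in> borel_measurable M" "Y \<in> borel_measurable M"
    using X Y by (auto simp: square_integrable_def)
  have cont: "continuous_on UNIV (\<lambda>p. prod (fst p) (snd p))"
    by (intro bounded_bilinear.continuous_on[OF bb] continuous_intros)
  have m: "(\<lambda>\<omega>. prod (X \<omega>) (Y \<omega>)) \<in> borel_measurable M"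
    by (rule borel_measurable_continuous_Pair[OF _ _ cont]) simp_all
  note i = square_integrable_norm_mult(1)[OF X Y]
  show ip: "integrable M (\<lambda>\<omega>. prod (X \<omega>) (Y \<omega>))"
  proof (rule Bochner_Integration.integrable_bound[OF integrable_mult_right[OF i, of K] m])
    show "AE \<omega> in M. norm (prod (X \<omega>) (Y \<omega>)) \<le> norm (K * (norm (X \<omega>) * norm (Y \<omega>)))"
      using K by (auto intro!: AE_I2 order_trans[OF K(2)])
  qed
  have "norm (\<integral>\<omega>. prod (X \<omega>) (Y \<omega>) \<partial>M) \<le> (\<integral>\<omega>. norm (prod (X \<omega>) (Y \<omega>)) \<partial>M)"
    by (rule integral_norm_bound)
  also have "\<dots> \<le> (\<integral>\<omega>. K * (norm (X \<omega>) * norm (Y \<omega>)) \<partial>M)"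
    using ip i by (intro integral_mono K) auto
  also have "\<dots> \<le> K * (sqrt (\<integral>\<omega>. (norm (X \<omega>))\<^sup>2 \<partial>M) * sqrt (\<integral>\<omega>. (norm (Y \<omega>))\<^sup>2 \<partial>M))"
    using square_integrable_norm_mult(2)[OF X Y] K(1) by (simp add: mult_left_mono)
  finally show "norm (\<integral>\<omega>. prod (X \<omega>) (Y \<omega>) \<partial>M) \<le> K * (sqrt (\<integral>\<omega>. (norm (X \<omega>))\<^sup>2 \<partial>M) * sqrt (\<integral>\<omega>. (norm (Y \<omega>))\<^sup>2 \<partial>M))" .
qed

text \<open>The difference of products splits into three terms, each bounded by Cauchy-Schwarz. An
  arbitrary bounded bilinear product covers complex multiplication, pairing with a fixed vector and
  its conjugate at once.\<close>

lemma L2_converges_integral_prod: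
  fixes x :: "'w \<Rightarrow> 'a::{real_normed_vector, second_countable_topology}"
    and y :: "'w \<Rightarrow> 'b::{real_normed_vector, second_countable_topology}"
    and prod :: "'a \<Rightarrow> 'b \<Rightarrow> 'c::{banach, second_countable_topology}"
  assumes bb: "bounded_bilinear prod" and X: "L2_converges M X x" and Y: "L2_converges M Y y"
  shows "(\<lambda>N. \<integral>\<omega>. prod (X N \<omega>) (Y N \<omega>) \<partial>M) \<longlonglongrightarrow> (\<integral>\<omega>. prod (x \<omega>) (y \<omega>) \<partial>M)"
proof -
  obtain K where K: "K \<ge> 0" "\<And>x y. norm (prod x y) \<le> K * (norm x * norm y)"
    using bounded_bilinear.nonneg_bounded[OF bb] by (metis mult.assoc mult.commute)
  have sX: "square_integrable M (X N)" "square_integrable M x" and sY: "square_integrable M (Y N)" "square_integrable M y" for N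
    using X Y by (auto simp: L2_converges_def)
  define a where "a N = sqrt (\<integral>\<omega>. (norm (X N \<omega> - x \<omega>))\<^sup>2 \<partial>M)" for N
  define b where "b N = sqrt (\<integral>\<omega>. (norm (Y N \<omega> - y \<omega>))\<^sup>2 \<partial>M)" for N
  define nx where "nx = sqrt (\<integral>\<omega>. (norm (x \<omega>))\<^sup>2 \<partial>M)"
  define ny where "ny = sqrt (\<integral>\<omega>. (norm (y \<omega>))\<^sup>2 \<partial>M)"
  have a0: "a \<longlonglongrightarrow> 0" and b0: "b \<longlonglongrightarrow> 0"
    using X Y tendsto_real_sqrt[of _ 0] unfolding a_def b_def L2_converges_def by fastforce+
  note dX = square_integrable_diff[OF sX(1) sX(2)] and dY = square_integrable_diff[OF sY(1) sY(2)]
  note bnd = bilinear_integral_bound[OF bb _ _ K]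
  have "norm ((\<integral>\<omega>. prod (X N \<omega>) (Y N \<omega>) \<partial>M) - (\<integral>\<omega>. prod (x \<omega>) (y \<omega>) \<partial>M))
      \<le> K * (a N * b N) + K * (a N * ny) + K * (nx * b N)" for N
  proof -
    have "(\<integral>\<omega>. prod (X N \<omega>) (Y N \<omega>) \<partial>M) - (\<integral>\<omega>. prod (x \<omega>) (y \<omega>) \<partial>M)
        = (\<integral>\<omega>. prod (X N \<omega>) (Y N \<omega>) - prod (x \<omega>) (y \<omega>) \<partial>M)"
      by (rule Bochner_Integration.integral_diff[OF bnd(1)[OF sX(1) sY(1)] bnd(1)[OF sX(2) sY(2)], symmetric])
    also have "\<dots> = (\<integral>\<omega>. prod (X N \<omega> - x \<omega>) (Y N \<omega> - y \<omega>) + prod (X N \<omega> - x \<omega>) (y \<omega>) + prod (x \<omega>) (Y N \<omega> - y \<omega>) \<partial>M)"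
      by (simp add: bounded_bilinear.diff_left[OF bb] bounded_bilinear.diff_right[OF bb])
    also have "\<dots> = (\<integral>\<omega>. prod (X N \<omega> - x \<omega>) (Y N \<omega> - y \<omega>) \<partial>M) + (\<integral>\<omega>. prod (X N \<omega> - x \<omega>) (y \<omega>) \<partial>M) + (\<integral>\<omega>. prod (x \<omega>) (Y N \<omega> - y \<omega>) \<partial>M)"
      by (simp only: Bochner_Integration.integral_add bnd(1)[OF dX dY] bnd(1)[OF dX sY(2)] bnd(1)[OF sX(2) dY] Bochner_Integration.integrable_add)
    finally have e: "(\<integral>\<omega>. prod (X N \<omega>) (Y N \<omega>) \<partial>M) - (\<integral>\<omega>. prod (x \<omega>) (y \<omega>) \<partial>M) = \<dots>" .
    show ?thesis unfolding e
      by (intro order_trans[OF norm_triangle_ineq] add_mono order_trans[OF norm_triangle_ineq])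
        (simp_all add: a_def b_def nx_def ny_def bnd(2)[OF dX dY] bnd(2)[OF dX sY(2)] bnd(2)[OF sX(2) dY])
  qed
  then have bd: "\<forall>\<^sub>F N in sequentially. norm ((\<integral>\<omega>. prod (X N \<omega>) (Y N \<omega>) \<partial>M) - (\<integral>\<omega>. prod (x \<omega>) (y \<omega>) \<partial>M))
      \<le> K * (a N * b N) + K * (a N * ny) + K * (nx * b N)"
    by (intro always_eventually allI)
  have "(\<lambda>N. K * (a N * b N) + K * (a N * ny) + K * (nx * b N)) \<longlonglongrightarrow> K * (0 * 0) + K * (0 * ny) + K * (nx * 0)"
    by (intro tendsto_add tendsto_mult tendsto_const a0 b0)
  then have "(\<lambda>N. K * (a N * b N) + K * (a N * ny) + K * (nx * b N)) \<longlonglongrightarrow> 0"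
    by (simp only: mult_zero_left mult_zero_right add_0)
  from Lim_null_comparison[OF bd this] have "(\<lambda>N. (\<integral>\<omega>. prod (X N \<omega>) (Y N \<omega>) \<partial>M) - (\<integral>\<omega>. prod (x \<omega>) (y \<omega>) \<partial>M)) \<longlonglongrightarrow> 0"
    .
  then show ?thesis by (rule LIM_zero_cancel)
qed

lemma L2_converges_const: "square_integrable M x \<Longrightarrow> L2_converges M (\<lambda>_. x) x"
  by (simp add: L2_converges_def)

context prob_space
begin

lemma square_integrable_bounded:
  assumes [measurable]: "X \<in> borel_measurable M" and "\<And>\<omega>. norm (X \<omega>) \<le> C"
  shows "square_integrable M X"
proof -
  have "integrable M (\<lambda>\<omega>. (norm (X \<omega>))\<^sup>2)"
    by (rule integrable_const_bound[of _ "C\<^sup>2"]) (auto intro!: AE_I2 power_mono assms(2))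
  then show ?thesis by (simp add: square_integrable_def)
qed

end

section \<open>Exponential tests determine the derivative\<close>

context complex_isonormal
begin

text \<open>Both sides of \<open>smooth_test\<close> are continuous under the joint L2-convergence
  of functional and derivative, so the identity extends to the closed graph; its right side involves
  only \<open>F\<close>.\<close>

lemma malliavin_test:
  assumes "is_malliavin_deriv M Z F u" "norm h = 1"
  shows "(\<integral>\<omega>. cinner (u \<omega>) h * iexp (Re (Z g \<omega>)) \<partial>M)
    = (\<integral>\<omega>. F \<omega> * ((cnj (Z h \<omega>) - \<i> / 2 * cinner g h) * iexp (Re (Z g \<omega>))) \<partial>M)"
proof -
  obtain X U where sm: "\<And>N. smooth_malliavin Z (X N) (U N)" and X: "L2_converges M X F" and U: "L2_converges M U u"
    using assms(1) unfolding is_malliavin_deriv_def by blast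
  let ?E = "\<lambda>\<omega>. iexp (Re (Z g \<omega>))"
  let ?W = "\<lambda>\<omega>. (cnj (Z h \<omega>) - \<i> / 2 * cinner g h) * ?E \<omega>"
  have eq: "(\<integral>\<omega>. cinner (U N \<omega>) h * ?E \<omega> \<partial>M) = (\<integral>\<omega>. X N \<omega> * ?W \<omega> \<partial>M)" for N
  proof -
    obtain k \<phi> f where *: "smooth_polynomial_growth k f" "X N = (\<lambda>\<omega>. f (\<lambda>i. Z (\<phi> i) \<omega>))"
      "U N = (\<lambda>\<omega>. \<Sum>i<k. cscale (wirtinger_deriv i f (\<lambda>i. Z (\<phi> i) \<omega>)) (\<phi> i))"
      using sm[of N] unfolding smooth_malliavin_def by blast
    show ?thesis unfolding *(2,3) by (rule smooth_test[OF *(1) assms(2)])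
  qed
  have sE: "square_integrable M ?E" by (rule square_integrable_bounded[where C = 1]) simp_all
  have "square_integrable M (\<lambda>\<omega>. cnj (Z h \<omega>))"
    using integrable_Z_power[of h 2] by (simp add: square_integrable_def)
  then have "square_integrable M (\<lambda>\<omega>. cnj (Z h \<omega>) - \<i> / 2 * cinner g h)"
    by (rule square_integrable_diff[OF _ square_integrable_bounded[where C = "cmod (\<i> / 2 * cinner g h)"]]) simp_all
  then have sW: "square_integrable M ?W" by (simp add: square_integrable_def norm_mult)
  have bb: "bounded_bilinear (\<lambda>x y. cinner x h * y)"
    by (rule bounded_bilinear.comp1[OF bounded_bilinear_mult bounded_bilinear.bounded_linear_left[OF bounded_bilinear_cinner]])
  have "(\<lambda>N. \<integral>\<omega>. cinner (U N \<omega>) h * ?E \<omega> \<partial>M) \<longlonglongrightarrow> (\<integral>\<omega>. cinner (u \<omega>) h * ?E \<omega> \<partial>M)"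
    by (rule L2_converges_integral_prod[OF bb U L2_converges_const[OF sE]])
  moreover have "(\<lambda>N. \<integral>\<omega>. X N \<omega> * ?W \<omega> \<partial>M) \<longlonglongrightarrow> (\<integral>\<omega>. F \<omega> * ?W \<omega> \<partial>M)"
    by (rule L2_converges_integral_prod[OF bounded_bilinear_mult X L2_converges_const[OF sW]])
  ultimately show ?thesis unfolding eq by (rule LIMSEQ_unique)
qed

text \<open>Exponentials of the process are total: the positive and the negative part of \<open>r\<close> define two
  measures under which every finite family \<open>Z (\<phi> i)\<close> has the same law.\<close>

lemma exponentials_total_real:
  fixes p :: "(nat \<Rightarrow> complex) \<Rightarrow> complex" and r :: "'w \<Rightarrow> real" and \<phi> :: "nat \<Rightarrow> 'h cplx"
  assumes r: "integrable M r" and zero: "\<And>g. (\<integral>\<omega>. r \<omega> *\<^sub>R iexp (Re (Z g \<omega>)) \<partial>M) = 0"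
    and p: "p \<in> borel_measurable borel" "\<And>z w. (\<And>i. i < k \<Longrightarrow> z i = w i) \<Longrightarrow> p z = p w"
    and rp: "integrable M (\<lambda>\<omega>. r \<omega> *\<^sub>R p (\<lambda>i. Z (\<phi> i) \<omega>))"
  shows "(\<integral>\<omega>. r \<omega> *\<^sub>R p (\<lambda>i. Z (\<phi> i) \<omega>) \<partial>M) = 0"
proof -
  have [measurable]: "r \<in> borel_measurable M" using r by simp
  have pm[measurable]: "(\<lambda>\<omega>. p (\<lambda>i. Z (\<phi> i) \<omega>)) \<in> borel_measurable M"
    by (rule measurable_compose[OF measurable_Z_family p(1)])
  let ?N = "density M (\<lambda>\<omega>. ennreal (max 0 (r \<omega>)))"
  let ?L = "density M (\<lambda>\<omega>. ennreal (max 0 (- r \<omega>)))"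
  have fin: "finite_measure (density M (\<lambda>\<omega>. ennreal (max 0 (s \<omega>))))" if s: "integrable M s" for s :: "'w \<Rightarrow> real"
  proof (rule finite_measureI)
    have [measurable]: "s \<in> borel_measurable M" using s by simp
    have "emeasure (density M (\<lambda>\<omega>. ennreal (max 0 (s \<omega>)))) (space (density M (\<lambda>\<omega>. ennreal (max 0 (s \<omega>)))))
        = (\<integral>\<^sup>+\<omega>. ennreal (max 0 (s \<omega>)) \<partial>M)"
      by (simp add: emeasure_density cong: nn_integral_cong)
    also have "\<dots> = ennreal (\<integral>\<omega>. max 0 (s \<omega>) \<partial>M)" using s by (intro nn_integral_eq_integral) auto
    finally show "emeasure (density M (\<lambda>\<omega>. ennreal (max 0 (s \<omega>)))) (space (density M (\<lambda>\<omega>. ennreal (max 0 (s \<omega>))))) \<noteq> \<infinity>" by simp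
  qed
  have diff: "(\<integral>\<omega>. q \<omega> \<partial>?N) - (\<integral>\<omega>. q \<omega> \<partial>?L) = (\<integral>\<omega>. r \<omega> *\<^sub>R q \<omega> \<partial>M)"
    if [measurable]: "q \<in> borel_measurable M" and rq: "integrable M (\<lambda>\<omega>. r \<omega> *\<^sub>R q \<omega>)" for q :: "'w \<Rightarrow> complex"
  proof -
    have i1: "integrable M (\<lambda>\<omega>. max 0 (r \<omega>) *\<^sub>R q \<omega>)" and i2: "integrable M (\<lambda>\<omega>. max 0 (- r \<omega>) *\<^sub>R q \<omega>)"
      by (rule Bochner_Integration.integrable_bound[OF rq]; auto intro!: AE_I2 mult_right_mono)+
    have "(\<integral>\<omega>. q \<omega> \<partial>?N) - (\<integral>\<omega>. q \<omega> \<partial>?L) = (\<integral>\<omega>. max 0 (r \<omega>) *\<^sub>R q \<omega> \<partial>M) - (\<integral>\<omega>. max 0 (- r \<omega>) *\<^sub>R q \<omega> \<partial>M)"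
      by (intro arg_cong2[where f = minus] integral_density) auto
    also have "\<dots> = (\<integral>\<omega>. max 0 (r \<omega>) *\<^sub>R q \<omega> - max 0 (- r \<omega>) *\<^sub>R q \<omega> \<partial>M)"
      by (rule Bochner_Integration.integral_diff[OF i1 i2, symmetric])
    also have "\<dots> = (\<integral>\<omega>. r \<omega> *\<^sub>R q \<omega> \<partial>M)"
      by (intro Bochner_Integration.integral_cong refl) (auto simp: max_def)
    finally show ?thesis .
  qed
  have char: "(CLINT \<omega>|?N. iexp (Re (\<Sum>i<k. d i * Z (\<phi> i) \<omega>))) = (CLINT \<omega>|?L. iexp (Re (\<Sum>i<k. d i * Z (\<phi> i) \<omega>)))" for d
  proof -
    have "integrable M (\<lambda>\<omega>. r \<omega> *\<^sub>R iexp (Re (\<Sum>i<k. d i * Z (\<phi> i) \<omega>)))"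
      by (rule Bochner_Integration.integrable_bound[OF r]) auto
    then have "(CLINT \<omega>|?N. iexp (Re (\<Sum>i<k. d i * Z (\<phi> i) \<omega>))) - (CLINT \<omega>|?L. iexp (Re (\<Sum>i<k. d i * Z (\<phi> i) \<omega>)))
      = (\<integral>\<omega>. r \<omega> *\<^sub>R iexp (Re (\<Sum>i<k. d i * Z (\<phi> i) \<omega>)) \<partial>M)"
      by (intro diff) auto
    also have "\<dots> = (\<integral>\<omega>. r \<omega> *\<^sub>R iexp (Re (Z (\<Sum>i<k. cscale (d i) (\<phi> i)) \<omega>)) \<partial>M)"
      using Z_sum[of "{..<k}" d \<phi>] by (intro integral_cong_AE) (auto elim!: eventually_mono)
    also have "\<dots> = 0" by (rule zero)
    finally show ?thesis by simp
  qed
  have "(\<integral>\<omega>. p (\<lambda>i. Z (\<phi> i) \<omega>) \<partial>?N) = (\<integral>\<omega>. p (\<lambda>i. Z (\<phi> i) \<omega>) \<partial>?L)"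
    by (rule complex_vector_law_eqI(2)[OF fin[OF r] fin[OF Bochner_Integration.integrable_minus[OF r]] _ _ char p]) auto
  with diff[OF pm rp] show ?thesis by simp
qed

text \<open>Reduction to a real weight: the real and imaginary parts of v satisfy the same
  hypothesis, because conjugating the integral replaces g by -g.\<close>

lemma exponentials_total:
  fixes p :: "(nat \<Rightarrow> complex) \<Rightarrow> complex" and v :: "'w \<Rightarrow> complex" and \<phi> :: "nat \<Rightarrow> 'h cplx"
  assumes v: "integrable M v" and zero: "\<And>g. (\<integral>\<omega>. v \<omega> * iexp (Re (Z g \<omega>)) \<partial>M) = 0"
    and p: "p \<in> borel_measurable borel" "\<And>z w. (\<And>i. i < k \<Longrightarrow> z i = w i) \<Longrightarrow> p z = p w"
    and vp: "integrable M (\<lambda>\<omega>. v \<omega> * p (\<lambda>i. Z (\<phi> i) \<omega>))"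
  shows "(\<integral>\<omega>. v \<omega> * p (\<lambda>i. Z (\<phi> i) \<omega>) \<partial>M) = 0"
proof -
  have [measurable]: "v \<in> borel_measurable M" using v by simp
  have pm[measurable]: "(\<lambda>\<omega>. p (\<lambda>i. Z (\<phi> i) \<omega>)) \<in> borel_measurable M"
    by (rule measurable_compose[OF measurable_Z_family p(1)])
  have ive: "integrable M (\<lambda>\<omega>. v \<omega> * iexp (Re (Z g \<omega>)))" for g
    by (rule Bochner_Integration.integrable_bound[OF v]) (auto simp: norm_mult)
  have icve: "integrable M (\<lambda>\<omega>. cnj (v \<omega>) * iexp (Re (Z g \<omega>)))" for g
    by (rule Bochner_Integration.integrable_bound[OF v]) (auto simp: norm_mult)
  have zero': "(\<integral>\<omega>. cnj (v \<omega>) * iexp (Re (Z g \<omega>)) \<partial>M) = 0" for g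
  proof -
    have "AE \<omega> in M. cnj (v \<omega>) * iexp (Re (Z g \<omega>)) = cnj (v \<omega> * iexp (Re (Z (cscale (-1) g) \<omega>)))"
      using Z_cscale[of "-1" g] by eventually_elim (simp add: exp_cnj)
    then have "(\<integral>\<omega>. cnj (v \<omega>) * iexp (Re (Z g \<omega>)) \<partial>M) = (\<integral>\<omega>. cnj (v \<omega> * iexp (Re (Z (cscale (-1) g) \<omega>))) \<partial>M)"
      by (intro integral_cong_AE) auto
    also have "\<dots> = cnj (\<integral>\<omega>. v \<omega> * iexp (Re (Z (cscale (-1) g) \<omega>)) \<partial>M)"
      by (rule Bochner_Integration.integral_cnj)
    finally show ?thesis unfolding zero by simp
  qed
  have R: "(\<integral>\<omega>. Re (v \<omega>) *\<^sub>R iexp (Re (Z g \<omega>)) \<partial>M) = 0" for g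
  proof -
    have "(\<integral>\<omega>. Re (v \<omega>) *\<^sub>R iexp (Re (Z g \<omega>)) \<partial>M) = (\<integral>\<omega>. (1/2) * (v \<omega> * iexp (Re (Z g \<omega>)) + cnj (v \<omega>) * iexp (Re (Z g \<omega>))) \<partial>M)"
      by (intro Bochner_Integration.integral_cong refl) (simp add: distrib_right[symmetric] complex_add_cnj scaleR_conv_of_real)
    then show ?thesis
      by (simp only: integral_mult_right_zero Bochner_Integration.integral_add[OF ive icve] zero zero') simp
  qed
  have I: "(\<integral>\<omega>. Im (v \<omega>) *\<^sub>R iexp (Re (Z g \<omega>)) \<partial>M) = 0" for g
  proof -
    have "(\<integral>\<omega>. Im (v \<omega>) *\<^sub>R iexp (Re (Z g \<omega>)) \<partial>M) = (\<integral>\<omega>. (-\<i>/2) * (v \<omega> * iexp (Re (Z g \<omega>)) - cnj (v \<omega>) * iexp (Re (Z g \<omega>))) \<partial>M)"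
      by (intro Bochner_Integration.integral_cong refl) (simp add: complex_eq_iff field_simps)
    then show ?thesis
      by (simp only: integral_mult_right_zero Bochner_Integration.integral_diff[OF ive icve] zero zero') simp
  qed
  have iR: "integrable M (\<lambda>\<omega>. Re (v \<omega>) *\<^sub>R p (\<lambda>i. Z (\<phi> i) \<omega>))"
    by (rule Bochner_Integration.integrable_bound[OF vp]) (auto intro!: AE_I2 mult_right_mono abs_Re_le_cmod simp: norm_mult)
  have iI: "integrable M (\<lambda>\<omega>. Im (v \<omega>) *\<^sub>R p (\<lambda>i. Z (\<phi> i) \<omega>))"
    by (rule Bochner_Integration.integrable_bound[OF vp]) (auto intro!: AE_I2 mult_right_mono abs_Im_le_cmod simp: norm_mult)
  have "(\<integral>\<omega>. v \<omega> * p (\<lambda>i. Z (\<phi> i) \<omega>) \<partial>M) = (\<integral>\<omega>. Re (v \<omega>) *\<^sub>R p (\<lambda>i. Z (\<phi> i) \<omega>) + \<i> * (Im (v \<omega>) *\<^sub>R p (\<lambda>i. Z (\<phi> i) \<omega>)) \<partial>M)"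
    by (intro Bochner_Integration.integral_cong refl) (simp add: complex_eq_iff)
  also have "\<dots> = (\<integral>\<omega>. Re (v \<omega>) *\<^sub>R p (\<lambda>i. Z (\<phi> i) \<omega>) \<partial>M) + \<i> * (\<integral>\<omega>. Im (v \<omega>) *\<^sub>R p (\<lambda>i. Z (\<phi> i) \<omega>) \<partial>M)"
    by (simp only: Bochner_Integration.integral_add[OF iR integrable_mult_right[OF iI]] integral_mult_right_zero)
  also have "\<dots> = 0"
    using exponentials_total_real[where k = k, OF integrable_Re[OF v] R p iR] exponentials_total_real[where k = k, OF integrable_Im[OF v] I p iI] by simp
  finally show ?thesis .
qed

lemma smooth_wirtinger_dep:
  assumes f: "smooth_polynomial_growth k f" and j: "j < k" and eq: "\<And>i. i < k \<Longrightarrow> z i = w i"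
  shows "wirtinger_deriv j f z = wirtinger_deriv j f w"
proof -
  have "partial_deriv (j, v) f z = partial_deriv (j, v) f w" for v
  proof -
    have "f (z(j := z j + of_real t * v)) = f (w(j := w j + of_real t * v))" for t :: real
      by (rule smooth_polynomial_growth_dep[OF f]) (simp add: eq j)
    then show ?thesis by (simp add: partial_deriv_def)
  qed
  then show ?thesis by (simp add: wirtinger_deriv_def)
qed

lemma square_integrable_cinner:
  assumes "square_integrable M u" shows "square_integrable M (\<lambda>\<omega>. cinner (u \<omega>) h)"
proof -
  have [measurable]: "u \<in> borel_measurable M" using assms by (simp add: square_integrable_def)
  have m: "(\<lambda>\<omega>. cinner (u \<omega>) h) \<in> borel_measurable M"
    by (rule measurable_compose[OF _ borel_measurable_continuous_onI[OF bounded_bilinear.continuous_on[OF bounded_bilinear_cinner continuous_on_id continuous_on_const]]]) simp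
  have "integrable M (\<lambda>\<omega>. (norm (cinner (u \<omega>) h))\<^sup>2)"
  proof (rule Bochner_Integration.integrable_bound)
    show "integrable M (\<lambda>\<omega>. (norm h)\<^sup>2 * (norm (u \<omega>))\<^sup>2)" using assms by (simp add: square_integrable_def)
    have "(norm (cinner (u \<omega>) h))\<^sup>2 \<le> (norm h)\<^sup>2 * (norm (u \<omega>))\<^sup>2" for \<omega>
      using power_mono[OF cmod_cinner_le[of "u \<omega>" h], of 2] by (simp add: power_mult_distrib mult.commute)
    then show "AE \<omega> in M. norm ((norm (cinner (u \<omega>) h))\<^sup>2) \<le> norm ((norm h)\<^sup>2 * (norm (u \<omega>))\<^sup>2)" by auto
  qed (use m in simp)
  then show ?thesis using m by (simp add: square_integrable_def)
qed

text \<open>Any derivative is an L2-limit of functionals of \<open>Z\<close>, so a function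
  orthogonal to all exponentials is orthogonal to its components, even when \<open>M\<close> carries
  events outside the sigma-algebra of \<open>Z\<close>.\<close>

lemma malliavin_orthogonal:
  assumes v: "square_integrable M v" and zero: "\<And>g. (\<integral>\<omega>. v \<omega> * iexp (Re (Z g \<omega>)) \<partial>M) = 0"
    and u: "is_malliavin_deriv M Z F u"
  shows "(\<integral>\<omega>. v \<omega> * cnj (cinner (u \<omega>) h) \<partial>M) = 0"
proof -
  obtain X U where sm: "\<And>N. smooth_malliavin Z (X N) (U N)" and U: "L2_converges M U u"
    using u unfolding is_malliavin_deriv_def by blast
  have bb: "bounded_bilinear (\<lambda>x y. x * cnj (cinner y h))"
    by (rule bounded_bilinear.comp[OF bounded_bilinear_mult bounded_linear_ident
        bounded_linear_compose[OF bounded_linear_cnj bounded_bilinear.bounded_linear_left[OF bounded_bilinear_cinner]]])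
  have "integrable M (\<lambda>\<omega>. norm (v \<omega>) * norm (1::complex))"
    by (rule square_integrable_norm_mult(1)[OF v square_integrable_bounded[where C = 1]]) simp_all
  then have iv: "integrable M v" using v by (simp add: square_integrable_def integrable_norm_iff)
  have "(\<integral>\<omega>. v \<omega> * cnj (cinner (U N \<omega>) h) \<partial>M) = 0" for N
  proof -
    obtain k \<phi> f where f: "smooth_polynomial_growth k f"
      and UN: "U N = (\<lambda>\<omega>. \<Sum>i<k. cscale (wirtinger_deriv i f (\<lambda>i. Z (\<phi> i) \<omega>)) (\<phi> i))"
      using sm[of N] unfolding smooth_malliavin_def by blast
    define p where "p z = cnj (\<Sum>i<k. wirtinger_deriv i f z * cinner (\<phi> i) h)" for z
    have pU: "p (\<lambda>i. Z (\<phi> i) \<omega>) = cnj (cinner (U N \<omega>) h)" for \<omega>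
      by (simp add: p_def UN cinner_sum_left)
    have "continuous_on UNIV p"
      unfolding p_def by (intro continuous_intros smooth_wirtinger_continuous[OF f]) simp
    then have pm: "p \<in> borel_measurable borel" by (rule borel_measurable_continuous_onI)
    have dep: "p z = p w" if "\<And>i. i < k \<Longrightarrow> z i = w i" for z w
    proof -
      have "wirtinger_deriv i f z = wirtinger_deriv i f w" if "i < k" for i
        by (rule smooth_wirtinger_dep[OF f that]) fact
      then show ?thesis unfolding p_def by (intro arg_cong[where f = cnj] sum.cong) auto
    qed
    have sU: "square_integrable M (U N)" using U by (simp add: L2_converges_def)
    have ivU: "integrable M (\<lambda>\<omega>. v \<omega> * p (\<lambda>i. Z (\<phi> i) \<omega>))"
      unfolding pU
    proof (rule Bochner_Integration.integrable_bound[OF square_integrable_norm_mult(1)[OF v square_integrable_cinner[OF sU, of h]]])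
      show "(\<lambda>\<omega>. v \<omega> * cnj (cinner (U N \<omega>) h)) \<in> borel_measurable M"
        using v square_integrable_cinner[OF sU, of h] by (auto simp: square_integrable_def)
    qed (simp add: norm_mult)
    show ?thesis
      using exponentials_total[OF iv zero pm dep ivU] unfolding pU .
  qed
  then show ?thesis
    using L2_converges_integral_prod[OF bb L2_converges_const[OF v] U] by (simp add: LIMSEQ_const_iff)
qed

text \<open>The component v of the difference along a basis vector is orthogonal to all exponentials
  by \<open>malliavin_test\<close>, hence to the components of both derivatives by
  \<open>malliavin_orthogonal\<close>, hence to itself. Countability of the basis collects the
  exceptional sets.\<close>

theorem malliavin_deriv_unique:
  fixes e :: "nat \<Rightarrow> 'h cplx"
  assumes B: "orthonormal_basis K e" and u: "is_malliavin_deriv M Z F u" and u': "is_malliavin_deriv M Z F u'"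
  shows "AE \<omega> in M. u \<omega> = u' \<omega>"
proof -
  have su: "square_integrable M u" "square_integrable M u'"
    using u u' by (auto simp: is_malliavin_deriv_def L2_converges_def)
  have sd: "square_integrable M (\<lambda>\<omega>. u \<omega> - u' \<omega>)" by (rule square_integrable_diff[OF su])
  have "AE \<omega> in M. cinner (u \<omega> - u' \<omega>) (e k) = 0" if k: "k \<in> K" for k
  proof -
    let ?h = "e k"
    have unit: "norm ?h = 1" by (rule orthonormal_family_norm[OF orthonormal_basis_family[OF B] k])
    define v where "v \<omega> = cinner (u \<omega> - u' \<omega>) ?h" for \<omega>
    have sv: "square_integrable M v" unfolding v_def by (rule square_integrable_cinner[OF sd])
    have ic: "integrable M (\<lambda>\<omega>. cinner (w \<omega>) ?h * y \<omega>)"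
      if "square_integrable M w" "square_integrable M y" for w and y :: "'w \<Rightarrow> complex"
    proof (rule Bochner_Integration.integrable_bound[OF square_integrable_norm_mult(1)[OF square_integrable_cinner[OF that(1), of ?h] that(2)]])
      show "(\<lambda>\<omega>. cinner (w \<omega>) ?h * y \<omega>) \<in> borel_measurable M"
        using that(2) square_integrable_cinner[OF that(1), of ?h] by (auto simp: square_integrable_def)
    qed (simp add: norm_mult)
    have zero: "(\<integral>\<omega>. v \<omega> * iexp (Re (Z g \<omega>)) \<partial>M) = 0" for g
    proof -
      have sE: "square_integrable M (\<lambda>\<omega>. iexp (Re (Z g \<omega>)))"
        by (rule square_integrable_bounded[where C = 1]) simp_all
      have "(\<integral>\<omega>. v \<omega> * iexp (Re (Z g \<omega>)) \<partial>M)
          = (\<integral>\<omega>. cinner (u \<omega>) ?h * iexp (Re (Z g \<omega>)) - cinner (u' \<omega>) ?h * iexp (Re (Z g \<omega>)) \<partial>M)"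
        by (simp add: v_def cinner_diff_left left_diff_distrib)
      also have "\<dots> = (\<integral>\<omega>. cinner (u \<omega>) ?h * iexp (Re (Z g \<omega>)) \<partial>M) - (\<integral>\<omega>. cinner (u' \<omega>) ?h * iexp (Re (Z g \<omega>)) \<partial>M)"
        by (rule Bochner_Integration.integral_diff[OF ic[OF su(1) sE] ic[OF su(2) sE]])
      also have "\<dots> = 0" unfolding malliavin_test[OF u unit] malliavin_test[OF u' unit] by simp
      finally show ?thesis .
    qed
    have svc: "square_integrable M (\<lambda>\<omega>. cnj (v \<omega>))"
      using sv borel_measurable_cnj[of v M] by (simp add: square_integrable_def)
    have cc: "cinner (w \<omega>) ?h * cnj (v \<omega>) = cnj (v \<omega> * cnj (cinner (w \<omega>) ?h))" for w \<omega>
      by (simp add: mult.commute)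
    have "complex_of_real (\<integral>\<omega>. (cmod (v \<omega>))\<^sup>2 \<partial>M) = (\<integral>\<omega>. v \<omega> * cnj (v \<omega>) \<partial>M)"
      unfolding integral_complex_of_real[symmetric] complex_norm_square ..
    also have "\<dots> = (\<integral>\<omega>. cinner (u \<omega>) ?h * cnj (v \<omega>) - cinner (u' \<omega>) ?h * cnj (v \<omega>) \<partial>M)"
      by (intro Bochner_Integration.integral_cong refl) (simp add: v_def cinner_diff_left left_diff_distrib)
    also have "\<dots> = (\<integral>\<omega>. cinner (u \<omega>) ?h * cnj (v \<omega>) \<partial>M) - (\<integral>\<omega>. cinner (u' \<omega>) ?h * cnj (v \<omega>) \<partial>M)"
      by (rule Bochner_Integration.integral_diff[OF ic[OF su(1) svc] ic[OF su(2) svc]])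
    also have "\<dots> = 0"
      unfolding cc Bochner_Integration.integral_cnj malliavin_orthogonal[OF sv zero u] malliavin_orthogonal[OF sv zero u'] by simp
    finally have "(\<integral>\<omega>. (cmod (v \<omega>))\<^sup>2 \<partial>M) = 0" by (simp only: of_real_eq_0_iff)
    then have "AE \<omega> in M. (cmod (v \<omega>))\<^sup>2 = 0"
      using sv by (subst (asm) integral_nonneg_eq_0_iff_AE) (auto simp: square_integrable_def)
    then show ?thesis by (simp add: v_def)
  qed
  then have "AE \<omega> in M. \<forall>k\<in>K. cinner (u \<omega> - u' \<omega>) (e k) = 0"
    by (simp add: AE_ball_countable)
  then show ?thesis
    by eventually_elim (use orthonormal_basis_ext[OF B] in \<open>metis right_minus_eq\<close>)
qed

end

section \<open>Complex Hermite polynomials\<close>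

text \<open>A single pair (a, b) encodes all real directions of coordinate j: these are the
  derivatives in z and in its conjugate, and conjugating the function swaps and conjugates
  them.\<close>

definition has_wirtinger ::
  "nat \<Rightarrow> ((nat \<Rightarrow> complex) \<Rightarrow> complex) \<Rightarrow> ((nat \<Rightarrow> complex) \<Rightarrow> complex) \<Rightarrow> ((nat \<Rightarrow> complex) \<Rightarrow> complex) \<Rightarrow> bool" where
  "has_wirtinger j f a b \<longleftrightarrow>
     (\<forall>z v. ((\<lambda>t::real. f (z(j := z j + of_real t * v))) has_vector_derivative v * a z + cnj v * b z) (at 0))"

text \<open>The derivative with respect to the conjugate of \<open>z j\<close>; it enters through
  the Gaussian adjoint of \<open>wirtinger_deriv j\<close>, which is multiplication by
  \<open>z j\<close> minus this operator.\<close>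

definition wirtinger_bar :: "nat \<Rightarrow> ((nat \<Rightarrow> complex) \<Rightarrow> complex) \<Rightarrow> (nat \<Rightarrow> complex) \<Rightarrow> complex" where
  "wirtinger_bar j f z = (partial_deriv (j, 1) f z + \<i> * partial_deriv (j, \<i>) f z) / 2"

lemma has_wirtinger_partial:
  "has_wirtinger j f a b \<Longrightarrow> partial_deriv (j, v) f = (\<lambda>z. v * a z + cnj v * b z)"
  unfolding has_wirtinger_def partial_deriv_def by (auto intro!: ext vector_derivative_at)

lemma has_wirtinger_eq:
  assumes "has_wirtinger j f a b"
  shows "wirtinger_deriv j f = a" "wirtinger_bar j f = b"
  unfolding wirtinger_deriv_def [abs_def] wirtinger_bar_def [abs_def] has_wirtinger_partial[OF assms]
  by (auto simp: fun_eq_iff field_simps)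

lemma has_wirtinger_cong:
  assumes "has_wirtinger j f a b" "\<And>z. f z = f' z" "\<And>z. a z = a' z" "\<And>z. b z = b' z"
  shows "has_wirtinger j f' a' b'"
  using assms by (simp add: has_wirtinger_def)

lemma has_wirtinger_const: "has_wirtinger j (\<lambda>_. c) (\<lambda>_. 0) (\<lambda>_. 0)"
  by (simp add: has_wirtinger_def)

lemma has_wirtinger_var: "has_wirtinger j (\<lambda>z. z k) (\<lambda>_. of_bool (k = j)) (\<lambda>_. 0)"
proof -
  have "((\<lambda>t::real. z j + of_real t * v) has_vector_derivative v) (at 0)" for z :: "nat \<Rightarrow> complex" and v
    by (auto intro!: derivative_eq_intros has_vector_derivative_real_field)
  then show ?thesis by (auto simp: has_wirtinger_def)
qed

lemma has_wirtinger_cnj: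
  assumes "has_wirtinger j f a b"
  shows "has_wirtinger j (\<lambda>z. cnj (f z)) (\<lambda>z. cnj (b z)) (\<lambda>z. cnj (a z))"
  unfolding has_wirtinger_def
proof (intro allI)
  fix z v
  have "((\<lambda>t::real. cnj (f (z(j := z j + of_real t * v)))) has_vector_derivative cnj (v * a z + cnj v * b z)) (at 0)"
    using assms by (intro has_vector_derivative_cnj) (simp add: has_wirtinger_def)
  then show "((\<lambda>t::real. cnj (f (z(j := z j + of_real t * v)))) has_vector_derivative v * cnj (b z) + cnj v * cnj (a z)) (at 0)"
    by (simp add: add.commute)
qed

lemma has_wirtinger_add:
  assumes "has_wirtinger j f a b" "has_wirtinger j g c d"
  shows "has_wirtinger j (\<lambda>z. f z + g z) (\<lambda>z. a z + c z) (\<lambda>z. b z + d z)"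
  unfolding has_wirtinger_def
proof (intro allI)
  fix z v
  have "((\<lambda>t::real. f (z(j := z j + of_real t * v)) + g (z(j := z j + of_real t * v))) has_vector_derivative
      (v * a z + cnj v * b z) + (v * c z + cnj v * d z)) (at 0)"
    using assms by (intro has_vector_derivative_add) (simp_all add: has_wirtinger_def)
  then show "((\<lambda>t::real. f (z(j := z j + of_real t * v)) + g (z(j := z j + of_real t * v))) has_vector_derivative
      v * (a z + c z) + cnj v * (b z + d z)) (at 0)"
    by (simp add: algebra_simps)
qed

lemma has_wirtinger_mult:
  assumes "has_wirtinger j f a b" "has_wirtinger j g c d"
  shows "has_wirtinger j (\<lambda>z. f z * g z) (\<lambda>z. a z * g z + f z * c z) (\<lambda>z. b z * g z + f z * d z)"
  unfolding has_wirtinger_def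
proof (intro allI)
  fix z v
  have "((\<lambda>t::real. f (z(j := z j + of_real t * v)) * g (z(j := z j + of_real t * v))) has_vector_derivative
      f (z(j := z j + of_real 0 * v)) * (v * c z + cnj v * d z) + (v * a z + cnj v * b z) * g (z(j := z j + of_real 0 * v))) (at 0)"
    using assms by (intro has_vector_derivative_mult) (simp_all add: has_wirtinger_def)
  then show "((\<lambda>t::real. f (z(j := z j + of_real t * v)) * g (z(j := z j + of_real t * v))) has_vector_derivative
      v * (a z * g z + f z * c z) + cnj v * (b z * g z + f z * d z)) (at 0)"
    by (simp add: algebra_simps)
qed

lemma has_wirtinger_indep:
  assumes "\<And>z x. f (z(j := x)) = f z"
  shows "has_wirtinger j f (\<lambda>_. 0) (\<lambda>_. 0)"
  using assms by (simp add: has_wirtinger_def)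

text \<open>Polynomials in the coordinates and their conjugates, given by closure rules so that
  derivatives, growth and smoothness follow by induction; S lists the coordinates that may
  occur.\<close>

inductive_set cpoly :: "nat set \<Rightarrow> ((nat \<Rightarrow> complex) \<Rightarrow> complex) set" for S where
  const: "(\<lambda>_. c) \<in> cpoly S"
| var: "k \<in> S \<Longrightarrow> (\<lambda>z. z k) \<in> cpoly S"
| cvar: "k \<in> S \<Longrightarrow> (\<lambda>z. cnj (z k)) \<in> cpoly S"
| add: "p \<in> cpoly S \<Longrightarrow> q \<in> cpoly S \<Longrightarrow> (\<lambda>z. p z + q z) \<in> cpoly S"
| mult: "p \<in> cpoly S \<Longrightarrow> q \<in> cpoly S \<Longrightarrow> (\<lambda>z. p z * q z) \<in> cpoly S"

lemma cpoly_cnj: "p \<in> cpoly S \<Longrightarrow> (\<lambda>z. cnj (p z)) \<in> cpoly S"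
  by (induction rule: cpoly.induct) (auto intro: cpoly.intros)

lemma cpoly_scale: "p \<in> cpoly S \<Longrightarrow> (\<lambda>z. c * p z) \<in> cpoly S"
  by (intro cpoly.mult cpoly.const)

lemma cpoly_sum: "(\<And>i. i \<in> I \<Longrightarrow> p i \<in> cpoly S) \<Longrightarrow> (\<lambda>z. \<Sum>i\<in>I. p i z) \<in> cpoly S"
  by (induction I rule: infinite_finite_induct) (auto intro: cpoly.add cpoly.const)

lemma cpoly_prod: "(\<And>i. i \<in> I \<Longrightarrow> p i \<in> cpoly S) \<Longrightarrow> (\<lambda>z. \<Prod>i\<in>I. p i z) \<in> cpoly S"
  by (induction I rule: infinite_finite_induct) (auto intro: cpoly.mult cpoly.const)

lemma cpoly_power: "p \<in> cpoly S \<Longrightarrow> (\<lambda>z. p z ^ n) \<in> cpoly S"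
  by (induction n) (auto intro: cpoly.mult cpoly.const)

lemma cpoly_mono: "p \<in> cpoly S \<Longrightarrow> S \<subseteq> T \<Longrightarrow> p \<in> cpoly T"
  by (induction rule: cpoly.induct) (auto intro: cpoly.intros)

lemma cpoly_has_wirtinger_ex:
  assumes "p \<in> cpoly S"
  shows "\<exists>a\<in>cpoly S. \<exists>b\<in>cpoly S. has_wirtinger j p a b"
  using assms
proof (induction rule: cpoly.induct)
  case (const c)
  show ?case
    by (rule bexI[where x = "\<lambda>_. 0"], rule bexI[where x = "\<lambda>_. 0"], rule has_wirtinger_const) (rule cpoly.const)+
next
  case (var k)
  show ?case
    by (rule bexI[where x = "\<lambda>_. of_bool (k = j)"], rule bexI[where x = "\<lambda>_. 0"], rule has_wirtinger_var) (rule cpoly.const)+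
next
  case (cvar k)
  show ?case
    by (rule bexI[where x = "\<lambda>_. cnj 0"], rule bexI[where x = "\<lambda>_. cnj (of_bool (k = j))"],
        rule has_wirtinger_cnj[OF has_wirtinger_var]) (rule cpoly.const)+
next
  case (add p q)
  then show ?case using has_wirtinger_add cpoly.add by meson
next
  case (mult p q)
  then obtain a b c d where *: "a \<in> cpoly S" "b \<in> cpoly S" "has_wirtinger j p a b"
    "c \<in> cpoly S" "d \<in> cpoly S" "has_wirtinger j q c d" by blast
  show ?case
    by (rule bexI[where x = "\<lambda>z. a z * q z + p z * c z"], rule bexI[where x = "\<lambda>z. b z * q z + p z * d z"],
        rule has_wirtinger_mult[OF *(3,6)]) (intro cpoly.add cpoly.mult *(1,2,4,5) mult.hyps)+
qed

lemma cpoly_has_wirtinger: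
  assumes "p \<in> cpoly S"
  shows "has_wirtinger j p (wirtinger_deriv j p) (wirtinger_bar j p)"
    "wirtinger_deriv j p \<in> cpoly S" "wirtinger_bar j p \<in> cpoly S"
  using cpoly_has_wirtinger_ex[OF assms, of j] has_wirtinger_eq by metis+

lemma cpoly_continuous: "p \<in> cpoly S \<Longrightarrow> continuous_on UNIV p"
  by (induction rule: cpoly.induct) (auto intro!: continuous_intros continuous_on_product_coordinates)

lemma cpoly_dep: "p \<in> cpoly S \<Longrightarrow> (\<And>i. i \<in> S \<Longrightarrow> z i = w i) \<Longrightarrow> p z = p w"
  by (induction rule: cpoly.induct) auto

lemma cpoly_wirtinger_0:
  assumes "p \<in> cpoly S" "j \<notin> S" shows "wirtinger_deriv j p = (\<lambda>_. 0)" "wirtinger_bar j p = (\<lambda>_. 0)"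
proof -
  have "has_wirtinger j p (\<lambda>_. 0) (\<lambda>_. 0)"
    by (rule has_wirtinger_indep, rule cpoly_dep[OF assms(1)]) (use assms(2) in auto)
  from has_wirtinger_eq[OF this] show "wirtinger_deriv j p = (\<lambda>_. 0)" "wirtinger_bar j p = (\<lambda>_. 0)" .
qed

lemma poly_growth_coord: "j < k \<Longrightarrow> poly_growth k (\<lambda>z. z j)"
proof (rule poly_growthI[of _ 1 _ 1])
  fix z :: "nat \<Rightarrow> complex" assume "j < k"
  then have "cmod (z j) \<le> (\<Sum>i<k. cmod (z i))" by (intro member_le_sum) auto
  then show "cmod (z j) \<le> 1 * (1 + (\<Sum>i<k. cmod (z i))) ^ 1" by simp
qed

lemma cpoly_poly_growth: "p \<in> cpoly S \<Longrightarrow> S \<subseteq> {..<k} \<Longrightarrow> poly_growth k p"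
proof (induction rule: cpoly.induct)
  case (cvar j)
  show ?case by (rule poly_growth_bound[OF poly_growth_coord[of j]]) (use cvar in auto)
qed (auto intro: poly_growth_const poly_growth_add poly_growth_mult poly_growth_coord)

lemma cpoly_partial: "p \<in> cpoly S \<Longrightarrow> partial_deriv (j, v) p \<in> cpoly S"
  unfolding has_wirtinger_partial[OF cpoly_has_wirtinger(1)]
  by (intro cpoly.add cpoly_scale cpoly_has_wirtinger(2,3))

text \<open>The class is closed under partial derivatives, so one continuity and growth argument
  covers all iterated ones.\<close>

lemma cpoly_smooth:
  assumes p: "p \<in> cpoly S" and S: "S \<subseteq> {..<k}"
  shows "smooth_polynomial_growth k p"
  unfolding smooth_polynomial_growth_def Let_def
proof (intro conjI allI impI)
  fix z w :: "nat \<Rightarrow> complex" assume "\<forall>i<k. z i = w i"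
  then show "p z = p w" using S by (intro cpoly_dep[OF p]) auto
next
  fix ds :: "(nat \<times> complex) list"
  have fp: "fold partial_deriv ds p \<in> cpoly S"
    using p by (induction ds arbitrary: p) (auto simp: cpoly_partial)
  have "((\<lambda>t::real. fold partial_deriv ds p (z(j := z j + of_real t * v))) differentiable at 0)" for z j v
    using cpoly_has_wirtinger(1)[OF fp, of j] unfolding has_wirtinger_def
    by (blast intro: differentiableI_vector)
  then show "\<forall>v\<in>{1, \<i>}. (\<lambda>t::real. fold partial_deriv ds p (z(j := z j + of_real t * v))) differentiable at 0" for z j
    by blast
  show "continuous_on UNIV (fold partial_deriv ds p)" by (rule cpoly_continuous[OF fp])
  show "\<exists>C q. \<forall>z. cmod (fold partial_deriv ds p z) \<le> C * (1 + (\<Sum>i<k. cmod (z i))) ^ q"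
    using cpoly_poly_growth[OF fp S] by (simp add: poly_growth_def)
qed

section \<open>Hermite polynomials of one variable and their products\<close>

definition hermite1 :: "nat \<Rightarrow> nat \<Rightarrow> complex \<Rightarrow> complex" where
  "hermite1 a b z = complex_hermite a b z 1"

text \<open>Binomials vanish beyond the minimum, so any upper limit that is at least a will do; a
  common range lets sums for different degrees be combined.\<close>

lemma hermite1_sum:
  assumes "a \<le> n"
  shows "hermite1 a b z = (\<Sum>r\<le>n. (-1) ^ r * fact r * of_nat (a choose r) * of_nat (b choose r) * z ^ (a - r) * cnj z ^ (b - r))"
proof -
  have "hermite1 a b z = (\<Sum>r\<in>{0..min a b}. (-1) ^ r * fact r * of_nat (a choose r) * of_nat (b choose r) * z ^ (a - r) * cnj z ^ (b - r))"
    by (simp add: hermite1_def complex_hermite_def)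
  also have "\<dots> = (\<Sum>r\<le>n. (-1) ^ r * fact r * of_nat (a choose r) * of_nat (b choose r) * z ^ (a - r) * cnj z ^ (b - r))"
    using assms by (intro sum.mono_neutral_left) (auto simp: binomial_eq_0)
  finally show ?thesis .
qed

lemma hermite1_0_0 [simp]: "hermite1 0 0 z = 1"
  by (simp add: hermite1_def complex_hermite_def)

lemma hermite1_cnj: "cnj (hermite1 a b z) = hermite1 b a z"
  unfolding hermite1_def complex_hermite_def
  by (simp add: min.commute mult_ac)

text \<open>The powers of \<open>sqrt 2\<close> and of 2 in the r-th term multiply to
  \<open>2 powr (real (a + b) / 2)\<close> for every r, so the normalisation in
  \<open>basis_integral\<close> is the passage from parameter 2 to parameter 1.\<close>

lemma hermite1_rescale:
  "of_real (2 powr (- real (a + b) / 2)) * complex_hermite a b (of_real (sqrt 2) * z) 2 = hermite1 a b z"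
proof -
  have "of_real (2 powr (- real (a + b) / 2)) * ((of_real (sqrt 2) * z) ^ (a - r) * cnj (of_real (sqrt 2) * z) ^ (b - r) * of_real 2 ^ r)
      = z ^ (a - r) * cnj z ^ (b - r)" if "r \<le> min a b" for r
  proof -
    have "complex_of_real (2 powr (- real (a + b) / 2)) * (of_real (sqrt 2) ^ (a - r) * of_real (sqrt 2) ^ (b - r) * of_real 2 ^ r) = of_real 1"
      unfolding of_real_power[symmetric] of_real_mult[symmetric] of_real_eq_iff
    proof -
      have "sqrt 2 ^ (a - r) * sqrt 2 ^ (b - r) * 2 ^ r = 2 powr (real (a - r) / 2) * 2 powr (real (b - r) / 2) * 2 powr real r"
        by (simp add: powr_realpow[symmetric] powr_half_sqrt[symmetric] powr_powr)
      also have "\<dots> = 2 powr (real (a + b) / 2)"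
        unfolding powr_add[symmetric] using that by (intro arg_cong[where f = "\<lambda>x. 2 powr x"]) (simp add: of_nat_diff field_simps)
      finally show "2 powr (- real (a + b) / 2) * (sqrt 2 ^ (a - r) * sqrt 2 ^ (b - r) * 2 ^ r) = 1"
        by (simp add: powr_add[symmetric] add_divide_distrib diff_divide_distrib)
    qed
    then show ?thesis by (simp add: power_mult_distrib mult_ac)
  qed
  then show ?thesis
    unfolding hermite1_def complex_hermite_def sum_distrib_left
    by (intro sum.cong refl) (simp add: mult_ac)
qed

text \<open>Pascal's rule in a, together with the absorption of r + 1 into the binomial of b, which
  lowers b by one. At b = 0 the factor \<open>of_nat b\<close> neutralises the truncated
  \<open>b - 1\<close>.\<close>

lemma hermite1_Suc: "hermite1 (Suc a) b z = z * hermite1 a b z - of_nat b * hermite1 a (b - 1) z"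
proof -
  let ?t = "\<lambda>a b r. (-1) ^ r * fact r * of_nat (a choose r) * of_nat (b choose r) * z ^ (a - r) * cnj z ^ (b - r) :: complex"
  have e: "?t (Suc a) b (Suc r) = z * ?t a b (Suc r) - of_nat b * ?t a (b - 1) r" if "r \<le> a" for r
  proof -
    \<comment> \<open>At r = a the truncated exponent is wrong, but the binomial on both sides
      vanishes.\<close>
    have z: "of_nat (a choose Suc r) * z ^ (a - r) = of_nat (a choose Suc r) * (z * z ^ (a - Suc r))"
      by (cases "r < a") (auto simp: binomial_eq_0 Suc_diff_Suc power_Suc[symmetric] simp del: power_Suc)
    have b: "of_nat (Suc r) * of_nat (b choose Suc r) = (of_nat b * of_nat ((b - 1) choose r) :: complex)"
      unfolding of_nat_mult[symmetric] of_nat_eq_iff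
      by (cases b) (simp_all only: Suc_times_binomial diff_Suc_1 binomial_0_Suc mult_zero_left mult_zero_right)
    have "?t (Suc a) b (Suc r) = - ((-1) ^ r * fact r * (of_nat (Suc r) * of_nat (b choose Suc r)) * (of_nat (a choose r) + of_nat (a choose Suc r)) * z ^ (a - r) * cnj z ^ (b - Suc r))"
      by (simp add: mult_ac del: of_nat_Suc)
    also have "\<dots> = - ((-1) ^ r * fact r * (of_nat b * of_nat ((b - 1) choose r)) * of_nat (a choose r) * z ^ (a - r) * cnj z ^ (b - Suc r))
       - ((-1) ^ r * fact r * (of_nat (Suc r) * of_nat (b choose Suc r)) * (of_nat (a choose Suc r) * z ^ (a - r)) * cnj z ^ (b - Suc r))"
      unfolding b[symmetric] by (simp add: algebra_simps del: of_nat_Suc)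
    also have "\<dots> = z * ?t a b (Suc r) - of_nat b * ?t a (b - 1) r"
      unfolding z by (simp add: mult_ac del: of_nat_Suc)
    finally show ?thesis .
  qed
  have "hermite1 (Suc a) b z = ?t (Suc a) b 0 + (\<Sum>r\<le>a. ?t (Suc a) b (Suc r))"
    unfolding hermite1_sum[OF order_refl] by (rule sum.atMost_Suc_shift)
  also have "\<dots> = z * ?t a b 0 + (\<Sum>r\<le>a. z * ?t a b (Suc r) - of_nat b * ?t a (b - 1) r)"
    by (intro arg_cong2[where f = "(+)"] sum.cong refl e) simp_all
  also have "\<dots> = z * (?t a b 0 + (\<Sum>r\<le>a. ?t a b (Suc r))) - of_nat b * (\<Sum>r\<le>a. ?t a (b - 1) r)"
    by (simp add: sum_subtractf sum_distrib_left distrib_left)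
  also have "?t a b 0 + (\<Sum>r\<le>a. ?t a b (Suc r)) = (\<Sum>r\<le>Suc a. ?t a b r)"
    by (rule sum.atMost_Suc_shift[symmetric])
  also have "\<dots> = hermite1 a b z" by (rule hermite1_sum[symmetric]) simp
  also have "(\<Sum>r\<le>a. ?t a (b - 1) r) = hermite1 a (b - 1) z" by (rule hermite1_sum[symmetric]) simp
  finally show ?thesis .
qed

lemma hermite1_cpoly: "k \<in> S \<Longrightarrow> (\<lambda>z. hermite1 a b (z k)) \<in> cpoly S"
  unfolding hermite1_def complex_hermite_def
  by (intro cpoly_sum cpoly.mult cpoly_power cpoly.var cpoly.cvar cpoly.const) auto

lemma has_wirtinger_var_power:
  "has_wirtinger j (\<lambda>z. z j ^ n) (\<lambda>z. of_nat n * z j ^ (n - 1)) (\<lambda>_. 0)"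
proof (induction n)
  case 0
  show ?case using has_wirtinger_const[of j 1] by simp
next
  case (Suc n)
  show ?case
  proof (cases n)
    case 0
    then show ?thesis using has_wirtinger_var[of j j] by simp
  next
    case (Suc m)
    then show ?thesis using has_wirtinger_mult[OF has_wirtinger_var[of j j] Suc.IH] by (simp add: algebra_simps)
  qed
qed

lemma has_wirtinger_sum:
  assumes "\<And>i. i \<in> I \<Longrightarrow> has_wirtinger j (f i) (a i) (b i)"
  shows "has_wirtinger j (\<lambda>z. \<Sum>i\<in>I. f i z) (\<lambda>z. \<Sum>i\<in>I. a i z) (\<lambda>z. \<Sum>i\<in>I. b i z)"
  using assms by (induction I rule: infinite_finite_induct) (auto intro: has_wirtinger_const has_wirtinger_add)

text \<open>Absorption identities again: differentiating in z lowers a, in the conjugate lowers b,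
  and the truncated subtractions carry the factor zero.\<close>

lemma has_wirtinger_hermite1:
  "has_wirtinger j (\<lambda>z. hermite1 a b (z j)) (\<lambda>z. of_nat a * hermite1 (a - 1) b (z j)) (\<lambda>z. of_nat b * hermite1 a (b - 1) (z j))"
proof -
  have d: "of_nat (a choose r) * of_nat (a - r) = (of_nat a * of_nat ((a - 1) choose r) :: complex)" for a r :: nat
  proof (cases a)
    case (Suc a')
    have "(Suc a' choose r) * (Suc a' - r) = Suc a' * (a' choose r)"
      using binomial_absorb_comp[of "Suc a'" r] by (simp add: mult.commute)
    then show ?thesis unfolding Suc of_nat_mult[symmetric] by simp
  qed simp
  let ?t = "\<lambda>a b r z. (-1) ^ r * fact r * of_nat (a choose r) * of_nat (b choose r) * z j ^ (a - r) * cnj (z j) ^ (b - r) :: complex"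
  have t: "has_wirtinger j (?t a b r) (\<lambda>z. of_nat a * ?t (a - 1) b r z) (\<lambda>z. of_nat b * ?t a (b - 1) r z)" for r
  proof -
    have w: "has_wirtinger j (\<lambda>z. ((-1) ^ r * fact r * of_nat (a choose r) * of_nat (b choose r)) * (z j ^ (a - r) * cnj (z j ^ (b - r))))
      (\<lambda>z. 0 * (z j ^ (a - r) * cnj (z j ^ (b - r))) + ((-1) ^ r * fact r * of_nat (a choose r) * of_nat (b choose r)) * ((of_nat (a - r) * z j ^ (a - r - 1)) * cnj (z j ^ (b - r)) + z j ^ (a - r) * cnj 0))
      (\<lambda>z. 0 * (z j ^ (a - r) * cnj (z j ^ (b - r))) + ((-1) ^ r * fact r * of_nat (a choose r) * of_nat (b choose r)) * (0 * cnj (z j ^ (b - r)) + z j ^ (a - r) * cnj (of_nat (b - r) * z j ^ (b - r - 1))))"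
      by (intro has_wirtinger_mult has_wirtinger_const has_wirtinger_cnj has_wirtinger_var_power)
    have A: "((-1) ^ r * fact r * of_nat (a choose r) * of_nat (b choose r)) * ((of_nat (a - r) * z j ^ (a - r - 1)) * cnj (z j ^ (b - r))) = of_nat a * ?t (a - 1) b r z" for z
    proof -
      have "((-1) ^ r * fact r * of_nat (a choose r) * of_nat (b choose r)) * ((of_nat (a - r) * z j ^ (a - r - 1)) * cnj (z j ^ (b - r)))
        = (-1) ^ r * fact r * (of_nat (a choose r) * of_nat (a - r)) * of_nat (b choose r) * z j ^ (a - r - 1) * cnj (z j) ^ (b - r)"
        by (simp add: mult_ac)
      then show ?thesis unfolding d by (simp add: mult_ac diff_commute)
    qed
    have B: "((-1) ^ r * fact r * of_nat (a choose r) * of_nat (b choose r)) * (z j ^ (a - r) * cnj (of_nat (b - r) * z j ^ (b - r - 1))) = of_nat b * ?t a (b - 1) r z" for z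
    proof -
      have "((-1) ^ r * fact r * of_nat (a choose r) * of_nat (b choose r)) * (z j ^ (a - r) * cnj (of_nat (b - r) * z j ^ (b - r - 1)))
        = (-1) ^ r * fact r * of_nat (a choose r) * (of_nat (b choose r) * of_nat (b - r)) * z j ^ (a - r) * cnj (z j) ^ (b - r - 1)"
        by (simp add: mult_ac)
      then show ?thesis unfolding d by (simp add: mult_ac diff_commute)
    qed
    show ?thesis
    proof (rule has_wirtinger_cong[OF w], goal_cases)
      case (1 z)
      show ?case by (simp add: mult_ac)
    next
      case (2 z)
      show ?case unfolding A[symmetric] by (simp only: mult_zero_left add_0 complex_cnj_zero mult_zero_right add_0_right)
    next
      case (3 z)
      show ?case unfolding B[symmetric] by (simp only: mult_zero_left add_0)
    qed
  qed
  have "has_wirtinger j (\<lambda>z. \<Sum>r\<le>a. ?t a b r z) (\<lambda>z. \<Sum>r\<le>a. of_nat a * ?t (a - 1) b r z) (\<lambda>z. \<Sum>r\<le>a. of_nat b * ?t a (b - 1) r z)"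
    by (rule has_wirtinger_sum[OF t])
  then show ?thesis
    by (simp only: sum_distrib_left[symmetric] hermite1_sum[of a a] hermite1_sum[of "a - 1" a, OF diff_le_self] order_refl)
qed

text \<open>The polynomial of which \<open>basis_integral\<close> is the value at the process;
  indices outside both supports would contribute the factor \<open>hermite1 0 0\<close>, which is
  1.\<close>

definition hermite_prod :: "(nat \<Rightarrow> nat) \<Rightarrow> (nat \<Rightarrow> nat) \<Rightarrow> (nat \<Rightarrow> complex) \<Rightarrow> complex" where
  "hermite_prod \<mu> \<nu> z = (\<Prod>k | \<mu> k \<noteq> 0 \<or> \<nu> k \<noteq> 0. hermite1 (\<mu> k) (\<nu> k) (z k))"

lemma basis_integral_eq: "basis_integral Z e \<mu> \<nu> \<omega> = hermite_prod \<mu> \<nu> (\<lambda>i. Z (e i) \<omega>)"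
  unfolding basis_integral_def hermite_prod_def hermite1_rescale ..

lemma hermite_prod_superset:
  assumes "finite S" "{k. \<mu> k \<noteq> 0} \<subseteq> S" "{k. \<nu> k \<noteq> 0} \<subseteq> S"
  shows "hermite_prod \<mu> \<nu> z = (\<Prod>k\<in>S. hermite1 (\<mu> k) (\<nu> k) (z k))"
  unfolding hermite_prod_def using assms by (intro prod.mono_neutral_left) auto

lemma hermite_prod_cnj: "cnj (hermite_prod \<mu> \<nu> z) = hermite_prod \<nu> \<mu> z"
  unfolding hermite_prod_def cnj_prod hermite1_cnj by (intro prod.cong) auto

lemma has_wirtinger_hermite_prod:
  assumes fin: "finite {k. \<mu> k \<noteq> 0}" "finite {k. \<nu> k \<noteq> 0}"
  shows "has_wirtinger j (hermite_prod \<mu> \<nu>) (\<lambda>z. of_nat (\<mu> j) * hermite_prod (\<mu>(j := \<mu> j - 1)) \<nu> z)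
    (\<lambda>z. of_nat (\<nu> j) * hermite_prod \<mu> (\<nu>(j := \<nu> j - 1)) z)"
proof -
  define S where "S = insert j ({k. \<mu> k \<noteq> 0} \<union> {k. \<nu> k \<noteq> 0})"
  have S: "finite S" "j \<in> S" using fin by (auto simp: S_def)
  define R where "R z = (\<Prod>k\<in>S - {j}. hermite1 (\<mu> k) (\<nu> k) (z k))" for z
  have split: "hermite_prod \<mu>' \<nu>' z = hermite1 (\<mu>' j) (\<nu>' j) (z j) * R z"
    if "\<mu>' = \<mu> \<or> \<mu>' = \<mu>(j := \<mu> j - 1)" "\<nu>' = \<nu> \<or> \<nu>' = \<nu>(j := \<nu> j - 1)" for \<mu>' \<nu>' z
  proof -
    have "hermite_prod \<mu>' \<nu>' z = (\<Prod>k\<in>S. hermite1 (\<mu>' k) (\<nu>' k) (z k))"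
      using that S(1) by (intro hermite_prod_superset) (auto simp: S_def split: if_splits)
    also have "\<dots> = hermite1 (\<mu>' j) (\<nu>' j) (z j) * (\<Prod>k\<in>S - {j}. hermite1 (\<mu>' k) (\<nu>' k) (z k))"
      by (rule prod.remove[OF S])
    also have "(\<Prod>k\<in>S - {j}. hermite1 (\<mu>' k) (\<nu>' k) (z k)) = R z"
      unfolding R_def using that by (intro prod.cong) auto
    finally show ?thesis .
  qed
  have "has_wirtinger j R (\<lambda>_. 0) (\<lambda>_. 0)"
    by (rule has_wirtinger_indep) (auto simp: R_def intro!: prod.cong)
  from has_wirtinger_mult[OF has_wirtinger_hermite1[of j "\<mu> j" "\<nu> j"] this]
  show ?thesis
    by (rule has_wirtinger_cong) (simp_all add: split)
qed

section \<open>Finite chaoses of a given bidegree\<close>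

lemma multi_indices_sum:
  assumes "\<mu> \<in> multi_indices S m" "finite S"
  shows "(\<Sum>k\<in>S. \<mu> k) = m"
proof -
  have "(\<Sum>k | \<mu> k \<noteq> 0. \<mu> k) = (\<Sum>k\<in>S. \<mu> k)"
    using assms by (intro sum.mono_neutral_left) (auto simp: multi_indices_def)
  then show ?thesis using assms(1) by (simp add: multi_indices_def)
qed

lemma multi_indices_decr:
  assumes "\<mu> \<in> multi_indices S m" "\<mu> j \<noteq> 0"
  shows "\<mu>(j := \<mu> j - 1) \<in> multi_indices S (m - 1)"
proof -
  let ?T = "{k. \<mu> k \<noteq> 0}" and ?\<mu> = "\<mu>(j := \<mu> j - 1)"
  have T: "finite ?T" "?T \<subseteq> S" "(\<Sum>k\<in>?T. \<mu> k) = m" using assms(1) by (auto simp: multi_indices_def)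
  have sub: "{k. ?\<mu> k \<noteq> 0} \<subseteq> ?T" by auto
  have "(\<Sum>k | ?\<mu> k \<noteq> 0. ?\<mu> k) = (\<Sum>k\<in>?T. ?\<mu> k)"
    using T(1) by (intro sum.mono_neutral_left) auto
  also have "\<dots> = ?\<mu> j + (\<Sum>k\<in>?T - {j}. ?\<mu> k)" using T(1) assms(2) by (intro sum.remove) auto
  also have "(\<Sum>k\<in>?T - {j}. ?\<mu> k) = (\<Sum>k\<in>?T - {j}. \<mu> k)" by (intro sum.cong) auto
  also have "?\<mu> j + \<dots> = m - 1" using T(3) sum.remove[of ?T j \<mu>] T(1) assms(2) by simp
  finally show ?thesis using T sub finite_subset[OF sub T(1)] unfolding multi_indices_def mem_Collect_eq by blast
qed

text \<open>The span of the Hermite products of bidegree (m, n) with indices in S, taken as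
  functions of the coordinates rather than as random variables, so that they can be
  differentiated.\<close>

inductive_set chaos :: "nat set \<Rightarrow> nat \<Rightarrow> nat \<Rightarrow> ((nat \<Rightarrow> complex) \<Rightarrow> complex) set" for S m n where
  base: "\<mu> \<in> multi_indices S m \<Longrightarrow> \<nu> \<in> multi_indices S n \<Longrightarrow> hermite_prod \<mu> \<nu> \<in> chaos S m n"
| zero: "(\<lambda>_. 0) \<in> chaos S m n"
| add_scale: "p \<in> chaos S m n \<Longrightarrow> q \<in> chaos S m n \<Longrightarrow> (\<lambda>z. c * p z + q z) \<in> chaos S m n"

lemma chaos_scale: "p \<in> chaos S m n \<Longrightarrow> (\<lambda>z. c * p z) \<in> chaos S m n"
  using chaos.add_scale[OF _ chaos.zero, of p S m n c] by simp

lemma chaos_diff: "p \<in> chaos S m n \<Longrightarrow> q \<in> chaos S m n \<Longrightarrow> (\<lambda>z. p z - q z) \<in> chaos S m n"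
  using chaos.add_scale[of q S m n p "-1"] by (simp add: algebra_simps)

lemma chaos_sum: "(\<And>i. i \<in> I \<Longrightarrow> p i \<in> chaos S m n) \<Longrightarrow> (\<lambda>z. \<Sum>i\<in>I. c i * p i z) \<in> chaos S m n"
  by (induction I rule: infinite_finite_induct) (auto intro: chaos.zero chaos.add_scale)

lemma chaos_mono: "p \<in> chaos S m n \<Longrightarrow> S \<subseteq> T \<Longrightarrow> p \<in> chaos T m n"
  by (induction rule: chaos.induct) (auto intro: chaos.intros dest: multi_indices_mono)

lemma hermite_prod_cpoly:
  assumes "\<mu> \<in> multi_indices S m" "\<nu> \<in> multi_indices S n"
  shows "hermite_prod \<mu> \<nu> \<in> cpoly S"
  unfolding hermite_prod_def [abs_def] using assms
  by (intro cpoly_prod hermite1_cpoly) (auto simp: multi_indices_def)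

lemma chaos_cpoly: "p \<in> chaos S m n \<Longrightarrow> p \<in> cpoly S"
  by (induction rule: chaos.induct) (auto intro: hermite_prod_cpoly cpoly.const cpoly.add cpoly_scale)

lemma chaos_cnj: "p \<in> chaos S m n \<Longrightarrow> (\<lambda>z. cnj (p z)) \<in> chaos S n m"
proof (induction rule: chaos.induct)
  case (add_scale p q c)
  then show ?case using chaos.add_scale[of "\<lambda>z. cnj (p z)" S n m "\<lambda>z. cnj (q z)" "cnj c"] by simp
qed (auto simp: hermite_prod_cnj intro: chaos.intros)

lemma chaos_0_0: "p \<in> chaos S 0 0 \<Longrightarrow> \<exists>c. p = (\<lambda>_. c)"
proof (induction rule: chaos.induct)
  case (base \<mu> \<nu>)
  have "\<mu> k = 0" "\<nu> k = 0" for k using base by (auto simp: multi_indices_def)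
  then have "hermite_prod \<mu> \<nu> = (\<lambda>_. 1)" by (simp add: hermite_prod_def fun_eq_iff)
  then show ?case by blast
qed auto

lemma wirtinger_add_scale:
  assumes "p \<in> cpoly S" "q \<in> cpoly S"
  shows "wirtinger_deriv j (\<lambda>z. c * p z + q z) = (\<lambda>z. c * wirtinger_deriv j p z + wirtinger_deriv j q z)"
    "wirtinger_bar j (\<lambda>z. c * p z + q z) = (\<lambda>z. c * wirtinger_bar j p z + wirtinger_bar j q z)"
  using has_wirtinger_eq[OF has_wirtinger_add[OF has_wirtinger_mult[OF has_wirtinger_const[of j c]
      cpoly_has_wirtinger(1)[OF assms(1), of j]] cpoly_has_wirtinger(1)[OF assms(2), of j]]] by simp_all

lemma wirtinger_mult:
  assumes "p \<in> cpoly S" "q \<in> cpoly S"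
  shows "wirtinger_deriv j (\<lambda>z. p z * q z) = (\<lambda>z. wirtinger_deriv j p z * q z + p z * wirtinger_deriv j q z)"
    "wirtinger_bar j (\<lambda>z. p z * q z) = (\<lambda>z. wirtinger_bar j p z * q z + p z * wirtinger_bar j q z)"
  using has_wirtinger_eq[OF has_wirtinger_mult[OF cpoly_has_wirtinger(1)[OF assms(1), of j] cpoly_has_wirtinger(1)[OF assms(2), of j]]]
  by simp_all

lemma wirtinger_cnj:
  assumes "p \<in> cpoly S"
  shows "wirtinger_deriv j (\<lambda>z. cnj (p z)) = (\<lambda>z. cnj (wirtinger_bar j p z))"
    "wirtinger_bar j (\<lambda>z. cnj (p z)) = (\<lambda>z. cnj (wirtinger_deriv j p z))"
  using has_wirtinger_eq[OF has_wirtinger_cnj[OF cpoly_has_wirtinger(1)[OF assms, of j]]] by simp_all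

lemma wirtinger_diff:
  assumes "p \<in> cpoly S" "q \<in> cpoly S"
  shows "wirtinger_deriv j (\<lambda>z. p z - q z) = (\<lambda>z. wirtinger_deriv j p z - wirtinger_deriv j q z)"
  using wirtinger_add_scale(1)[OF assms(2,1), of j "-1"] by simp

lemma wirtinger_hermite_prod:
  assumes "\<mu> \<in> multi_indices S m" "\<nu> \<in> multi_indices S n"
  shows "wirtinger_deriv j (hermite_prod \<mu> \<nu>) = (\<lambda>z. of_nat (\<mu> j) * hermite_prod (\<mu>(j := \<mu> j - 1)) \<nu> z)"
    "wirtinger_bar j (hermite_prod \<mu> \<nu>) = (\<lambda>z. of_nat (\<nu> j) * hermite_prod \<mu> (\<nu>(j := \<nu> j - 1)) z)"
  using has_wirtinger_eq[OF has_wirtinger_hermite_prod[of \<mu> \<nu> j]] assms by (auto simp: multi_indices_def)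

text \<open>Lowering one entry of \<mu> moves to bidegree (m - 1, n). The second claim complements
  the first at m = 0, where \<open>m - 1\<close> is truncated.\<close>

lemma chaos_wirtinger:
  assumes "p \<in> chaos S m n"
  shows "wirtinger_deriv j p \<in> chaos S (m - 1) n" "m = 0 \<Longrightarrow> wirtinger_deriv j p = (\<lambda>_. 0)"
  using assms
proof (induction rule: chaos.induct)
  case (base \<mu> \<nu>)
  {
    case 1
    show ?case
    proof (cases "\<mu> j = 0")
      case True
      then show ?thesis unfolding wirtinger_hermite_prod(1)[OF base] by (simp add: chaos.zero)
    next
      case False
      then show ?thesis unfolding wirtinger_hermite_prod(1)[OF base]
        by (intro chaos_scale chaos.base multi_indices_decr base)
    qed
  next
    case 2
    then have "\<mu> j = 0" using base(1) by (auto simp: multi_indices_def)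
    then show ?case unfolding wirtinger_hermite_prod(1)[OF base] by simp
  }
next
  case zero
  have "wirtinger_deriv j (\<lambda>_. 0) = (\<lambda>_. 0)" by (rule has_wirtinger_eq(1)[OF has_wirtinger_const])
  then show "wirtinger_deriv j (\<lambda>_. 0) \<in> chaos S (m - 1) n" "m = 0 \<Longrightarrow> wirtinger_deriv j (\<lambda>_. 0) = (\<lambda>_. 0)"
    by (simp_all add: chaos.zero)
next
  case (add_scale p q c)
  note w = wirtinger_add_scale(1)[OF chaos_cpoly[OF add_scale.hyps(1)] chaos_cpoly[OF add_scale.hyps(2)], of j c]
  show "wirtinger_deriv j (\<lambda>z. c * p z + q z) \<in> chaos S (m - 1) n"
    "m = 0 \<Longrightarrow> wirtinger_deriv j (\<lambda>z. c * p z + q z) = (\<lambda>_. 0)"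
    unfolding w using add_scale.IH by (auto intro: chaos.add_scale)
qed

text \<open>\<open>hermite1_Suc\<close> in the factor j; the remaining factors are common to all
  three products.\<close>

lemma hermite_prod_recurrence:
  assumes "\<mu> \<in> multi_indices S m" "\<nu> \<in> multi_indices S n" "\<mu> j \<noteq> 0"
  shows "hermite_prod \<mu> \<nu> z = z j * hermite_prod (\<mu>(j := \<mu> j - 1)) \<nu> z
    - of_nat (\<nu> j) * hermite_prod (\<mu>(j := \<mu> j - 1)) (\<nu>(j := \<nu> j - 1)) z"
proof -
  define T where "T = insert j ({k. \<mu> k \<noteq> 0} \<union> {k. \<nu> k \<noteq> 0})"
  have T: "finite T" "j \<in> T" using assms by (auto simp: T_def multi_indices_def)
  define R where "R = (\<Prod>k\<in>T - {j}. hermite1 (\<mu> k) (\<nu> k) (z k))"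
  have split: "hermite_prod \<mu>' \<nu>' z = hermite1 (\<mu>' j) (\<nu>' j) (z j) * R"
    if "\<mu>' = \<mu> \<or> \<mu>' = \<mu>(j := \<mu> j - 1)" "\<nu>' = \<nu> \<or> \<nu>' = \<nu>(j := \<nu> j - 1)" for \<mu>' \<nu>'
  proof -
    have "hermite_prod \<mu>' \<nu>' z = (\<Prod>k\<in>T. hermite1 (\<mu>' k) (\<nu>' k) (z k))"
      using that T(1) by (intro hermite_prod_superset) (auto simp: T_def split: if_splits)
    also have "\<dots> = hermite1 (\<mu>' j) (\<nu>' j) (z j) * (\<Prod>k\<in>T - {j}. hermite1 (\<mu>' k) (\<nu>' k) (z k))"
      by (rule prod.remove[OF T])
    also have "(\<Prod>k\<in>T - {j}. hermite1 (\<mu>' k) (\<nu>' k) (z k)) = R"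
      unfolding R_def using that by (intro prod.cong) auto
    finally show ?thesis .
  qed
  obtain a where "\<mu> j = Suc a" using assms(3) by (cases "\<mu> j") auto
  then show ?thesis by (simp add: split hermite1_Suc left_diff_distrib mult.assoc)
qed

text \<open>The chaos of bidegree \<open>(m, n)\<close> consists of eigenfunctions of the complex Ornstein-Uhlenbeck
  operator, with eigenvalue \<open>m\<close>.\<close>

lemma chaos_eigen:
  assumes "p \<in> chaos S m n" "finite S"
  shows "(\<Sum>k\<in>S. z k * wirtinger_deriv k p z - wirtinger_bar k (wirtinger_deriv k p) z) = of_nat m * p z"
  using assms(1)
proof (induction rule: chaos.induct)
  case (base \<mu> \<nu>)
  have "z k * wirtinger_deriv k (hermite_prod \<mu> \<nu>) z - wirtinger_bar k (wirtinger_deriv k (hermite_prod \<mu> \<nu>)) z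
      = of_nat (\<mu> k) * hermite_prod \<mu> \<nu> z" for k
  proof (cases "\<mu> k = 0")
    case True
    then have "wirtinger_deriv k (hermite_prod \<mu> \<nu>) = (\<lambda>_. 0)"
      unfolding wirtinger_hermite_prod(1)[OF base] by simp
    then show ?thesis using True has_wirtinger_eq(2)[OF has_wirtinger_const[of k 0]] by simp
  next
    case False
    note d = multi_indices_decr[OF base(1) False]
    have "wirtinger_bar k (\<lambda>z. of_nat (\<mu> k) * hermite_prod (\<mu>(k := \<mu> k - 1)) \<nu> z)
      = (\<lambda>z. of_nat (\<mu> k) * (of_nat (\<nu> k) * hermite_prod (\<mu>(k := \<mu> k - 1)) (\<nu>(k := \<nu> k - 1)) z))"
      using wirtinger_mult(2)[OF cpoly.const hermite_prod_cpoly[OF d base(2)], of k "of_nat (\<mu> k)"]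
        has_wirtinger_eq(2)[OF has_wirtinger_const[of k "of_nat (\<mu> k)"]] wirtinger_hermite_prod(2)[OF d base(2), of k] by simp
    then show ?thesis
      unfolding wirtinger_hermite_prod(1)[OF base] hermite_prod_recurrence[OF base False] by (simp add: algebra_simps)
  qed
  then have "(\<Sum>k\<in>S. z k * wirtinger_deriv k (hermite_prod \<mu> \<nu>) z - wirtinger_bar k (wirtinger_deriv k (hermite_prod \<mu> \<nu>)) z)
      = of_nat (\<Sum>k\<in>S. \<mu> k) * hermite_prod \<mu> \<nu> z"
    by (simp add: sum_distrib_right)
  then show ?case unfolding multi_indices_sum[OF base(1) assms(2)] .
next
  case zero
  have "wirtinger_deriv k (\<lambda>_. 0) = (\<lambda>_. 0)" "wirtinger_bar k (\<lambda>_. 0) = (\<lambda>_. 0)" for k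
    by (rule has_wirtinger_eq[OF has_wirtinger_const])+
  then show ?case by simp
next
  case (add_scale p q c)
  have pc: "p \<in> cpoly S" "q \<in> cpoly S" using add_scale.hyps chaos_cpoly by auto
  have t: "z k * wirtinger_deriv k (\<lambda>z. c * p z + q z) z - wirtinger_bar k (wirtinger_deriv k (\<lambda>z. c * p z + q z)) z
      = c * (z k * wirtinger_deriv k p z - wirtinger_bar k (wirtinger_deriv k p) z)
        + (z k * wirtinger_deriv k q z - wirtinger_bar k (wirtinger_deriv k q) z)" for k
    unfolding wirtinger_add_scale(1)[OF pc]
      wirtinger_add_scale(2)[OF cpoly_has_wirtinger(2)[OF pc(1)] cpoly_has_wirtinger(2)[OF pc(2)]]
    by (simp add: algebra_simps)
  show ?case
    unfolding t sum.distrib sum_distrib_left[symmetric] add_scale.IH by (simp add: algebra_simps)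
qed

section \<open>Integration by parts for polynomials and the Dirichlet form\<close>

context complex_isonormal
begin

lemma cpoly_bounded_index: "finite S \<Longrightarrow> \<exists>k. S \<subseteq> {..<k::nat}"
  by (rule finite_nat_iff_bounded[THEN iffD1])

lemma cpoly_measurable: "p \<in> cpoly S \<Longrightarrow> (\<lambda>\<omega>. p (\<lambda>i. Z (e i) \<omega>)) \<in> borel_measurable M"
  by (rule measurable_compose[OF measurable_Z_family borel_measurable_continuous_onI[OF cpoly_continuous]])

lemma cpoly_integrable_power:
  assumes "p \<in> cpoly S" "finite S"
  shows "integrable M (\<lambda>\<omega>. cmod (p (\<lambda>i. Z (e i) \<omega>)) ^ r)"
proof -
  obtain k where k: "S \<subseteq> {..<k}" using cpoly_bounded_index[OF assms(2)] by blast
  obtain C q where Cq: "C \<ge> 0" "\<And>z. cmod (p z) \<le> C * (1 + (\<Sum>i<k. cmod (z i))) ^ q"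
    by (rule poly_growthE[OF cpoly_poly_growth[OF assms(1) k]], rule that)
  show ?thesis
  proof (rule integrable_poly_growth)
    show "(\<lambda>z. cmod (p z) ^ r) \<in> borel_measurable borel"
      using borel_measurable_continuous_onI[OF cpoly_continuous[OF assms(1)]] by simp
    fix z
    have "cmod (p z) ^ r \<le> (C * (1 + (\<Sum>i<k. cmod (z i))) ^ q) ^ r" by (intro power_mono Cq) simp
    then show "norm (cmod (p z) ^ r) \<le> C ^ r * (1 + (\<Sum>i<k. cmod (z i))) ^ (q * r)"
      by (simp add: power_mult_distrib power_mult)
  qed
qed

lemma cpoly_integrable:
  assumes "p \<in> cpoly S" "finite S"
  shows "integrable M (\<lambda>\<omega>. p (\<lambda>i. Z (e i) \<omega>))"
  using cpoly_integrable_power[OF assms, of e 1] cpoly_measurable[OF assms(1), of e] by (simp add: integrable_norm_iff)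

text \<open>\<open>smooth_test\<close> at g = 0, where the exponential is almost surely 1;
  orthonormality reduces the pairing of the derivative with \<open>e j\<close> to one Wirtinger
  derivative.\<close>

lemma cpoly_ibp:
  assumes p: "p \<in> cpoly S" and S: "finite S" "orthonormal_family S e" "j \<in> S"
  shows "(\<integral>\<omega>. wirtinger_deriv j p (\<lambda>i. Z (e i) \<omega>) \<partial>M) = (\<integral>\<omega>. cnj (Z (e j) \<omega>) * p (\<lambda>i. Z (e i) \<omega>) \<partial>M)"
proof -
  obtain k where k: "S \<subseteq> {..<k}" using cpoly_bounded_index[OF S(1)] by blast
  note m = cpoly_measurable[OF p, of e] cpoly_measurable[OF cpoly_has_wirtinger(2)[OF p], of j e]
  have E1: "AE \<omega> in M. iexp (Re (Z 0 \<omega>)) = 1" using Z_zero by eventually_elim simp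
  have eq: "cinner (\<Sum>i<k. cscale (wirtinger_deriv i p z) (e i)) (e j) = wirtinger_deriv j p z" for z
  proof -
    have "cinner (\<Sum>i<k. cscale (wirtinger_deriv i p z) (e i)) (e j) = (\<Sum>i<k. wirtinger_deriv i p z * cinner (e i) (e j))"
      by (simp add: cinner_sum_left)
    also have "\<dots> = (\<Sum>i\<in>S. wirtinger_deriv i p z * cinner (e i) (e j))"
      using k by (intro sum.mono_neutral_right) (auto simp: cpoly_wirtinger_0[OF p])
    also have "\<dots> = (\<Sum>i\<in>S. if i = j then wirtinger_deriv j p z else 0)"
      by (intro sum.cong refl) (auto simp: orthonormal_familyD[OF S(2) _ S(3)])
    finally show ?thesis using S by simp
  qed
  have "(\<integral>\<omega>. wirtinger_deriv j p (\<lambda>i. Z (e i) \<omega>) \<partial>M)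
    = (\<integral>\<omega>. cinner (\<Sum>i<k. cscale (wirtinger_deriv i p (\<lambda>i. Z (e i) \<omega>)) (e i)) (e j) * iexp (Re (Z 0 \<omega>)) \<partial>M)"
    unfolding eq using E1 m by (intro integral_cong_AE) (auto elim!: eventually_mono)
  also have "\<dots> = (\<integral>\<omega>. p (\<lambda>i. Z (e i) \<omega>) * ((cnj (Z (e j) \<omega>) - \<i> / 2 * cinner 0 (e j)) * iexp (Re (Z 0 \<omega>))) \<partial>M)"
    by (rule smooth_test[OF cpoly_smooth[OF p k] orthonormal_family_norm[OF S(2,3)]])
  also have "\<dots> = (\<integral>\<omega>. cnj (Z (e j) \<omega>) * p (\<lambda>i. Z (e i) \<omega>) \<partial>M)"
    using E1 m by (intro integral_cong_AE) (auto elim!: eventually_mono intro!: borel_measurable_times borel_measurable_cnj)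
  finally show ?thesis .
qed

lemma cpoly_ibp_bar:
  assumes p: "p \<in> cpoly S" and S: "finite S" "orthonormal_family S e" "j \<in> S"
  shows "(\<integral>\<omega>. wirtinger_bar j p (\<lambda>i. Z (e i) \<omega>) \<partial>M) = (\<integral>\<omega>. Z (e j) \<omega> * p (\<lambda>i. Z (e i) \<omega>) \<partial>M)"
proof -
  have "cnj (\<integral>\<omega>. wirtinger_bar j p (\<lambda>i. Z (e i) \<omega>) \<partial>M) = (\<integral>\<omega>. wirtinger_deriv j (\<lambda>z. cnj (p z)) (\<lambda>i. Z (e i) \<omega>) \<partial>M)"
    unfolding wirtinger_cnj(1)[OF p] by simp
  also have "\<dots> = (\<integral>\<omega>. cnj (Z (e j) \<omega> * p (\<lambda>i. Z (e i) \<omega>)) \<partial>M)"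
    unfolding cpoly_ibp[OF cpoly_cnj[OF p] S] by simp
  also have "\<dots> = cnj (\<integral>\<omega>. Z (e j) \<omega> * p (\<lambda>i. Z (e i) \<omega>) \<partial>M)" by (rule Bochner_Integration.integral_cnj)
  finally show ?thesis by (simp only: complex_cnj_cancel_iff)
qed

text \<open>Integration by parts moves the derivative off G, leaving \<open>z k\<close> minus
  \<open>wirtinger_bar k\<close> applied to the derivative of F; summed over S this is the operator
  of \<open>chaos_eigen\<close>. Only F is confined to the chaos, which is what admits a cubic G
  later.\<close>

lemma chaos_dirichlet:
  assumes F: "F \<in> chaos S m n" and G: "G \<in> cpoly S" and S: "finite S" "orthonormal_family S e"
  shows "(\<Sum>k\<in>S. \<integral>\<omega>. wirtinger_deriv k F (\<lambda>i. Z (e i) \<omega>) * cnj (wirtinger_deriv k G (\<lambda>i. Z (e i) \<omega>)) \<partial>M)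
    = of_nat m * (\<integral>\<omega>. F (\<lambda>i. Z (e i) \<omega>) * cnj (G (\<lambda>i. Z (e i) \<omega>)) \<partial>M)"
proof -
  have Fc: "F \<in> cpoly S" by (rule chaos_cpoly[OF F])
  let ?z = "\<lambda>\<omega> i. Z (e i) \<omega>"
  define D where "D k = wirtinger_deriv k F" for k
  have Dc: "D k \<in> cpoly S" for k unfolding D_def by (rule cpoly_has_wirtinger(2)[OF Fc])
  note Gc = cpoly_cnj[OF G]
  have i1: "integrable M (\<lambda>\<omega>. wirtinger_bar k (D k) (?z \<omega>) * cnj (G (?z \<omega>)))" for k
    by (rule cpoly_integrable[OF cpoly.mult[OF cpoly_has_wirtinger(3)[OF Dc] Gc] S(1)])
  have i2: "integrable M (\<lambda>\<omega>. D k (?z \<omega>) * cnj (wirtinger_deriv k G (?z \<omega>)))" for k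
    by (rule cpoly_integrable[OF cpoly.mult[OF Dc cpoly_cnj[OF cpoly_has_wirtinger(2)[OF G]]] S(1)])
  have i3: "integrable M (\<lambda>\<omega>. Z (e k) \<omega> * (D k (?z \<omega>) * cnj (G (?z \<omega>))))" if "k \<in> S" for k
    using cpoly_integrable[OF cpoly.mult[OF cpoly.var[OF that] cpoly.mult[OF Dc Gc]] S(1)] .
  have "(\<integral>\<omega>. D k (?z \<omega>) * cnj (wirtinger_deriv k G (?z \<omega>)) \<partial>M)
    = (\<integral>\<omega>. (Z (e k) \<omega> * D k (?z \<omega>) - wirtinger_bar k (D k) (?z \<omega>)) * cnj (G (?z \<omega>)) \<partial>M)" if k: "k \<in> S" for k
  proof -
    have "(\<integral>\<omega>. wirtinger_bar k (\<lambda>z. D k z * cnj (G z)) (?z \<omega>) \<partial>M) = (\<integral>\<omega>. Z (e k) \<omega> * (D k (?z \<omega>) * cnj (G (?z \<omega>))) \<partial>M)"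
      by (rule cpoly_ibp_bar[OF cpoly.mult[OF Dc Gc] S k])
    then have "(\<integral>\<omega>. wirtinger_bar k (D k) (?z \<omega>) * cnj (G (?z \<omega>)) \<partial>M) + (\<integral>\<omega>. D k (?z \<omega>) * cnj (wirtinger_deriv k G (?z \<omega>)) \<partial>M)
      = (\<integral>\<omega>. Z (e k) \<omega> * (D k (?z \<omega>) * cnj (G (?z \<omega>))) \<partial>M)"
      unfolding wirtinger_mult(2)[OF Dc Gc] wirtinger_cnj(2)[OF G] Bochner_Integration.integral_add[OF i1 i2] .
    then have "(\<integral>\<omega>. D k (?z \<omega>) * cnj (wirtinger_deriv k G (?z \<omega>)) \<partial>M)
      = (\<integral>\<omega>. Z (e k) \<omega> * (D k (?z \<omega>) * cnj (G (?z \<omega>))) \<partial>M) - (\<integral>\<omega>. wirtinger_bar k (D k) (?z \<omega>) * cnj (G (?z \<omega>)) \<partial>M)"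
      by (simp add: algebra_simps)
    also have "\<dots> = (\<integral>\<omega>. Z (e k) \<omega> * (D k (?z \<omega>) * cnj (G (?z \<omega>))) - wirtinger_bar k (D k) (?z \<omega>) * cnj (G (?z \<omega>)) \<partial>M)"
      by (rule Bochner_Integration.integral_diff[OF i3[OF k] i1, symmetric])
    finally show ?thesis by (simp add: left_diff_distrib mult.assoc)
  qed
  then have "(\<Sum>k\<in>S. \<integral>\<omega>. D k (?z \<omega>) * cnj (wirtinger_deriv k G (?z \<omega>)) \<partial>M)
    = (\<Sum>k\<in>S. \<integral>\<omega>. (Z (e k) \<omega> * D k (?z \<omega>) - wirtinger_bar k (D k) (?z \<omega>)) * cnj (G (?z \<omega>)) \<partial>M)"
    by (intro sum.cong) auto
  also have "\<dots> = (\<integral>\<omega>. (\<Sum>k\<in>S. (Z (e k) \<omega> * D k (?z \<omega>) - wirtinger_bar k (D k) (?z \<omega>)) * cnj (G (?z \<omega>))) \<partial>M)"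
    using i1 i3 by (intro Bochner_Integration.integral_sum[symmetric]) (simp add: left_diff_distrib mult.assoc)
  also have "\<dots> = (\<integral>\<omega>. of_nat m * (F (?z \<omega>) * cnj (G (?z \<omega>))) \<partial>M)"
  proof (rule Bochner_Integration.integral_cong[OF refl])
    fix \<omega>
    show "(\<Sum>k\<in>S. (Z (e k) \<omega> * D k (?z \<omega>) - wirtinger_bar k (D k) (?z \<omega>)) * cnj (G (?z \<omega>))) = of_nat m * (F (?z \<omega>) * cnj (G (?z \<omega>)))"
      using chaos_eigen[OF F S(1), of "?z \<omega>"] unfolding D_def by (simp add: sum_distrib_right[symmetric])
  qed
  finally show ?thesis unfolding D_def by simp
qed

end

section \<open>Fourth moments on a finite chaos\<close>

context complex_isonormal
begin

text \<open>For a polynomial p in the coordinates S this is the Malliavin derivative at the process;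
  a larger finite S adds only zero terms.\<close>

definition gradient :: "nat set \<Rightarrow> (nat \<Rightarrow> 'h cplx) \<Rightarrow> ((nat \<Rightarrow> complex) \<Rightarrow> complex) \<Rightarrow> 'w \<Rightarrow> 'h cplx" where
  "gradient S e p \<omega> = (\<Sum>k\<in>S. cscale (wirtinger_deriv k p (\<lambda>i. Z (e i) \<omega>)) (e k))"

lemma gradient_norm_sq:
  assumes "finite S" "orthonormal_family S e"
  shows "(norm (gradient S e p \<omega>))\<^sup>2 = (\<Sum>k\<in>S. (cmod (wirtinger_deriv k p (\<lambda>i. Z (e i) \<omega>)))\<^sup>2)"
  unfolding gradient_def by (rule norm_sq_sum_orthonormal[OF assms])

lemma gradient_cinner:
  assumes "finite S" "orthonormal_family S e"
  shows "cinner (gradient S e p \<omega>) (gradient S e q \<omega>)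
    = (\<Sum>k\<in>S. wirtinger_deriv k p (\<lambda>i. Z (e i) \<omega>) * cnj (wirtinger_deriv k q (\<lambda>i. Z (e i) \<omega>)))"
proof -
  have "cinner (gradient S e p \<omega>) (gradient S e q \<omega>)
    = (\<Sum>k\<in>S. cnj (wirtinger_deriv k q (\<lambda>i. Z (e i) \<omega>)) * cinner (gradient S e p \<omega>) (e k))"
    unfolding gradient_def[of S e q] by (simp add: cinner_sum_right)
  also have "\<dots> = (\<Sum>k\<in>S. wirtinger_deriv k p (\<lambda>i. Z (e i) \<omega>) * cnj (wirtinger_deriv k q (\<lambda>i. Z (e i) \<omega>)))"
    unfolding gradient_def by (intro sum.cong refl) (simp add: cinner_sum_orthonormal[OF assms])
  finally show ?thesis .
qed

lemma gradient_mono: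
  assumes "p \<in> cpoly S" "S \<subseteq> T" "finite T"
  shows "gradient T e p = gradient S e p"
  unfolding gradient_def using assms
  by (intro ext sum.mono_neutral_right) (auto simp: cpoly_wirtinger_0[OF assms(1)])

lemma gradient_diff:
  assumes "p \<in> cpoly S" "q \<in> cpoly S"
  shows "gradient T e (\<lambda>z. p z - q z) \<omega> = gradient T e p \<omega> - gradient T e q \<omega>"
  unfolding gradient_def wirtinger_diff[OF assms] by (simp add: cscale_diff_left sum_subtractf)

lemma gradient_measurable:
  assumes "p \<in> cpoly S" shows "gradient T e p \<in> borel_measurable M"
proof -
  have "(\<lambda>\<omega>. cscale (wirtinger_deriv k p (\<lambda>i. Z (e i) \<omega>)) (e k)) \<in> borel_measurable M" for k
    by (rule measurable_compose[OF cpoly_measurable[OF cpoly_has_wirtinger(2)[OF assms]]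
        borel_measurable_continuous_onI[OF bounded_bilinear.continuous_on[OF bounded_bilinear_cscale continuous_on_id continuous_on_const]]])
  then show ?thesis unfolding gradient_def [abs_def] by (intro borel_measurable_sum)
qed

text \<open>Cauchy-Schwarz in the shape needed for the cross terms in the square of a sum, with
  reference values a and b under a common constant.\<close>

lemma cmod_mult_integral_le:
  assumes X: "integrable M (\<lambda>\<omega>. (X \<omega>)\<^sup>2)" and Y: "integrable M (\<lambda>\<omega>. (Y \<omega>)\<^sup>2)"
    and m: "X \<in> borel_measurable M" "Y \<in> borel_measurable M" and nn: "\<And>\<omega>. 0 \<le> X \<omega>" "\<And>\<omega>. 0 \<le> Y \<omega>"
    and a: "(\<integral>\<omega>. (X \<omega>)\<^sup>2 \<partial>M) \<le> C * a\<^sup>2" and b: "(\<integral>\<omega>. (Y \<omega>)\<^sup>2 \<partial>M) \<le> C * b\<^sup>2"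
    and C: "0 \<le> C" "0 \<le> a" "0 \<le> (b::real)"
  shows "(\<integral>\<omega>. X \<omega> * Y \<omega> \<partial>M) \<le> C * (a * b)"
proof (rule power2_le_imp_le)
  have "(\<integral>\<omega>. X \<omega> * Y \<omega> \<partial>M)\<^sup>2 \<le> (\<integral>\<omega>. (X \<omega>)\<^sup>2 \<partial>M) * (\<integral>\<omega>. (Y \<omega>)\<^sup>2 \<partial>M)"
    by (rule Cauchy_Schwarz_integral(2)[OF m X Y nn])
  also have "\<dots> \<le> (C * a\<^sup>2) * (C * b\<^sup>2)"
    using C by (intro mult_mono a b) auto
  also have "\<dots> = (C * (a * b))\<^sup>2" by (simp add: power2_eq_square mult_ac)
  finally show "(\<integral>\<omega>. X \<omega> * Y \<omega> \<partial>M)\<^sup>2 \<le> (C * (a * b))\<^sup>2" .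
qed (use C in simp)

text \<open>The squared norm is a sum of nonnegative functions; expanding its square and applying
  Cauchy-Schwarz to each cross term transfers a bound for every component to the whole gradient with
  the same constant C.\<close>

lemma gradient_moments:
  assumes p: "p \<in> cpoly S" and S: "finite S" "orthonormal_family S e"
  shows "integrable M (\<lambda>\<omega>. (norm (gradient S e p \<omega>))\<^sup>2)" "integrable M (\<lambda>\<omega>. norm (gradient S e p \<omega>) ^ 4)"
    "(\<integral>\<omega>. (norm (gradient S e p \<omega>))\<^sup>2 \<partial>M) = (\<Sum>k\<in>S. \<integral>\<omega>. (cmod (wirtinger_deriv k p (\<lambda>i. Z (e i) \<omega>)))\<^sup>2 \<partial>M)"
    "0 \<le> C \<Longrightarrow> (\<And>k. k \<in> S \<Longrightarrow> (\<integral>\<omega>. cmod (wirtinger_deriv k p (\<lambda>i. Z (e i) \<omega>)) ^ 4 \<partial>M)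
        \<le> C * (\<integral>\<omega>. (cmod (wirtinger_deriv k p (\<lambda>i. Z (e i) \<omega>)))\<^sup>2 \<partial>M)\<^sup>2) \<Longrightarrow>
      (\<integral>\<omega>. norm (gradient S e p \<omega>) ^ 4 \<partial>M) \<le> C * (\<integral>\<omega>. (norm (gradient S e p \<omega>))\<^sup>2 \<partial>M)\<^sup>2"
proof -
  define d where "d k \<omega> = (cmod (wirtinger_deriv k p (\<lambda>i. Z (e i) \<omega>)))\<^sup>2" for k \<omega>
  have i2: "integrable M (d k)" for k
    unfolding d_def [abs_def] by (rule cpoly_integrable_power[OF cpoly_has_wirtinger(2)[OF p] S(1)])
  have i4: "integrable M (\<lambda>\<omega>. (d k \<omega>)\<^sup>2)" for k
    using cpoly_integrable_power[OF cpoly_has_wirtinger(2)[OF p] S(1), of k e 4] by (simp add: d_def power_mult[symmetric])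
  have dm: "d k \<in> borel_measurable M" for k using i2[of k] by simp
  have dn: "0 \<le> d k \<omega>" for k \<omega> by (simp add: d_def)
  have i22: "integrable M (\<lambda>\<omega>. d k \<omega> * d l \<omega>)" for k l
    by (rule Cauchy_Schwarz_integral(1)[OF dm dm i4 i4 dn dn])
  have n2: "(norm (gradient S e p \<omega>))\<^sup>2 = (\<Sum>k\<in>S. d k \<omega>)" for \<omega>
    unfolding d_def by (rule gradient_norm_sq[OF S])
  have n4: "norm (gradient S e p \<omega>) ^ 4 = (\<Sum>k\<in>S. \<Sum>l\<in>S. d k \<omega> * d l \<omega>)" for \<omega>
  proof -
    have "norm (gradient S e p \<omega>) ^ 4 = ((norm (gradient S e p \<omega>))\<^sup>2)\<^sup>2" by (simp add: power_mult[symmetric])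
    then show ?thesis unfolding n2 unfolding power2_eq_square sum_product .
  qed
  show "integrable M (\<lambda>\<omega>. (norm (gradient S e p \<omega>))\<^sup>2)" unfolding n2 by (intro Bochner_Integration.integrable_sum i2)
  show "integrable M (\<lambda>\<omega>. norm (gradient S e p \<omega>) ^ 4)" unfolding n4 by (intro Bochner_Integration.integrable_sum i22)
  have e2: "(\<integral>\<omega>. (norm (gradient S e p \<omega>))\<^sup>2 \<partial>M) = (\<Sum>k\<in>S. \<integral>\<omega>. d k \<omega> \<partial>M)"
    unfolding n2 by (rule Bochner_Integration.integral_sum[OF i2])
  then show "(\<integral>\<omega>. (norm (gradient S e p \<omega>))\<^sup>2 \<partial>M) = (\<Sum>k\<in>S. \<integral>\<omega>. (cmod (wirtinger_deriv k p (\<lambda>i. Z (e i) \<omega>)))\<^sup>2 \<partial>M)"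
    unfolding d_def .
  assume C: "0 \<le> C" and b: "\<And>k. k \<in> S \<Longrightarrow> (\<integral>\<omega>. cmod (wirtinger_deriv k p (\<lambda>i. Z (e i) \<omega>)) ^ 4 \<partial>M)
        \<le> C * (\<integral>\<omega>. (cmod (wirtinger_deriv k p (\<lambda>i. Z (e i) \<omega>)))\<^sup>2 \<partial>M)\<^sup>2"
  have b': "(\<integral>\<omega>. (d k \<omega>)\<^sup>2 \<partial>M) \<le> C * (\<integral>\<omega>. d k \<omega> \<partial>M)\<^sup>2" if "k \<in> S" for k
    using b[OF that] by (simp add: d_def power_mult[symmetric])
  have nn: "0 \<le> (\<integral>\<omega>. d k \<omega> \<partial>M)" for k by (intro integral_nonneg_AE) (simp add: dn)
  have "(\<integral>\<omega>. norm (gradient S e p \<omega>) ^ 4 \<partial>M) = (\<Sum>k\<in>S. \<Sum>l\<in>S. \<integral>\<omega>. d k \<omega> * d l \<omega> \<partial>M)"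
    unfolding n4 by (simp add: Bochner_Integration.integral_sum i22)
  also have "\<dots> \<le> (\<Sum>k\<in>S. \<Sum>l\<in>S. C * ((\<integral>\<omega>. d k \<omega> \<partial>M) * (\<integral>\<omega>. d l \<omega> \<partial>M)))"
    by (intro sum_mono cmod_mult_integral_le i4 dm dn b' C nn)
  also have "\<dots> = C * ((\<Sum>k\<in>S. \<integral>\<omega>. d k \<omega> \<partial>M) * (\<Sum>l\<in>S. \<integral>\<omega>. d l \<omega> \<partial>M))"
    unfolding sum_product by (simp add: sum_distrib_left)
  finally show "(\<integral>\<omega>. norm (gradient S e p \<omega>) ^ 4 \<partial>M) \<le> C * (\<integral>\<omega>. (norm (gradient S e p \<omega>))\<^sup>2 \<partial>M)\<^sup>2"
    unfolding e2 unfolding power2_eq_square .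
qed

lemma chaos_gradient_L2:
  assumes F: "F \<in> chaos S m n" and S: "finite S" "orthonormal_family S e"
  shows "(\<integral>\<omega>. (norm (gradient S e F \<omega>))\<^sup>2 \<partial>M) = of_nat m * (\<integral>\<omega>. (cmod (F (\<lambda>i. Z (e i) \<omega>)))\<^sup>2 \<partial>M)"
proof -
  have "complex_of_real (\<integral>\<omega>. (norm (gradient S e F \<omega>))\<^sup>2 \<partial>M)
    = (\<Sum>k\<in>S. \<integral>\<omega>. wirtinger_deriv k F (\<lambda>i. Z (e i) \<omega>) * cnj (wirtinger_deriv k F (\<lambda>i. Z (e i) \<omega>)) \<partial>M)"
    unfolding gradient_moments(3)[OF chaos_cpoly[OF F] S] of_real_sum integral_complex_of_real[symmetric] complex_norm_square ..
  also have "\<dots> = of_nat m * (\<integral>\<omega>. F (\<lambda>i. Z (e i) \<omega>) * cnj (F (\<lambda>i. Z (e i) \<omega>)) \<partial>M)"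
    by (rule chaos_dirichlet[OF F chaos_cpoly[OF F] S])
  also have "\<dots> = complex_of_real (of_nat m * (\<integral>\<omega>. (cmod (F (\<lambda>i. Z (e i) \<omega>)))\<^sup>2 \<partial>M))"
    unfolding of_real_mult integral_complex_of_real[symmetric] complex_norm_square by simp
  finally show ?thesis unfolding of_real_eq_iff .
qed

lemma chaos_fourth_moment_identity:
  assumes F: "F \<in> chaos S m n" and S: "finite S" "orthonormal_family S e"
  defines "G \<equiv> \<lambda>\<omega>. of_real (2 * (norm (gradient S e F \<omega>))\<^sup>2 * (cmod (F (\<lambda>i. Z (e i) \<omega>)))\<^sup>2)
      + cinner (gradient S e F \<omega>) (gradient S e (\<lambda>z. cnj (F z)) \<omega>) * (cnj (F (\<lambda>i. Z (e i) \<omega>)))\<^sup>2"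
  shows "integrable M G"
    and "of_nat m * complex_of_real (\<integral>\<omega>. cmod (F (\<lambda>i. Z (e i) \<omega>)) ^ 4 \<partial>M) = (\<integral>\<omega>. G \<omega> \<partial>M)"
proof -
  let ?z = "\<lambda>\<omega> i. Z (e i) \<omega>"
  have Fc: "F \<in> cpoly S" by (rule chaos_cpoly[OF F])
  \<comment> \<open>\<open>F z * cnj (H z)\<close> is the fourth power of the modulus. The factor 2
    in the first term of G counts the two occurrences of F, and the single conjugate factor produces
    the second term.\<close>
  define H where "H z = F z * (F z * cnj (F z))" for z
  have Hc: "H \<in> cpoly S" unfolding H_def by (intro cpoly.mult Fc cpoly_cnj)
  have dH: "wirtinger_deriv k H z = 2 * F z * cnj (F z) * wirtinger_deriv k F z + F z ^ 2 * wirtinger_deriv k (\<lambda>z. cnj (F z)) z" for k z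
    unfolding H_def [abs_def] wirtinger_mult(1)[OF Fc cpoly.mult[OF Fc cpoly_cnj[OF Fc]]]
      wirtinger_mult(1)[OF Fc cpoly_cnj[OF Fc]] by (simp add: algebra_simps power2_eq_square)
  have G: "G \<omega> = (\<Sum>k\<in>S. wirtinger_deriv k F (?z \<omega>) * cnj (wirtinger_deriv k H (?z \<omega>)))" for \<omega>
  proof -
    have "wirtinger_deriv k F (?z \<omega>) * cnj (wirtinger_deriv k H (?z \<omega>))
      = (wirtinger_deriv k F (?z \<omega>) * cnj (wirtinger_deriv k F (?z \<omega>))) * (2 * (F (?z \<omega>) * cnj (F (?z \<omega>))))
        + (wirtinger_deriv k F (?z \<omega>) * cnj (wirtinger_deriv k (\<lambda>z. cnj (F z)) (?z \<omega>))) * (cnj (F (?z \<omega>)))\<^sup>2" for k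
      unfolding dH by (simp add: algebra_simps)
    then have "(\<Sum>k\<in>S. wirtinger_deriv k F (?z \<omega>) * cnj (wirtinger_deriv k H (?z \<omega>)))
      = (\<Sum>k\<in>S. wirtinger_deriv k F (?z \<omega>) * cnj (wirtinger_deriv k F (?z \<omega>))) * (2 * (F (?z \<omega>) * cnj (F (?z \<omega>))))
        + cinner (gradient S e F \<omega>) (gradient S e (\<lambda>z. cnj (F z)) \<omega>) * (cnj (F (?z \<omega>)))\<^sup>2"
      unfolding gradient_cinner[OF S] by (simp only: sum.distrib sum_distrib_right)
    also have "(\<Sum>k\<in>S. wirtinger_deriv k F (?z \<omega>) * cnj (wirtinger_deriv k F (?z \<omega>))) = of_real ((norm (gradient S e F \<omega>))\<^sup>2)"
      unfolding gradient_norm_sq[OF S] of_real_sum complex_norm_square ..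
    also have "F (?z \<omega>) * cnj (F (?z \<omega>)) = of_real ((cmod (F (?z \<omega>)))\<^sup>2)" by (rule complex_norm_square[symmetric])
    finally show ?thesis by (simp add: G_def mult_ac)
  qed
  have ik: "integrable M (\<lambda>\<omega>. wirtinger_deriv k F (?z \<omega>) * cnj (wirtinger_deriv k H (?z \<omega>)))" for k
    by (rule cpoly_integrable[OF cpoly.mult[OF cpoly_has_wirtinger(2)[OF Fc] cpoly_cnj[OF cpoly_has_wirtinger(2)[OF Hc]]] S(1)])
  show "integrable M G" unfolding G by (intro Bochner_Integration.integrable_sum ik)
  have "(\<integral>\<omega>. G \<omega> \<partial>M) = (\<Sum>k\<in>S. \<integral>\<omega>. wirtinger_deriv k F (?z \<omega>) * cnj (wirtinger_deriv k H (?z \<omega>)) \<partial>M)"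
    unfolding G by (rule Bochner_Integration.integral_sum[OF ik])
  also have "\<dots> = of_nat m * (\<integral>\<omega>. F (?z \<omega>) * cnj (H (?z \<omega>)) \<partial>M)"
    by (rule chaos_dirichlet[OF F Hc S])
  also have "(\<integral>\<omega>. F (?z \<omega>) * cnj (H (?z \<omega>)) \<partial>M) = complex_of_real (\<integral>\<omega>. cmod (F (?z \<omega>)) ^ 4 \<partial>M)"
  proof -
    have "F (?z \<omega>) * cnj (H (?z \<omega>)) = of_real (cmod (F (?z \<omega>)) ^ 4)" for \<omega>
    proof -
      have "F (?z \<omega>) * cnj (H (?z \<omega>)) = (F (?z \<omega>) * cnj (F (?z \<omega>)))\<^sup>2" by (simp add: H_def power2_eq_square mult_ac)
      also have "\<dots> = of_real (cmod (F (?z \<omega>)) ^ 4)"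
        unfolding complex_norm_square[symmetric] of_real_power[symmetric] power_mult[symmetric] by simp
      finally show ?thesis .
    qed
    then show ?thesis by (simp only: integral_complex_of_real)
  qed
  finally show "of_nat m * complex_of_real (\<integral>\<omega>. cmod (F (?z \<omega>)) ^ 4 \<partial>M) = (\<integral>\<omega>. G \<omega> \<partial>M)" by simp
qed

text \<open>The constant may depend on the bidegree but not on S or F: it is later applied to
  differences of approximants with varying index sets.\<close>

definition fourth_moment_bound :: "nat set \<Rightarrow> (nat \<Rightarrow> 'h cplx) \<Rightarrow> nat \<Rightarrow> nat \<Rightarrow> real \<Rightarrow> bool" where
  "fourth_moment_bound K e m n C \<longleftrightarrow> 0 \<le> C \<and> (\<forall>S F. finite S \<longrightarrow> S \<subseteq> K \<longrightarrow> F \<in> chaos S m n \<longrightarrow>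
     (\<integral>\<omega>. cmod (F (\<lambda>i. Z (e i) \<omega>)) ^ 4 \<partial>M) \<le> C * (\<integral>\<omega>. (cmod (F (\<lambda>i. Z (e i) \<omega>)))\<^sup>2 \<partial>M)\<^sup>2)"

lemma fourth_moment_boundD:
  assumes "fourth_moment_bound K e m n C"
  shows "0 \<le> C" "finite S \<Longrightarrow> S \<subseteq> K \<Longrightarrow> F \<in> chaos S m n \<Longrightarrow>
     (\<integral>\<omega>. cmod (F (\<lambda>i. Z (e i) \<omega>)) ^ 4 \<partial>M) \<le> C * (\<integral>\<omega>. (cmod (F (\<lambda>i. Z (e i) \<omega>)))\<^sup>2 \<partial>M)\<^sup>2"
  using assms unfolding fourth_moment_bound_def by auto

lemma fourth_moment_bound_cnj:
  assumes "fourth_moment_bound K e m n C"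
  shows "fourth_moment_bound K e n m C"
  unfolding fourth_moment_bound_def
proof (intro conjI allI impI fourth_moment_boundD(1)[OF assms])
  fix S F assume "finite S" "S \<subseteq> K" "F \<in> chaos S n m"
  from fourth_moment_boundD(2)[OF assms this(1,2) chaos_cnj[OF this(3)]]
  show "(\<integral>\<omega>. cmod (F (\<lambda>i. Z (e i) \<omega>)) ^ 4 \<partial>M) \<le> C * (\<integral>\<omega>. (cmod (F (\<lambda>i. Z (e i) \<omega>)))\<^sup>2 \<partial>M)\<^sup>2"
    by simp
qed

text \<open>Each component of the gradient lies in bidegree (m - 1, n), so the assumed bound passes
  to the whole gradient by \<open>gradient_moments\<close>, and \<open>chaos_gradient_L2\<close>
  evaluates the second moment. At m = 0 all components vanish.\<close>

lemma chaos_gradient_fourth_moment: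
  assumes b: "m = 0 \<or> fourth_moment_bound K e (m - 1) n C" "0 \<le> C"
    and F: "F \<in> chaos S m n" and S: "finite S" "S \<subseteq> K" "orthonormal_family K e"
  shows "(\<integral>\<omega>. norm (gradient S e F \<omega>) ^ 4 \<partial>M) \<le> C * (of_nat m * (\<integral>\<omega>. (cmod (F (\<lambda>i. Z (e i) \<omega>)))\<^sup>2 \<partial>M))\<^sup>2"
proof -
  note ON = orthonormal_family_subset[OF S(3,2)]
  show ?thesis
    unfolding chaos_gradient_L2[OF F S(1) ON, symmetric]
  proof (rule gradient_moments(4)[OF chaos_cpoly[OF F] S(1) ON b(2)])
    fix k assume "k \<in> S"
    show "(\<integral>\<omega>. cmod (wirtinger_deriv k F (\<lambda>i. Z (e i) \<omega>)) ^ 4 \<partial>M)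
        \<le> C * (\<integral>\<omega>. (cmod (wirtinger_deriv k F (\<lambda>i. Z (e i) \<omega>)))\<^sup>2 \<partial>M)\<^sup>2"
    proof (cases "m = 0")
      case True
      then show ?thesis unfolding chaos_wirtinger(2)[OF F True] by simp
    next
      case False
      then show ?thesis using b(1) fourth_moment_boundD(2)[OF _ S(1,2) chaos_wirtinger(1)[OF F]] by blast
    qed
  qed
qed

text \<open>The identity itself bounds the fourth moment on the chaos of bidegree \<open>(m, n)\<close> by those of
  the gradients, which live in chaoses of smaller degree.\<close>

lemma fourth_moment_bound_step:
  assumes ON: "orthonormal_family K e" and m: "m \<ge> 1"
    and C1: "fourth_moment_bound K e (m - 1) n C1"
    and C2: "n = 0 \<or> fourth_moment_bound K e (n - 1) m C2" "0 \<le> C2"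
  shows "fourth_moment_bound K e m n (9 * C1 * (of_nat m)\<^sup>2 + C2 * (of_nat n)\<^sup>2)"
  unfolding fourth_moment_bound_def
proof (intro conjI allI impI)
  note C1_0 = fourth_moment_boundD(1)[OF C1]
  show "0 \<le> 9 * C1 * (of_nat m)\<^sup>2 + C2 * (of_nat n)\<^sup>2" using C1_0 C2 by simp
  fix S F assume S: "finite S" "S \<subseteq> K" and F: "F \<in> chaos S m n"
  note ONS = orthonormal_family_subset[OF ON S(2)]
  note Fc = chaos_cpoly[OF F]
  let ?F = "\<lambda>\<omega>. F (\<lambda>i. Z (e i) \<omega>)" and ?F' = "\<lambda>z. cnj (F z)"
  let ?g = "gradient S e F" and ?g' = "gradient S e ?F'"
  define R where "R = (\<integral>\<omega>. (cmod (?F \<omega>))\<^sup>2 \<partial>M)"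
  define Q where "Q = (\<integral>\<omega>. cmod (?F \<omega>) ^ 4 \<partial>M)"
  define a where "a = (\<integral>\<omega>. norm (?g \<omega>) ^ 4 \<partial>M)"
  define b where "b = (\<integral>\<omega>. norm (?g' \<omega>) ^ 4 \<partial>M)"
  have a_le: "a \<le> C1 * (of_nat m * R)\<^sup>2"
    unfolding a_def R_def by (rule chaos_gradient_fourth_moment[OF _ C1_0 F S ON]) (use C1 in simp)
  have b_le: "b \<le> C2 * (of_nat n * R)\<^sup>2"
    using chaos_gradient_fourth_moment[OF C2 chaos_cnj[OF F] S ON] by (simp add: b_def R_def)
  note ia = gradient_moments(2)[OF Fc S(1) ONS] and ib = gradient_moments(2)[OF cpoly_cnj[OF Fc] S(1) ONS]
  note iQ = cpoly_integrable_power[OF Fc S(1), of e 4]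
  define G where "G \<omega> = of_real (2 * (norm (?g \<omega>))\<^sup>2 * (cmod (?F \<omega>))\<^sup>2) + cinner (?g \<omega>) (?g' \<omega>) * (cnj (?F \<omega>))\<^sup>2" for \<omega>
  note G = chaos_fourth_moment_identity[OF F S(1) ONS, folded G_def [abs_def]]
  \<comment> \<open>Young's inequality with weight 1/2 on the fourth power of F, so that this term
    can be absorbed on the left since m is at least 1; doubling the rest gives the constants 9 and
    1.\<close>
  have pw: "cmod (G \<omega>) \<le> 9/2 * norm (?g \<omega>) ^ 4 + 1/2 * norm (?g' \<omega>) ^ 4 + 1/2 * cmod (?F \<omega>) ^ 4" for \<omega>
  proof -
    define x where "x = norm (?g \<omega>)" define x' where "x' = norm (?g' \<omega>)" define y where "y = (cmod (?F \<omega>))\<^sup>2"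
    have "cmod (G \<omega>) \<le> 2 * x\<^sup>2 * y + x * x' * y"
      unfolding G_def x_def x'_def y_def
      by (rule order_trans[OF norm_triangle_ineq], rule add_mono)
        (auto simp: norm_mult norm_power intro!: mult_right_mono cmod_cinner_le)
    also have "x * x' * y \<le> (x\<^sup>2 + x'\<^sup>2) / 2 * y"
      using sum_squares_bound[of x x'] by (intro mult_right_mono) (auto simp: y_def)
    also have "2 * x\<^sup>2 * y + (x\<^sup>2 + x'\<^sup>2) / 2 * y \<le> 9/2 * (x\<^sup>2)\<^sup>2 + 1/2 * (x'\<^sup>2)\<^sup>2 + 1/2 * y\<^sup>2"
    proof -
      \<comment> \<open>The difference of the two sides written as a sum of squares.\<close>
      have "9/2 * (x\<^sup>2)\<^sup>2 + 1/2 * (x'\<^sup>2)\<^sup>2 + 1/2 * y\<^sup>2 = 2 * x\<^sup>2 * y + (x\<^sup>2 + x'\<^sup>2) / 2 * y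
        + (1/4 * (4 * x\<^sup>2 - y)\<^sup>2 + 1/8 * (2 * x\<^sup>2 - y)\<^sup>2 + 1/8 * (2 * x'\<^sup>2 - y)\<^sup>2)"
        by (simp add: power2_eq_square field_simps)
      moreover have "0 \<le> 1/4 * (4 * x\<^sup>2 - y)\<^sup>2 + 1/8 * (2 * x\<^sup>2 - y)\<^sup>2 + 1/8 * (2 * x'\<^sup>2 - y)\<^sup>2" by simp
      ultimately show ?thesis by linarith
    qed
    finally show ?thesis by (simp add: x_def x'_def y_def power_mult[symmetric])
  qed
  have "of_nat m * Q = cmod (of_nat m * complex_of_real Q)"
  proof -
    have "Q \<ge> 0" unfolding Q_def by (intro integral_nonneg_AE) simp
    then show ?thesis by (simp add: norm_mult)
  qed
  also have "\<dots> = cmod (\<integral>\<omega>. G \<omega> \<partial>M)" unfolding Q_def G(2) ..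
  also have "\<dots> \<le> (\<integral>\<omega>. cmod (G \<omega>) \<partial>M)" by (rule integral_norm_bound)
  also have "\<dots> \<le> (\<integral>\<omega>. 9/2 * norm (?g \<omega>) ^ 4 + 1/2 * norm (?g' \<omega>) ^ 4 + 1/2 * cmod (?F \<omega>) ^ 4 \<partial>M)"
    using G(1) ia ib iQ by (intro integral_mono pw) auto
  also have "\<dots> = 9/2 * a + 1/2 * b + 1/2 * Q"
    using ia ib iQ by (simp add: a_def b_def Q_def)
  finally have "of_nat m * Q \<le> 9/2 * a + 1/2 * b + 1/2 * Q" .
  moreover have "1 * Q \<le> of_nat m * Q"
    using m by (intro mult_right_mono) (auto simp: Q_def intro!: integral_nonneg_AE)
  ultimately have "Q \<le> 9 * a + b" by simp
  also have "\<dots> \<le> 9 * (C1 * (of_nat m * R)\<^sup>2) + C2 * (of_nat n * R)\<^sup>2" using a_le b_le by simp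
  finally show "(\<integral>\<omega>. cmod (?F \<omega>) ^ 4 \<partial>M) \<le> (9 * C1 * (of_nat m)\<^sup>2 + C2 * (of_nat n)\<^sup>2) * (\<integral>\<omega>. (cmod (?F \<omega>))\<^sup>2 \<partial>M)\<^sup>2"
    by (simp add: Q_def R_def power_mult_distrib algebra_simps)
qed

text \<open>Both (m - 1, n) and (n - 1, m) have smaller total degree. The step requires m \<ge> 1,
  so a bidegree with m = 0 < n is reached by conjugation, and (0, 0) consists of constants.\<close>

lemma fourth_moment_bound_ex:
  assumes ON: "orthonormal_family K e"
  shows "\<exists>C. fourth_moment_bound K e m n C"
proof (induction "m + n" arbitrary: m n rule: less_induct)
  case less
  have pos: "\<exists>C. fourth_moment_bound K e m' n' C" if eq: "m' + n' = m + n" and m': "m' \<ge> 1" for m' n'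
  proof -
    have "m' - 1 + n' < m + n" using eq m' by linarith
    from less[OF this] obtain C1 where C1: "fourth_moment_bound K e (m' - 1) n' C1" by blast
    obtain C2 where C2: "n' = 0 \<or> fourth_moment_bound K e (n' - 1) m' C2" "0 \<le> C2"
    proof (cases "n' = 0")
      case True
      then show ?thesis using that[of 0] by simp
    next
      case False
      then have "n' - 1 + m' < m + n" using eq by linarith
      from less[OF this] obtain C where "fourth_moment_bound K e (n' - 1) m' C" by blast
      then show ?thesis using that[of C] fourth_moment_boundD(1) by blast
    qed
    show ?thesis using fourth_moment_bound_step[OF ON m' C1 C2] by blast
  qed
  consider "m \<ge> 1" | "n \<ge> 1" | "m = 0" "n = 0" by linarith
  then show ?case
  proof cases
    case 1
    then show ?thesis using pos by simp
  next
    case 2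
    then obtain C where "fourth_moment_bound K e n m C" using pos[of n m] by auto
    then show ?thesis using fourth_moment_bound_cnj by blast
  next
    case 3
    have "fourth_moment_bound K e 0 0 1"
      unfolding fourth_moment_bound_def
    proof (intro conjI allI impI)
      fix S F assume "F \<in> chaos S 0 0"
      then obtain c where "F = (\<lambda>_. c)" using chaos_0_0 by blast
      then show "(\<integral>\<omega>. cmod (F (\<lambda>i. Z (e i) \<omega>)) ^ 4 \<partial>M) \<le> 1 * (\<integral>\<omega>. (cmod (F (\<lambda>i. Z (e i) \<omega>)))\<^sup>2 \<partial>M)\<^sup>2"
        by (simp add: prob_space power_mult[symmetric])
    qed simp
    then show ?thesis using 3 by blast
  qed
qed

end

section \<open>Mean-square limits\<close>

text \<open>Increments decay geometrically with ratio \<open>sqrt (1/2)\<close>, and the geometric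
  sum bounds all tails uniformly in their length.\<close>

lemma Cauchy_geometric:
  fixes x :: "nat \<Rightarrow> 'a::real_normed_vector"
  assumes "\<And>i. (norm (x (Suc i) - x i))\<^sup>2 \<le> B * (1/2) ^ i"
  shows "Cauchy x"
proof -
  have B: "0 \<le> B" using order_trans[OF zero_le_power2 assms[of 0]] by simp
  define c where "c = sqrt (1/2)"
  have c: "0 \<le> c" "c < 1" by (simp_all add: c_def)
  have step: "norm (x (Suc i) - x i) \<le> sqrt B * c ^ i" for i
  proof (rule power2_le_imp_le)
    show "(norm (x (Suc i) - x i))\<^sup>2 \<le> (sqrt B * c ^ i)\<^sup>2"
      using assms[of i] B by (simp add: c_def power_mult_distrib power_mult[symmetric] mult.commute[of i 2]) (simp add: power_mult)
  qed (use B c in simp)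
  \<comment> \<open>Chosen so that C times 1 - c is \<open>sqrt B\<close>, which makes the tail
    bound telescope in the induction.\<close>
  define C where "C = sqrt B / (1 - c)"
  have C: "0 \<le> C" using B c by (simp add: C_def)
  have tail: "norm (x (i + k) - x i) \<le> C * c ^ i * (1 - c ^ k)" for i k
  proof (induction k)
    case (Suc k)
    have "norm (x (i + Suc k) - x i) \<le> norm (x (Suc (i + k)) - x (i + k)) + norm (x (i + k) - x i)"
      using norm_triangle_ineq[of "x (Suc (i + k)) - x (i + k)" "x (i + k) - x i"] by simp
    also have "\<dots> \<le> sqrt B * c ^ (i + k) + C * c ^ i * (1 - c ^ k)" by (intro add_mono step Suc)
    also have "sqrt B = C * (1 - c)" using c by (simp add: C_def)
    finally show ?case by (simp add: power_add algebra_simps)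
  qed simp
  have tail': "norm (x (i + k) - x i) \<le> C * c ^ i" for i k
  proof -
    have "C * c ^ i * (1 - c ^ k) \<le> C * c ^ i * 1" using C c by (intro mult_left_mono) auto
    with tail[of i k] show ?thesis by simp
  qed
  show ?thesis
  proof (rule metric_CauchyI)
    fix \<epsilon> :: real assume "\<epsilon> > 0"
    have "(\<lambda>i. C * c ^ i) \<longlonglongrightarrow> C * 0" using c by (intro tendsto_mult tendsto_const LIMSEQ_power_zero) simp
    then have "(\<lambda>i. C * c ^ i) \<longlonglongrightarrow> 0" by simp
    from order_tendstoD(2)[OF this, of "\<epsilon>/2"] obtain i where i: "C * c ^ i < \<epsilon> / 2"
      using \<open>\<epsilon> > 0\<close> unfolding eventually_sequentially by auto
    have "dist (x a) (x b) < \<epsilon>" if "a \<ge> i" "b \<ge> i" for a b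
    proof -
      have "norm (x a - x i) < \<epsilon> / 2" "norm (x b - x i) < \<epsilon> / 2"
        using tail'[of i "a - i"] tail'[of i "b - i"] i that by auto
      then show ?thesis
        using dist_triangle2[of "x a" "x b" "x i"] by (simp add: dist_norm)
    qed
    then show "\<exists>i. \<forall>a\<ge>i. \<forall>b\<ge>i. dist (x a) (x b) < \<epsilon>" by blast
  qed
qed

text \<open>Fatou's lemma for limits almost everywhere, packaged so that integrability of the limit
  comes with the bound.\<close>

lemma Fatou_integral_bound:
  fixes g :: "'w \<Rightarrow> real" and f :: "nat \<Rightarrow> 'w \<Rightarrow> real"
  assumes f: "\<And>i. integrable M (f i)" "\<And>i \<omega>. 0 \<le> f i \<omega>" and g: "g \<in> borel_measurable M" "\<And>\<omega>. 0 \<le> g \<omega>"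
    and lim: "AE \<omega> in M. (\<lambda>i. f i \<omega>) \<longlonglongrightarrow> g \<omega>" and b: "\<And>i. (\<integral>\<omega>. f i \<omega> \<partial>M) \<le> b i" "b \<longlonglongrightarrow> B"
  shows "integrable M g" "(\<integral>\<omega>. g \<omega> \<partial>M) \<le> B"
proof -
  have fm: "f i \<in> borel_measurable M" for i using f(1) by simp
  have b0: "0 \<le> b i" for i
    using order_trans[OF _ b(1)] f(2) by (metis integral_nonneg_AE AE_I2)
  then have B0: "0 \<le> B" by (intro LIMSEQ_le_const[OF b(2)]) auto
  have "(\<integral>\<^sup>+\<omega>. ennreal (g \<omega>) \<partial>M) = (\<integral>\<^sup>+\<omega>. liminf (\<lambda>i. ennreal (f i \<omega>)) \<partial>M)"
  proof (rule nn_integral_cong_AE)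
    show "AE \<omega> in M. ennreal (g \<omega>) = liminf (\<lambda>i. ennreal (f i \<omega>))"
      using lim
    proof eventually_elim
      case (elim \<omega>)
      from lim_imp_Liminf[OF _ tendsto_ennrealI[OF elim]] show ?case by simp
    qed
  qed
  also have "\<dots> \<le> liminf (\<lambda>i. \<integral>\<^sup>+\<omega>. ennreal (f i \<omega>) \<partial>M)"
    using fm by (intro nn_integral_liminf) simp
  also have "\<dots> = liminf (\<lambda>i. ennreal (\<integral>\<omega>. f i \<omega> \<partial>M))"
    using f by (subst nn_integral_eq_integral) auto
  also have "\<dots> \<le> liminf (\<lambda>i. ennreal (b i))"
    by (intro Liminf_mono always_eventually allI ennreal_leI b)
  also have "\<dots> = ennreal B"
    by (rule lim_imp_Liminf[OF _ tendsto_ennrealI[OF b(2)]]) simp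
  finally have le: "(\<integral>\<^sup>+\<omega>. ennreal (g \<omega>) \<partial>M) \<le> ennreal B" .
  then have "(\<integral>\<^sup>+\<omega>. ennreal (g \<omega>) \<partial>M) < \<infinity>" using le_less_trans[OF _ ennreal_less_top] by auto
  then show ig: "integrable M g"
    using g by (intro integrableI_bounded) auto
  have "ennreal (\<integral>\<omega>. g \<omega> \<partial>M) \<le> ennreal B"
    using le nn_integral_eq_integral[OF ig] g(2) by simp
  then show "(\<integral>\<omega>. g \<omega> \<partial>M) \<le> B" by (simp only: ennreal_le_iff[OF B0])
qed

lemma norm_sq_tendsto:
  assumes "(\<lambda>i. x i) \<longlonglongrightarrow> y" shows "(\<lambda>i. norm (a - x i) ^ k) \<longlonglongrightarrow> norm (a - y :: 'a::real_normed_vector) ^ k"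
  by (intro tendsto_power tendsto_norm tendsto_diff tendsto_const assms)

text \<open>The Riesz-Fischer argument for vector-valued functions: a subsequence with rapidly
  decreasing increments converges almost everywhere, and Fatou's lemma turns this back into
  mean-square convergence of the full sequence.\<close>

lemma (in prob_space) L2_complete:
  fixes X :: "nat \<Rightarrow> 'a \<Rightarrow> 'b::{real_normed_vector, second_countable_topology, complete_space}"
  assumes X: "\<And>N. square_integrable M (X N)"
    and cauchy: "\<And>\<epsilon>. \<epsilon> > 0 \<Longrightarrow> \<exists>N0. \<forall>N\<ge>N0. \<forall>L\<ge>N0. (\<integral>\<omega>. (norm (X N \<omega> - X L \<omega>))\<^sup>2 \<partial>M) < \<epsilon>"
  shows "\<exists>x. L2_converges M X x"
proof -
  have Xm[measurable]: "X N \<in> borel_measurable M" for N using X by (simp add: square_integrable_def)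
  have d2: "integrable M (\<lambda>\<omega>. (norm (X N \<omega> - X L \<omega>))\<^sup>2)" for N L
    using square_integrable_diff[OF X X] by (simp add: square_integrable_def)
  \<comment> \<open>Integrals below \<open>(1/4) ^ i\<close> survive the weights
    \<open>2 ^ i\<close> used next: the weighted sum has finite integral, and where it equals a
    finite B the squared increments are at most \<open>B * (1/2) ^ i\<close>.\<close>
  have "\<exists>r. \<forall>i. (\<forall>N\<ge>r i. \<forall>L\<ge>r i. (\<integral>\<omega>. (norm (X N \<omega> - X L \<omega>))\<^sup>2 \<partial>M) < (1/4) ^ i) \<and> r i < r (Suc i)"
  proof (rule dependent_nat_choice)
    show "\<exists>n. \<forall>N\<ge>n. \<forall>L\<ge>n. (\<integral>\<omega>. (norm (X N \<omega> - X L \<omega>))\<^sup>2 \<partial>M) < (1/4) ^ 0" by (rule cauchy) simp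
    fix n i
    obtain N0 where "\<forall>N\<ge>N0. \<forall>L\<ge>N0. (\<integral>\<omega>. (norm (X N \<omega> - X L \<omega>))\<^sup>2 \<partial>M) < (1/4) ^ Suc i"
      using cauchy[of "(1/4) ^ Suc i"] by auto
    then show "\<exists>k. (\<forall>N\<ge>k. \<forall>L\<ge>k. (\<integral>\<omega>. (norm (X N \<omega> - X L \<omega>))\<^sup>2 \<partial>M) < (1/4) ^ Suc i) \<and> n < k"
      by (intro exI[of _ "max N0 (Suc n)"]) auto
  qed
  then obtain r where r: "\<And>i N L. N \<ge> r i \<Longrightarrow> L \<ge> r i \<Longrightarrow> (\<integral>\<omega>. (norm (X N \<omega> - X L \<omega>))\<^sup>2 \<partial>M) < (1/4) ^ i"
    and mono: "\<And>i. r i < r (Suc i)" by blast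
  define \<Delta> where "\<Delta> i \<omega> = (norm (X (r (Suc i)) \<omega> - X (r i) \<omega>))\<^sup>2" for i \<omega>
  have \<Delta>m[measurable]: "\<Delta> i \<in> borel_measurable M" for i unfolding \<Delta>_def by measurable
  have "(\<integral>\<^sup>+\<omega>. (\<Sum>i. ennreal (2 ^ i * \<Delta> i \<omega>)) \<partial>M) = (\<Sum>i. \<integral>\<^sup>+\<omega>. ennreal (2 ^ i * \<Delta> i \<omega>) \<partial>M)"
    by (rule nn_integral_suminf) simp
  also have "\<dots> \<le> (\<Sum>i. ennreal ((1/2) ^ i))"
  proof (intro suminf_le allI)
    fix i
    have "(\<integral>\<^sup>+\<omega>. ennreal (2 ^ i * \<Delta> i \<omega>) \<partial>M) = ennreal (\<integral>\<omega>. 2 ^ i * \<Delta> i \<omega> \<partial>M)"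
      using d2 by (intro nn_integral_eq_integral) (auto simp: \<Delta>_def)
    also have "(\<integral>\<omega>. 2 ^ i * \<Delta> i \<omega> \<partial>M) \<le> 2 ^ i * (1/4) ^ i"
      using r[of i "r (Suc i)" "r i"] mono[of i] by (simp add: \<Delta>_def mult_left_mono less_imp_le)
    also have "(2::real) ^ i * (1/4) ^ i = (1/2) ^ i" by (simp add: power_mult_distrib[symmetric])
    finally show "(\<integral>\<^sup>+\<omega>. ennreal (2 ^ i * \<Delta> i \<omega>) \<partial>M) \<le> ennreal ((1/2) ^ i)" by (simp add: ennreal_leI)
  qed auto
  also have "\<dots> = ennreal (\<Sum>i. (1/2) ^ i)" by (rule suminf_ennreal2) (auto intro!: summable_geometric)
  finally have "(\<integral>\<^sup>+\<omega>. (\<Sum>i. ennreal (2 ^ i * \<Delta> i \<omega>)) \<partial>M) < \<infinity>"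
    by (rule le_less_trans) (simp add: ennreal_less_top)
  then have fin: "(\<integral>\<^sup>+\<omega>. (\<Sum>i. ennreal (2 ^ i * \<Delta> i \<omega>)) \<partial>M) \<noteq> \<infinity>" by (rule less_imp_neq)
  define S where "S \<omega> = (\<Sum>i. ennreal (2 ^ i * \<Delta> i \<omega>))" for \<omega>
  have Sm[measurable]: "S \<in> borel_measurable M" unfolding S_def by measurable
  have AES: "AE \<omega> in M. S \<omega> \<noteq> \<infinity>" unfolding S_def by (rule nn_integral_PInf_AE[OF _ fin]) simp
  \<comment> \<open>Setting the sequence to 0 on the exceptional set makes it converge everywhere,
    so that the limit is measurable.\<close>
  define Y where "Y i \<omega> = (if S \<omega> = \<infinity> then 0 else X (r i) \<omega>)" for i \<omega>
  have Ym: "Y i \<in> borel_measurable M" for i unfolding Y_def by measurable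
  have "Cauchy (\<lambda>i. Y i \<omega>)" for \<omega>
  proof (cases "S \<omega> = \<infinity>")
    case True
    then have "(\<lambda>i. Y i \<omega>) = (\<lambda>_. 0)" by (simp add: Y_def)
    then show ?thesis using convergent_Cauchy[OF convergent_const, of 0] by metis
  next
    case False
    then obtain B where B: "S \<omega> = ennreal B" "0 \<le> B" by (cases "S \<omega>") auto
    show ?thesis
    proof (rule Cauchy_geometric[of _ B])
      fix i
      have "ennreal (2 ^ i * \<Delta> i \<omega>) \<le> S \<omega>"
        unfolding S_def using sum_le_suminf[of "\<lambda>i. ennreal (2 ^ i * \<Delta> i \<omega>)" "{i}"] by simp
      then have "2 ^ i * \<Delta> i \<omega> \<le> B" using B by simp
      then have "\<Delta> i \<omega> \<le> B * (1/2) ^ i" by (simp add: field_simps)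
      then show "(norm (Y (Suc i) \<omega> - Y i \<omega>))\<^sup>2 \<le> B * (1/2) ^ i" using False by (simp add: Y_def \<Delta>_def)
    qed
  qed
  then have "\<exists>x. \<forall>\<omega>. (\<lambda>i. Y i \<omega>) \<longlonglongrightarrow> x \<omega>"
    by (intro choice allI) (simp add: Cauchy_convergent_iff convergent_def)
  then obtain x where x: "\<And>\<omega>. (\<lambda>i. Y i \<omega>) \<longlonglongrightarrow> x \<omega>" by blast
  have xm[measurable]: "x \<in> borel_measurable M" by (rule borel_measurable_LIMSEQ_metric[OF Ym x])
  have lim: "AE \<omega> in M. (\<lambda>i. X (r i) \<omega>) \<longlonglongrightarrow> x \<omega>"
    using AES
  proof eventually_elim
    case (elim \<omega>)
    then show ?case using x[of \<omega>] by (simp add: Y_def)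
  qed
  have rge: "i \<le> r i" for i
  proof (induction i)
    case (Suc i)
    then show ?case using mono[of i] by simp
  qed simp
  have tail: "integrable M (\<lambda>\<omega>. (norm (X N \<omega> - x \<omega>))\<^sup>2)" "(\<integral>\<omega>. (norm (X N \<omega> - x \<omega>))\<^sup>2 \<partial>M) \<le> (1/4) ^ i"
    if "N \<ge> r i" for N i
  proof -
    have rm: "r i \<le> r (j + i)" for j
    proof (induction j)
      case (Suc j)
      then show ?case using mono[of "j + i"] by simp
    qed simp
    have l: "AE \<omega> in M. (\<lambda>j. (norm (X N \<omega> - X (r (j + i)) \<omega>))\<^sup>2) \<longlonglongrightarrow> (norm (X N \<omega> - x \<omega>))\<^sup>2"
      using lim by eventually_elim (rule norm_sq_tendsto[OF LIMSEQ_ignore_initial_segment])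
    have bd: "(\<integral>\<omega>. (norm (X N \<omega> - X (r (j + i)) \<omega>))\<^sup>2 \<partial>M) \<le> (1/4) ^ i" for j
      using r[OF that rm] by (simp add: less_imp_le)
    show "integrable M (\<lambda>\<omega>. (norm (X N \<omega> - x \<omega>))\<^sup>2)" "(\<integral>\<omega>. (norm (X N \<omega> - x \<omega>))\<^sup>2 \<partial>M) \<le> (1/4) ^ i"
      by (rule Fatou_integral_bound[OF d2 _ _ _ l bd tendsto_const]; simp)+
  qed
  have "square_integrable M (\<lambda>\<omega>. X (r 0) \<omega> - x \<omega>)" using tail(1)[of 0 "r 0"] by (simp add: square_integrable_def)
  from square_integrable_diff[OF X this, of "r 0"] have sx: "square_integrable M x" by simp
  have "(\<lambda>N. \<integral>\<omega>. (norm (X N \<omega> - x \<omega>))\<^sup>2 \<partial>M) \<longlonglongrightarrow> 0"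
  proof (rule LIMSEQ_I)
    fix \<epsilon> :: real assume "\<epsilon> > 0"
    obtain i where "(1/4 :: real) ^ i < \<epsilon>" using real_arch_pow_inv[OF \<open>\<epsilon> > 0\<close>, of "1/4"] by auto
    then have "norm ((\<integral>\<omega>. (norm (X N \<omega> - x \<omega>))\<^sup>2 \<partial>M) - 0) < \<epsilon>" if "N \<ge> r i" for N
      using tail(2)[OF that] integral_nonneg_AE[OF AE_I2, of M "\<lambda>\<omega>. (norm (X N \<omega> - x \<omega>))\<^sup>2"] by simp
    then show "\<exists>n. \<forall>N\<ge>n. norm ((\<integral>\<omega>. (norm (X N \<omega> - x \<omega>))\<^sup>2 \<partial>M) - 0) < \<epsilon>" by blast
  qed
  then show ?thesis using X sx unfolding L2_converges_def by blast
qed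

lemma norm_diff_sq_bound: "(norm (a - b))\<^sup>2 \<le> 2 * (norm (a - c))\<^sup>2 + 2 * (norm (b - c :: 'a::real_normed_vector))\<^sup>2"
proof -
  have "norm (a - b) \<le> norm (a - c) + norm (b - c)"
    using norm_triangle_ineq4[of "a - c" "b - c"] by simp
  then have "(norm (a - b))\<^sup>2 \<le> (norm (a - c) + norm (b - c))\<^sup>2" by (intro power_mono) auto
  then show ?thesis using sum_squares_bound[of "norm (a - c)" "norm (b - c)"] by (simp add: power2_sum)
qed

section \<open>Convergence in fourth mean\<close>

definition L4_converges ::
  "'w measure \<Rightarrow> (nat \<Rightarrow> 'w \<Rightarrow> 'b::{real_normed_vector, second_countable_topology}) \<Rightarrow> ('w \<Rightarrow> 'b) \<Rightarrow> bool" where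
  "L4_converges M X x \<longleftrightarrow> (\<forall>N. X N \<in> borel_measurable M \<and> integrable M (\<lambda>\<omega>. norm (X N \<omega>) ^ 4)) \<and>
     x \<in> borel_measurable M \<and> integrable M (\<lambda>\<omega>. norm (x \<omega>) ^ 4) \<and>
     (\<lambda>N. \<integral>\<omega>. norm (X N \<omega> - x \<omega>) ^ 4 \<partial>M) \<longlonglongrightarrow> 0"

text \<open>\<open>norm_diff_sq_bound\<close> with c = 0, squared once more; 8 is twice the square
  of 2.\<close>

lemma norm_pow4_diff: "norm (a - b) ^ 4 \<le> 8 * norm a ^ 4 + 8 * norm (b :: 'a::real_normed_vector) ^ 4"
proof -
  have "(norm (a - b))\<^sup>2 \<le> 2 * (norm a)\<^sup>2 + 2 * (norm b)\<^sup>2" using norm_diff_sq_bound[of a b 0] by simp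
  then have "((norm (a - b))\<^sup>2)\<^sup>2 \<le> (2 * (norm a)\<^sup>2 + 2 * (norm b)\<^sup>2)\<^sup>2" by (intro power_mono) auto
  also have "\<dots> \<le> 8 * ((norm a)\<^sup>2)\<^sup>2 + 8 * ((norm b)\<^sup>2)\<^sup>2"
    using sum_squares_bound[of "(norm a)\<^sup>2" "(norm b)\<^sup>2"] by (simp add: power2_sum power_mult_distrib)
  finally show ?thesis by (simp add: power_mult[symmetric])
qed

lemma integrable_pow4_diff:
  fixes x y :: "'w \<Rightarrow> 'b::{real_normed_vector, second_countable_topology}"
  assumes [measurable]: "x \<in> borel_measurable M" "y \<in> borel_measurable M"
    and i: "integrable M (\<lambda>\<omega>. norm (x \<omega>) ^ 4)" "integrable M (\<lambda>\<omega>. norm (y \<omega>) ^ 4)"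
  shows "integrable M (\<lambda>\<omega>. norm (x \<omega> - y \<omega>) ^ 4)"
proof (rule Bochner_Integration.integrable_bound)
  show "integrable M (\<lambda>\<omega>. 8 * norm (x \<omega>) ^ 4 + 8 * norm (y \<omega>) ^ 4)" using i by auto
  show "AE \<omega> in M. norm (norm (x \<omega> - y \<omega>) ^ 4) \<le> norm (8 * norm (x \<omega>) ^ 4 + 8 * norm (y \<omega>) ^ 4)"
    using norm_pow4_diff by (intro AE_I2) (simp add: order_trans[OF _ abs_ge_self])
qed simp

text \<open>Hypercontractivity upgrades convergence in \<open>L\<^sup>2\<close> to convergence in \<open>L\<^sup>4\<close>.\<close>

lemma L2_converges_imp_L4:
  fixes X :: "nat \<Rightarrow> 'w \<Rightarrow> 'b::{real_normed_vector, second_countable_topology}"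
  assumes X: "L2_converges M X x" and i4: "\<And>N. integrable M (\<lambda>\<omega>. norm (X N \<omega>) ^ 4)" and C: "0 \<le> C"
    and hyp: "\<And>N L. (\<integral>\<omega>. norm (X N \<omega> - X L \<omega>) ^ 4 \<partial>M) \<le> C * (\<integral>\<omega>. (norm (X N \<omega> - X L \<omega>))\<^sup>2 \<partial>M)\<^sup>2"
  shows "L4_converges M X x"
proof -
  have sX: "square_integrable M (X N)" "square_integrable M x" for N using X by (auto simp: L2_converges_def)
  have [measurable]: "X N \<in> borel_measurable M" "x \<in> borel_measurable M" for N
    using sX by (auto simp: square_integrable_def)
  define d where "d N = (\<integral>\<omega>. (norm (X N \<omega> - x \<omega>))\<^sup>2 \<partial>M)" for N
  have d0: "d \<longlonglongrightarrow> 0" using X by (simp add: L2_converges_def d_def [abs_def])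
  have id: "integrable M (\<lambda>\<omega>. (norm (X N \<omega> - x \<omega>))\<^sup>2)" for N
    using square_integrable_diff[OF sX] by (simp add: square_integrable_def)
  have idd: "integrable M (\<lambda>\<omega>. (norm (X N \<omega> - X L \<omega>))\<^sup>2)" for N L
    using square_integrable_diff[OF sX(1) sX(1)] by (simp add: square_integrable_def)
  have dNL: "(\<integral>\<omega>. (norm (X N \<omega> - X L \<omega>))\<^sup>2 \<partial>M) \<le> 2 * d N + 2 * d L" for N L
  proof -
    have "(\<integral>\<omega>. (norm (X N \<omega> - X L \<omega>))\<^sup>2 \<partial>M) \<le> (\<integral>\<omega>. 2 * (norm (X N \<omega> - x \<omega>))\<^sup>2 + 2 * (norm (X L \<omega> - x \<omega>))\<^sup>2 \<partial>M)"
      using id idd by (intro integral_mono norm_diff_sq_bound) auto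
    then show ?thesis using id by (simp add: d_def)
  qed
  have "(\<lambda>N. \<integral>\<omega>. norm ((norm (X N \<omega> - x \<omega>))\<^sup>2) \<partial>M) \<longlonglongrightarrow> 0" using d0 by (simp add: d_def [abs_def])
  \<comment> \<open>Fatou's lemma asks for convergence almost everywhere, which mean-square
    convergence supplies along a subsequence; \<open>hyp\<close> is then applied to
    \<open>X N\<close> against \<open>X (r i)\<close> with i tending to infinity.\<close>
  from tendsto_L1_AE_subseq[OF id this] obtain r where r: "strict_mono r"
    "AE \<omega> in M. (\<lambda>i. (norm (X (r i) \<omega> - x \<omega>))\<^sup>2) \<longlonglongrightarrow> 0" by blast
  have lim: "AE \<omega> in M. (\<lambda>i. X (r i) \<omega>) \<longlonglongrightarrow> x \<omega>"
    using r(2)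
  proof eventually_elim
    case (elim \<omega>)
    from tendsto_real_sqrt[OF elim] have "(\<lambda>i. norm (X (r i) \<omega> - x \<omega>)) \<longlonglongrightarrow> 0" by simp
    then show ?case by (simp add: tendsto_norm_zero_iff LIM_zero_iff)
  qed
  have dr: "(\<lambda>i. d (r i)) \<longlonglongrightarrow> 0" using LIMSEQ_subseq_LIMSEQ[OF d0 r(1)] by (simp add: o_def)
  have tail: "integrable M (\<lambda>\<omega>. norm (X N \<omega> - x \<omega>) ^ 4)" "(\<integral>\<omega>. norm (X N \<omega> - x \<omega>) ^ 4 \<partial>M) \<le> C * (2 * d N)\<^sup>2" for N
  proof -
    have i: "integrable M (\<lambda>\<omega>. norm (X N \<omega> - X (r i) \<omega>) ^ 4)" for i
      by (rule integrable_pow4_diff[OF _ _ i4 i4]) simp_all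
    have l: "AE \<omega> in M. (\<lambda>i. norm (X N \<omega> - X (r i) \<omega>) ^ 4) \<longlonglongrightarrow> norm (X N \<omega> - x \<omega>) ^ 4"
      using lim by eventually_elim (rule norm_sq_tendsto)
    have bd: "(\<integral>\<omega>. norm (X N \<omega> - X (r i) \<omega>) ^ 4 \<partial>M) \<le> C * (2 * d N + 2 * d (r i))\<^sup>2" for i
      using C dNL by (intro order_trans[OF hyp] mult_left_mono power_mono) (auto intro!: integral_nonneg_AE)
    have bl: "(\<lambda>i. C * (2 * d N + 2 * d (r i))\<^sup>2) \<longlonglongrightarrow> C * (2 * d N + 2 * 0)\<^sup>2"
      by (intro tendsto_mult tendsto_const tendsto_power tendsto_add dr)
    show "integrable M (\<lambda>\<omega>. norm (X N \<omega> - x \<omega>) ^ 4)" "(\<integral>\<omega>. norm (X N \<omega> - x \<omega>) ^ 4 \<partial>M) \<le> C * (2 * d N)\<^sup>2"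
      using Fatou_integral_bound[OF i _ _ _ l bd bl] by simp_all
  qed
  have "integrable M (\<lambda>\<omega>. norm (X 0 \<omega> - (X 0 \<omega> - x \<omega>)) ^ 4)"
    by (rule integrable_pow4_diff[OF _ _ i4 tail(1)]) simp_all
  then have ix: "integrable M (\<lambda>\<omega>. norm (x \<omega>) ^ 4)" by simp
  have "(\<lambda>N. C * (2 * d N)\<^sup>2) \<longlonglongrightarrow> C * (2 * 0)\<^sup>2"
    by (intro tendsto_mult tendsto_const tendsto_power d0)
  then have z: "(\<lambda>N. C * (2 * d N)\<^sup>2) \<longlonglongrightarrow> 0" by simp
  have "(\<lambda>N. \<integral>\<omega>. norm (X N \<omega> - x \<omega>) ^ 4 \<partial>M) \<longlonglongrightarrow> 0"
  proof (rule tendsto_sandwich[OF always_eventually[OF allI] always_eventually[OF allI] tendsto_const z])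
    show "0 \<le> (\<integral>\<omega>. norm (X N \<omega> - x \<omega>) ^ 4 \<partial>M)" for N by (intro integral_nonneg_AE) simp
    show "(\<integral>\<omega>. norm (X N \<omega> - x \<omega>) ^ 4 \<partial>M) \<le> C * (2 * d N)\<^sup>2" for N by (rule tail(2))
  qed
  then show ?thesis using i4 ix by (simp add: L4_converges_def)
qed

text \<open>Cauchy-Schwarz after splitting the difference of products in three. Since the result
  converges in L2, two such products may afterwards be multiplied under the integral.\<close>

lemma L4_converges_prod:
  fixes x :: "'w \<Rightarrow> 'a::{real_normed_vector, second_countable_topology}"
    and y :: "'w \<Rightarrow> 'b::{real_normed_vector, second_countable_topology}"
    and prod :: "'a \<Rightarrow> 'b \<Rightarrow> 'c::{real_normed_vector, second_countable_topology}"
  assumes bb: "bounded_bilinear prod" and X: "L4_converges M X x" and Y: "L4_converges M Y y"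
  shows "L2_converges M (\<lambda>N \<omega>. prod (X N \<omega>) (Y N \<omega>)) (\<lambda>\<omega>. prod (x \<omega>) (y \<omega>))"
proof -
  obtain K where K: "K \<ge> 0" "\<And>x y. norm (prod x y) \<le> K * (norm x * norm y)"
    using bounded_bilinear.nonneg_bounded[OF bb] by (metis mult.assoc mult.commute)
  have cont: "continuous_on UNIV (\<lambda>p. prod (fst p) (snd p))"
    by (intro bounded_bilinear.continuous_on[OF bb] continuous_intros)
  have bnd: "square_integrable M (\<lambda>\<omega>. prod (u \<omega>) (v \<omega>))"
    "(\<integral>\<omega>. (norm (prod (u \<omega>) (v \<omega>)))\<^sup>2 \<partial>M) \<le> K\<^sup>2 * (sqrt (\<integral>\<omega>. norm (u \<omega>) ^ 4 \<partial>M) * sqrt (\<integral>\<omega>. norm (v \<omega>) ^ 4 \<partial>M))"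
    if [measurable]: "u \<in> borel_measurable M" "v \<in> borel_measurable M"
      and i: "integrable M (\<lambda>\<omega>. norm (u \<omega>) ^ 4)" "integrable M (\<lambda>\<omega>. norm (v \<omega>) ^ 4)" for u v
  proof -
    have m[measurable]: "(\<lambda>\<omega>. prod (u \<omega>) (v \<omega>)) \<in> borel_measurable M"
      by (rule borel_measurable_continuous_Pair[OF _ _ cont]) simp_all
    have s: "square_integrable M (\<lambda>\<omega>. (norm (u \<omega>))\<^sup>2)" "square_integrable M (\<lambda>\<omega>. (norm (v \<omega>))\<^sup>2)"
      using i by (auto simp: square_integrable_def power_mult[symmetric])
    note cs = square_integrable_norm_mult[OF s]
    have le: "(norm (prod (u \<omega>) (v \<omega>)))\<^sup>2 \<le> K\<^sup>2 * (norm ((norm (u \<omega>))\<^sup>2) * norm ((norm (v \<omega>))\<^sup>2))" for \<omega>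
      using power_mono[OF K(2)[of "u \<omega>" "v \<omega>"], of 2] by (simp add: power_mult_distrib)
    have ip: "integrable M (\<lambda>\<omega>. (norm (prod (u \<omega>) (v \<omega>)))\<^sup>2)"
    proof (rule Bochner_Integration.integrable_bound[OF integrable_mult_right[OF cs(1), of "K\<^sup>2"]])
      show "AE \<omega> in M. norm ((norm (prod (u \<omega>) (v \<omega>)))\<^sup>2) \<le> norm (K\<^sup>2 * (norm ((norm (u \<omega>))\<^sup>2) * norm ((norm (v \<omega>))\<^sup>2)))"
        using le by (intro AE_I2) (simp add: order_trans[OF _ abs_ge_self])
    qed simp
    then show "square_integrable M (\<lambda>\<omega>. prod (u \<omega>) (v \<omega>))" by (simp add: square_integrable_def)
    have "(\<integral>\<omega>. (norm (prod (u \<omega>) (v \<omega>)))\<^sup>2 \<partial>M) \<le> (\<integral>\<omega>. K\<^sup>2 * (norm ((norm (u \<omega>))\<^sup>2) * norm ((norm (v \<omega>))\<^sup>2)) \<partial>M)"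
      using ip cs(1) by (intro integral_mono le) auto
    also have "\<dots> = K\<^sup>2 * (\<integral>\<omega>. norm ((norm (u \<omega>))\<^sup>2) * norm ((norm (v \<omega>))\<^sup>2) \<partial>M)" by simp
    also have "\<dots> \<le> K\<^sup>2 * (sqrt (\<integral>\<omega>. norm (u \<omega>) ^ 4 \<partial>M) * sqrt (\<integral>\<omega>. norm (v \<omega>) ^ 4 \<partial>M))"
      using cs(2) by (intro mult_left_mono) (simp_all add: power_mult[symmetric])
    finally show "(\<integral>\<omega>. (norm (prod (u \<omega>) (v \<omega>)))\<^sup>2 \<partial>M) \<le> K\<^sup>2 * (sqrt (\<integral>\<omega>. norm (u \<omega>) ^ 4 \<partial>M) * sqrt (\<integral>\<omega>. norm (v \<omega>) ^ 4 \<partial>M))" .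
  qed
  have mX: "X N \<in> borel_measurable M" "x \<in> borel_measurable M" "Y N \<in> borel_measurable M" "y \<in> borel_measurable M" for N
    using X Y by (auto simp: L4_converges_def)
  have i4: "integrable M (\<lambda>\<omega>. norm (X N \<omega>) ^ 4)" "integrable M (\<lambda>\<omega>. norm (x \<omega>) ^ 4)"
    "integrable M (\<lambda>\<omega>. norm (Y N \<omega>) ^ 4)" "integrable M (\<lambda>\<omega>. norm (y \<omega>) ^ 4)" for N
    using X Y by (auto simp: L4_converges_def)
  have mdX: "(\<lambda>\<omega>. X N \<omega> - x \<omega>) \<in> borel_measurable M" and mdY: "(\<lambda>\<omega>. Y N \<omega> - y \<omega>) \<in> borel_measurable M" for N
    using mX by simp_all
  note idX = integrable_pow4_diff[OF mX(1,2) i4(1,2)] and idY = integrable_pow4_diff[OF mX(3,4) i4(3,4)]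
  define a where "a N = sqrt (\<integral>\<omega>. norm (X N \<omega> - x \<omega>) ^ 4 \<partial>M)" for N
  define b where "b N = sqrt (\<integral>\<omega>. norm (Y N \<omega> - y \<omega>) ^ 4 \<partial>M)" for N
  define nx where "nx = sqrt (\<integral>\<omega>. norm (x \<omega>) ^ 4 \<partial>M)"
  define ny where "ny = sqrt (\<integral>\<omega>. norm (y \<omega>) ^ 4 \<partial>M)"
  have lX: "(\<lambda>N. \<integral>\<omega>. norm (X N \<omega> - x \<omega>) ^ 4 \<partial>M) \<longlonglongrightarrow> 0" and lY: "(\<lambda>N. \<integral>\<omega>. norm (Y N \<omega> - y \<omega>) ^ 4 \<partial>M) \<longlonglongrightarrow> 0"
    using X Y by (auto simp: L4_converges_def)
  have a0: "a \<longlonglongrightarrow> 0" and b0: "b \<longlonglongrightarrow> 0"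
    using tendsto_real_sqrt[OF lX] tendsto_real_sqrt[OF lY] unfolding a_def [abs_def] b_def [abs_def] by simp_all
  note P1 = bnd[OF mdX mdY idX idY] and P2 = bnd[OF mdX mX(4) idX i4(4)] and P3 = bnd[OF mX(2) mdY i4(2) idY]
  have key: "(\<integral>\<omega>. (norm (prod (X N \<omega>) (Y N \<omega>) - prod (x \<omega>) (y \<omega>)))\<^sup>2 \<partial>M)
      \<le> 3 * (K\<^sup>2 * (a N * b N)) + 3 * (K\<^sup>2 * (a N * ny)) + 3 * (K\<^sup>2 * (nx * b N))" for N
  proof -
    let ?p = "\<lambda>\<omega>. (norm (prod (X N \<omega> - x \<omega>) (Y N \<omega> - y \<omega>)))\<^sup>2"
    let ?q = "\<lambda>\<omega>. (norm (prod (X N \<omega> - x \<omega>) (y \<omega>)))\<^sup>2"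
    let ?r = "\<lambda>\<omega>. (norm (prod (x \<omega>) (Y N \<omega> - y \<omega>)))\<^sup>2"
    have ipqr: "integrable M ?p" "integrable M ?q" "integrable M ?r"
      using P1(1) P2(1) P3(1) by (auto simp: square_integrable_def)
    have "(norm (prod (X N \<omega>) (Y N \<omega>) - prod (x \<omega>) (y \<omega>)))\<^sup>2 \<le> 3 * ?p \<omega> + 3 * ?q \<omega> + 3 * ?r \<omega>" for \<omega>
    proof -
      let ?u = "norm (prod (X N \<omega> - x \<omega>) (Y N \<omega> - y \<omega>))" and ?v = "norm (prod (X N \<omega> - x \<omega>) (y \<omega>))" and ?w = "norm (prod (x \<omega>) (Y N \<omega> - y \<omega>))"
      have "prod (X N \<omega>) (Y N \<omega>) - prod (x \<omega>) (y \<omega>)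
        = prod (X N \<omega> - x \<omega>) (Y N \<omega> - y \<omega>) + prod (X N \<omega> - x \<omega>) (y \<omega>) + prod (x \<omega>) (Y N \<omega> - y \<omega>)"
        by (simp add: bounded_bilinear.diff_left[OF bb] bounded_bilinear.diff_right[OF bb])
      then have "norm (prod (X N \<omega>) (Y N \<omega>) - prod (x \<omega>) (y \<omega>)) \<le> ?u + ?v + ?w"
        using norm_triangle_ineq[of "prod (X N \<omega> - x \<omega>) (Y N \<omega> - y \<omega>) + prod (X N \<omega> - x \<omega>) (y \<omega>)" "prod (x \<omega>) (Y N \<omega> - y \<omega>)"]
          norm_triangle_ineq[of "prod (X N \<omega> - x \<omega>) (Y N \<omega> - y \<omega>)" "prod (X N \<omega> - x \<omega>) (y \<omega>)"] by simp
      then have "(norm (prod (X N \<omega>) (Y N \<omega>) - prod (x \<omega>) (y \<omega>)))\<^sup>2 \<le> (?u + ?v + ?w)\<^sup>2" by (intro power_mono) auto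
      also have "\<dots> \<le> 3 * ?p \<omega> + 3 * ?q \<omega> + 3 * ?r \<omega>"
        using sum_squares_bound[of ?u ?v] sum_squares_bound[of ?u ?w] sum_squares_bound[of ?v ?w]
        by (simp add: power2_eq_square algebra_simps)
      finally show ?thesis .
    qed
    moreover have "integrable M (\<lambda>\<omega>. (norm (prod (X N \<omega>) (Y N \<omega>) - prod (x \<omega>) (y \<omega>)))\<^sup>2)"
      using square_integrable_diff[OF bnd(1)[OF mX(1,3) i4(1,3)] bnd(1)[OF mX(2,4) i4(2,4)]] by (simp add: square_integrable_def)
    ultimately have "(\<integral>\<omega>. (norm (prod (X N \<omega>) (Y N \<omega>) - prod (x \<omega>) (y \<omega>)))\<^sup>2 \<partial>M)
        \<le> (\<integral>\<omega>. 3 * ?p \<omega> + 3 * ?q \<omega> + 3 * ?r \<omega> \<partial>M)"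
      using ipqr by (intro integral_mono) auto
    also have "\<dots> = 3 * (\<integral>\<omega>. ?p \<omega> \<partial>M) + 3 * (\<integral>\<omega>. ?q \<omega> \<partial>M) + 3 * (\<integral>\<omega>. ?r \<omega> \<partial>M)"
      using ipqr by simp
    finally show ?thesis
      using P1(2)[of N N] P2(2)[of N] P3(2)[of N] unfolding a_def b_def nx_def ny_def by linarith
  qed
  have "(\<lambda>N. 3 * (K\<^sup>2 * (a N * b N)) + 3 * (K\<^sup>2 * (a N * ny)) + 3 * (K\<^sup>2 * (nx * b N)))
      \<longlonglongrightarrow> 3 * (K\<^sup>2 * (0 * 0)) + 3 * (K\<^sup>2 * (0 * ny)) + 3 * (K\<^sup>2 * (nx * 0))"
    by (intro tendsto_add tendsto_mult tendsto_const a0 b0)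
  then have z: "(\<lambda>N. 3 * (K\<^sup>2 * (a N * b N)) + 3 * (K\<^sup>2 * (a N * ny)) + 3 * (K\<^sup>2 * (nx * b N))) \<longlonglongrightarrow> 0"
    by (simp only: mult_zero_left mult_zero_right add_0)
  have "(\<lambda>N. \<integral>\<omega>. (norm (prod (X N \<omega>) (Y N \<omega>) - prod (x \<omega>) (y \<omega>)))\<^sup>2 \<partial>M) \<longlonglongrightarrow> 0"
  proof (rule tendsto_sandwich[OF always_eventually[OF allI] always_eventually[OF allI] tendsto_const z])
    show "0 \<le> (\<integral>\<omega>. (norm (prod (X N \<omega>) (Y N \<omega>) - prod (x \<omega>) (y \<omega>)))\<^sup>2 \<partial>M)" for N by (intro integral_nonneg_AE) simp
  qed (rule key)
  then show ?thesis
    using bnd(1)[OF mX(1,3) i4(1,3)] bnd(1)[OF mX(2,4) i4(2,4)] by (simp add: L2_converges_def)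
qed

section \<open>Multiple integrals\<close>

text \<open>Finitely many multi-indices involve finitely many coordinates, so each approximant in
  the definition of the integral is a polynomial in a finite part of the process.\<close>

lemma multi_indices_support:
  assumes "finite A" "A \<subseteq> multi_indices K m \<times> multi_indices K n"
  obtains S where "finite S" "S \<subseteq> K" "A \<subseteq> multi_indices S m \<times> multi_indices S n"
proof
  let ?S = "\<Union>a\<in>A. {k. fst a k \<noteq> 0} \<union> {k. snd a k \<noteq> 0}"
  have *: "fst a \<in> multi_indices K m" "snd a \<in> multi_indices K n" if "a \<in> A" for a using assms(2) that by auto
  show "finite ?S" using assms(1) multi_indicesD(1)[OF *(1)] multi_indicesD(1)[OF *(2)]
    by (intro finite_UN_I finite_UnI) auto
  show "?S \<subseteq> K" by (intro UN_least Un_least multi_indicesD(2)[OF *(1)] multi_indicesD(2)[OF *(2)])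
  show "A \<subseteq> multi_indices ?S m \<times> multi_indices ?S n"
  proof
    fix a assume "a \<in> A"
    then have "fst a \<in> multi_indices ?S m" "snd a \<in> multi_indices ?S n"
      using *[of a] by (auto simp: multi_indices_def)
    then show "a \<in> multi_indices ?S m \<times> multi_indices ?S n" by (cases a) simp
  qed
qed

lemma chaos_sum_hermite:
  assumes "A \<subseteq> multi_indices S m \<times> multi_indices S n"
  shows "(\<lambda>z. \<Sum>(\<mu>, \<nu>)\<in>A. c \<mu> \<nu> * hermite_prod \<mu> \<nu> z) \<in> chaos S m n"
  unfolding case_prod_beta
  by (rule chaos_sum) (use assms in \<open>auto intro!: chaos.base\<close>)

section \<open>Orthogonality of Hermite products and existence of the integral\<close>

context complex_isonormal
begin

text \<open>The recurrence writes the product as \<open>z j\<close> minus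
  \<open>wirtinger_bar j\<close> applied to the lowered product, and that operator is the adjoint of
  \<open>wirtinger_deriv j\<close>.\<close>

lemma hermite_prod_step:
  assumes \<mu>: "\<mu> \<in> multi_indices S m" "\<nu> \<in> multi_indices S n" "\<mu> j \<noteq> 0" and G: "G \<in> cpoly S"
    and S: "finite S" "orthonormal_family S e"
  shows "(\<integral>\<omega>. hermite_prod \<mu> \<nu> (\<lambda>i. Z (e i) \<omega>) * cnj (G (\<lambda>i. Z (e i) \<omega>)) \<partial>M)
    = (\<integral>\<omega>. hermite_prod (\<mu>(j := \<mu> j - 1)) \<nu> (\<lambda>i. Z (e i) \<omega>) * cnj (wirtinger_deriv j G (\<lambda>i. Z (e i) \<omega>)) \<partial>M)"
proof -
  let ?z = "\<lambda>\<omega> i. Z (e i) \<omega>"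
  have j: "j \<in> S" using \<mu>(1,3) by (auto simp: multi_indices_def)
  note \<mu>' = multi_indices_decr[OF \<mu>(1,3)]
  define H where "H = hermite_prod (\<mu>(j := \<mu> j - 1)) \<nu>"
  have Hc: "H \<in> cpoly S" unfolding H_def by (rule hermite_prod_cpoly[OF \<mu>' \<mu>(2)])
  note Gc = cpoly_cnj[OF G]
  have int: "integrable M (\<lambda>\<omega>. wirtinger_bar j H (?z \<omega>) * cnj (G (?z \<omega>)))"
    "integrable M (\<lambda>\<omega>. H (?z \<omega>) * cnj (wirtinger_deriv j G (?z \<omega>)))"
    "integrable M (\<lambda>\<omega>. Z (e j) \<omega> * (H (?z \<omega>) * cnj (G (?z \<omega>))))"
    using cpoly_integrable[OF cpoly.mult[OF cpoly_has_wirtinger(3)[OF Hc] Gc] S(1)]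
      cpoly_integrable[OF cpoly.mult[OF Hc cpoly_cnj[OF cpoly_has_wirtinger(2)[OF G]]] S(1)]
      cpoly_integrable[OF cpoly.mult[OF cpoly.var[OF j] cpoly.mult[OF Hc Gc]] S(1)] by auto
  have "(\<integral>\<omega>. Z (e j) \<omega> * (H (?z \<omega>) * cnj (G (?z \<omega>))) \<partial>M)
    = (\<integral>\<omega>. wirtinger_bar j H (?z \<omega>) * cnj (G (?z \<omega>)) \<partial>M)
      + (\<integral>\<omega>. H (?z \<omega>) * cnj (wirtinger_deriv j G (?z \<omega>)) \<partial>M)"
    using cpoly_ibp_bar[OF cpoly.mult[OF Hc Gc] S j] int
    unfolding wirtinger_mult(2)[OF Hc Gc] wirtinger_cnj(2)[OF G] by simp
  moreover have "hermite_prod \<mu> \<nu> z * cnj (G z) = z j * (H z * cnj (G z)) - wirtinger_bar j H z * cnj (G z)" for z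
    unfolding hermite_prod_recurrence[OF \<mu>] H_def wirtinger_hermite_prod(2)[OF \<mu>' \<mu>(2)]
    by (simp add: algebra_simps)
  ultimately show ?thesis using int by (simp add: H_def)
qed

text \<open>The diagonal value is recorded only through a bound uniform in S, which is what controls
  the norm of a finite sum.\<close>

definition hermite_orthogonal :: "nat set \<Rightarrow> (nat \<Rightarrow> 'h cplx) \<Rightarrow> nat \<Rightarrow> nat \<Rightarrow> bool" where
  "hermite_orthogonal S e m n \<longleftrightarrow>
    (\<forall>\<mu>\<in>multi_indices S m. \<forall>\<nu>\<in>multi_indices S n. \<forall>\<mu>'\<in>multi_indices S m. \<forall>\<nu>'\<in>multi_indices S n.
      \<exists>c. 0 \<le> c \<and> c \<le> fact m * fact n \<and>
        (\<integral>\<omega>. hermite_prod \<mu> \<nu> (\<lambda>i. Z (e i) \<omega>) * cnj (hermite_prod \<mu>' \<nu>' (\<lambda>i. Z (e i) \<omega>)) \<partial>M)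
          = (if \<mu> = \<mu>' \<and> \<nu> = \<nu>' then complex_of_real c else 0))"

text \<open>\<open>hermite_prod_step\<close> at an index j with \<open>\<mu> j\<close> nonzero
  lowers both products and produces the factor \<open>\<mu>' j\<close>, at most m + 1. If this
  factor vanishes, the multi-indices differ at j.\<close>

lemma hermite_orthogonal_Suc:
  assumes S: "finite S" "orthonormal_family S e" and IH: "hermite_orthogonal S e m n"
  shows "hermite_orthogonal S e (Suc m) n"
  unfolding hermite_orthogonal_def
proof (intro ballI)
  fix \<mu> \<nu> \<mu>' \<nu>' assume \<mu>: "\<mu> \<in> multi_indices S (Suc m)" and \<nu>: "\<nu> \<in> multi_indices S n"
    and \<mu>': "\<mu>' \<in> multi_indices S (Suc m)" and \<nu>': "\<nu>' \<in> multi_indices S n"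
  let ?z = "\<lambda>\<omega> i. Z (e i) \<omega>"
  obtain j where j: "j \<in> S" "\<mu> j \<noteq> 0" using multi_indices_sum[OF \<mu> S(1)] by (metis nat.distinct(1) sum.neutral)
  have le: "\<mu>' j \<le> Suc m"
    using member_le_sum[OF j(1), of \<mu>'] S(1) multi_indices_sum[OF \<mu>' S(1)] by simp
  have eq: "(\<integral>\<omega>. hermite_prod \<mu> \<nu> (?z \<omega>) * cnj (hermite_prod \<mu>' \<nu>' (?z \<omega>)) \<partial>M)
    = of_nat (\<mu>' j) * (\<integral>\<omega>. hermite_prod (\<mu>(j := \<mu> j - 1)) \<nu> (?z \<omega>) * cnj (hermite_prod (\<mu>'(j := \<mu>' j - 1)) \<nu>' (?z \<omega>)) \<partial>M)"
    unfolding hermite_prod_step[OF \<mu> \<nu> j(2) hermite_prod_cpoly[OF \<mu>' \<nu>'] S] wirtinger_hermite_prod(1)[OF \<mu>' \<nu>']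
    by (simp add: mult.left_commute)
  show "\<exists>c. 0 \<le> c \<and> c \<le> fact (Suc m) * fact n \<and>
        (\<integral>\<omega>. hermite_prod \<mu> \<nu> (?z \<omega>) * cnj (hermite_prod \<mu>' \<nu>' (?z \<omega>)) \<partial>M)
          = (if \<mu> = \<mu>' \<and> \<nu> = \<nu>' then complex_of_real c else 0)"
  proof (cases "\<mu>' j = 0")
    case True
    then have "\<mu> \<noteq> \<mu>'" using j by auto
    then show ?thesis unfolding eq using True by (intro exI[of _ 0]) simp
  next
    case False
    have d: "\<mu>(j := \<mu> j - 1) \<in> multi_indices S m" "\<mu>'(j := \<mu>' j - 1) \<in> multi_indices S m"
      using multi_indices_decr[OF \<mu> j(2)] multi_indices_decr[OF \<mu>' False] by simp_all
    \<comment> \<open>Both entries at j are positive here, so the truncated subtraction is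
      injective.\<close>
    have iff: "\<mu>(j := \<mu> j - 1) = \<mu>'(j := \<mu>' j - 1) \<longleftrightarrow> \<mu> = \<mu>'"
    proof
      assume *: "\<mu>(j := \<mu> j - 1) = \<mu>'(j := \<mu>' j - 1)"
      have "\<mu> k = \<mu>' k" for k using fun_cong[OF *, of k] False j(2) by (cases "k = j") auto
      then show "\<mu> = \<mu>'" by (rule ext)
    qed simp
    obtain c where c: "0 \<le> c" "c \<le> fact m * fact n" and
      ceq: "(\<integral>\<omega>. hermite_prod (\<mu>(j := \<mu> j - 1)) \<nu> (?z \<omega>) * cnj (hermite_prod (\<mu>'(j := \<mu>' j - 1)) \<nu>' (?z \<omega>)) \<partial>M)
        = (if \<mu>(j := \<mu> j - 1) = \<mu>'(j := \<mu>' j - 1) \<and> \<nu> = \<nu>' then complex_of_real c else 0)"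
      using IH d \<nu> \<nu>' unfolding hermite_orthogonal_def by blast
    have "real (\<mu>' j) * c \<le> real (Suc m) * (fact m * fact n)" using le c by (intro mult_mono) auto
    then have "real (\<mu>' j) * c \<le> fact (Suc m) * fact n" by (simp add: mult.assoc)
    then show ?thesis unfolding eq ceq iff using c by (intro exI[of _ "real (\<mu>' j) * c"]) simp
  qed
qed

lemma hermite_orthogonal_swap:
  assumes "hermite_orthogonal S e m n" shows "hermite_orthogonal S e n m"
  unfolding hermite_orthogonal_def
proof (intro ballI)
  fix \<mu> \<nu> \<mu>' \<nu>' assume a: "\<mu> \<in> multi_indices S n" "\<nu> \<in> multi_indices S m" "\<mu>' \<in> multi_indices S n" "\<nu>' \<in> multi_indices S m"
  obtain c where "0 \<le> c" "c \<le> fact m * fact n"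
    "(\<integral>\<omega>. hermite_prod \<nu>' \<mu>' (\<lambda>i. Z (e i) \<omega>) * cnj (hermite_prod \<nu> \<mu> (\<lambda>i. Z (e i) \<omega>)) \<partial>M)
       = (if \<nu>' = \<nu> \<and> \<mu>' = \<mu> then complex_of_real c else 0)"
    using assms a unfolding hermite_orthogonal_def by blast
  then show "\<exists>c. 0 \<le> c \<and> c \<le> fact n * fact m \<and>
        (\<integral>\<omega>. hermite_prod \<mu> \<nu> (\<lambda>i. Z (e i) \<omega>) * cnj (hermite_prod \<mu>' \<nu>' (\<lambda>i. Z (e i) \<omega>)) \<partial>M)
          = (if \<mu> = \<mu>' \<and> \<nu> = \<nu>' then complex_of_real c else 0)"
    by (intro exI[of _ c]) (auto simp: hermite_prod_cnj mult.commute)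
qed

text \<open>The step raises only the first degree, so the second is built up first and moved into
  place by conjugation: (0, 0), (n, 0), (0, n), (m, n).\<close>

lemma hermite_prod_orthogonal:
  assumes S: "finite S" "orthonormal_family S e"
  shows "hermite_orthogonal S e m n"
proof -
  have "hermite_orthogonal S e 0 0"
    unfolding hermite_orthogonal_def
  proof (intro ballI)
    fix \<mu> \<nu> \<mu>' \<nu>' :: "nat \<Rightarrow> nat"
    assume "\<mu> \<in> multi_indices S 0" "\<nu> \<in> multi_indices S 0" "\<mu>' \<in> multi_indices S 0" "\<nu>' \<in> multi_indices S 0"
    then have "\<mu> = (\<lambda>_. 0)" "\<nu> = (\<lambda>_. 0)" "\<mu>' = (\<lambda>_. 0)" "\<nu>' = (\<lambda>_. 0)" by (auto simp: multi_indices_def)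
    then show "\<exists>c. 0 \<le> c \<and> c \<le> fact 0 * fact 0 \<and>
        (\<integral>\<omega>. hermite_prod \<mu> \<nu> (\<lambda>i. Z (e i) \<omega>) * cnj (hermite_prod \<mu>' \<nu>' (\<lambda>i. Z (e i) \<omega>)) \<partial>M)
          = (if \<mu> = \<mu>' \<and> \<nu> = \<nu>' then complex_of_real c else 0)"
      by (intro exI[of _ 1]) (simp add: hermite_prod_def prob_space)
  qed
  then have "hermite_orthogonal S e n 0" by (induction n) (auto intro: hermite_orthogonal_Suc[OF S])
  then have "hermite_orthogonal S e 0 n" by (rule hermite_orthogonal_swap)
  then show ?thesis by (induction m) (auto intro: hermite_orthogonal_Suc[OF S])
qed

text \<open>The Gram matrix of the Hermite products is diagonal with entries at most
  \<open>fact m * fact n\<close>.\<close>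

lemma hermite_sum_L2:
  assumes A: "finite A" "A \<subseteq> multi_indices K m \<times> multi_indices K n" and ON: "orthonormal_family K e"
  shows "(\<integral>\<omega>. (cmod (\<Sum>(\<mu>, \<nu>)\<in>A. c \<mu> \<nu> * hermite_prod \<mu> \<nu> (\<lambda>i. Z (e i) \<omega>)))\<^sup>2 \<partial>M)
    \<le> fact m * fact n * (\<Sum>(\<mu>, \<nu>)\<in>A. (cmod (c \<mu> \<nu>))\<^sup>2)"
proof -
  obtain S where S: "finite S" "S \<subseteq> K" and AS: "A \<subseteq> multi_indices S m \<times> multi_indices S n"
    by (rule multi_indices_support[OF A])
  note ONS = orthonormal_family_subset[OF ON S(2)]
  define h where "h a = hermite_prod (fst a) (snd a)" for a
  define C where "C a = c (fst a) (snd a)" for a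
  let ?z = "\<lambda>\<omega> i. Z (e i) \<omega>"
  have hc: "h a \<in> cpoly S" if "a \<in> A" for a
    unfolding h_def using AS that by (intro hermite_prod_cpoly[of _ S m _ n]) auto
  have int: "integrable M (\<lambda>\<omega>. h a (?z \<omega>) * cnj (h b (?z \<omega>)))" if "a \<in> A" "b \<in> A" for a b
    by (rule cpoly_integrable[OF cpoly.mult[OF hc[OF that(1)] cpoly_cnj[OF hc[OF that(2)]]] S(1)])
  define Q where "Q a d \<longleftrightarrow> 0 \<le> d \<and> d \<le> fact m * fact n \<and>
      (\<forall>b\<in>A. (\<integral>\<omega>. h a (?z \<omega>) * cnj (h b (?z \<omega>)) \<partial>M) = (if a = b then complex_of_real d else 0))" for a d
  have "\<exists>d. Q a d" if "a \<in> A" for a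
  proof -
    have mem: "fst b \<in> multi_indices S m" "snd b \<in> multi_indices S n" if "b \<in> A" for b using AS that by auto
    note o = hermite_prod_orthogonal[OF S(1) ONS, of m n, unfolded hermite_orthogonal_def]
    obtain d where d: "0 \<le> d" "d \<le> fact m * fact n"
      "(\<integral>\<omega>. h a (?z \<omega>) * cnj (h a (?z \<omega>)) \<partial>M) = complex_of_real d"
      using bspec[OF bspec[OF bspec[OF bspec[OF o mem(1)[OF \<open>a \<in> A\<close>]] mem(2)[OF \<open>a \<in> A\<close>]] mem(1)[OF \<open>a \<in> A\<close>]] mem(2)[OF \<open>a \<in> A\<close>]]
      unfolding h_def by auto
    have "(\<integral>\<omega>. h a (?z \<omega>) * cnj (h b (?z \<omega>)) \<partial>M) = 0" if "b \<in> A" "a \<noteq> b" for b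
      using bspec[OF bspec[OF bspec[OF bspec[OF o mem(1)[OF \<open>a \<in> A\<close>]] mem(2)[OF \<open>a \<in> A\<close>]] mem(1)[OF that(1)]] mem(2)[OF that(1)]] that(2)
      unfolding h_def by (auto simp: prod_eq_iff)
    with d show ?thesis unfolding Q_def by (intro exI[of _ d]) auto
  qed
  then obtain d where "\<And>a. a \<in> A \<Longrightarrow> Q a (d a)" by metis
  then have d: "\<And>a. a \<in> A \<Longrightarrow> d a \<le> fact m * fact n"
    "\<And>a b. a \<in> A \<Longrightarrow> b \<in> A \<Longrightarrow> (\<integral>\<omega>. h a (?z \<omega>) * cnj (h b (?z \<omega>)) \<partial>M) = (if a = b then complex_of_real (d a) else 0)"
    unfolding Q_def by auto
  have "complex_of_real (\<integral>\<omega>. (cmod (\<Sum>a\<in>A. C a * h a (?z \<omega>)))\<^sup>2 \<partial>M)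
    = (\<integral>\<omega>. (\<Sum>a\<in>A. C a * h a (?z \<omega>)) * cnj (\<Sum>a\<in>A. C a * h a (?z \<omega>)) \<partial>M)"
    unfolding integral_complex_of_real[symmetric] complex_norm_square by (rule refl)
  also have "\<dots> = (\<integral>\<omega>. (\<Sum>a\<in>A. \<Sum>b\<in>A. (C a * cnj (C b)) * (h a (?z \<omega>) * cnj (h b (?z \<omega>)))) \<partial>M)"
    by (simp add: cnj_sum sum_product mult_ac)
  also have "\<dots> = (\<Sum>a\<in>A. \<Sum>b\<in>A. (C a * cnj (C b)) * (\<integral>\<omega>. h a (?z \<omega>) * cnj (h b (?z \<omega>)) \<partial>M))"
    using int by (simp add: Bochner_Integration.integral_sum)
  also have "\<dots> = (\<Sum>a\<in>A. \<Sum>b\<in>A. if a = b then C a * cnj (C b) * complex_of_real (d a) else 0)"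
    by (intro sum.cong refl) (simp add: d(2))
  also have "\<dots> = complex_of_real (\<Sum>a\<in>A. (cmod (C a))\<^sup>2 * d a)"
    using A(1) by (simp add: complex_norm_square[symmetric])
  finally have "(\<integral>\<omega>. (cmod (\<Sum>a\<in>A. C a * h a (?z \<omega>)))\<^sup>2 \<partial>M) = (\<Sum>a\<in>A. (cmod (C a))\<^sup>2 * d a)"
    by (simp only: of_real_eq_iff)
  also have "\<dots> \<le> (\<Sum>a\<in>A. (cmod (C a))\<^sup>2 * (fact m * fact n))"
    by (intro sum_mono mult_left_mono d(1)) auto
  also have "\<dots> = fact m * fact n * (\<Sum>a\<in>A. (cmod (C a))\<^sup>2)" by (simp add: sum_distrib_left mult.commute)
  finally show ?thesis by (simp add: h_def C_def case_prod_beta)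
qed

lemma chaos_square_integrable:
  assumes "p \<in> cpoly S" "finite S" shows "square_integrable M (\<lambda>\<omega>. p (\<lambda>i. Z (e i) \<omega>))"
  unfolding square_integrable_def using cpoly_measurable[OF assms(1)] cpoly_integrable_power[OF assms] by simp

text \<open>The coefficients from \<open>sym_tensor_power2_approx\<close> serve twice: the tensors
  converge to f, and by \<open>hermite_sum_L2\<close> the integrals form a Cauchy sequence. Hence
  the choice in \<open>wiener_ito\<close> picks a member of the graph.\<close>

lemma wiener_ito_exists:
  assumes e: "orthonormal_basis K e" and f: "f \<in> sym_tensor_power2 m n"
  shows "is_wiener_ito M Z K e m n f (wiener_ito M Z K e m n f)"
proof -
  note ON = orthonormal_basis_family[OF e]
  define A where "A N = multi_indices (K \<inter> {..<N}) m \<times> multi_indices (K \<inter> {..<N}) n" for N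
  obtain c s where c: "(\<lambda>N. hs_norm_sq (m + n) (\<lambda>xs. (\<Sum>(\<mu>, \<nu>)\<in>A N. c \<mu> \<nu> * basis_tensor e m n \<mu> \<nu> xs) - f xs)) \<longlonglongrightarrow> 0"
    and s: "convergent s" and cs: "\<And>N L. N \<le> L \<Longrightarrow> (\<Sum>(\<mu>, \<nu>)\<in>A L - A N. (cmod (c \<mu> \<nu>))\<^sup>2) \<le> s L - s N"
    by (rule sym_tensor_power2_approx[OF e f, folded A_def], rule that)
  have fin: "finite (A N)" for N unfolding A_def by (intro finite_cartesian_product finite_multi_indices) auto
  have AK: "A N \<subseteq> multi_indices K m \<times> multi_indices K n" for N
    unfolding A_def by (intro Sigma_mono multi_indices_mono) auto
  have Amono: "A N \<subseteq> A L" if "N \<le> L" for N L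
    unfolding A_def using that by (intro Sigma_mono multi_indices_mono) auto
  define X where "X N \<omega> = (\<Sum>(\<mu>, \<nu>)\<in>A N. c \<mu> \<nu> * basis_integral Z e \<mu> \<nu> \<omega>)" for N \<omega>
  have sX: "square_integrable M (X N)" for N
    unfolding X_def [abs_def] basis_integral_eq A_def
    by (rule chaos_square_integrable[OF chaos_cpoly[OF chaos_sum_hermite[OF subset_refl]]]) simp
  have bound: "(\<integral>\<omega>. (cmod (X L \<omega> - X N \<omega>))\<^sup>2 \<partial>M) \<le> fact m * fact n * (s L - s N)" if "N \<le> L" for N L
  proof -
    have "X L \<omega> - X N \<omega> = (\<Sum>(\<mu>, \<nu>)\<in>A L - A N. c \<mu> \<nu> * hermite_prod \<mu> \<nu> (\<lambda>i. Z (e i) \<omega>))" for \<omega>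
      unfolding X_def basis_integral_eq by (rule sum_diff[OF fin Amono[OF that], symmetric])
    then have "(\<integral>\<omega>. (cmod (X L \<omega> - X N \<omega>))\<^sup>2 \<partial>M) \<le> fact m * fact n * (\<Sum>(\<mu>, \<nu>)\<in>A L - A N. (cmod (c \<mu> \<nu>))\<^sup>2)"
      using hermite_sum_L2[of "A L - A N" K m n e c] fin AK ON by auto
    also have "\<dots> \<le> fact m * fact n * (s L - s N)" by (intro mult_left_mono cs that) simp
    finally show ?thesis .
  qed
  have "\<exists>F. L2_converges M X F"
  proof (rule L2_complete[OF sX])
    fix \<epsilon> :: real assume "\<epsilon> > 0"
    define \<delta> where "\<delta> = \<epsilon> / (fact m * fact n)"
    have "\<delta> > 0" using \<open>\<epsilon> > 0\<close> by (simp add: \<delta>_def)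
    from metric_CauchyD[OF convergent_Cauchy[OF s] this]
    obtain N0 where N0: "\<And>N L. N \<ge> N0 \<Longrightarrow> L \<ge> N0 \<Longrightarrow> dist (s N) (s L) < \<delta>" by blast
    have lt: "(\<integral>\<omega>. (cmod (X L \<omega> - X N \<omega>))\<^sup>2 \<partial>M) < \<epsilon>" if "N0 \<le> N" "N \<le> L" for N L
    proof -
      have "s L - s N < \<delta>" using N0[of N L] that by (simp add: dist_real_def)
      then have "fact m * fact n * (s L - s N) < fact m * fact n * \<delta>" by (intro mult_strict_left_mono) auto
      also have "\<dots> = \<epsilon>" by (simp add: \<delta>_def)
      finally show ?thesis using bound[OF that(2)] by simp
    qed
    have "(\<integral>\<omega>. (cmod (X N \<omega> - X L \<omega>))\<^sup>2 \<partial>M) < \<epsilon>" if "N0 \<le> N" "N0 \<le> L" for N L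
      using lt[of N L] lt[of L N] that by (cases "N \<le> L") (auto simp: norm_minus_commute[of "X N _"])
    then show "\<exists>N0. \<forall>N\<ge>N0. \<forall>L\<ge>N0. (\<integral>\<omega>. (cmod (X N \<omega> - X L \<omega>))\<^sup>2 \<partial>M) < \<epsilon>" by blast
  qed
  then obtain F where F: "L2_converges M X F" by blast
  have "is_wiener_ito M Z K e m n f F"
    unfolding is_wiener_ito_def
    by (rule exI[of _ A], rule exI[of _ "\<lambda>_. c"], intro conjI allI fin AK c F[unfolded X_def [abs_def]])
  then show ?thesis unfolding wiener_ito_def by (rule someI[where P = "is_wiener_ito M Z K e m n f"])
qed

end

section \<open>Passage to the limit\<close>

lemma L2_converges_cong_AE:
  assumes "L2_converges M X x" "y \<in> borel_measurable M" "AE \<omega> in M. y \<omega> = x \<omega>"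
  shows "L2_converges M X y"
proof -
  have sx: "square_integrable M x" and [measurable]: "X N \<in> borel_measurable M" "x \<in> borel_measurable M" for N
    using assms(1) by (auto simp: L2_converges_def square_integrable_def)
  note [measurable] = assms(2)
  have "integrable M (\<lambda>\<omega>. (norm (y \<omega>))\<^sup>2) \<longleftrightarrow> integrable M (\<lambda>\<omega>. (norm (x \<omega>))\<^sup>2)"
    by (rule integrable_cong_AE) (use assms(3) in auto)
  moreover have "(\<integral>\<omega>. (norm (X N \<omega> - y \<omega>))\<^sup>2 \<partial>M) = (\<integral>\<omega>. (norm (X N \<omega> - x \<omega>))\<^sup>2 \<partial>M)" for N
    by (rule integral_cong_AE) (use assms(3) in auto)
  ultimately show ?thesis using assms(1,2) by (simp add: L2_converges_def square_integrable_def)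
qed

lemma L2_converges_cnj:
  assumes "L2_converges M X x" shows "L2_converges M (\<lambda>N \<omega>. cnj (X N \<omega>)) (\<lambda>\<omega>. cnj (x \<omega>))"
  using assms unfolding L2_converges_def square_integrable_def
  by (auto simp del: complex_cnj_diff simp: complex_cnj_diff[symmetric] intro: borel_measurable_cnj)

lemma L2_converges_integrable_mult:
  fixes x y :: "'w \<Rightarrow> 'b::{real_normed_field, banach, second_countable_topology}"
  assumes "L2_converges M X x" "L2_converges M Y y"
  shows "integrable M (\<lambda>\<omega>. x \<omega> * y \<omega>)" "integrable M (\<lambda>\<omega>. X N \<omega> * Y N \<omega>)"
proof -
  have s: "square_integrable M x" "square_integrable M y" "square_integrable M (X N)" "square_integrable M (Y N)"
    using assms by (auto simp: L2_converges_def)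
  show "integrable M (\<lambda>\<omega>. x \<omega> * y \<omega>)" "integrable M (\<lambda>\<omega>. X N \<omega> * Y N \<omega>)"
    using bilinear_integral_bound(1)[OF bounded_bilinear_mult s(1,2), of 1]
      bilinear_integral_bound(1)[OF bounded_bilinear_mult s(3,4), of 1] by (simp_all add: norm_mult)
qed

context complex_isonormal
begin

lemma chaos_smooth_malliavin:
  assumes "p \<in> cpoly S" "finite S"
  shows "smooth_malliavin Z (\<lambda>\<omega>. p (\<lambda>i. Z (e i) \<omega>)) (gradient S e p)"
proof -
  obtain k where k: "S \<subseteq> {..<k}" using cpoly_bounded_index[OF assms(2)] by blast
  have "gradient S e p = gradient {..<k} e p" by (rule gradient_mono[OF assms(1) k, symmetric]) simp
  then have "gradient S e p = (\<lambda>\<omega>. \<Sum>i<k. cscale (wirtinger_deriv i p (\<lambda>i. Z (e i) \<omega>)) (e i))"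
    by (simp add: gradient_def [abs_def])
  then show ?thesis
    unfolding smooth_malliavin_def using cpoly_smooth[OF assms(1) k] by blast
qed

text \<open>Approximants may use different finite index sets, but a difference lies in the chaos
  over their union, to which the uniform fourth-moment constant applies. Squared L2-distances of
  gradients are exactly m times those of the functionals, so the gradients converge as well.\<close>

lemma chaos_limit:
  fixes e :: "nat \<Rightarrow> 'h cplx"
  assumes ON: "orthonormal_family K e" and p: "\<And>N. p N \<in> chaos (S N) m n"
    and S: "\<And>N. finite (S N)" "\<And>N. S N \<subseteq> K"
    and F: "L2_converges M (\<lambda>N \<omega>. p N (\<lambda>i. Z (e i) \<omega>)) F"
  shows "L4_converges M (\<lambda>N \<omega>. p N (\<lambda>i. Z (e i) \<omega>)) F"
    and "\<exists>u. L4_converges M (\<lambda>N. gradient (S N) e (p N)) u \<and> is_malliavin_deriv M Z F u"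
proof -
  let ?p = "\<lambda>N \<omega>. p N (\<lambda>i. Z (e i) \<omega>)"
  let ?g = "\<lambda>N. gradient (S N) e (p N)"
  have pc: "p N \<in> cpoly (S N)" for N by (rule chaos_cpoly[OF p])
  have T: "finite (S N \<union> S L)" "S N \<union> S L \<subseteq> K" for N L using S by auto
  have pd: "(\<lambda>z. p N z - p L z) \<in> chaos (S N \<union> S L) m n" for N L
    by (intro chaos_diff chaos_mono[OF p]) auto
  obtain C where C: "fourth_moment_bound K e m n C" using fourth_moment_bound_ex[OF ON] by blast
  show "L4_converges M ?p F"
    by (rule L2_converges_imp_L4[OF F cpoly_integrable_power[OF pc S(1)] fourth_moment_boundD(1)[OF C]
          fourth_moment_boundD(2)[OF C T pd]])
  obtain C' where C': "fourth_moment_bound K e (m - 1) n C'" using fourth_moment_bound_ex[OF ON] by blast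
  have gd: "?g N \<omega> - ?g L \<omega> = gradient (S N \<union> S L) e (\<lambda>z. p N z - p L z) \<omega>" for N L \<omega>
  proof -
    have "p N \<in> cpoly (S N \<union> S L)" "p L \<in> cpoly (S N \<union> S L)" by (rule cpoly_mono[OF pc]; simp)+
    from gradient_diff[OF this] show ?thesis
      using gradient_mono[OF pc _ T(1), of N N L] gradient_mono[OF pc _ T(1), of L N L] by simp
  qed
  have g2: "(\<integral>\<omega>. (norm (?g N \<omega> - ?g L \<omega>))\<^sup>2 \<partial>M) = of_nat m * (\<integral>\<omega>. (cmod (?p N \<omega> - ?p L \<omega>))\<^sup>2 \<partial>M)" for N L
    unfolding gd by (rule chaos_gradient_L2[OF pd T(1) orthonormal_family_subset[OF ON T(2)]])
  have sg: "square_integrable M (?g N)" for N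
    unfolding square_integrable_def
    by (intro conjI gradient_measurable[OF pc] gradient_moments(1)[OF pc S(1) orthonormal_family_subset[OF ON S(2)]])
  define d where "d N = (\<integral>\<omega>. (cmod (?p N \<omega> - F \<omega>))\<^sup>2 \<partial>M)" for N
  have d: "d \<longlonglongrightarrow> 0" using F by (simp add: L2_converges_def d_def [abs_def])
  have sp: "square_integrable M (?p N)" "square_integrable M F" for N using F by (auto simp: L2_converges_def)
  have id: "integrable M (\<lambda>\<omega>. (cmod (?p N \<omega> - F \<omega>))\<^sup>2)" for N
    using square_integrable_diff[OF sp] by (simp add: square_integrable_def)
  have p2: "(\<integral>\<omega>. (cmod (?p N \<omega> - ?p L \<omega>))\<^sup>2 \<partial>M) \<le> 2 * d N + 2 * d L" for N L
  proof -
    have "(\<integral>\<omega>. (cmod (?p N \<omega> - ?p L \<omega>))\<^sup>2 \<partial>M) \<le> (\<integral>\<omega>. 2 * (cmod (?p N \<omega> - F \<omega>))\<^sup>2 + 2 * (cmod (?p L \<omega> - F \<omega>))\<^sup>2 \<partial>M)"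
      using square_integrable_diff[OF sp(1) sp(1)] id norm_diff_sq_bound
      by (intro integral_mono) (auto simp: square_integrable_def)
    then show ?thesis using id by (simp add: d_def)
  qed
  have "\<exists>u. L2_converges M ?g u"
  proof (rule L2_complete[OF sg])
    fix \<epsilon> :: real assume "\<epsilon> > 0"
    \<comment> \<open>Squared distances of approximants are at most 4 \<delta>, twice \<delta> from
      each; the added 1 gives strict inequality and covers m = 0.\<close>
    define \<delta> where "\<delta> = \<epsilon> / (4 * (of_nat m + 1))"
    have \<delta>: "\<delta> > 0" "of_nat m * (4 * \<delta>) < \<epsilon>" using \<open>\<epsilon> > 0\<close> by (simp_all add: \<delta>_def field_simps add_pos_nonneg)
    from order_tendstoD(2)[OF d \<delta>(1)] obtain N0 where N0: "\<And>N. N \<ge> N0 \<Longrightarrow> d N < \<delta>"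
      unfolding eventually_sequentially by blast
    have "(\<integral>\<omega>. (norm (?g N \<omega> - ?g L \<omega>))\<^sup>2 \<partial>M) < \<epsilon>" if "N \<ge> N0" "L \<ge> N0" for N L
    proof -
      have "of_nat m * (\<integral>\<omega>. (cmod (?p N \<omega> - ?p L \<omega>))\<^sup>2 \<partial>M) \<le> of_nat m * (4 * \<delta>)"
        using p2[of N L] N0[OF that(1)] N0[OF that(2)] by (intro mult_left_mono) auto
      then show ?thesis unfolding g2 using \<delta>(2) by linarith
    qed
    then show "\<exists>N0. \<forall>N\<ge>N0. \<forall>L\<ge>N0. (\<integral>\<omega>. (norm (?g N \<omega> - ?g L \<omega>))\<^sup>2 \<partial>M) < \<epsilon>" by blast
  qed
  then obtain u where u: "L2_converges M ?g u" by blast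
  have b: "m = 0 \<or> fourth_moment_bound K e (m - 1) n C'" using C' by blast
  have "L4_converges M ?g u"
  proof (rule L2_converges_imp_L4[OF u _ fourth_moment_boundD(1)[OF C']])
    show "integrable M (\<lambda>\<omega>. norm (?g N \<omega>) ^ 4)" for N
      by (rule gradient_moments(2)[OF pc S(1) orthonormal_family_subset[OF ON S(2)]])
    show "(\<integral>\<omega>. norm (?g N \<omega> - ?g L \<omega>) ^ 4 \<partial>M) \<le> C' * (\<integral>\<omega>. (norm (?g N \<omega> - ?g L \<omega>))\<^sup>2 \<partial>M)\<^sup>2" for N L
      unfolding g2 unfolding gd
      by (rule chaos_gradient_fourth_moment[OF b fourth_moment_boundD(1)[OF C'] pd T ON])
  qed
  moreover have "is_malliavin_deriv M Z F u"
    unfolding is_malliavin_deriv_def using chaos_smooth_malliavin[OF pc S(1)] F u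
    by (intro exI[of _ ?p] exI[of _ ?g] conjI allI)
  ultimately show "\<exists>u. L4_converges M ?g u \<and> is_malliavin_deriv M Z F u" by blast
qed

text \<open>The functionals and both gradients converge in L4, so squares and pairings converge in
  L2, and each product of two of these has a convergent integral. The derivative of the conjugate
  comes from \<open>chaos_limit\<close> in bidegree (n, m).\<close>

lemma wiener_ito_fourth_moment:
  fixes e :: "nat \<Rightarrow> 'h cplx"
  assumes ON: "orthonormal_family K e" and F: "is_wiener_ito M Z K e m n f F"
  obtains u v where "is_malliavin_deriv M Z F u" "is_malliavin_deriv M Z (\<lambda>\<omega>. cnj (F \<omega>)) v"
    "integrable M (\<lambda>\<omega>. cmod (F \<omega>) ^ 4)"
    "integrable M (\<lambda>\<omega>. of_real (2 * (norm (u \<omega>))\<^sup>2 * (cmod (F \<omega>))\<^sup>2) + cinner (u \<omega>) (v \<omega>) * (cnj (F \<omega>))\<^sup>2)"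
    "of_nat m * complex_of_real (\<integral>\<omega>. cmod (F \<omega>) ^ 4 \<partial>M)
      = (\<integral>\<omega>. of_real (2 * (norm (u \<omega>))\<^sup>2 * (cmod (F \<omega>))\<^sup>2) + cinner (u \<omega>) (v \<omega>) * (cnj (F \<omega>))\<^sup>2 \<partial>M)"
proof -
  obtain A c where A: "\<And>N. finite (A N)" "\<And>N. A N \<subseteq> multi_indices K m \<times> multi_indices K n"
    and X: "L2_converges M (\<lambda>N \<omega>. \<Sum>(\<mu>, \<nu>) \<in> A N. c N \<mu> \<nu> * basis_integral Z e \<mu> \<nu> \<omega>) F"
    using F unfolding is_wiener_ito_def by blast
  have "\<exists>S. finite S \<and> S \<subseteq> K \<and> A N \<subseteq> multi_indices S m \<times> multi_indices S n" for N
    by (rule multi_indices_support[OF A]) blast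
  then obtain S where S: "\<And>N. finite (S N)" "\<And>N. S N \<subseteq> K"
    and AS: "\<And>N. A N \<subseteq> multi_indices (S N) m \<times> multi_indices (S N) n" by metis
  define p where "p N z = (\<Sum>(\<mu>, \<nu>)\<in>A N. c N \<mu> \<nu> * hermite_prod \<mu> \<nu> z)" for N z
  have p: "p N \<in> chaos (S N) m n" for N unfolding p_def [abs_def] by (rule chaos_sum_hermite[OF AS])
  have q: "(\<lambda>z. cnj (p N z)) \<in> chaos (S N) n m" for N by (rule chaos_cnj[OF p])
  define P where "P N \<omega> = p N (\<lambda>i. Z (e i) \<omega>)" for N \<omega>
  define g where "g N = gradient (S N) e (p N)" for N
  define h where "h N = gradient (S N) e (\<lambda>z. cnj (p N z))" for N
  have P2: "L2_converges M (\<lambda>N \<omega>. p N (\<lambda>i. Z (e i) \<omega>)) F" using X by (simp add: p_def basis_integral_eq)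
  note Q2 = L2_converges_cnj[OF P2]
  have P4: "L4_converges M P F" unfolding P_def [abs_def] by (rule chaos_limit(1)[OF ON p S P2])
  have Q4: "L4_converges M (\<lambda>N \<omega>. cnj (P N \<omega>)) (\<lambda>\<omega>. cnj (F \<omega>))"
    unfolding P_def by (rule chaos_limit(1)[OF ON q S Q2])
  obtain u where g4: "L4_converges M g u" and u: "is_malliavin_deriv M Z F u"
    using chaos_limit(2)[OF ON p S P2] unfolding g_def [abs_def] by blast
  obtain v where h4: "L4_converges M h v" and v: "is_malliavin_deriv M Z (\<lambda>\<omega>. cnj (F \<omega>)) v"
    using chaos_limit(2)[OF ON q S Q2] unfolding h_def [abs_def] by blast
  have gg: "L2_converges M (\<lambda>N \<omega>. (norm (g N \<omega>))\<^sup>2) (\<lambda>\<omega>. (norm (u \<omega>))\<^sup>2)"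
    unfolding power2_norm_eq_inner by (rule L4_converges_prod[OF bounded_bilinear_inner g4 g4])
  have PP: "L2_converges M (\<lambda>N \<omega>. (cmod (P N \<omega>))\<^sup>2) (\<lambda>\<omega>. (cmod (F \<omega>))\<^sup>2)"
    unfolding power2_norm_eq_inner by (rule L4_converges_prod[OF bounded_bilinear_inner P4 P4])
  have gh: "L2_converges M (\<lambda>N \<omega>. cinner (g N \<omega>) (h N \<omega>)) (\<lambda>\<omega>. cinner (u \<omega>) (v \<omega>))"
    by (rule L4_converges_prod[OF bounded_bilinear_cinner g4 h4])
  have QQ: "L2_converges M (\<lambda>N \<omega>. (cnj (P N \<omega>))\<^sup>2) (\<lambda>\<omega>. (cnj (F \<omega>))\<^sup>2)"
    unfolding power2_eq_square by (rule L4_converges_prod[OF bounded_bilinear_mult Q4 Q4])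
  note i1 = L2_converges_integrable_mult[OF gg PP] and i2 = L2_converges_integrable_mult[OF gh QQ]
  \<comment> \<open>The integrand as a function of its three ingredients, so that one splitting of
    the integral serves both the approximants and the limit.\<close>
  define G where "G u v F = of_real (2 * (norm u)\<^sup>2 * (cmod F)\<^sup>2) + cinner u v * (cnj F)\<^sup>2" for u v :: "'h cplx" and F
  have G: "integrable M (\<lambda>\<omega>. G (u \<omega>) (v \<omega>) (F \<omega>))"
    "(\<integral>\<omega>. G (u \<omega>) (v \<omega>) (F \<omega>) \<partial>M)
      = of_real (2 * (\<integral>\<omega>. (norm (u \<omega>))\<^sup>2 * (cmod (F \<omega>))\<^sup>2 \<partial>M)) + (\<integral>\<omega>. cinner (u \<omega>) (v \<omega>) * (cnj (F \<omega>))\<^sup>2 \<partial>M)"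
    if "integrable M (\<lambda>\<omega>. (norm (u \<omega>))\<^sup>2 * (cmod (F \<omega>))\<^sup>2)" "integrable M (\<lambda>\<omega>. cinner (u \<omega>) (v \<omega>) * (cnj (F \<omega>))\<^sup>2)"
    for u v F
  proof -
    have i: "integrable M (\<lambda>\<omega>. complex_of_real (2 * ((norm (u \<omega>))\<^sup>2 * (cmod (F \<omega>))\<^sup>2)))"
      by (intro integrable_of_real integrable_mult_right that(1))
    show "integrable M (\<lambda>\<omega>. G (u \<omega>) (v \<omega>) (F \<omega>))"
      unfolding G_def mult.assoc using Bochner_Integration.integrable_add[OF i that(2)] by (simp only: mult.assoc)
    show "(\<integral>\<omega>. G (u \<omega>) (v \<omega>) (F \<omega>) \<partial>M)
      = of_real (2 * (\<integral>\<omega>. (norm (u \<omega>))\<^sup>2 * (cmod (F \<omega>))\<^sup>2 \<partial>M)) + (\<integral>\<omega>. cinner (u \<omega>) (v \<omega>) * (cnj (F \<omega>))\<^sup>2 \<partial>M)"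
      using Bochner_Integration.integral_add[OF i that(2)]
      unfolding G_def mult.assoc integral_complex_of_real integral_mult_right_zero by simp
  qed
  have "(\<lambda>N. \<integral>\<omega>. G (g N \<omega>) (h N \<omega>) (P N \<omega>) \<partial>M) \<longlonglongrightarrow> (\<integral>\<omega>. G (u \<omega>) (v \<omega>) (F \<omega>) \<partial>M)"
    unfolding G(2)[OF i1(2) i2(2)] G(2)[OF i1(1) i2(1)]
    by (intro tendsto_add tendsto_of_real tendsto_mult_left
        L2_converges_integral_prod[OF bounded_bilinear_mult gg PP] L2_converges_integral_prod[OF bounded_bilinear_mult gh QQ])
  moreover have "of_nat m * complex_of_real (\<integral>\<omega>. cmod (P N \<omega>) ^ 4 \<partial>M) = (\<integral>\<omega>. G (g N \<omega>) (h N \<omega>) (P N \<omega>) \<partial>M)" for N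
    unfolding G_def P_def g_def h_def
    by (rule chaos_fourth_moment_identity(2)[OF p S(1) orthonormal_family_subset[OF ON S(2)]])
  ultimately have 1: "(\<lambda>N. of_nat m * complex_of_real (\<integral>\<omega>. cmod (P N \<omega>) ^ 4 \<partial>M)) \<longlonglongrightarrow> (\<integral>\<omega>. G (u \<omega>) (v \<omega>) (F \<omega>) \<partial>M)"
    by simp
  have pow4: "(x::real) ^ 4 = x\<^sup>2 * x\<^sup>2" for x by (simp add: power2_eq_square power4_eq_xxxx)
  have "(\<lambda>N. of_nat m * complex_of_real (\<integral>\<omega>. cmod (P N \<omega>) ^ 4 \<partial>M)) \<longlonglongrightarrow> of_nat m * complex_of_real (\<integral>\<omega>. cmod (F \<omega>) ^ 4 \<partial>M)"
    unfolding pow4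
    by (intro tendsto_mult_left tendsto_of_real L2_converges_integral_prod[OF bounded_bilinear_mult PP PP])
  from LIMSEQ_unique[OF this 1] have eq: "of_nat m * complex_of_real (\<integral>\<omega>. cmod (F \<omega>) ^ 4 \<partial>M) = (\<integral>\<omega>. G (u \<omega>) (v \<omega>) (F \<omega>) \<partial>M)" .
  have i4: "integrable M (\<lambda>\<omega>. cmod (F \<omega>) ^ 4)" unfolding pow4 by (rule L2_converges_integrable_mult(1)[OF PP PP])
  show thesis
    using G(1)[OF i1(1) i2(1)] eq unfolding G_def by (intro that[OF u v i4])
qed

text \<open>The existence of u makes the chosen derivative a genuine one, and uniqueness identifies
  the two.\<close>

lemma malliavin_deriv_AE:
  fixes e :: "nat \<Rightarrow> 'h cplx"
  assumes "orthonormal_basis K e" "is_malliavin_deriv M Z F u"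
  shows "malliavin_deriv M Z F \<in> borel_measurable M" "u \<in> borel_measurable M" "AE \<omega> in M. malliavin_deriv M Z F \<omega> = u \<omega>"
proof -
  have D: "is_malliavin_deriv M Z F (malliavin_deriv M Z F)"
    unfolding malliavin_deriv_def by (rule someI[where P = "is_malliavin_deriv M Z F", OF assms(2)])
  show "AE \<omega> in M. malliavin_deriv M Z F \<omega> = u \<omega>" by (rule malliavin_deriv_unique[OF assms(1) D assms(2)])
  show "malliavin_deriv M Z F \<in> borel_measurable M" "u \<in> borel_measurable M"
    using D assms(2) by (auto simp: is_malliavin_deriv_def L2_converges_def square_integrable_def)
qed

end

theorem proposition3p11:
  fixes M :: "'w measure" and Z :: "'h::{real_inner, polish_space} cplx \<Rightarrow> 'w \<Rightarrow> complex"
    and K :: "nat set" and e :: "nat \<Rightarrow> 'h cplx" and m n :: nat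
    and f :: "'h tensor" and F :: "'w \<Rightarrow> complex"
  assumes "complex_isonormal M Z"
    and "orthonormal_basis K e"
    and "m \<ge> 1"
    and "f \<in> sym_tensor_power2 m n"
    and "F \<in> borel_measurable M"
    and "AE \<omega> in M. F \<omega> = wiener_ito M Z K e m n f \<omega>"
  shows "F \<in> malliavin_domain M Z \<and> (\<lambda>\<omega>. cnj (F \<omega>)) \<in> malliavin_domain M Z \<and>
    (let DF = malliavin_deriv M Z F;
         DFbar = malliavin_deriv M Z (\<lambda>\<omega>. cnj (F \<omega>));
         G = (\<lambda>\<omega>. of_real (2 * (norm (DF \<omega>))\<^sup>2 * (cmod (F \<omega>))\<^sup>2)
                  + cinner (DF \<omega>) (DFbar \<omega>) * (cnj (F \<omega>))\<^sup>2)
     in integrable M (\<lambda>\<omega>. (cmod (F \<omega>)) ^ 4) \<and> integrable M G \<and>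
        complex_of_real (\<integral>\<omega>. (cmod (F \<omega>)) ^ 4 \<partial>M) = 1 / of_nat m * (\<integral>\<omega>. G \<omega> \<partial>M))"
proof -
  interpret complex_isonormal M Z by (rule assms(1))
  \<comment> \<open>\<open>F\<close> is any measurable version of the chosen integral; altering the
    limit on a null set keeps it in the graph.\<close>
  have "is_wiener_ito M Z K e m n f F"
    using wiener_ito_exists[OF assms(2,4)] L2_converges_cong_AE[OF _ assms(5,6)]
    unfolding is_wiener_ito_def by blast
  then obtain u v where u: "is_malliavin_deriv M Z F u" and v: "is_malliavin_deriv M Z (\<lambda>\<omega>. cnj (F \<omega>)) v"
    and i4: "integrable M (\<lambda>\<omega>. cmod (F \<omega>) ^ 4)"
    and iG: "integrable M (\<lambda>\<omega>. of_real (2 * (norm (u \<omega>))\<^sup>2 * (cmod (F \<omega>))\<^sup>2) + cinner (u \<omega>) (v \<omega>) * (cnj (F \<omega>))\<^sup>2)"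
    and eq: "of_nat m * complex_of_real (\<integral>\<omega>. cmod (F \<omega>) ^ 4 \<partial>M)
      = (\<integral>\<omega>. of_real (2 * (norm (u \<omega>))\<^sup>2 * (cmod (F \<omega>))\<^sup>2) + cinner (u \<omega>) (v \<omega>) * (cnj (F \<omega>))\<^sup>2 \<partial>M)"
    by (rule wiener_ito_fourth_moment[OF orthonormal_basis_family[OF assms(2)]])
  note D = malliavin_deriv_AE[OF assms(2) u] and E = malliavin_deriv_AE[OF assms(2) v]
  define G where "G a b z = of_real (2 * (norm a)\<^sup>2 * (cmod z)\<^sup>2) + cinner a b * (cnj z)\<^sup>2" for a b :: "'h cplx" and z
  have Gm: "(\<lambda>\<omega>. G (a \<omega>) (b \<omega>) (F \<omega>)) \<in> borel_measurable M"
    if [measurable]: "a \<in> borel_measurable M" "b \<in> borel_measurable M" for a b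
  proof -
    note [measurable] = assms(5) borel_measurable_cnj[OF assms(5)]
    have [measurable]: "(\<lambda>\<omega>. cinner (a \<omega>) (b \<omega>)) \<in> borel_measurable M"
      by (rule borel_measurable_continuous_Pair[OF that])
        (intro bounded_bilinear.continuous_on[OF bounded_bilinear_cinner] continuous_intros)
    show ?thesis unfolding G_def by measurable
  qed
  let ?D = "malliavin_deriv M Z F" and ?E = "malliavin_deriv M Z (\<lambda>\<omega>. cnj (F \<omega>))"
  \<comment> \<open>The conclusion concerns the chosen derivatives, which are known to agree with u
    and v only almost everywhere; measurability of both integrands then transfers integrability and
    the integral.\<close>
  have AE: "AE \<omega> in M. G (?D \<omega>) (?E \<omega>) (F \<omega>) = G (u \<omega>) (v \<omega>) (F \<omega>)"
    using D(3) E(3) by eventually_elim simp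
  note m = Gm[OF D(1) E(1)] Gm[OF D(2) E(2)]
  have "integrable M (\<lambda>\<omega>. G (?D \<omega>) (?E \<omega>) (F \<omega>))"
    using integrable_cong_AE[OF m AE] iG unfolding G_def by simp
  moreover have "of_nat m * complex_of_real (\<integral>\<omega>. cmod (F \<omega>) ^ 4 \<partial>M) = (\<integral>\<omega>. G (?D \<omega>) (?E \<omega>) (F \<omega>) \<partial>M)"
    using integral_cong_AE[OF m AE] eq unfolding G_def by simp
  then have "complex_of_real (\<integral>\<omega>. cmod (F \<omega>) ^ 4 \<partial>M) = 1 / of_nat m * (\<integral>\<omega>. G (?D \<omega>) (?E \<omega>) (F \<omega>) \<partial>M)"
    using assms(3) by (simp add: field_simps)
  ultimately show ?thesis
    using u v i4 unfolding malliavin_domain_def Let_def G_def by blast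
qed

end
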